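(* Let $K$ be a perfect field of characteristic $2$, $\mathscr{F}$ a flag of an $n$-dimensional $K$-space $E$ with coordinated basis $x_1,\dots,x_n$, and let $\omega$ be a non-alternating Hamiltonian form over $O(\mathscr{F})$ with $\omega(0)$ in canonical form, $$\omega=\omega(0)+d\varphi+\sum_{i<j}b_{ij}\,dz_i\,dz_j,$$ where $\varphi\in\widetilde{\mathfrak m}^{(2)}S\Omega^1$ and $b_{ij}\in K$ (put $b_{ji}=b_{ij}$). Let $I=\{i\mid\overline a_{ii}\ne0\}$, where $(\overline a_{ij})$ is the inverse of the matrix of $\omega(0)$. Then: (1) If either (A) there exists $i\in I$ with $m_i>1$, or (B) $m_i=1$ for all $i\in I$ and $\sum_{i<j}b_{ij}dz_idz_j$ involves only terms $dz_sdz_j$ with $s,j\notin I$, then $\omega$ is conjugate with respect to $G'$ to the form $\omega(0)$. (2) $\omega$ is conjugate with respect to $G'$ to the form $$\omega(0)+\sum_{i\in I}\sum_{j\notin I}b_{ij}\,dz_i\,dz_j+\sum_{i<j;\ i,j\in I}b_{ij}\,dz_i\,dz_j.$$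
   Context: Divided powers. $O(E)$ is the divided power algebra of $E$; a flag is $\mathscr{F}\colon E=E_0\supseteq E_1\supseteq\ldots\supseteq E_r\supset E_{r+1}=0$; $O(\mathscr{F})\subseteq O(E)$ is generated by all $u^{(2^j)}$, $u\in E_j$. The basis $x_1,\dots,x_n$ of $E$ is coordinated with $\mathscr{F}$: $\{x_i\}\cap E_j$ is a basis of $E_j$ for each $j$; $m_i=\min\{s\mid x_i\notin E_s\}$ is the height of $x_i$. $O(\mathscr{F})$ has basis $x^{(\alpha)}=\prod x_i^{(\alpha_i)}$, $0\le\alpha_i<2^{m_i}$. $\mathfrak m$ is its maximal ideal, $\mathfrak m^{(j)}=\langle x^{(\alpha)}:|\alpha|\ge j\rangle$, and $\mathfrak m^2$ is the ordinary square of $\mathfrak m$. $W=W(\mathscr{F})$ is the free $O(\mathscr{F})$-module with basis $\partial_i$, $\partial_ix^{(\alpha)}=x^{(\alpha-\varepsilon_i)}$. $z_i=x_i^{(2^{m_i})}$ and $dz_i=x_i^{(2^{m_i}-1)}dx_i$. Forms. $S\Omega=S\Omega(\mathscr{F})$ is the divided power algebra over $O(\mathscr{F})$ of $\mathrm{Hom}_{O(\mathscr{F})}(W,O(\mathscr{F}))$ (the free module on $dx_i$); $S\Omega^k$ consists of symmetric $k$-forms. The differential satisfies $d^2=0$, $df(D)=D(f)$, $d(\omega_1\omega_2)=(d\omega_1)\omega_2+\omega_1d\omega_2$, $d(\omega^{(r)})=\omega^{(r-1)}d\omega$. A $2$-form $\omega=\sum\omega_{ii}(dx_i)^{(2)}+\sum_{i<j}\omega_{ij}dx_idx_j$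 is a non-alternating Hamiltonian form if it is closed, $\det(\omega_{ij})$ is invertible ($\omega_{ji}=\omega_{ij}$), and $\omega(D,D)\ne0$ for some $D\in W$. $\omega(0)$ is the form with coefficients $\omega_{ij}$ mod $\mathfrak m$. Canonical form: $\omega(0)=dx_1dx_2+\ldots+dx_{2r-1}dx_{2r}+\varepsilon_1dx_2^{(2)}+\varepsilon_3dx_4^{(2)}+\ldots+\varepsilon_{2r-1}dx_{2r}^{(2)}+dx_{2r+1}^{(2)}+\ldots+dx_n^{(2)}$ with $0\le r\le n/2$, $\varepsilon_j\in\{0,1\}$, where $m_{2i-1}<m_{2i}$ whenever $\varepsilon_{2i-1}=1$. $\widetilde{\mathfrak m}^{(j)}S\Omega^1$ is the $K$-span of the set $$\{x^{(\alpha)}dx_k : |\alpha|\ge j,\ 1\le k\le n\}\setminus\{x_r^{(2^l)}x_s^{(2^t)}dx_i,\ x_q^{(2)}dx_i : i,q\in I\}$$ ($r,s,l,t$ arbitrary). Groups. An admissible automorphism $\sigma$ of $O(\mathscr{F})$ is one that is the restriction of a continuous automorphism of the completion $\widehat O(E)$ of $O(E)$ satisfying $\sigma(x^{(\alpha)})=\sigma(x)^{(\alpha)}$; it acts on forms by $(\sigma\omega)(D_1,\dots,D_k)=\sigma(\omega(\sigma^{-1}D_1\sigma,\dots,\sigma^{-1}D_k\sigma))$. $G'=G'(\mathscr{F})$ is the group of admissible automorphisms with $\sigma f-f\in\mathfrak m^2$ for all $f\in O(\mathscr{F})$. Forms $\omega,\omega'$ are conjugate with respect to $G'$ if $\omega'=\sigma\omega$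 for some $\sigma\in G'$. *)

theory Defs
  imports
    "HOL-Library.Poly_Mapping"
    "HOL-Library.Multiset"
    "Jordan_Normal_Form.Determinant"
begin

section \<open>Formal divided power series\<close>

text \<open>A multi-index is a finitely supported map \<open>nat \<Rightarrow>\<^sub>0 nat\<close>. An element of \<open>'a dps\<close> is a formal
  (possibly infinite) sum of the divided monomials \<open>x\<^bsup>(\<alpha>)\<^esup> = \<Prod>\<^sub>i x\<^sub>i\<^bsup>(\<alpha>\<^sub>i)\<^esup>\<close> with
  coefficients in \<open>'a\<close>. Variables are indexed by all of \<open>nat\<close>; the \<open>n\<close>-variable objects below
  are carved out as those involving the variables \<open>1, \<dots>, n\<close> only.\<close>

type_synonym mindex = "nat \<Rightarrow>\<^sub>0 nat"

abbreviation keys :: "mindex \<Rightarrow> nat set" where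
  "keys \<equiv> Poly_Mapping.keys"

abbreviation lookup :: "mindex \<Rightarrow> nat \<Rightarrow> nat" where
  "lookup \<equiv> Poly_Mapping.lookup"

abbreviation eps :: "nat \<Rightarrow> mindex" where
  "eps i \<equiv> Poly_Mapping.single i 1"

definition mdeg :: "mindex \<Rightarrow> nat" where
  "mdeg \<alpha> = (\<Sum>i\<in>keys \<alpha>. lookup \<alpha> i)"

definition mfact :: "mindex \<Rightarrow> nat" where
  "mfact \<alpha> = (\<Prod>i\<in>keys \<alpha>. fact (lookup \<alpha> i))"

definition mchoose :: "mindex \<Rightarrow> mindex \<Rightarrow> nat" where
  "mchoose \<gamma> \<alpha> = (\<Prod>i\<in>keys \<gamma>. lookup \<gamma> i choose lookup \<alpha> i)"

typedef 'a dps = "UNIV :: (mindex \<Rightarrow> 'a) set"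
  morphisms dcoeff Abs_dps ..

lemma dcoeff_Abs [simp]: "dcoeff (Abs_dps f) = f"
  by (simp add: Abs_dps_inverse)

lemma dps_eqI: "(\<And>\<alpha>. dcoeff f \<alpha> = dcoeff g \<alpha>) \<Longrightarrow> f = g"
  by (metis dcoeff_inject ext)

definition splits :: "mindex \<Rightarrow> (mindex \<times> mindex) set" where
  "splits \<gamma> = {(\<alpha>, \<beta>). \<alpha> + \<beta> = \<gamma>}"

lemma finite_below: "finite {\<alpha>::mindex. \<forall>i. lookup \<alpha> i \<le> lookup \<gamma> i}" (is "finite ?B")
proof -
  define m where "m = Max (lookup \<gamma> ` keys \<gamma>)"
  define F where "F = {f :: nat \<Rightarrow> nat. \<forall>i. (i \<in> keys \<gamma> \<longrightarrow> f i \<in> {..m}) \<and> (i \<notin> keys \<gamma> \<longrightarrow> f i = 0)}"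
  have "lookup \<alpha> \<in> F" if "\<alpha> \<in> ?B" for \<alpha>
  proof -
    have le: "lookup \<alpha> i \<le> lookup \<gamma> i" for i
      using that by simp
    have "lookup \<gamma> i \<le> m" if "i \<in> keys \<gamma>" for i
      unfolding m_def using that by (intro Max_ge) simp_all
    then have "lookup \<alpha> i \<le> m" if "i \<in> keys \<gamma>" for i
      using le that order_trans by blast
    moreover have "lookup \<alpha> i = 0" if "i \<notin> keys \<gamma>" for i
      using le[of i] that by (simp add: in_keys_iff)
    ultimately show ?thesis
      by (simp add: F_def)
  qed
  then have "lookup ` ?B \<subseteq> F"
    by (rule image_subsetI)
  moreover have "finite F"
    unfolding F_def by (rule finite_set_of_finite_funs) simp_all
  ultimately have "finite (lookup ` ?B)"
    by (rule finite_subset)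
  then show ?thesis
    by (rule finite_imageD) (simp add: inj_on_def)
qed

lemma finite_splits: "finite (splits \<gamma>)"
proof (rule finite_subset)
  show "splits \<gamma> \<subseteq> {\<alpha>. \<forall>i. lookup \<alpha> i \<le> lookup \<gamma> i} \<times> {\<alpha>. \<forall>i. lookup \<alpha> i \<le> lookup \<gamma> i}"
    by (auto simp: splits_def lookup_add)
qed (use finite_below in auto)

lemma mchoose_mfact: "mchoose (\<alpha> + \<beta>) \<alpha> * (mfact \<alpha> * mfact \<beta>) = mfact (\<alpha> + \<beta>)"
proof -
  let ?S = "keys (\<alpha> + \<beta>)"
  have sub: "keys \<alpha> \<subseteq> ?S" "keys \<beta> \<subseteq> ?S"
    by (auto simp: in_keys_iff lookup_add)
  have a: "mfact \<alpha> = (\<Prod>i\<in>?S. fact (lookup \<alpha> i))"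
    unfolding mfact_def by (rule prod.mono_neutral_left) (use sub in \<open>auto simp: in_keys_iff\<close>)
  have b: "mfact \<beta> = (\<Prod>i\<in>?S. fact (lookup \<beta> i))"
    unfolding mfact_def by (rule prod.mono_neutral_left) (use sub in \<open>auto simp: in_keys_iff\<close>)
  have "(lookup (\<alpha> + \<beta>) i choose lookup \<alpha> i) * (fact (lookup \<alpha> i) * fact (lookup \<beta> i))
      = (fact (lookup (\<alpha> + \<beta>) i) :: nat)" for i
    using binomial_fact_lemma[of "lookup \<alpha> i" "lookup (\<alpha> + \<beta>) i"]
    by (simp add: lookup_add mult.commute)
  then show ?thesis
    unfolding a b mchoose_def prod.distrib[symmetric] by (simp add: mfact_def)
qed

lemma mfact_pos: "mfact \<alpha> > 0"
  by (simp add: mfact_def)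

lemma mchoose_comm: "mchoose (\<alpha> + \<beta>) \<alpha> = mchoose (\<alpha> + \<beta>) \<beta>"
proof -
  have "mchoose (\<alpha> + \<beta>) \<alpha> * (mfact \<alpha> * mfact \<beta>) = mchoose (\<alpha> + \<beta>) \<beta> * (mfact \<alpha> * mfact \<beta>)"
    by (metis add.commute mchoose_mfact mult.commute)
  then show ?thesis using mfact_pos[of \<alpha>] mfact_pos[of \<beta>] by simp
qed

lemma mchoose_assoc:
  "mchoose (\<alpha> + \<beta> + \<gamma>) (\<alpha> + \<beta>) * mchoose (\<alpha> + \<beta>) \<alpha>
     = mchoose (\<alpha> + \<beta> + \<gamma>) \<alpha> * mchoose (\<beta> + \<gamma>) \<beta>"
proof -
  let ?F = "mfact \<alpha> * mfact \<beta> * mfact \<gamma>"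
  have "mchoose (\<alpha> + \<beta> + \<gamma>) (\<alpha> + \<beta>) * mchoose (\<alpha> + \<beta>) \<alpha> * ?F
      = mchoose (\<alpha> + \<beta> + \<gamma>) (\<alpha> + \<beta>) * (mfact (\<alpha> + \<beta>) * mfact \<gamma>)"
    by (simp only: mchoose_mfact[of \<alpha> \<beta>, symmetric] mult.assoc)
  also have "\<dots> = mfact (\<alpha> + \<beta> + \<gamma>)" by (rule mchoose_mfact)
  also have "\<dots> = mchoose (\<alpha> + \<beta> + \<gamma>) \<alpha> * (mfact \<alpha> * mfact (\<beta> + \<gamma>))"
    using mchoose_mfact[of \<alpha> "\<beta> + \<gamma>"] by (simp add: add.assoc)
  also have "\<dots> = mchoose (\<alpha> + \<beta> + \<gamma>) \<alpha> * mchoose (\<beta> + \<gamma>) \<beta> * ?F"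
    by (simp only: mchoose_mfact[of \<beta> \<gamma>, symmetric] mult.assoc mult.left_commute)
  finally show ?thesis using mfact_pos[of \<alpha>] mfact_pos[of \<beta>] mfact_pos[of \<gamma>] by simp
qed

definition dp_const :: "'a::zero \<Rightarrow> 'a dps" where
  "dp_const c = Abs_dps (\<lambda>\<alpha>. if \<alpha> = 0 then c else 0)"

definition dmon :: "mindex \<Rightarrow> 'a::zero_neq_one dps" where
  "dmon \<alpha> = Abs_dps (\<lambda>\<beta>. if \<beta> = \<alpha> then 1 else 0)"

instantiation dps :: (comm_ring_1) comm_ring_1
begin

definition zero_dps :: "'a dps" where "0 = Abs_dps (\<lambda>_. 0)"
definition one_dps :: "'a dps" where "1 = dp_const 1"
definition plus_dps :: "'a dps \<Rightarrow> 'a dps \<Rightarrow> 'a dps" where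
  "f + g = Abs_dps (\<lambda>\<alpha>. dcoeff f \<alpha> + dcoeff g \<alpha>)"
definition minus_dps :: "'a dps \<Rightarrow> 'a dps \<Rightarrow> 'a dps" where
  "f - g = Abs_dps (\<lambda>\<alpha>. dcoeff f \<alpha> - dcoeff g \<alpha>)"
definition uminus_dps :: "'a dps \<Rightarrow> 'a dps" where
  "- f = Abs_dps (\<lambda>\<alpha>. - dcoeff f \<alpha>)"

text \<open>The product is determined by
  \<open>x\<^bsup>(\<alpha>)\<^esup> x\<^bsup>(\<beta>)\<^esup> = (\<Prod>\<^sub>i (\<alpha>\<^sub>i + \<beta>\<^sub>i choose \<alpha>\<^sub>i)) x\<^bsup>(\<alpha>+\<beta>)\<^esup>\<close>.\<close>

definition times_dps :: "'a dps \<Rightarrow> 'a dps \<Rightarrow> 'a dps" where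
  "f * g = Abs_dps (\<lambda>\<gamma>. \<Sum>(\<alpha>, \<beta>)\<in>splits \<gamma>. of_nat (mchoose \<gamma> \<alpha>) * dcoeff f \<alpha> * dcoeff g \<beta>)"

instance
proof
  fix f g h :: "'a dps"
  show "f * g * h = f * (g * h)"
  proof (rule dps_eqI)
    fix \<tau> :: mindex
    let ?T = "{(\<alpha>, \<beta>, \<gamma>). \<alpha> + \<beta> + \<gamma> = \<tau>}"
    let ?t = "\<lambda>\<alpha> \<beta> \<gamma>. dcoeff f \<alpha> * dcoeff g \<beta> * dcoeff h \<gamma>"
    have "dcoeff (f * g * h) \<tau> = (\<Sum>(\<delta>, \<gamma>)\<in>splits \<tau>. \<Sum>(\<alpha>, \<beta>)\<in>splits \<delta>.
        of_nat (mchoose \<tau> \<delta> * mchoose \<delta> \<alpha>) * ?t \<alpha> \<beta> \<gamma>)"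
      by (simp add: times_dps_def sum_distrib_left sum_distrib_right split_def ac_simps)
    also have "\<dots> = (\<Sum>((\<delta>, \<gamma>), (\<alpha>, \<beta>))\<in>Sigma (splits \<tau>) (\<lambda>(\<delta>, \<gamma>). splits \<delta>).
        of_nat (mchoose \<tau> \<delta> * mchoose \<delta> \<alpha>) * ?t \<alpha> \<beta> \<gamma>)"
      by (subst sum.Sigma[symmetric]) (auto simp: finite_splits split_def)
    also have "\<dots> = (\<Sum>(\<alpha>, \<beta>, \<gamma>)\<in>?T. of_nat (mchoose \<tau> (\<alpha> + \<beta>) * mchoose (\<alpha> + \<beta>) \<alpha>) * ?t \<alpha> \<beta> \<gamma>)"
      by (rule sum.reindex_bij_witness[where
            i = "\<lambda>(\<alpha>, \<beta>, \<gamma>). ((\<alpha> + \<beta>, \<gamma>), (\<alpha>, \<beta>))" and j = "\<lambda>((\<delta>, \<gamma>), (\<alpha>, \<beta>)). (\<alpha>, \<beta>, \<gamma>)"])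
         (auto simp: splits_def)
    also have "\<dots> = (\<Sum>(\<alpha>, \<beta>, \<gamma>)\<in>?T. of_nat (mchoose \<tau> \<alpha> * mchoose (\<beta> + \<gamma>) \<beta>) * ?t \<alpha> \<beta> \<gamma>)"
      by (rule sum.cong) (auto simp only: mem_Collect_eq prod.case mchoose_assoc[symmetric])
    also have "\<dots> = (\<Sum>((\<alpha>, \<delta>), (\<beta>, \<gamma>))\<in>Sigma (splits \<tau>) (\<lambda>(\<alpha>, \<delta>). splits \<delta>).
        of_nat (mchoose \<tau> \<alpha> * mchoose \<delta> \<beta>) * ?t \<alpha> \<beta> \<gamma>)"
      by (rule sum.reindex_bij_witness[where
            j = "\<lambda>(\<alpha>, \<beta>, \<gamma>). ((\<alpha>, \<beta> + \<gamma>), (\<beta>, \<gamma>))" and i = "\<lambda>((\<alpha>, \<delta>), (\<beta>, \<gamma>)). (\<alpha>, \<beta>, \<gamma>)"])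
         (auto simp: splits_def add.assoc)
    also have "\<dots> = (\<Sum>(\<alpha>, \<delta>)\<in>splits \<tau>. \<Sum>(\<beta>, \<gamma>)\<in>splits \<delta>.
        of_nat (mchoose \<tau> \<alpha> * mchoose \<delta> \<beta>) * ?t \<alpha> \<beta> \<gamma>)"
      by (subst sum.Sigma[symmetric]) (auto simp: finite_splits split_def)
    also have "\<dots> = dcoeff (f * (g * h)) \<tau>"
      by (simp add: times_dps_def sum_distrib_left sum_distrib_right split_def ac_simps)
    finally show "dcoeff (f * g * h) \<tau> = dcoeff (f * (g * h)) \<tau>" .
  qed
  show "f * g = g * f"
  proof (rule dps_eqI)
    fix \<gamma> :: mindex
    have "mchoose \<gamma> (fst p) = mchoose \<gamma> (snd p)" if "p \<in> splits \<gamma>" for p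
      using that mchoose_comm[of "fst p" "snd p"] by (auto simp: splits_def)
    then show "dcoeff (f * g) \<gamma> = dcoeff (g * f) \<gamma>"
      unfolding times_dps_def dcoeff_Abs
      by (intro sum.reindex_bij_witness[where i = prod.swap and j = prod.swap])
         (auto simp: splits_def add.commute mult.commute mult.left_commute)
  qed
  show "1 * f = f"
  proof (rule dps_eqI)
    fix \<gamma> :: mindex
    have "dcoeff (1 * f) \<gamma> = (\<Sum>(\<alpha>, \<beta>)\<in>{(0, \<gamma>)}. of_nat (mchoose \<gamma> \<alpha>) * dcoeff 1 \<alpha> * dcoeff f \<beta>)"
      unfolding times_dps_def dcoeff_Abs
      by (rule sum.mono_neutral_right)
         (auto simp: finite_splits, auto simp: splits_def one_dps_def dp_const_def split: if_splits)
    also have "\<dots> = dcoeff f \<gamma>"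
      by (simp add: one_dps_def dp_const_def mchoose_def)
    finally show "dcoeff (1 * f) \<gamma> = dcoeff f \<gamma>" .
  qed
  show "(f + g) * h = f * h + g * h"
    by (rule dps_eqI)
       (simp add: times_dps_def plus_dps_def split_def sum.distrib distrib_left distrib_right)
  show "(0::'a dps) \<noteq> 1"
  proof
    assume "(0::'a dps) = 1"
    then have "dcoeff (0::'a dps) 0 = dcoeff 1 0" by simp
    then show False by (simp add: zero_dps_def one_dps_def dp_const_def)
  qed
qed (simp_all add: zero_dps_def plus_dps_def minus_dps_def uminus_dps_def dcoeff_inverse ac_simps)

end

abbreviation xpow :: "nat \<Rightarrow> nat \<Rightarrow> 'a::comm_ring_1 dps" where
  "xpow i a \<equiv> dmon (Poly_Mapping.single i a)"

definition dscale :: "'a::comm_ring_1 \<Rightarrow> 'a dps \<Rightarrow> 'a dps" where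
  "dscale c f = dp_const c * f"

text \<open>The divided power \<open>f\<^bsup>(k)\<^esup>\<close> of \<open>f = \<Sum>\<^sub>\<alpha> a\<^sub>\<alpha> x\<^bsup>(\<alpha>)\<^esup>\<close> with zero constant term. By
  \<open>(f + g)\<^bsup>(k)\<^esup> = \<Sum> f\<^bsup>(i)\<^esup> g\<^bsup>(k-i)\<^esup>\<close>, \<open>(c f)\<^bsup>(k)\<^esup> = c\<^bsup>k\<^esup> f\<^bsup>(k)\<^esup>\<close> it is the sum over all
  multisets \<open>M\<close> of \<open>k\<close> nonzero multi-indices, \<open>\<alpha>\<close> occurring \<open>r\<^sub>\<alpha>\<close> times, of
  \<open>\<Prod>\<^sub>\<alpha> a\<^sub>\<alpha>\<^bsup>r\<^sub>\<alpha>\<^esup> (x\<^bsup>(\<alpha>)\<^esup>)\<^bsup>(r\<^sub>\<alpha>)\<^esup>\<close>. Formally \<open>x\<^bsup>(\<alpha>)\<^esup> = x\<^bsup>\<alpha>\<^esup> / \<alpha>!\<close> and \<open>f\<^bsup>(k)\<^esup> = f\<^bsup>k\<^esup> / k!\<close>, so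
  \<open>\<Prod>\<^sub>\<alpha> (x\<^bsup>(\<alpha>)\<^esup>)\<^bsup>(r\<^sub>\<alpha>)\<^esup> = \<beta>! / (\<Prod>\<^sub>\<alpha> r\<^sub>\<alpha>! (\<alpha>!)\<^bsup>r\<^sub>\<alpha>\<^esup>) x\<^bsup>(\<beta>)\<^esup>\<close> with \<open>\<beta> = \<Sum>\<^sub>\<alpha> r\<^sub>\<alpha> \<alpha>\<close>; the quotient is
  an integer. A constant term of \<open>f\<close> is ignored.\<close>

definition dpow_coeff :: "mindex multiset \<Rightarrow> nat" where
  "dpow_coeff M = mfact (\<Sum>\<^sub># M) div
     ((\<Prod>\<alpha>\<in>set_mset M. fact (count M \<alpha>)) * (\<Prod>\<alpha>\<in>#M. mfact \<alpha>))"

definition dpow :: "nat \<Rightarrow> 'a::comm_ring_1 dps \<Rightarrow> 'a dps" where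
  "dpow k f = Abs_dps (\<lambda>\<beta>. \<Sum>M | size M = k \<and> 0 \<notin># M \<and> \<Sum>\<^sub># M = \<beta>.
     of_nat (dpow_coeff M) * (\<Prod>\<alpha>\<in>#M. dcoeff f \<alpha>))"

definition pd :: "nat \<Rightarrow> 'a dps \<Rightarrow> 'a dps" where
  "pd i f = Abs_dps (\<lambda>\<alpha>. dcoeff f (\<alpha> + eps i))"


section \<open>Flags and the algebra of a flag\<close>

text \<open>The vector space \<open>E\<close> is the whole type \<open>'e\<close>, with scalar multiplication \<open>sc\<close>;
  only \<open>Fl 0, \<dots>, Fl (s + 1)\<close> are relevant.\<close>

definition is_flag :: "('k::field \<Rightarrow> 'e::ab_group_add \<Rightarrow> 'e) \<Rightarrow> nat \<Rightarrow> (nat \<Rightarrow> 'e set) \<Rightarrow> bool" where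
  "is_flag sc s Fl \<longleftrightarrow> Fl 0 = UNIV \<and> (\<forall>j\<le>s. Fl (Suc j) \<subseteq> Fl j) \<and>
     (\<forall>j\<le>Suc s. module.subspace sc (Fl j)) \<and> Fl s \<noteq> {0} \<and> Fl (Suc s) = {0}"

definition is_basis_of :: "('k::field \<Rightarrow> 'e::ab_group_add \<Rightarrow> 'e) \<Rightarrow> 'e set \<Rightarrow> 'e set \<Rightarrow> bool" where
  "is_basis_of sc B V \<longleftrightarrow> \<not> module.dependent sc B \<and> module.span sc B = V"

definition coordinated_basis ::
  "('k::field \<Rightarrow> 'e::ab_group_add \<Rightarrow> 'e) \<Rightarrow> nat \<Rightarrow> (nat \<Rightarrow> 'e set) \<Rightarrow> nat \<Rightarrow> (nat \<Rightarrow> 'e) \<Rightarrow> bool" where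
  "coordinated_basis sc s Fl n x \<longleftrightarrow> inj_on x {1..n} \<and> is_basis_of sc (x ` {1..n}) UNIV \<and>
     (\<forall>j\<le>Suc s. is_basis_of sc (x ` {1..n} \<inter> Fl j) (Fl j))"

definition height :: "(nat \<Rightarrow> 'e set) \<Rightarrow> (nat \<Rightarrow> 'e) \<Rightarrow> nat \<Rightarrow> nat" where
  "height Fl x i = (LEAST j. x i \<notin> Fl j)"

definition embedE ::
  "('k::field \<Rightarrow> 'e::ab_group_add \<Rightarrow> 'e) \<Rightarrow> nat \<Rightarrow> (nat \<Rightarrow> 'e) \<Rightarrow> 'e \<Rightarrow> 'k dps" where
  "embedE sc n x u = (\<Sum>i=1..n. dscale (module.representation sc (x ` {1..n}) u (x i)) (xpow i 1))"

inductive_set gen_subalgebra :: "'a::comm_ring_1 dps set \<Rightarrow> 'a dps set" for G where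
  "dp_const c \<in> gen_subalgebra G"
| "g \<in> G \<Longrightarrow> g \<in> gen_subalgebra G"
| "f \<in> gen_subalgebra G \<Longrightarrow> g \<in> gen_subalgebra G \<Longrightarrow> f + g \<in> gen_subalgebra G"
| "f \<in> gen_subalgebra G \<Longrightarrow> g \<in> gen_subalgebra G \<Longrightarrow> f * g \<in> gen_subalgebra G"

text \<open>The completion of the divided power algebra \<open>O(E)\<close>, with the basis \<open>x\<close> of \<open>E\<close> as variables;
  \<open>O(E)\<close> itself consists of the finitely supported elements.\<close>

definition Ohat :: "nat \<Rightarrow> 'a::comm_ring_1 dps set" where
  "Ohat n = {f. \<forall>\<alpha>. dcoeff f \<alpha> \<noteq> 0 \<longrightarrow> keys \<alpha> \<subseteq> {1..n}}"

definition O_flag :: "('k::field \<Rightarrow> 'e::ab_group_add \<Rightarrow> 'e) \<Rightarrow> nat \<Rightarrow> (nat \<Rightarrow> 'e set) \<Rightarrow> nat \<Rightarrow> (nat \<Rightarrow> 'e)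
    \<Rightarrow> 'k dps set" where
  "O_flag sc s Fl n x = gen_subalgebra {dpow (2 ^ j) (embedE sc n x u) | j u. j \<le> s \<and> u \<in> Fl j}"

text \<open>From here on \<open>A\<close> stands for \<open>O(\<F>)\<close>. Its elements with zero constant term form the
  unique maximal ideal.\<close>

definition max_ideal :: "'a::comm_ring_1 dps set \<Rightarrow> 'a dps set" where
  "max_ideal A = {f \<in> A. dcoeff f 0 = 0}"

definition max_ideal_sq :: "'a::comm_ring_1 dps set \<Rightarrow> 'a dps set" where
  "max_ideal_sq A = module.span dscale {f * g | f g. f \<in> max_ideal A \<and> g \<in> max_ideal A}"

text \<open>Elements of \<open>W\<close> are represented by the operators \<open>\<Sum>\<^sub>i g\<^sub>i \<partial>\<^sub>i\<close>.\<close>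

definition W :: "nat \<Rightarrow> 'a::comm_ring_1 dps set \<Rightarrow> ('a dps \<Rightarrow> 'a dps) set" where
  "W n A = {\<lambda>f. \<Sum>i=1..n. g i * pd i f | g. \<forall>i\<in>{1..n}. g i \<in> A}"


section \<open>Symmetric differential forms\<close>

text \<open>The divided power algebra over \<open>O(\<F>)\<close> on \<open>dx\<^sub>1, \<dots>, dx\<^sub>n\<close> is again a set of divided power
  series, now in the variables \<open>dx\<^sub>i\<close> and with coefficients in \<open>O(\<F>) \<subseteq> 'a dps\<close>; thus
  \<open>dcoeff \<omega> \<gamma>\<close> is the coefficient of \<open>\<omega>\<close> at \<open>\<Prod>\<^sub>i (dx\<^sub>i)\<^bsup>(\<gamma>\<^sub>i)\<^esup>\<close>.\<close>

type_synonym 'a form = "'a dps dps"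

abbreviation dxpow :: "nat \<Rightarrow> nat \<Rightarrow> 'a::comm_ring_1 form" where
  "dxpow i a \<equiv> dmon (Poly_Mapping.single i a)"

abbreviation dx :: "nat \<Rightarrow> 'a::comm_ring_1 form" where
  "dx i \<equiv> dxpow i 1"

definition kscale :: "'a::comm_ring_1 \<Rightarrow> 'a form \<Rightarrow> 'a form" where
  "kscale c \<omega> = dscale (dp_const c) \<omega>"

definition SOmega :: "nat \<Rightarrow> 'a::comm_ring_1 dps set \<Rightarrow> nat \<Rightarrow> 'a form set" where
  "SOmega n A k = {\<omega>. (\<forall>\<gamma>. dcoeff \<omega> \<gamma> \<in> A) \<and>
     (\<forall>\<gamma>. dcoeff \<omega> \<gamma> \<noteq> 0 \<longrightarrow> keys \<gamma> \<subseteq> {1..n} \<and> mdeg \<gamma> = k)}"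

text \<open>The rules \<open>d\<^sup>2 = 0\<close>, \<open>d(\<omega>\<^bsup>(r)\<^esup>) = \<omega>\<^bsup>(r-1)\<^esup> d\<omega>\<close> give \<open>d((dx\<^sub>1)\<^bsup>(\<gamma>\<^sub>1)\<^esup> \<cdots> (dx\<^sub>n)\<^bsup>(\<gamma>\<^sub>n)\<^esup>) = 0\<close>, so \<open>d\<close> is
  determined by \<open>df = \<Sum>\<^sub>i \<partial>\<^sub>i f dx\<^sub>i\<close> on the coefficients.\<close>

definition diff_form :: "nat \<Rightarrow> 'a::comm_ring_1 form \<Rightarrow> 'a form" where
  "diff_form n \<omega> = (\<Sum>i=1..n. dx i * Abs_dps (\<lambda>\<gamma>. pd i (dcoeff \<omega> \<gamma>)))"

text \<open>The matrix \<open>(\<omega>\<^sub>i\<^sub>j)\<close> (\<open>1 \<le> i, j \<le> n\<close>, shifted to \<open>0\<close>-based indices): for \<open>i \<noteq> j\<close> the entry is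
  the coefficient at \<open>dx\<^sub>i dx\<^sub>j\<close>, for \<open>i = j\<close> the one at \<open>(dx\<^sub>i)\<^bsup>(2)\<^esup>\<close>.\<close>

definition form_mat :: "nat \<Rightarrow> 'a::comm_ring_1 form \<Rightarrow> 'a dps mat" where
  "form_mat n \<omega> = mat n n (\<lambda>(i, j). dcoeff \<omega> (eps (Suc i) + eps (Suc j)))"

text \<open>\<open>\<omega>(D, D')\<close> for a 2-form \<open>\<omega>\<close>: here \<open>dx\<^sub>i(D) = D x\<^sub>i\<close>,
  \<open>(dx\<^sub>i dx\<^sub>j)(D, D') = D x\<^sub>i D' x\<^sub>j + D x\<^sub>j D' x\<^sub>i\<close> and \<open>(dx\<^sub>i)\<^bsup>(2)\<^esup>(D, D') = D x\<^sub>i D' x\<^sub>i\<close>.\<close>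

definition eval2 :: "nat \<Rightarrow> 'a::comm_ring_1 form \<Rightarrow> ('a dps \<Rightarrow> 'a dps) \<Rightarrow> ('a dps \<Rightarrow> 'a dps) \<Rightarrow> 'a dps" where
  "eval2 n \<omega> D D' = (\<Sum>i=1..n. \<Sum>j=1..n. dcoeff \<omega> (eps i + eps j) * D (xpow i 1) * D' (xpow j 1))"

definition nonalt_Hamiltonian :: "nat \<Rightarrow> 'a::comm_ring_1 dps set \<Rightarrow> 'a form \<Rightarrow> bool" where
  "nonalt_Hamiltonian n A \<omega> \<longleftrightarrow> \<omega> \<in> SOmega n A 2 \<and> diff_form n \<omega> = 0 \<and>
     (\<exists>u\<in>A. det (form_mat n \<omega>) * u = 1) \<and> (\<exists>D\<in>W n A. eval2 n \<omega> D D \<noteq> 0)"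

definition form_at_0 :: "'a::comm_ring_1 form \<Rightarrow> 'a form" where
  "form_at_0 \<omega> = Abs_dps (\<lambda>\<gamma>. dp_const (dcoeff (dcoeff \<omega> \<gamma>) 0))"

definition mat_at_0 :: "nat \<Rightarrow> 'a::comm_ring_1 form \<Rightarrow> 'a mat" where
  "mat_at_0 n \<omega> = map_mat (\<lambda>f. dcoeff f 0) (form_mat n \<omega>)"

definition canonical_form :: "nat \<Rightarrow> (nat \<Rightarrow> nat) \<Rightarrow> 'a::comm_ring_1 form \<Rightarrow> bool" where
  "canonical_form n m \<omega>0 \<longleftrightarrow> (\<exists>r e. 2 * r \<le> n \<and> (\<forall>i\<in>{1..r}. e (2*i - 1) \<in> {0, 1}) \<and>
     (\<forall>i\<in>{1..r}. e (2*i - 1) = 1 \<longrightarrow> m (2*i - 1) < m (2*i)) \<and>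
     \<omega>0 = (\<Sum>i=1..r. dx (2*i - 1) * dx (2*i)) + (\<Sum>i=1..r. kscale (e (2*i - 1)) (dxpow (2*i) 2))
          + (\<Sum>i=2*r+1..n. dxpow i 2))"

definition dz :: "(nat \<Rightarrow> nat) \<Rightarrow> nat \<Rightarrow> 'a::comm_ring_1 form" where
  "dz m i = dscale (xpow i (2 ^ m i - 1)) (dx i)"

text \<open>The removed set is a set of products taken in \<open>S\<Omega>\<^sup>1\<close>. For \<open>r = s\<close>, \<open>l = t\<close> the product
  \<open>x\<^sub>r\<^bsup>(2^l)\<^esup> x\<^sub>s\<^bsup>(2^t)\<^esup>\<close> vanishes in characteristic 2 and removes nothing.\<close>

definition m_tilde :: "nat \<Rightarrow> (nat \<Rightarrow> nat) \<Rightarrow> nat set \<Rightarrow> nat \<Rightarrow> 'a::comm_ring_1 form set" where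
  "m_tilde n m I j = module.span kscale
     ({dscale (dmon \<alpha>) (dx k) | \<alpha> k. keys \<alpha> \<subseteq> {1..n} \<and> (\<forall>i\<in>{1..n}. lookup \<alpha> i < 2 ^ m i) \<and>
         mdeg \<alpha> \<ge> j \<and> k \<in> {1..n}}
      - ({dscale (xpow r (2 ^ l) * xpow s (2 ^ t)) (dx i) | r s l t i. r \<in> {1..n} \<and> s \<in> {1..n} \<and> i \<in> I}
         \<union> {dscale (xpow q 2) (dx i) | q i. q \<in> I \<and> i \<in> I}))"


section \<open>Admissible automorphisms and conjugacy\<close>

definition algebra_aut :: "'a::comm_ring_1 dps set \<Rightarrow> ('a dps \<Rightarrow> 'a dps) \<Rightarrow> bool" where
  "algebra_aut A \<sigma> \<longleftrightarrow> bij_betw \<sigma> A A \<and> \<sigma> 1 = 1 \<and>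
     (\<forall>f\<in>A. \<forall>g\<in>A. \<sigma> (f + g) = \<sigma> f + \<sigma> g \<and> \<sigma> (f * g) = \<sigma> f * \<sigma> g) \<and>
     (\<forall>c. \<forall>f\<in>A. \<sigma> (dscale c f) = dscale c (\<sigma> f))"

text \<open>Continuity refers to the linear topology of the completion whose basic neighbourhoods of
  zero are \<open>{f. all x\<^bsup>(\<alpha>)\<^esup> occurring in f have |\<alpha>| \<ge> j}\<close>.\<close>

definition Ohat_ge :: "nat \<Rightarrow> nat \<Rightarrow> 'a::comm_ring_1 dps set" where
  "Ohat_ge n j = {f \<in> Ohat n. \<forall>\<alpha>. dcoeff f \<alpha> \<noteq> 0 \<longrightarrow> mdeg \<alpha> \<ge> j}"

definition Ohat_continuous :: "nat \<Rightarrow> ('a::comm_ring_1 dps \<Rightarrow> 'a dps) \<Rightarrow> bool" where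
  "Ohat_continuous n \<tau> \<longleftrightarrow> (\<forall>f\<in>Ohat n. \<forall>j. \<exists>k. \<forall>g\<in>Ohat n.
     g - f \<in> Ohat_ge n k \<longrightarrow> \<tau> g - \<tau> f \<in> Ohat_ge n j)"

definition admissible :: "nat \<Rightarrow> 'a::comm_ring_1 dps set \<Rightarrow> ('a dps \<Rightarrow> 'a dps) \<Rightarrow> bool" where
  "admissible n A \<sigma> \<longleftrightarrow> algebra_aut A \<sigma> \<and>
     (\<exists>\<tau>. algebra_aut (Ohat n) \<tau> \<and> Ohat_continuous n \<tau> \<and>
        (\<forall>\<alpha>. keys \<alpha> \<subseteq> {1..n} \<longrightarrow> \<tau> (dmon \<alpha>) = (\<Prod>i=1..n. dpow (lookup \<alpha> i) (\<tau> (xpow i 1)))) \<and>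
        (\<forall>f\<in>A. \<sigma> f = \<tau> f))"

definition G' :: "nat \<Rightarrow> 'a::comm_ring_1 dps set \<Rightarrow> ('a dps \<Rightarrow> 'a dps) set" where
  "G' n A = {\<sigma>. admissible n A \<sigma> \<and> (\<forall>f\<in>A. \<sigma> f - f \<in> max_ideal_sq A)}"

text \<open>\<open>acts_to n A \<sigma> \<omega> \<omega>'\<close> says \<open>\<omega>' = \<sigma>\<omega>\<close>; a 2-form is determined by its values on \<open>W \<times> W\<close>.\<close>

definition acts_to :: "nat \<Rightarrow> 'a::comm_ring_1 dps set \<Rightarrow> ('a dps \<Rightarrow> 'a dps) \<Rightarrow> 'a form \<Rightarrow> 'a form \<Rightarrow> bool" where
  "acts_to n A \<sigma> \<omega> \<omega>' \<longleftrightarrow> \<omega>' \<in> SOmega n A 2 \<and> (\<forall>D\<in>W n A. \<forall>D'\<in>W n A.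
     eval2 n \<omega>' D D' = \<sigma> (eval2 n \<omega> (the_inv_into A \<sigma> \<circ> D \<circ> \<sigma>) (the_inv_into A \<sigma> \<circ> D' \<circ> \<sigma>)))"

definition G'_conjugate :: "nat \<Rightarrow> 'a::comm_ring_1 dps set \<Rightarrow> 'a form \<Rightarrow> 'a form \<Rightarrow> bool" where
  "G'_conjugate n A \<omega> \<omega>' \<longleftrightarrow> (\<exists>\<sigma>\<in>G' n A. acts_to n A \<sigma> \<omega> \<omega>')"

end

theory Submission imports Defs begin

text \<open>The substitutions \<open>x\<^sub>i \<mapsto> x\<^sub>i + g\<^sub>i\<close>, where all \<open>g\<^sub>i\<close> are combinations of decomposable monomials,
  give enough elements of \<open>G'\<close> to bring \<open>\<omega>\<close> to the simplified forms. A monomial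
  is decomposable when it is a product of two monomials without constant term. In characteristic two
  the product \<open>x\<^bsup>(\<alpha>)\<^esup> x\<^bsup>(\<beta>)\<^esup>\<close> is \<open>x\<^bsup>(\<alpha>+\<beta>)\<^esup>\<close> if the binary addition of \<open>\<alpha>\<close> and \<open>\<beta>\<close> has no carries, and is zero
  otherwise, so the indecomposable monomials are the \<open>x\<^sub>i\<^bsup>(q)\<^esup>\<close> with \<open>q\<close> a power of two. The divided powers
  \<open>u\<^bsup>(j)\<^esup>\<close>, \<open>j \<ge> 2\<close>, of a decomposable monomial \<open>u\<close> vanish, whence \<open>(f + c u)\<^bsup>(k)\<^esup> = f\<^bsup>(k)\<^esup> + c u f\<^bsup>(k-1)\<^esup>\<close>
  (\<open>dpow_add_dmon\<close>). Every property of the divided powers of \<open>x\<^sub>i + g\<^sub>i\<close> follows from this by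
  induction over the monomials of \<open>g\<^sub>i\<close>.

  Let \<open>g = M\<^bsup>-1\<^esup> \<psi>\<close> with \<open>M\<close> the matrix of \<open>\<omega>(0)\<close> and \<open>M\<^bsup>-1\<^esup> = (ab\<^sub>i\<^sub>j)\<close>. If \<open>\<psi>\<close> is changed by \<open>\<eta>\<close> with terms of
  degree at least \<open>t\<close>, the image of \<open>\<omega>\<close> changes by \<open>d\<eta> + \<Sum>\<^sub>i ab\<^sub>i\<^sub>i (d\<eta>\<^sub>i)\<^bsup>(2)\<^esup>\<close>, up to differentials of
  one-forms of degree greater than \<open>t\<close> (\<open>image_coeff_diff\<close>). The squares are additive over monomials up to
  such differentials, and \<open>(du)\<^bsup>(2)\<^esup>\<close> vanishes unless \<open>u = x\<^sub>k\<^bsup>(p)\<^esup> x\<^sub>l\<^bsup>(q)\<^esup>\<close> with powers of two \<open>p\<close>, \<open>q\<close> and \<open>k \<noteq> l\<close>; then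
  it is \<open>x\<^sub>k\<^bsup>(2p-1)\<^esup> x\<^sub>l\<^bsup>(2q-1)\<^esup> dx\<^sub>k dx\<^sub>l\<close>. This is exact except for the single critical monomial \<open>u\<close> in which \<open>p\<close>
  and \<open>q\<close> are as large as possible, and there it equals \<open>dz\<^sub>k dz\<^sub>l\<close> (\<open>square_dmon\<close>).

  So the one-form \<open>\<phi>\<close> can be cancelled degree by degree, and the coefficients of the \<open>dz\<^sub>k dz\<^sub>l\<close> move by
  \<open>\<Sum>\<^sub>i ab\<^sub>i\<^sub>i c\<^sub>i\<^sup>2\<close>, \<open>c\<^sub>i\<close> the coefficient of the critical monomial in \<open>\<eta>\<^sub>i\<close>. For a given \<open>i0 \<in> I\<close> the coefficient
  \<open>c\<^sub>i\<^sub>0\<close> can be chosen freely without changing \<open>d\<eta>\<close>, by adding to \<open>\<eta>\<close> the differential of the critical monomial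
  times \<open>x\<^sub>i\<^sub>0\<close>. As \<open>K\<close> is perfect, every change of the coefficient of \<open>dz\<^sub>k dz\<^sub>l\<close> arises in this way
  (\<open>adjust_crit_sum\<close>). The product with \<open>x\<^sub>i\<^sub>0\<close> is available for all \<open>k\<close>, \<open>l\<close> if \<open>i0\<close> has height
  greater than one. If all heights on \<open>I\<close> are one, it is available for \<open>k, l \<notin> I\<close>, and the coefficients of the
  other \<open>dz\<^sub>k dz\<^sub>l\<close> stay fixed: for \<open>i \<in> I\<close> the monomials with two binary digits that involve
  a variable \<open>x\<^sub>k\<close> with \<open>k \<in> I\<close> are absent from \<open>\<phi>\<^sub>i\<close> and remain absent, because a product of a decomposable element with an element without constant term
  contains none of them (\<open>dec_times_free\<close>). Accordingly the reduction is carried out for a set \<open>J\<close> that is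
  empty in the first case and \<open>I\<close> in the second.

  The set \<open>I\<close> is not empty, for otherwise \<open>\<omega>(0)\<close>, and with it \<open>\<omega>\<close>, would be alternating.\<close>

section \<open>Parity of binomial coefficients\<close>

text \<open>By Kummer's theorem the binomial coefficient is odd exactly if the binary addition of \<open>a\<close> and \<open>b\<close> has no
  carry; the recursion \<open>no_carry_rec\<close> is this description digit by digit.\<close>

abbreviation no_carry :: "nat \<Rightarrow> nat \<Rightarrow> bool" where
  "no_carry a b \<equiv> odd ((a + b) choose a)"

lemma odd_choose_double:
  "odd ((2 * n) choose (2 * k)) = odd (n choose k) \<and> even ((2 * n) choose (2 * k + 1))"
proof (induction n arbitrary: k)
  case 0
  then show ?case by (cases k) auto
next
  case (Suc n)
  have D: "2 * Suc n = Suc (Suc (2 * n))" by simp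
  have E: "even ((2 * Suc n) choose (2 * k + 1))"
  proof (cases k)
    case 0
    then show ?thesis by simp
  next
    case (Suc j)
    have "(2 * Suc n) choose (2 * k + 1)
        = (2 * n choose (2 * j + 1)) + 2 * (2 * n choose (2 * k)) + (2 * n choose (2 * k + 1))"
      using Suc unfolding D by simp
    then show ?thesis using Suc.IH[of j] Suc.IH[of k] by simp
  qed
  have O: "odd ((2 * Suc n) choose (2 * k)) = odd (Suc n choose k)"
  proof (cases k)
    case 0
    then show ?thesis by simp
  next
    case (Suc j)
    have "(2 * Suc n) choose (2 * k)
        = (2 * n choose (2 * j)) + 2 * (2 * n choose (2 * j + 1)) + (2 * n choose (2 * k))"
      using Suc unfolding D by simp
    then show ?thesis using Suc.IH[of j] Suc.IH[of k] Suc by simp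
  qed
  from E O show ?case by blast
qed

lemma no_carry_rec:
  "no_carry a b \<longleftrightarrow> \<not> (odd a \<and> odd b) \<and> no_carry (a div 2) (b div 2)"
proof -
  define c d where "c = a div 2" and "d = b div 2"
  have ev: "no_carry (2 * c) (2 * d) = no_carry c d"
    using odd_choose_double[of "c + d" c] by (simp add: distrib_left)
  have e1: "odd (Suc (2 * (c + d)) choose (2 * c)) = no_carry c d"
  proof (cases c)
    case (Suc j)
    have "Suc (2 * (c + d)) choose (2 * c)
        = (2 * (c + d) choose (2 * j + 1)) + (2 * (c + d) choose (2 * c))"
      using Suc by simp
    then show ?thesis using odd_choose_double[of "c + d"] by simp
  qed simp
  have e2: "odd (Suc (2 * (c + d)) choose (2 * c + 1)) = no_carry c d"
    using odd_choose_double[of "c + d" c] by simp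
  have e3: "even (Suc (Suc (2 * (c + d))) choose (2 * c + 1))"
    using odd_choose_double[of "Suc (c + d)" c] by simp
  have s: "2 * c + Suc (2 * d) = Suc (2 * (c + d))" "Suc (2 * c) + 2 * d = Suc (2 * (c + d))"
     "Suc (2 * c) + Suc (2 * d) = Suc (Suc (2 * (c + d)))" by auto
  have "(a = 2 * c \<or> a = Suc (2 * c))" "(b = 2 * d \<or> b = Suc (2 * d))"
    unfolding c_def d_def by presburger+
  then consider "a = 2 * c" "b = 2 * d" | "a = 2 * c" "b = Suc (2 * d)"
    | "a = Suc (2 * c)" "b = 2 * d" | "a = Suc (2 * c)" "b = Suc (2 * d)" by blast
  then show ?thesis
  proof cases
    case 1 then show ?thesis using ev by simp
  next
    case 2 then show ?thesis using e1 s(1) by simp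
  next
    case 3 then show ?thesis using e2 s(2) by simp
  next
    case 4 then show ?thesis using e3 s(3) by simp
  qed
qed

lemma no_carry_commute: "no_carry a b \<longleftrightarrow> no_carry b a"
  using binomial_symmetric[of a "a + b"] by (simp add: add.commute)

lemma no_carry_0 [simp]: "no_carry 0 b" "no_carry a 0"
  by simp_all

lemma no_carry_less:
  assumes "no_carry a b" "a < 2 ^ m" "b < 2 ^ m" shows "a + b < 2 ^ m"
  using assms
proof (induction m arbitrary: a b)
  case (Suc m)
  have "a div 2 + b div 2 < 2 ^ m"
    using Suc.prems by (intro Suc.IH) (use no_carry_rec[of a b] in auto)
  moreover have "\<not> (odd a \<and> odd b)" using Suc.prems(1) no_carry_rec[of a b] by blast
  ultimately show ?case by (simp only: power_Suc) presburger
qed simp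

text \<open>A power of two has a single digit, which cannot be shared out without a carry. Hence
  \<open>x\<^sub>i\<^bsup>(q)\<^esup>\<close> with \<open>q = 2\<^sup>e\<close> is not a product.\<close>

lemma no_carry_eq_pow2:
  assumes "no_carry a b" "a + b = 2 ^ e" shows "a = 0 \<or> b = 0"
  using assms
proof (induction e arbitrary: a b)
  case (Suc e)
  have ev: "even (a + b)" using Suc.prems(2) by simp
  have nn: "\<not> (odd a \<and> odd b)" using Suc.prems(1) no_carry_rec[of a b] by blast
  with ev have "even a" "even b" by auto
  moreover from this have "a div 2 = 0 \<or> b div 2 = 0"
    using Suc.prems by (intro Suc.IH) (use no_carry_rec[of a b] in auto)
  ultimately show ?case by auto
qed auto

lemma no_carry_self: "no_carry a a \<Longrightarrow> a = 0"
proof (induction a rule: less_induct)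
  case (less a)
  have "\<not> odd a" "no_carry (a div 2) (a div 2)" using less.prems no_carry_rec[of a a] by blast+
  then show ?case using less.IH[of "a div 2"] by (cases "a = 0") auto
qed

lemma no_carry_split:
  assumes "a > 0" "\<And>e. a \<noteq> 2 ^ e"
  shows "\<exists>b c. b > 0 \<and> c > 0 \<and> a = b + c \<and> no_carry b c"
  using assms
proof (induction a rule: less_induct)
  case (less a)
  show ?case
  proof (cases "even a")
    case True
    then obtain a' where a': "a = 2 * a'" by blast
    have "a' \<noteq> 2 ^ e" for e using less.prems(2)[of "Suc e"] a' by simp
    with a' less obtain b c where bc: "b > 0" "c > 0" "a' = b + c" "no_carry b c"
      by (metis mult_2 less_add_same_cancel1 mult_0_right neq0_conv)
    have "no_carry (2 * b) (2 * c)" using bc(4) no_carry_rec[of "2 * b" "2 * c"] by simp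
    then show ?thesis using bc a' by (intro exI[of _ "2 * b"] exI[of _ "2 * c"]) auto
  next
    case False
    have "a \<noteq> 1" using less.prems(2)[of 0] by simp
    moreover have "no_carry 1 (a - 1)" using False no_carry_rec[of 1 "a - 1"] by simp
    ultimately show ?thesis using less.prems(1)
      by (intro exI[of _ 1] exI[of _ "a - 1"]) auto
  qed
qed

text \<open>Above the lowest digit one of \<open>a\<close> the digits of \<open>a\<close> and \<open>a - 1\<close> agree, so they must all be zero; at that digit
  and below there is never a carry.\<close>

lemma no_carry_pred_self:
  assumes "a > 0" shows "no_carry (a - 1) a \<longleftrightarrow> (\<exists>e. a = 2 ^ e)"
  using assms
proof (induction a rule: less_induct)
  case (less a)
  show ?case
  proof (cases "even a")
    case True
    then obtain b where b: "a = 2 * b" by blast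
    with less.prems have "b > 0" "b < a" by auto
    have "(a - 1) div 2 = b - 1" "a div 2 = b" using b \<open>b > 0\<close> by auto
    then have "no_carry (a - 1) a \<longleftrightarrow> no_carry (b - 1) b"
      using no_carry_rec[of "a - 1" a] True by metis
    also have "\<dots> \<longleftrightarrow> (\<exists>e. b = 2 ^ e)" using less.IH \<open>b > 0\<close> \<open>b < a\<close> by blast
    also have "\<dots> \<longleftrightarrow> (\<exists>e. a = 2 ^ e)"
    proof
      assume "\<exists>e. b = 2 ^ e" then show "\<exists>e. a = 2 ^ e" using b by (metis power_Suc)
    next
      assume "\<exists>e. a = 2 ^ e"
      then obtain e where e: "a = 2 ^ e" by blast
      then show "\<exists>e. b = 2 ^ e" using b by (cases e) auto
    qed
    finally show ?thesis .
  next
    case False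
    then obtain b where b: "a = Suc (2 * b)" by (metis oddE Suc_eq_plus1)
    have "(a - 1) div 2 = b" "a div 2 = b" using b by auto
    then have "no_carry (a - 1) a \<longleftrightarrow> no_carry b b"
      using no_carry_rec[of "a - 1" a] b by simp
    also have "\<dots> \<longleftrightarrow> b = 0" using no_carry_self[of b] by fastforce
    also have "\<dots> \<longleftrightarrow> (\<exists>e. a = 2 ^ e)"
    proof
      assume "b = 0" then show "\<exists>e. a = 2 ^ e" using b by (metis mult_0_right power_0 One_nat_def)
    next
      assume "\<exists>e. a = 2 ^ e"
      then obtain e where e: "a = 2 ^ e" by blast
      then show "b = 0" using b by (cases e) (auto, presburger)
    qed
    finally show ?thesis .
  qed
qed

section \<open>Multi-indices and coefficients\<close>

definition mno_carry :: "mindex \<Rightarrow> mindex \<Rightarrow> bool" where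
  "mno_carry \<alpha> \<beta> \<longleftrightarrow> (\<forall>i. no_carry (lookup \<alpha> i) (lookup \<beta> i))"

lemma odd_mchoose: "odd (mchoose (\<alpha> + \<beta>) \<alpha>) \<longleftrightarrow> mno_carry \<alpha> \<beta>"
proof -
  have "odd (mchoose (\<alpha> + \<beta>) \<alpha>) \<longleftrightarrow> (\<forall>i\<in>keys (\<alpha> + \<beta>). no_carry (lookup \<alpha> i) (lookup \<beta> i))"
    by (simp add: mchoose_def even_prod_iff lookup_add)
  also have "\<dots> \<longleftrightarrow> mno_carry \<alpha> \<beta>"
    unfolding mno_carry_def by (metis add_is_0 in_keys_iff lookup_add no_carry_0(1))
  finally show ?thesis .
qed

lemma mno_carry_commute: "mno_carry \<alpha> \<beta> \<longleftrightarrow> mno_carry \<beta> \<alpha>"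
  unfolding mno_carry_def by (metis no_carry_commute)

lemma mno_carry_0 [simp]: "mno_carry 0 \<beta>" "mno_carry \<alpha> 0"
  by (auto simp: mno_carry_def)

lemma mno_carry_self: "mno_carry \<alpha> \<alpha> \<Longrightarrow> \<alpha> = 0"
  unfolding mno_carry_def by (intro poly_mapping_eqI) (use no_carry_self in auto)

lemma mindex_le_imp_diff: "(\<And>i. lookup \<alpha> i \<le> lookup \<gamma> i) \<Longrightarrow> \<alpha> + (\<gamma> - \<alpha>) = \<gamma>" for \<alpha> \<gamma> :: mindex
  by (intro poly_mapping_eqI) (simp add: lookup_add lookup_minus)

lemma mdeg_superset: "finite S \<Longrightarrow> keys \<alpha> \<subseteq> S \<Longrightarrow> mdeg \<alpha> = (\<Sum>i\<in>S. lookup \<alpha> i)"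
  unfolding mdeg_def by (rule sum.mono_neutral_left) (auto simp: in_keys_iff)

lemma mdeg_add [simp]: "mdeg (\<alpha> + \<beta>) = mdeg \<alpha> + mdeg \<beta>"
proof -
  let ?S = "keys \<alpha> \<union> keys \<beta>"
  have "keys (\<alpha> + \<beta>) \<subseteq> ?S" by (rule Poly_Mapping.keys_add)
  then show ?thesis
    by (simp add: mdeg_superset[of ?S] lookup_add sum.distrib)
qed

lemma mdeg_single [simp]: "mdeg (Poly_Mapping.single i a) = a"
  by (simp add: mdeg_def)

lemma mdeg_zero [simp]: "mdeg 0 = 0"
  by (simp add: mdeg_def)

lemma mdeg_eq_0_iff [simp]: "mdeg \<alpha> = 0 \<longleftrightarrow> \<alpha> = 0"
  by (auto simp: mdeg_def in_keys_iff intro: poly_mapping_eqI)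

lemma keys_add_mindex: "keys (\<alpha> + \<beta>) = keys \<alpha> \<union> keys \<beta>" for \<alpha> \<beta> :: mindex
  by (auto simp: in_keys_iff lookup_add)

text \<open>The sums that define the action of a substitution on power series range over such sets.\<close>

lemma finite_bounded_mdeg: "finite S \<Longrightarrow> finite {\<alpha>::mindex. keys \<alpha> \<subseteq> S \<and> mdeg \<alpha> \<le> d}"
proof -
  assume S: "finite S"
  define \<gamma> where "\<gamma> = (\<Sum>i\<in>S. Poly_Mapping.single i d)"
  have \<gamma>: "lookup \<gamma> i = d" if "i \<in> S" for i
    using S that unfolding \<gamma>_def by (simp add: lookup_sum lookup_single when_def sum.delta)
  have "{\<alpha>::mindex. keys \<alpha> \<subseteq> S \<and> mdeg \<alpha> \<le> d} \<subseteq> {\<alpha>. \<forall>i. lookup \<alpha> i \<le> lookup \<gamma> i}"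
  proof safe
    fix \<alpha> :: mindex and i assume a: "keys \<alpha> \<subseteq> S" "mdeg \<alpha> \<le> d"
    show "lookup \<alpha> i \<le> lookup \<gamma> i"
    proof (cases "i \<in> keys \<alpha>")
      case True
      have "lookup \<alpha> i \<le> mdeg \<alpha>" unfolding mdeg_def by (rule member_le_sum) (use True in auto)
      with a True \<gamma> show ?thesis by fastforce
    qed (simp add: in_keys_iff)
  qed
  then show ?thesis by (rule finite_subset) (rule finite_below)
qed

lemma dcoeff_simps [simp]:
  "dcoeff 0 \<alpha> = 0" "dcoeff (f + g) \<alpha> = dcoeff f \<alpha> + dcoeff g \<alpha>"
  "dcoeff (f - g) \<alpha> = dcoeff f \<alpha> - dcoeff g \<alpha>" "dcoeff (- f) \<alpha> = - dcoeff f \<alpha>"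
  "dcoeff (dp_const c) \<alpha> = (if \<alpha> = 0 then c else 0)"
  "dcoeff (dmon \<beta>) \<alpha> = (if \<alpha> = \<beta> then 1 else 0)"
  "dcoeff 1 \<alpha> = (if \<alpha> = 0 then 1 else 0)"
  "dcoeff (pd i f) \<alpha> = dcoeff f (\<alpha> + eps i)"
  by (simp_all add: zero_dps_def plus_dps_def minus_dps_def uminus_dps_def dp_const_def dmon_def
      one_dps_def pd_def)

lemma dcoeff_sum [simp]: "dcoeff (\<Sum>i\<in>S. f i) \<alpha> = (\<Sum>i\<in>S. dcoeff (f i) \<alpha>)"
  by (induction S rule: infinite_finite_induct) auto

lemma dcoeff_times: "dcoeff (f * g) \<gamma>
    = (\<Sum>(\<alpha>, \<beta>)\<in>splits \<gamma>. of_nat (mchoose \<gamma> \<alpha>) * dcoeff f \<alpha> * dcoeff g \<beta>)"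
  by (simp add: times_dps_def)

lemma dcoeff_times_dmon:
  "dcoeff (dmon \<alpha> * g) (\<alpha> + \<beta>) = of_nat (mchoose (\<alpha> + \<beta>) \<alpha>) * dcoeff g \<beta>"
proof -
  have "dcoeff (dmon \<alpha> * g) (\<alpha> + \<beta>) = (\<Sum>(\<mu>, \<nu>)\<in>{(\<alpha>, \<beta>)}. of_nat (mchoose (\<alpha> + \<beta>) \<mu>) * dcoeff (dmon \<alpha>) \<mu> * dcoeff g \<nu>)"
    unfolding dcoeff_times by (rule sum.mono_neutral_right) (auto simp: finite_splits, auto simp: splits_def split: if_splits)
  then show ?thesis by simp
qed

lemma dcoeff_times_dmon_0:
  assumes "\<And>\<beta>. \<gamma> \<noteq> \<alpha> + \<beta>" shows "dcoeff (dmon \<alpha> * g) \<gamma> = 0"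
  unfolding dcoeff_times using assms by (intro sum.neutral) (auto simp: splits_def)

lemma dmon_times_dmon: "dmon \<alpha> * dmon \<beta> = of_nat (mchoose (\<alpha> + \<beta>) \<alpha>) * (dmon (\<alpha> + \<beta>) :: 'a::comm_ring_1 dps)"
proof (rule dps_eqI)
  fix \<gamma>
  have c: "of_nat k = (dp_const (of_nat k) :: 'a dps)" for k
    by (rule dps_eqI, induction k) auto
  have z: "(dmon 0 :: 'a dps) = 1" by (rule dps_eqI) simp
  have s: "dcoeff (dp_const a * h) \<gamma> = a * dcoeff h \<gamma>" for a :: 'a and h \<gamma>
  proof -
    have "dp_const a * h = dmon 0 * (dp_const a * h)" using z by simp
    have "dcoeff (dp_const a * h) \<gamma> = (\<Sum>(\<mu>, \<nu>)\<in>{(0, \<gamma>)}. of_nat (mchoose \<gamma> \<mu>) * dcoeff (dp_const a) \<mu> * dcoeff h \<nu>)"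
      unfolding dcoeff_times by (rule sum.mono_neutral_right) (auto simp: finite_splits, auto simp: splits_def split: if_splits)
    then show ?thesis by (simp add: mchoose_def)
  qed
  show "dcoeff (dmon \<alpha> * dmon \<beta>) \<gamma> = dcoeff (of_nat (mchoose (\<alpha> + \<beta>) \<alpha>) * (dmon (\<alpha> + \<beta>) :: 'a dps)) \<gamma>"
  proof (cases "\<exists>\<delta>. \<gamma> = \<alpha> + \<delta>")
    case True
    then obtain \<delta> where "\<gamma> = \<alpha> + \<delta>" by blast
    then show ?thesis by (auto simp: dcoeff_times_dmon c s)
  next
    case False
    then show ?thesis by (auto simp: dcoeff_times_dmon_0 c s)
  qed
qed

lemma dmon_0 [simp]: "dmon 0 = (1 :: 'a::comm_ring_1 dps)"
  by (rule dps_eqI) simp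

lemma dcoeff_dscale [simp]: "dcoeff (dscale a h) \<gamma> = a * dcoeff h \<gamma>"
proof -
  have "dcoeff (dp_const a * h) \<gamma> = (\<Sum>(\<mu>, \<nu>)\<in>{(0, \<gamma>)}. of_nat (mchoose \<gamma> \<mu>) * dcoeff (dp_const a) \<mu> * dcoeff h \<nu>)"
    unfolding dcoeff_times by (rule sum.mono_neutral_right) (auto simp: finite_splits, auto simp: splits_def split: if_splits)
  then show ?thesis by (simp add: mchoose_def dscale_def)
qed

lemma of_nat_dps: "of_nat k = (dp_const (of_nat k) :: 'a::comm_ring_1 dps)"
  by (rule dps_eqI, induction k) auto

lemma dscale_mult: "dscale c (f * g) = dscale c f * g" "dscale c (f * g) = f * dscale c g"
  by (simp_all add: dscale_def ac_simps)

lemma dscale_add: "dscale c (f + g) = dscale c f + dscale c g"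
  by (simp add: dscale_def distrib_left)

lemma dscale_sum: "dscale c (\<Sum>i\<in>S. f i) = (\<Sum>i\<in>S. dscale c (f i))"
  by (simp add: dscale_def sum_distrib_left)

lemma pd_linear: "pd i (f + g) = pd i f + pd i g" "pd i (f - g) = pd i f - pd i g" "pd i 0 = 0"
  "pd i (dscale c f) = dscale c (pd i f)" "pd i (dp_const c) = 0"
  by (rule dps_eqI; auto simp: poly_mapping_eq_iff fun_eq_iff lookup_add dest: spec[of _ i])+

lemma pd_sum: "pd i (\<Sum>j\<in>S. f j) = (\<Sum>j\<in>S. pd i (f j))"
  by (rule dps_eqI) simp

lemma pd_commute: "pd i (pd j f) = pd j (pd i f)" for f :: "'a::comm_ring_1 dps"
  by (rule dps_eqI) (simp add: ac_simps)

section \<open>Divided powers\<close>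

text \<open>The quotient \<open>c\<close> is the coefficient in \<open>(x\<^bsup>(a)\<^esup>)\<^bsup>(j)\<^esup> = c x\<^bsup>(ja)\<^esup>\<close>. It is the product of the binomial coefficients
  \<open>(ia - 1) choose (a - 1)\<close>, \<open>i \<le> j\<close>, of which the one with \<open>i = 2\<close> is even unless \<open>a\<close> is a power of two.\<close>

lemma fact_mult_pow:
  assumes "a > 0"
  obtains c :: nat where "fact (j * a) = c * (fact j * fact a ^ j)"
    and "j \<ge> 2 \<Longrightarrow> (\<And>e. a \<noteq> 2 ^ e) \<Longrightarrow> even c"
proof -
  have step: "fact (Suc j * a) = (((Suc j * a - 1) choose (a - 1)) * c) * (fact (Suc j) * fact a ^ Suc j)"
    if c: "fact (j * a) = c * (fact j * fact a ^ j)" for j c :: nat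
  proof -
    have "a * ((Suc j * a) choose a) = a * (Suc j * ((Suc j * a - 1) choose (a - 1)))"
      using times_binomial_minus1_eq[of a "Suc j * a"] assms by (simp only: ac_simps)
    then have e: "(Suc j * a) choose a = Suc j * ((Suc j * a - 1) choose (a - 1))"
      using assms by simp
    have "fact (Suc j * a) = fact a * fact (j * a) * ((Suc j * a) choose a)"
      using binomial_fact_lemma[of a "Suc j * a"] by simp
    then show ?thesis unfolding c e by (simp only: fact_Suc power_Suc of_nat_id ac_simps)
  qed
  have "\<exists>c::nat. fact (j * a) = c * (fact j * fact a ^ j) \<and> (j \<ge> 2 \<longrightarrow> (\<forall>e. a \<noteq> 2 ^ e) \<longrightarrow> even c)"
  proof (induction j)
    case 0
    then show ?case by simp
  next
    case (Suc j)
    then obtain c :: nat where c: "fact (j * a) = c * (fact j * fact a ^ j)"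
      "j \<ge> 2 \<Longrightarrow> (\<forall>e. a \<noteq> 2 ^ e) \<Longrightarrow> even c" by blast
    let ?d = "((Suc j * a - 1) choose (a - 1)) * c"
    have "even ?d" if "Suc j \<ge> 2" "\<forall>e. a \<noteq> 2 ^ e"
    proof (cases "j \<ge> 2")
      case True
      then show ?thesis using c(2) that by simp
    next
      case False
      then have "j = 1" using that by simp
      then have "Suc j * a - 1 = (a - 1) + a" using assms by simp
      then have "even ((Suc j * a - 1) choose (a - 1))"
        using no_carry_pred_self[OF assms] that(2) by metis
      then show ?thesis by simp
    qed
    then show ?case using step[OF c(1)] by blast
  qed
  then obtain c :: nat where "fact (j * a) = c * (fact j * fact a ^ j)" "j \<ge> 2 \<longrightarrow> (\<forall>e. a \<noteq> 2 ^ e) \<longrightarrow> even c"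
    by blast
  then show thesis by (intro that[of c]) auto
qed

text \<open>The multi-indices of the monomials that are products of two monomials without constant
  term: in characteristic two \<open>x\<^bsup>(\<alpha>)\<^esup>\<close> is indecomposable exactly for \<open>\<alpha> = 2\<^sup>e \<epsilon>\<^sub>i\<close>.\<close>

definition decomposable :: "mindex \<Rightarrow> bool" where
  "decomposable \<alpha> \<longleftrightarrow> \<alpha> \<noteq> 0 \<and> (\<forall>i e. \<alpha> \<noteq> Poly_Mapping.single i (2 ^ e))"

declare sum_mset_replicate_mset [simp del]

lemma lookup_sum_replicate: "lookup (\<Sum>\<^sub># (replicate_mset j \<alpha>)) i = j * lookup \<alpha> i"
  by (induction j) (auto simp: lookup_add)

lemma mfact_superset: "finite S \<Longrightarrow> keys \<alpha> \<subseteq> S \<Longrightarrow> mfact \<alpha> = (\<Prod>i\<in>S. fact (lookup \<alpha> i))"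
  unfolding mfact_def by (rule prod.mono_neutral_left) (auto simp: in_keys_iff)

lemma single_eq_if_keys: "keys \<alpha> = {i} \<Longrightarrow> \<alpha> = Poly_Mapping.single i (lookup \<alpha> i)" for \<alpha> :: mindex
  by (rule poly_mapping_eqI) (auto simp: lookup_single when_def in_keys_iff set_eq_iff)

text \<open>Divided powers \<open>u\<^bsup>(j)\<^esup>\<close>, \<open>j \<ge> 2\<close>, of a decomposable monomial vanish modulo two: if \<open>\<alpha>\<close> has at least two
  keys, the quotient contains a factor \<open>j!\<close>, and otherwise \<open>fact_mult_pow\<close> applies.\<close>

lemma mfact_mult_pow:
  assumes "\<alpha> \<noteq> 0"
  obtains c where "mfact (\<Sum>\<^sub># (replicate_mset j \<alpha>)) = c * (fact j * mfact \<alpha> ^ j)"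
    and "j \<ge> 2 \<Longrightarrow> decomposable \<alpha> \<Longrightarrow> even c"
proof -
  define S where "S = keys \<alpha>"
  have S: "finite S" "S \<noteq> {}" using assms by (auto simp: S_def)
  have "\<exists>c::nat. fact (j * lookup \<alpha> i) = c * (fact j * fact (lookup \<alpha> i) ^ j) \<and>
      (j \<ge> 2 \<longrightarrow> (\<forall>e. lookup \<alpha> i \<noteq> 2 ^ e) \<longrightarrow> even c)" if "i \<in> S" for i
  proof -
    have "lookup \<alpha> i > 0" using that by (simp add: S_def in_keys_iff)
    then obtain c :: nat where "fact (j * lookup \<alpha> i) = c * (fact j * fact (lookup \<alpha> i) ^ j)"
      "j \<ge> 2 \<Longrightarrow> (\<And>e. lookup \<alpha> i \<noteq> 2 ^ e) \<Longrightarrow> even c" using fact_mult_pow[of "lookup \<alpha> i" j] by metis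
    then show ?thesis by (intro exI[of _ c]) auto
  qed
  then obtain c :: "nat \<Rightarrow> nat" where c: "\<And>i. i \<in> S \<Longrightarrow> fact (j * lookup \<alpha> i) = c i * (fact j * fact (lookup \<alpha> i) ^ j)"
    "\<And>i. i \<in> S \<Longrightarrow> j \<ge> 2 \<Longrightarrow> (\<forall>e. lookup \<alpha> i \<noteq> 2 ^ e) \<Longrightarrow> even (c i)"
    by metis
  have "mfact (\<Sum>\<^sub># (replicate_mset j \<alpha>)) = (\<Prod>i\<in>S. fact (j * lookup \<alpha> i))"
    by (subst mfact_superset[of S]) (auto simp: S_def in_keys_iff lookup_sum_replicate)
  also have "\<dots> = (\<Prod>i\<in>S. c i) * fact j ^ card S * (\<Prod>i\<in>S. fact (lookup \<alpha> i)) ^ j"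
    by (simp add: c(1) prod.distrib prod_power_distrib mult.assoc)
  also have "fact j ^ card S = fact j * fact j ^ (card S - 1)"
    using S by (metis card_gt_0_iff power_Suc Suc_pred')
  finally have e: "mfact (\<Sum>\<^sub># (replicate_mset j \<alpha>))
      = ((\<Prod>i\<in>S. c i) * fact j ^ (card S - 1)) * (fact j * mfact \<alpha> ^ j)"
    by (simp add: mfact_def S_def ac_simps)
  have "even ((\<Prod>i\<in>S. c i) * fact j ^ (card S - 1))" if "j \<ge> 2" "decomposable \<alpha>"
  proof (cases "card S = 1")
    case True
    then obtain i where i: "S = {i}" by (rule card_1_singletonE)
    have "\<forall>e. lookup \<alpha> i \<noteq> 2 ^ e"
      using single_eq_if_keys[of \<alpha> i] i that(2) unfolding S_def decomposable_def by metis
    then show ?thesis using c(2)[of i] i that(1) by simp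
  next
    case False
    then have "card S - 1 > 0" using S by (metis card_gt_0_iff One_nat_def Suc_lessI zero_less_diff)
    moreover have "even (fact j :: nat)" using that(1) by (simp add: dvd_fact)
    ultimately show ?thesis by simp
  qed
  then show thesis using that e by blast
qed

definition dpow_den :: "mindex multiset \<Rightarrow> nat" where
  "dpow_den M = (\<Prod>\<alpha>\<in>set_mset M. fact (count M \<alpha>)) * (\<Prod>\<alpha>\<in>#M. mfact \<alpha>)"

lemma dpow_den_pos: "dpow_den M > 0"
proof -
  have "(\<Prod>\<alpha>\<in>#M. mfact \<alpha>) > 0" by (induction M) (auto simp: mfact_pos)
  then show ?thesis by (simp add: dpow_den_def prod_pos)
qed

lemma dpow_coeff_eqI: "mfact (\<Sum>\<^sub># M) = c * dpow_den M \<Longrightarrow> dpow_coeff M = c"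
  using dpow_den_pos[of M] by (simp add: dpow_coeff_def dpow_den_def)

lemma dpow_den_split:
  assumes "\<alpha> \<notin># N"
  shows "dpow_den (replicate_mset j \<alpha> + N) = (fact j * mfact \<alpha> ^ j) * dpow_den N"
proof -
  let ?M = "replicate_mset j \<alpha> + N"
  have "(\<Prod>\<beta>\<in>set_mset ?M. fact (count ?M \<beta>) :: nat) = (\<Prod>\<beta>\<in>insert \<alpha> (set_mset N). fact (count ?M \<beta>))"
    by (rule prod.mono_neutral_left) (auto split: if_splits simp: not_in_iff)
  also have "\<dots> = fact j * (\<Prod>\<beta>\<in>set_mset N. fact (count N \<beta>))"
  proof -
    have "count N \<alpha> = 0" using assms by (simp add: not_in_iff)
    moreover have "(\<Prod>\<beta>\<in>set_mset N. fact (count ?M \<beta>) :: nat) = (\<Prod>\<beta>\<in>set_mset N. fact (count N \<beta>))"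
      by (rule prod.cong) (use assms in auto)
    ultimately show ?thesis using assms by simp
  qed
  finally show ?thesis unfolding dpow_den_def by (simp add: image_replicate_mset ac_simps)
qed

lemma mfact_split_mset:
  assumes "\<alpha> \<notin># N" "mfact (\<Sum>\<^sub># (replicate_mset j \<alpha>)) = c * (fact j * mfact \<alpha> ^ j)"
    "mfact (\<Sum>\<^sub># N) = d * dpow_den N"
  shows "mfact (\<Sum>\<^sub># (replicate_mset j \<alpha> + N))
    = (mchoose (\<Sum>\<^sub># (replicate_mset j \<alpha> + N)) (\<Sum>\<^sub># (replicate_mset j \<alpha>)) * c * d)
       * dpow_den (replicate_mset j \<alpha> + N)"
  using mchoose_mfact[of "\<Sum>\<^sub># (replicate_mset j \<alpha>)" "\<Sum>\<^sub># N"]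
  unfolding dpow_den_split[OF assms(1)] assms(2,3) sum_mset.union by (simp only: ac_simps)

text \<open>The truncating division in \<open>dpow_coeff\<close> is exact: the multiset is split into the blocks of equal
  elements, each block has an integral quotient by \<open>mfact_mult_pow\<close>, and the blocks are joined by multinomial
  coefficients.\<close>

lemma dpow_den_dvd: "0 \<notin># M \<Longrightarrow> dpow_den M dvd mfact (\<Sum>\<^sub># M)"
proof (induction "card (set_mset M)" arbitrary: M rule: less_induct)
  case less
  show ?case
  proof (cases "M = {#}")
    case True
    then show ?thesis by (simp add: dpow_den_def)
  next
    case False
    then obtain \<alpha> where \<alpha>: "\<alpha> \<in># M" by blast
    define N where "N = filter_mset (\<lambda>x. x \<noteq> \<alpha>) M"
    have M: "M = replicate_mset (count M \<alpha>) \<alpha> + N"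
      unfolding N_def by (rule multiset_eqI) auto
    have "set_mset N = set_mset M - {\<alpha>}" unfolding N_def by auto
    then have "card (set_mset N) < card (set_mset M)" using \<alpha> by (metis card_Diff1_less finite_set_mset)
    moreover have "0 \<notin># N" using less.prems by (simp add: N_def)
    ultimately obtain d where d: "mfact (\<Sum>\<^sub># N) = d * dpow_den N"
      using less.hyps[of N] by (metis dvd_def mult.commute)
    have "\<alpha> \<noteq> 0" using \<alpha> less.prems by auto
    then obtain c where "mfact (\<Sum>\<^sub># (replicate_mset (count M \<alpha>) \<alpha>)) = c * (fact (count M \<alpha>) * mfact \<alpha> ^ count M \<alpha>)"
      by (rule mfact_mult_pow)
    from mfact_split_mset[OF _ this d] show ?thesis unfolding M[symmetric] by (simp add: N_def)
  qed
qed

lemma dpow_coeff_exact: "0 \<notin># M \<Longrightarrow> mfact (\<Sum>\<^sub># M) = dpow_coeff M * dpow_den M"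
  using dpow_den_dvd[of M] by (simp add: dpow_coeff_def dpow_den_def)

text \<open>By this the multisets with a repeated decomposable index drop out of the divided powers in characteristic
  two.\<close>

lemma dpow_coeff_even:
  assumes "0 \<notin># M" "decomposable \<alpha>" "count M \<alpha> \<ge> 2"
  shows "even (dpow_coeff M)"
proof -
  define N where "N = filter_mset (\<lambda>x. x \<noteq> \<alpha>) M"
  have M: "M = replicate_mset (count M \<alpha>) \<alpha> + N"
    unfolding N_def by (rule multiset_eqI) auto
  have "0 \<notin># N" using assms(1) by (simp add: N_def)
  note d = dpow_coeff_exact[OF this]
  have "\<alpha> \<noteq> 0" using assms by (auto simp: decomposable_def)
  then obtain c where c: "mfact (\<Sum>\<^sub># (replicate_mset (count M \<alpha>) \<alpha>)) = c * (fact (count M \<alpha>) * mfact \<alpha> ^ count M \<alpha>)"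
    "count M \<alpha> \<ge> 2 \<Longrightarrow> decomposable \<alpha> \<Longrightarrow> even c"
    using mfact_mult_pow[of \<alpha> "count M \<alpha>"] by metis
  have "even c" using c(2) assms by blast
  from mfact_split_mset[OF _ c(1) d]
  have "mfact (\<Sum>\<^sub># M) = (mchoose (\<Sum>\<^sub># M) (\<Sum>\<^sub># (replicate_mset (count M \<alpha>) \<alpha>)) * c * dpow_coeff N) * dpow_den M"
    unfolding M[symmetric] by (simp add: N_def)
  then have "dpow_coeff M = mchoose (\<Sum>\<^sub># M) (\<Sum>\<^sub># (replicate_mset (count M \<alpha>) \<alpha>)) * c * dpow_coeff N"
    by (rule dpow_coeff_eqI)
  then show ?thesis using \<open>even c\<close> by simp
qed

lemma dpow_coeff_add_mset:
  assumes "0 \<notin># N" "\<alpha> \<notin># N" "\<alpha> \<noteq> 0"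
  shows "dpow_coeff (add_mset \<alpha> N) = mchoose (\<alpha> + \<Sum>\<^sub># N) \<alpha> * dpow_coeff N"
proof -
  have "mfact (\<Sum>\<^sub># (replicate_mset 1 \<alpha>)) = 1 * (fact 1 * mfact \<alpha> ^ 1)" by simp
  from mfact_split_mset[OF assms(2) this dpow_coeff_exact[OF assms(1)]]
  show ?thesis by (intro dpow_coeff_eqI) simp
qed

definition dpow_msets :: "nat \<Rightarrow> mindex \<Rightarrow> mindex multiset set" where
  "dpow_msets k \<beta> = {M. size M = k \<and> 0 \<notin># M \<and> \<Sum>\<^sub># M = \<beta>}"

lemma dcoeff_dpow: "dcoeff (dpow k f) \<beta> =
    (\<Sum>M\<in>dpow_msets k \<beta>. of_nat (dpow_coeff M) * (\<Prod>\<alpha>\<in>#M. dcoeff f \<alpha>))"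
  by (simp add: dpow_def dpow_msets_def)

lemma lookup_le_sum_mset: "\<alpha> \<in># M \<Longrightarrow> lookup \<alpha> i \<le> lookup (\<Sum>\<^sub># M) i" for M :: "mindex multiset"
  by (induction M) (auto simp: lookup_add)

lemma finite_dpow_msets: "finite (dpow_msets k \<beta>)"
proof (rule finite_subset)
  show "dpow_msets k \<beta> \<subseteq> multisets_of_size {\<alpha>. \<forall>i. lookup \<alpha> i \<le> lookup \<beta> i} k"
    by (auto simp: dpow_msets_def multisets_of_size_def lookup_le_sum_mset)
qed (intro finite_multisets_of_size finite_below)

lemma dpow_0 [simp]: "dpow 0 f = 1"
proof (rule dps_eqI)
  fix \<beta>
  have "dpow_msets 0 \<beta> = (if \<beta> = 0 then {{#}} else {})" by (auto simp: dpow_msets_def)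
  then show "dcoeff (dpow 0 f) \<beta> = dcoeff 1 \<beta>" by (simp add: dcoeff_dpow dpow_coeff_def mfact_def)
qed

lemma prod_mset_eq_0: "\<alpha> \<in># M \<Longrightarrow> g \<alpha> = 0 \<Longrightarrow> (\<Prod>\<alpha>\<in>#M. g \<alpha>) = 0" for g :: "_ \<Rightarrow> 'a::comm_ring_1"
  by (induction M) auto

lemma dcoeff_dpow_nonzeroE:
  fixes f :: "'a::comm_ring_1 dps"
  assumes "dcoeff (dpow k f) \<beta> \<noteq> 0"
  obtains M where "M \<in> dpow_msets k \<beta>" "\<And>\<alpha>. \<alpha> \<in># M \<Longrightarrow> dcoeff f \<alpha> \<noteq> 0"
proof -
  obtain M where M: "M \<in> dpow_msets k \<beta>" "of_nat (dpow_coeff M) * (\<Prod>\<alpha>\<in>#M. dcoeff f \<alpha>) \<noteq> 0"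
    using assms unfolding dcoeff_dpow by (meson sum.neutral)
  then have "dcoeff f \<alpha> \<noteq> 0" if "\<alpha> \<in># M" for \<alpha>
    using prod_mset_eq_0[OF that, of "dcoeff f"] by auto
  with M that show thesis by blast
qed

lemma dpow_order:
  assumes "dcoeff (dpow k f) \<beta> \<noteq> 0" shows "k \<le> mdeg \<beta>"
proof -
  obtain M where "M \<in> dpow_msets k \<beta>" using assms by (rule dcoeff_dpow_nonzeroE)
  then have "size M = k" "0 \<notin># M" "\<Sum>\<^sub># M = \<beta>" by (auto simp: dpow_msets_def)
  moreover have "0 \<notin># M \<Longrightarrow> size M \<le> mdeg (\<Sum>\<^sub># M)"
  proof (induction M)
    case (add \<alpha> M)
    then have "mdeg \<alpha> \<noteq> 0" by auto
    then have "Suc 0 \<le> mdeg \<alpha>" by linarith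
    with add show ?case by simp
  qed simp
  ultimately show ?thesis by blast
qed

lemma mfact_single: "mfact (Poly_Mapping.single i k) = fact k"
  by (cases "k = 0") (auto simp: mfact_def)

lemma dpow_xpow_1: "dpow k (xpow i 1 :: 'a::comm_ring_1 dps) = xpow i k"
proof (rule dps_eqI)
  fix \<beta>
  let ?M = "replicate_mset k (eps i)"
  have s: "\<Sum>\<^sub># ?M = Poly_Mapping.single i k"
    by (rule poly_mapping_eqI) (auto simp: lookup_sum_replicate lookup_single when_def)
  have c: "dpow_coeff ?M = 1"
    by (rule dpow_coeff_eqI) (simp only: s mfact_single, cases "k = 0", auto simp: dpow_den_def mfact_single)
  have e: "M = ?M" if "size M = k" "\<And>\<alpha>. \<alpha> \<in># M \<Longrightarrow> dcoeff (xpow i 1 :: 'a dps) \<alpha> \<noteq> 0" for M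
  proof -
    have "set_mset M \<subseteq> {eps i}" using that(2) by (fastforce split: if_splits)
    then show ?thesis using that(1) set_mset_subset_singletonD[of M "eps i"] by blast
  qed
  have "dcoeff (dpow k (xpow i 1 :: 'a dps)) \<beta> = (\<Sum>M\<in>(if \<beta> = Poly_Mapping.single i k then {?M} else {}).
      of_nat (dpow_coeff M) * (\<Prod>\<alpha>\<in>#M. dcoeff (xpow i 1 :: 'a dps) \<alpha>))"
    unfolding dcoeff_dpow
  proof (rule sum.mono_neutral_right[OF finite_dpow_msets])
    show "(if \<beta> = Poly_Mapping.single i k then {?M} else {}) \<subseteq> dpow_msets k \<beta>"
      using s by (auto simp: dpow_msets_def dest: arg_cong[of _ _ "\<lambda>\<alpha>. lookup \<alpha> i"])
    show "\<forall>M\<in>dpow_msets k \<beta> - (if \<beta> = Poly_Mapping.single i k then {?M} else {}).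
      of_nat (dpow_coeff M) * (\<Prod>\<alpha>\<in>#M. dcoeff (xpow i 1 :: 'a dps) \<alpha>) = 0"
    proof
      fix M assume M: "M \<in> dpow_msets k \<beta> - (if \<beta> = Poly_Mapping.single i k then {?M} else {})"
      have "M \<noteq> ?M"
      proof
        assume "M = ?M"
        moreover have "\<Sum>\<^sub># M = \<beta>" using M by (simp add: dpow_msets_def)
        ultimately have "\<beta> = Poly_Mapping.single i k" using s by simp
        note \<open>M = ?M\<close> and this
        then show False using M by simp
      qed
      moreover have "size M = k" using M by (auto simp: dpow_msets_def)
      ultimately obtain \<alpha> where "\<alpha> \<in># M" "dcoeff (xpow i 1 :: 'a dps) \<alpha> = 0" using e by blast
      then have "(\<Prod>\<alpha>\<in>#M. dcoeff (xpow i 1 :: 'a dps) \<alpha>) = 0" by (rule prod_mset_eq_0)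
      then show "of_nat (dpow_coeff M) * (\<Prod>\<alpha>\<in>#M. dcoeff (xpow i 1 :: 'a dps) \<alpha>) = 0" by simp
    qed
  qed
  also have "\<dots> = dcoeff (xpow i k) \<beta>"
    using c by (simp add: image_replicate_mset)
  finally show "dcoeff (dpow k (xpow i 1 :: 'a dps)) \<beta> = dcoeff (xpow i k) \<beta>" .
qed

section \<open>Characteristic two\<close>

lemma of_nat_char2: "CHAR('a::comm_ring_1) = 2 \<Longrightarrow> (of_nat k :: 'a) = (if odd k then 1 else 0)"
  by (metis (no_types, opaque_lifting) add.left_neutral even_iff_mod_2_eq_zero mult_zero_left odd_iff_mod_2_eq_one of_nat_0
      of_nat_1 of_nat_CHAR of_nat_add of_nat_mult div_mult_mod_eq mult.commute)

lemma char2_dps: "CHAR('a::comm_ring_1) = 2 \<Longrightarrow> CHAR('a dps) = 2"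
proof (rule CHAR_eqI)
  assume c: "CHAR('a) = 2"
  show "of_nat 2 = (0 :: 'a dps)"
    unfolding of_nat_dps of_nat_char2[OF c] by (rule dps_eqI) simp
  fix x assume "of_nat x = (0 :: 'a dps)"
  then have "dcoeff (of_nat x :: 'a dps) 0 = 0" by simp
  then show "2 dvd x" unfolding of_nat_dps by (simp add: of_nat_char2[OF c] split: if_splits)
qed

lemma add_self_char2: "CHAR('a::comm_ring_1) = 2 \<Longrightarrow> (x :: 'a) + x = 0"
  using minus_CHAR_2[of x x] by simp

lemma dcoeff_times_char2:
  assumes "CHAR('a::comm_ring_1) = 2"
  shows "dcoeff (f * g :: 'a dps) \<gamma>
    = (\<Sum>(\<alpha>, \<beta>)\<in>{(\<alpha>, \<beta>)\<in>splits \<gamma>. mno_carry \<alpha> \<beta>}. dcoeff f \<alpha> * dcoeff g \<beta>)"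
proof -
  have "dcoeff (f * g) \<gamma> = (\<Sum>(\<alpha>, \<beta>)\<in>splits \<gamma>. if mno_carry \<alpha> \<beta> then dcoeff f \<alpha> * dcoeff g \<beta> else 0)"
    unfolding dcoeff_times
    by (rule sum.cong) (auto simp: splits_def of_nat_char2[OF assms] odd_mchoose)
  also have "\<dots> = (\<Sum>(\<alpha>, \<beta>)\<in>{(\<alpha>, \<beta>)\<in>splits \<gamma>. mno_carry \<alpha> \<beta>}. dcoeff f \<alpha> * dcoeff g \<beta>)"
    by (rule sum.mono_neutral_cong_right[OF finite_splits]) (auto split: if_splits)
  finally show ?thesis .
qed

lemma dmon_times_char2:
  assumes "CHAR('a::comm_ring_1) = 2"
  shows "dmon \<alpha> * dmon \<beta> = (if mno_carry \<alpha> \<beta> then dmon (\<alpha> + \<beta>) else (0 :: 'a dps))"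
  unfolding dmon_times_dmon using of_nat_char2[OF char2_dps[OF assms]] odd_mchoose[of \<alpha> \<beta>] by auto

lemma dmon_square_char2: "CHAR('a::comm_ring_1) = 2 \<Longrightarrow> \<alpha> \<noteq> 0 \<Longrightarrow> dmon \<alpha> * dmon \<alpha> = (0 :: 'a dps)"
  using mno_carry_self[of \<alpha>] by (auto simp: dmon_times_char2)

text \<open>The formula \<open>(f + c u)\<^bsup>(k+1)\<^esup> = f\<^bsup>(k+1)\<^esup> + c u f\<^bsup>(k)\<^esup>\<close> for a decomposable monomial \<open>u\<close> that does not occur in
  \<open>f\<close>. The multisets without \<open>u\<close> contribute the first summand, those containing \<open>u\<close> once the second, and those
  containing it more often nothing. As \<open>u\<^sup>2 = 0\<close>, the restriction on \<open>f\<close> is then lifted in \<open>dpow_add_dmon\<close>.\<close>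

lemma dpow_add_dmon_fresh:
  fixes f :: "'a::comm_ring_1 dps"
  assumes "CHAR('a) = 2" "decomposable \<alpha>" "dcoeff f \<alpha> = 0"
  shows "dpow (Suc k) (f + dscale c (dmon \<alpha>)) = dpow (Suc k) f + dscale c (dmon \<alpha>) * dpow k f"
proof (rule dps_eqI)
  fix \<beta>
  let ?h = "f + dscale c (dmon \<alpha>)"
  let ?P = "\<lambda>g M. of_nat (dpow_coeff M) * (\<Prod>\<gamma>\<in>#M. dcoeff g \<gamma>) :: 'a"
  let ?S = "dpow_msets (Suc k) \<beta>"
  have \<alpha>0: "\<alpha> \<noteq> 0" using assms(2) by (simp add: decomposable_def)
  have h_off: "(\<Prod>\<gamma>\<in>#M. dcoeff ?h \<gamma>) = (\<Prod>\<gamma>\<in>#M. dcoeff f \<gamma>)" if "\<alpha> \<notin># M" for M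
    using that by (intro arg_cong[of _ _ prod_mset] image_mset_cong) auto
  have "dcoeff (dpow (Suc k) ?h) \<beta> = sum (?P ?h) (?S \<inter> {M. count M \<alpha> \<le> 1})"
    unfolding dcoeff_dpow
  proof (rule sum.mono_neutral_right[OF finite_dpow_msets], blast, rule ballI)
    fix M assume "M \<in> ?S - ?S \<inter> {M. count M \<alpha> \<le> 1}"
    then have "0 \<notin># M" "count M \<alpha> \<ge> 2" by (auto simp: dpow_msets_def)
    then show "?P ?h M = 0" using dpow_coeff_even[OF _ assms(2)] by (simp add: of_nat_char2[OF assms(1)])
  qed
  also have "?S \<inter> {M. count M \<alpha> \<le> 1} = {M\<in>?S. \<alpha> \<notin># M} \<union> {M\<in>?S. count M \<alpha> = 1}"
    by (auto simp: not_in_iff)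
  also have "sum (?P ?h) \<dots> = sum (?P ?h) {M\<in>?S. \<alpha> \<notin># M} + sum (?P ?h) {M\<in>?S. count M \<alpha> = 1}"
    by (rule sum.union_disjoint) (auto simp: finite_dpow_msets not_in_iff)
  also have "sum (?P ?h) {M\<in>?S. \<alpha> \<notin># M} = sum (?P f) {M\<in>?S. \<alpha> \<notin># M}"
    by (rule sum.cong[OF refl]) (use h_off in simp)
  also have "\<dots> = dcoeff (dpow (Suc k) f) \<beta>"
    unfolding dcoeff_dpow
    by (rule sum.mono_neutral_left) (auto simp: finite_dpow_msets assms(3) prod_mset_eq_0)
  also have "sum (?P ?h) {M\<in>?S. count M \<alpha> = 1} = dcoeff (dscale c (dmon \<alpha>) * dpow k f) \<beta>"
  proof (cases "\<exists>\<delta>. \<beta> = \<alpha> + \<delta>")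
    case False
    have "{M\<in>?S. count M \<alpha> = 1} = {}"
    proof safe
      fix M assume "M \<in> ?S" "count M \<alpha> = 1"
      then have "\<alpha> \<in># M" "\<Sum>\<^sub># M = \<beta>" by (metis count_inI zero_neq_one, simp add: dpow_msets_def)
      then obtain N where "M = add_mset \<alpha> N" by (blast dest: multi_member_split)
      with \<open>\<Sum>\<^sub># M = \<beta>\<close> have "\<beta> = \<alpha> + \<Sum>\<^sub># N" by simp
      with False show "M \<in> {}" by blast
    qed
    moreover have "dcoeff (dmon \<alpha> * dpow k f) \<beta> = 0" using False by (intro dcoeff_times_dmon_0) blast
    then have "dcoeff (dscale c (dmon \<alpha>) * dpow k f) \<beta> = 0" by (simp flip: dscale_mult(1))
    ultimately show ?thesis by (simp only: sum.empty)
  next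
    case True
    then obtain \<delta> where \<delta>: "\<beta> = \<alpha> + \<delta>" by blast
    have "sum (?P ?h) {M\<in>?S. count M \<alpha> = 1}
        = (\<Sum>N\<in>{N\<in>dpow_msets k \<delta>. \<alpha> \<notin># N}. c * of_nat (mchoose \<beta> \<alpha>) * ?P f N)"
    proof (rule sum.reindex_bij_witness[where i = "add_mset \<alpha>" and j = "\<lambda>M. M - {#\<alpha>#}"])
      fix M assume M: "M \<in> {M\<in>?S. count M \<alpha> = 1}"
      then have "\<alpha> \<in># M" by (metis (mono_tags, lifting) count_inI mem_Collect_eq zero_neq_one)
      define N where "N = M - {#\<alpha>#}"
      have MN: "M = add_mset \<alpha> N" using \<open>\<alpha> \<in># M\<close> by (simp add: N_def)
      have N_props: "0 \<notin># N" "\<alpha> \<notin># N" "\<Sum>\<^sub># N = \<delta>" "size N = k"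
        using M \<delta> \<alpha>0 unfolding MN by (auto simp: dpow_msets_def not_in_iff)
      show "add_mset \<alpha> (M - {#\<alpha>#}) = M" using \<open>\<alpha> \<in># M\<close> by simp
      show "M - {#\<alpha>#} \<in> {N\<in>dpow_msets k \<delta>. \<alpha> \<notin># N}"
        unfolding N_def[symmetric] using N_props by (simp add: dpow_msets_def)
      show "c * of_nat (mchoose \<beta> \<alpha>) * ?P f (M - {#\<alpha>#}) = ?P ?h M"
        unfolding N_def[symmetric] unfolding MN
        using \<alpha>0 \<delta> assms(3) h_off[of N] N_props by (simp add: dpow_coeff_add_mset ac_simps)
    next
      fix N assume N: "N \<in> {N\<in>dpow_msets k \<delta>. \<alpha> \<notin># N}"
      then show "add_mset \<alpha> N - {#\<alpha>#} = N" by simp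
      show "add_mset \<alpha> N \<in> {M\<in>?S. count M \<alpha> = 1}"
        using N \<delta> \<alpha>0 by (auto simp: dpow_msets_def not_in_iff)
    qed
    also have "\<dots> = (\<Sum>N\<in>dpow_msets k \<delta>. c * of_nat (mchoose \<beta> \<alpha>) * ?P f N)"
      by (rule sum.mono_neutral_left) (auto simp: finite_dpow_msets assms(3) prod_mset_eq_0)
    also have "\<dots> = c * dcoeff (dmon \<alpha> * dpow k f) \<beta>"
      unfolding \<delta> dcoeff_times_dmon by (simp add: dcoeff_dpow sum_distrib_left ac_simps)
    finally show ?thesis by (simp flip: dscale_mult(1))
  qed
  finally show "dcoeff (dpow (Suc k) ?h) \<beta>
      = dcoeff (dpow (Suc k) f + dscale c (dmon \<alpha>) * dpow k f) \<beta>" by simp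
qed

lemma dpow_add_dmon:
  fixes f :: "'a::comm_ring_1 dps"
  assumes "CHAR('a) = 2" "decomposable \<alpha>"
  shows "dpow (Suc k) (f + dscale c (dmon \<alpha>)) = dpow (Suc k) f + dscale c (dmon \<alpha>) * dpow k f"
proof -
  let ?u = "\<lambda>c. dscale c (dmon \<alpha>) :: 'a dps"
  define a f0 where "a = dcoeff f \<alpha>" and "f0 = f - ?u a"
  have f0: "dcoeff f0 \<alpha> = 0" "f = f0 + ?u a" by (simp_all add: f0_def a_def)
  have "\<alpha> \<noteq> 0" using assms(2) by (simp add: decomposable_def)
  have sq: "?u c * (?u a * g) = 0" for g
  proof -
    have "?u c * (?u a * g) = dp_const c * dp_const a * g * (dmon \<alpha> * dmon \<alpha>)"
      unfolding dscale_def by (simp only: ac_simps)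
    then show ?thesis using dmon_square_char2[OF assms(1) \<open>\<alpha> \<noteq> 0\<close>] by simp
  qed
  have uadd: "?u (a + c) = ?u a + ?u c" by (rule dps_eqI) (simp add: distrib_right)
  have prev: "?u c * dpow k f = ?u c * dpow k f0"
  proof (cases k)
    case (Suc j)
    show ?thesis unfolding Suc by (simp add: f0(2) dpow_add_dmon_fresh[OF assms f0(1)] distrib_left sq)
  qed simp
  have "dpow (Suc k) (f + ?u c) = dpow (Suc k) (f0 + ?u (a + c))"
    using f0(2) uadd by (simp add: add.assoc)
  also have "\<dots> = dpow (Suc k) f0 + (?u a + ?u c) * dpow k f0"
    by (simp only: dpow_add_dmon_fresh[OF assms f0(1)] uadd[symmetric])
  also have "\<dots> = dpow (Suc k) f + ?u c * dpow k f"
    unfolding prev by (simp add: f0(2) dpow_add_dmon_fresh[OF assms f0(1)] distrib_right)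
  finally show ?thesis .
qed

section \<open>Supports\<close>

definition supp_in :: "mindex set \<Rightarrow> 'a::comm_ring_1 dps set" where
  "supp_in S = {f. \<forall>\<alpha>. dcoeff f \<alpha> \<noteq> 0 \<longrightarrow> \<alpha> \<in> S}"

lemma supp_inD: "f \<in> supp_in S \<Longrightarrow> \<alpha> \<notin> S \<Longrightarrow> dcoeff f \<alpha> = 0"
  by (auto simp: supp_in_def)

lemma supp_in_mono: "S \<subseteq> T \<Longrightarrow> f \<in> supp_in S \<Longrightarrow> f \<in> supp_in T"
  by (auto simp: supp_in_def)

lemma supp_in_0 [simp]: "0 \<in> supp_in S"
  by (simp add: supp_in_def)

lemma supp_in_add: "f \<in> supp_in S \<Longrightarrow> g \<in> supp_in S \<Longrightarrow> f + g \<in> supp_in S"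
  by (auto simp: supp_in_def) (metis add.right_neutral)

lemma supp_in_uminus: "f \<in> supp_in S \<Longrightarrow> - f \<in> supp_in S"
  by (auto simp: supp_in_def)

lemma supp_in_diff: "f \<in> supp_in S \<Longrightarrow> g \<in> supp_in S \<Longrightarrow> f - g \<in> supp_in S"
  using supp_in_add[of f S "- g"] supp_in_uminus[of g S] by simp

lemma supp_in_sum: "(\<And>i. i \<in> I \<Longrightarrow> f i \<in> supp_in S) \<Longrightarrow> (\<Sum>i\<in>I. f i) \<in> supp_in S"
  by (induction I rule: infinite_finite_induct) (auto intro: supp_in_add)

lemma supp_in_dscale: "f \<in> supp_in S \<Longrightarrow> dscale c f \<in> supp_in S"
  by (auto simp: supp_in_def) (metis mult_zero_right)

lemma supp_in_dmon: "\<alpha> \<in> S \<Longrightarrow> dmon \<alpha> \<in> supp_in S"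
  by (auto simp: supp_in_def split: if_splits)

lemma supp_in_pd: "f \<in> supp_in S \<Longrightarrow> (\<And>\<alpha>. \<alpha> + eps k \<in> S \<Longrightarrow> \<alpha> \<in> T) \<Longrightarrow> pd k f \<in> supp_in T"
  by (auto simp: supp_in_def)

lemma supp_in_times:
  assumes "CHAR('a::comm_ring_1) = 2" "f \<in> supp_in S" "(g :: 'a dps) \<in> supp_in T"
    and "\<And>\<mu> \<nu>. \<mu> \<in> S \<Longrightarrow> \<nu> \<in> T \<Longrightarrow> mno_carry \<mu> \<nu> \<Longrightarrow> \<mu> + \<nu> \<in> U"
  shows "f * g \<in> supp_in U"
  unfolding supp_in_def
proof (safe, rule ccontr)
  fix \<gamma> assume nz: "dcoeff (f * g) \<gamma> \<noteq> 0" and "\<gamma> \<notin> U"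
  have "dcoeff (f * g) \<gamma> = 0"
    unfolding dcoeff_times_char2[OF assms(1)]
  proof (rule sum.neutral, clarify)
    fix \<mu> \<nu> assume "(\<mu>, \<nu>) \<in> splits \<gamma>" "mno_carry \<mu> \<nu>"
    then have "\<mu> \<notin> S \<or> \<nu> \<notin> T" using assms(4)[of \<mu> \<nu>] \<open>\<gamma> \<notin> U\<close> by (auto simp: splits_def)
    then show "dcoeff f \<mu> * dcoeff g \<nu> = 0" using assms(2,3) by (metis supp_inD mult_zero_left mult_zero_right)
  qed
  with nz show False ..
qed

text \<open>The form in which \<open>dpow_add_dmon\<close> is used: induction over the monomials of a polynomial.\<close>

lemma supp_in_induct [consumes 2, case_names zero add]:
  fixes f :: "'a::comm_ring_1 dps"
  assumes "finite S" "f \<in> supp_in S" "P 0"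
    and "\<And>f \<alpha> c. f \<in> supp_in S \<Longrightarrow> \<alpha> \<in> S \<Longrightarrow> P f \<Longrightarrow> P (f + dscale c (dmon \<alpha>))"
  shows "P f"
proof -
  have "P (\<Sum>\<alpha>\<in>T. dscale (dcoeff f \<alpha>) (dmon \<alpha>))" if "T \<subseteq> S" for T
    using finite_subset[OF that assms(1)] that
  proof (induction T rule: finite_induct)
    case (insert \<alpha> T)
    have "(\<Sum>\<beta>\<in>T. dscale (dcoeff f \<beta>) (dmon \<beta>)) \<in> supp_in S"
      using insert.prems by (intro supp_in_sum supp_in_dscale supp_in_dmon) auto
    then have "P ((\<Sum>\<beta>\<in>T. dscale (dcoeff f \<beta>) (dmon \<beta>)) + dscale (dcoeff f \<alpha>) (dmon \<alpha>))"
      using insert by (intro assms(4)) auto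
    then show ?case using insert.hyps by (simp add: add.commute)
  qed (simp add: assms(3))
  moreover have "(\<Sum>\<alpha>\<in>S. dscale (dcoeff f \<alpha>) (dmon \<alpha>)) = f"
  proof (rule dps_eqI)
    fix \<beta>
    have "dcoeff (\<Sum>\<alpha>\<in>S. dscale (dcoeff f \<alpha>) (dmon \<alpha>)) \<beta> = (\<Sum>\<alpha>\<in>S. if \<alpha> = \<beta> then dcoeff f \<alpha> else 0)"
      by (auto intro!: sum.cong)
    then show "dcoeff (\<Sum>\<alpha>\<in>S. dscale (dcoeff f \<alpha>) (dmon \<alpha>)) \<beta> = dcoeff f \<beta>"
      using assms(1,2) by (auto simp: sum.delta supp_in_def)
  qed
  ultimately show ?thesis by (metis order_refl)
qed

section \<open>Partial derivatives\<close>

lemma mfact_add_eps: "mfact (\<alpha> + eps k) = Suc (lookup \<alpha> k) * mfact \<alpha>"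
proof -
  let ?S = "insert k (keys \<alpha>)"
  have "mfact (\<alpha> + eps k) = (\<Prod>i\<in>?S. fact (lookup (\<alpha> + eps k) i))"
    by (rule mfact_superset) (auto simp: keys_add_mindex)
  also have "\<dots> = fact (Suc (lookup \<alpha> k)) * (\<Prod>i\<in>?S - {k}. fact (lookup (\<alpha> + eps k) i))"
    by (subst prod.remove[of _ k]) (auto simp: lookup_add lookup_single)
  also have "(\<Prod>i\<in>?S - {k}. fact (lookup (\<alpha> + eps k) i) :: nat) = (\<Prod>i\<in>?S - {k}. fact (lookup \<alpha> i))"
    by (rule prod.cong) (auto simp: lookup_add lookup_single)
  also have "fact (Suc (lookup \<alpha> k)) * \<dots> = Suc (lookup \<alpha> k) * (\<Prod>i\<in>?S. fact (lookup \<alpha> i))"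
    by (subst prod.remove[of ?S k]) (auto simp: algebra_simps)
  also have "(\<Prod>i\<in>?S. fact (lookup \<alpha> i)) = mfact \<alpha>"
    by (rule mfact_superset[symmetric]) auto
  finally show ?thesis .
qed

lemma minus_eps_add: "lookup \<mu> k > 0 \<Longrightarrow> \<mu> - eps k + eps k = \<mu>" for \<mu> :: mindex
  by (intro poly_mapping_eqI) (auto simp: lookup_add lookup_minus lookup_single when_def)

lemma minus_eps_add_left:
  assumes "\<mu> + \<nu> = \<gamma> + eps k" "lookup \<mu> k > 0" shows "\<mu> - eps k + \<nu> = \<gamma>"
proof -
  have "\<mu> - eps k + \<nu> + eps k = \<gamma> + eps k"
    using assms(1) minus_eps_add[OF assms(2)] by (metis add.assoc add.commute)
  then show ?thesis by (simp only: add_right_cancel)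
qed

lemma add_eps_nonzero [simp]: "\<alpha> + Poly_Mapping.single k (Suc 0) \<noteq> 0" for \<alpha> :: mindex
proof
  assume "\<alpha> + Poly_Mapping.single k (Suc 0) = 0"
  from arg_cong[OF this, of mdeg] show False by simp
qed

text \<open>Pascal's rule in the variable \<open>k\<close>; it amounts to the Leibniz rule on monomials.\<close>

lemma mchoose_pascal:
  assumes "\<mu> + \<nu> = \<gamma> + eps k"
  shows "mchoose (\<gamma> + eps k) \<mu> = (if lookup \<mu> k > 0 then mchoose \<gamma> (\<mu> - eps k) else 0)
    + (if lookup \<nu> k > 0 then mchoose \<gamma> \<mu> else 0)"
proof -
  have deg: "lookup \<mu> k + lookup \<nu> k = Suc (lookup \<gamma> k)"
    using arg_cong[OF assms, of "\<lambda>\<alpha>. lookup \<alpha> k"] by (simp add: lookup_add)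
  have a: "(if lookup \<mu> k > 0 then mchoose \<gamma> (\<mu> - eps k) else 0) * (mfact \<mu> * mfact \<nu>) = lookup \<mu> k * mfact \<gamma>"
  proof (cases "lookup \<mu> k > 0")
    case True
    define \<mu>' where "\<mu>' = \<mu> - eps k"
    have \<mu>: "\<mu> = \<mu>' + eps k" using minus_eps_add[OF True] by (simp add: \<mu>'_def)
    have "\<gamma> = \<mu>' + \<nu>" using minus_eps_add_left[OF assms True] by (simp add: \<mu>'_def)
    then have "mchoose \<gamma> \<mu>' * (mfact \<mu>' * mfact \<nu>) = mfact \<gamma>" using mchoose_mfact by simp
    moreover have "mfact \<mu> = lookup \<mu> k * mfact \<mu>'" unfolding \<mu> mfact_add_eps by (simp add: lookup_add)
    ultimately show ?thesis using True by (simp add: \<mu>'_def)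
  qed simp
  have b: "(if lookup \<nu> k > 0 then mchoose \<gamma> \<mu> else 0) * (mfact \<mu> * mfact \<nu>) = lookup \<nu> k * mfact \<gamma>"
  proof (cases "lookup \<nu> k > 0")
    case True
    define \<nu>' where "\<nu>' = \<nu> - eps k"
    have \<nu>: "\<nu> = \<nu>' + eps k" using minus_eps_add[OF True] by (simp add: \<nu>'_def)
    have "\<gamma> = \<mu> + \<nu>'" using minus_eps_add_left[of \<nu> \<mu> \<gamma> k] assms True by (simp add: \<nu>'_def add.commute)
    then have "mchoose \<gamma> \<mu> * (mfact \<mu> * mfact \<nu>') = mfact \<gamma>" using mchoose_mfact by simp
    moreover have "mfact \<nu> = lookup \<nu> k * mfact \<nu>'" unfolding \<nu> mfact_add_eps by (simp add: lookup_add)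
    ultimately show ?thesis using True by simp
  qed simp
  have "mchoose (\<gamma> + eps k) \<mu> * (mfact \<mu> * mfact \<nu>) = Suc (lookup \<gamma> k) * mfact \<gamma>"
    using mchoose_mfact[of \<mu> \<nu>] assms mfact_add_eps by simp
  also have "\<dots> = lookup \<mu> k * mfact \<gamma> + lookup \<nu> k * mfact \<gamma>"
    unfolding deg[symmetric] by (simp only: distrib_right)
  also have "\<dots> = ((if lookup \<mu> k > 0 then mchoose \<gamma> (\<mu> - eps k) else 0)
    + (if lookup \<nu> k > 0 then mchoose \<gamma> \<mu> else 0)) * (mfact \<mu> * mfact \<nu>)"
    unfolding a[symmetric] b[symmetric] by (simp only: distrib_right)
  finally show ?thesis using mfact_pos[of \<mu>] mfact_pos[of \<nu>] by simp
qed

lemma dcoeff_pd_times: "dcoeff (pd k f * g) \<gamma> = (\<Sum>(\<mu>, \<nu>)\<in>splits (\<gamma> + eps k).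
    (if lookup \<mu> k > 0 then of_nat (mchoose \<gamma> (\<mu> - eps k)) else 0) * dcoeff f \<mu> * dcoeff g \<nu>)"
  (is "_ = sum ?f ?S") for f g :: "'a::comm_ring_1 dps"
proof -
  have "sum ?f ?S = sum ?f {(\<mu>, \<nu>)\<in>?S. lookup \<mu> k > 0}"
    by (rule sum.mono_neutral_right) (auto simp: finite_splits split: if_splits)
  also have "\<dots> = dcoeff (pd k f * g) \<gamma>" unfolding dcoeff_times
  proof (rule sum.reindex_bij_witness[where i = "\<lambda>(\<mu>, \<nu>). (\<mu> + eps k, \<nu>)" and j = "\<lambda>(\<mu>, \<nu>). (\<mu> - eps k, \<nu>)"])
    fix p assume "p \<in> {(\<mu>, \<nu>)\<in>?S. lookup \<mu> k > 0}"
    then obtain \<mu> \<nu> where p: "p = (\<mu>, \<nu>)" "\<mu> + \<nu> = \<gamma> + eps k" "lookup \<mu> k > 0" by (auto simp: splits_def)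
    note q = minus_eps_add[OF p(3)] minus_eps_add_left[OF p(2,3)]
    show "(\<lambda>(\<mu>, \<nu>). (\<mu> + eps k, \<nu>)) ((\<lambda>(\<mu>, \<nu>). (\<mu> - eps k, \<nu>)) p) = p"
      "(\<lambda>(\<mu>, \<nu>). (\<mu> - eps k, \<nu>)) p \<in> splits \<gamma>"
      using p q by (simp_all add: splits_def)
    show "(case (\<lambda>(\<mu>, \<nu>). (\<mu> - eps k, \<nu>)) p of (\<alpha>, \<beta>) \<Rightarrow>
      of_nat (mchoose \<gamma> \<alpha>) * dcoeff (pd k f) \<alpha> * dcoeff g \<beta>) = ?f p"
      using p q by (simp del: One_nat_def)
  next
    fix p assume "p \<in> splits \<gamma>"
    then obtain \<mu> \<nu> where p: "p = (\<mu>, \<nu>)" "\<mu> + \<nu> = \<gamma>" by (auto simp: splits_def)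
    then have "\<mu> + eps k + \<nu> = \<gamma> + eps k" by (simp only: ac_simps flip: p(2))
    then show "(\<lambda>(\<mu>, \<nu>). (\<mu> - eps k, \<nu>)) ((\<lambda>(\<mu>, \<nu>). (\<mu> + eps k, \<nu>)) p) = p"
      "(\<lambda>(\<mu>, \<nu>). (\<mu> + eps k, \<nu>)) p \<in> {(\<mu>, \<nu>)\<in>?S. lookup \<mu> k > 0}"
      using p(1) by (simp_all add: splits_def lookup_add)
  qed
  finally show ?thesis by simp
qed

lemma pd_times: "pd k (f * g) = pd k f * g + f * pd k g" for f g :: "'a::comm_ring_1 dps"
proof (rule dps_eqI)
  fix \<gamma>
  let ?S = "splits (\<gamma> + eps k)"
  note 1 = dcoeff_pd_times[of k f g \<gamma>]
  have 2: "dcoeff (f * pd k g) \<gamma> = (\<Sum>(\<mu>, \<nu>)\<in>?S. (if lookup \<nu> k > 0 then of_nat (mchoose \<gamma> \<mu>) else 0)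
      * dcoeff f \<mu> * dcoeff g \<nu>)"
    unfolding mult.commute[of f] dcoeff_pd_times
  proof (rule sum.reindex_bij_witness[where i = prod.swap and j = prod.swap])
    fix p assume "p \<in> ?S"
    then obtain \<mu> \<nu> where p: "p = (\<nu>, \<mu>)" "\<nu> + \<mu> = \<gamma> + eps k" by (auto simp: splits_def)
    show "prod.swap p \<in> ?S" using p by (simp add: splits_def add.commute)
    have "mchoose \<gamma> (\<nu> - eps k) = mchoose \<gamma> \<mu>" if "lookup \<nu> k > 0"
      using mchoose_comm[of "\<nu> - eps k" \<mu>] minus_eps_add_left[OF p(2) that] by simp
    then show "(case prod.swap p of (\<mu>, \<nu>) \<Rightarrow> (if lookup \<nu> k > 0 then of_nat (mchoose \<gamma> \<mu>) else 0)
        * dcoeff f \<mu> * dcoeff g \<nu>) = (case p of (\<mu>, \<nu>) \<Rightarrow>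
        (if lookup \<mu> k > 0 then of_nat (mchoose \<gamma> (\<mu> - eps k)) else 0) * dcoeff g \<mu> * dcoeff f \<nu>)"
      using p(1) by (simp add: ac_simps)
  qed (auto simp: splits_def add.commute)
  have "dcoeff (pd k (f * g)) \<gamma> = (\<Sum>(\<mu>, \<nu>)\<in>?S. (if lookup \<mu> k > 0 then of_nat (mchoose \<gamma> (\<mu> - eps k)) else 0)
      * dcoeff f \<mu> * dcoeff g \<nu> + (if lookup \<nu> k > 0 then of_nat (mchoose \<gamma> \<mu>) else 0)
      * dcoeff f \<mu> * dcoeff g \<nu>)"
    unfolding dcoeff_simps dcoeff_times
  proof (rule sum.cong[OF refl], clarify)
    fix \<mu> \<nu> assume "(\<mu>, \<nu>) \<in> ?S"
    then have "mchoose (\<gamma> + eps k) \<mu> = (if lookup \<mu> k > 0 then mchoose \<gamma> (\<mu> - eps k) else 0)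
      + (if lookup \<nu> k > 0 then mchoose \<gamma> \<mu> else 0)" by (intro mchoose_pascal) (simp add: splits_def)
    then show "of_nat (mchoose (\<gamma> + eps k) \<mu>) * dcoeff f \<mu> * dcoeff g \<nu>
      = (if lookup \<mu> k > 0 then of_nat (mchoose \<gamma> (\<mu> - eps k)) else 0)
      * dcoeff f \<mu> * dcoeff g \<nu> + (if lookup \<nu> k > 0 then of_nat (mchoose \<gamma> \<mu>) else 0)
      * dcoeff f \<mu> * dcoeff g \<nu>" by (auto simp: distrib_right)
  qed
  then show "dcoeff (pd k (f * g)) \<gamma> = dcoeff (pd k f * g + f * pd k g) \<gamma>"
    unfolding dcoeff_simps(2) 1 2 by (simp add: sum.distrib split_def)
qed

lemma pd_dmon: "pd k (dmon \<alpha>) = (if lookup \<alpha> k > 0 then dmon (\<alpha> - eps k) else (0 :: 'a::comm_ring_1 dps))"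
proof (rule dps_eqI)
  fix \<beta>
  have "\<beta> + eps k = \<alpha> \<longleftrightarrow> lookup \<alpha> k > 0 \<and> \<beta> = \<alpha> - eps k"
    using minus_eps_add[of \<alpha> k] by (auto simp: lookup_add)
  then show "dcoeff (pd k (dmon \<alpha>)) \<beta> = dcoeff (if lookup \<alpha> k > 0 then dmon (\<alpha> - eps k) else (0 :: 'a dps)) \<beta>"
    by auto
qed

lemma pd_prod: "finite S \<Longrightarrow> pd k (\<Prod>i\<in>S. f i) = (\<Sum>i\<in>S. pd k (f i) * (\<Prod>j\<in>S - {i}. f j))"
  for f :: "'b \<Rightarrow> 'a::comm_ring_1 dps"
proof (induction S rule: finite_induct)
  case empty
  have "pd k (1 :: 'a dps) = 0" by (rule dps_eqI) simp
  then show ?case by simp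
next
  case (insert i S)
  have "(\<Prod>l\<in>insert i S - {j}. f l) = f i * (\<Prod>l\<in>S - {j}. f l)" if "j \<in> S" for j
  proof -
    have "insert i S - {j} = insert i (S - {j})" using insert.hyps that by auto
    then show ?thesis using insert.hyps by simp
  qed
  then have "(\<Sum>j\<in>S. pd k (f j) * (\<Prod>l\<in>insert i S - {j}. f l)) = f i * (\<Sum>j\<in>S. pd k (f j) * (\<Prod>l\<in>S - {j}. f l))"
    by (simp add: sum_distrib_left ac_simps)
  moreover have "insert i S - {i} = S" using insert.hyps by auto
  ultimately show ?case using insert by (simp add: pd_times)
qed

section \<open>Truncation boxes and decomposable indices\<close>

definition box :: "nat \<Rightarrow> (nat \<Rightarrow> nat) \<Rightarrow> mindex set" where
  "box n m = {\<alpha>. keys \<alpha> \<subseteq> {1..n} \<and> (\<forall>i\<in>{1..n}. lookup \<alpha> i < 2 ^ m i)}"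

lemma finite_box: "finite (box n m)"
proof (rule finite_subset)
  show "box n m \<subseteq> {\<alpha>. keys \<alpha> \<subseteq> {1..n} \<and> mdeg \<alpha> \<le> (\<Sum>i\<in>{1..n}. 2 ^ m i)}"
  proof
    fix \<alpha> assume \<alpha>: "\<alpha> \<in> box n m"
    then have "mdeg \<alpha> = (\<Sum>i\<in>{1..n}. lookup \<alpha> i)" by (intro mdeg_superset) (auto simp: box_def)
    also have "\<dots> \<le> (\<Sum>i\<in>{1..n}. 2 ^ m i)" using \<alpha> by (intro sum_mono less_imp_le) (simp add: box_def)
    finally show "\<alpha> \<in> {\<alpha>. keys \<alpha> \<subseteq> {1..n} \<and> mdeg \<alpha> \<le> (\<Sum>i\<in>{1..n}. 2 ^ m i)}"
      using \<alpha> by (simp add: box_def)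
  qed
qed (simp add: finite_bounded_mdeg)

lemma box_add: "\<mu> \<in> box n m \<Longrightarrow> \<nu> \<in> box n m \<Longrightarrow> mno_carry \<mu> \<nu> \<Longrightarrow> \<mu> + \<nu> \<in> box n m"
  using no_carry_less by (auto simp: box_def keys_add_mindex lookup_add mno_carry_def)

lemma box_addD: "\<mu> + \<nu> \<in> box n m \<Longrightarrow> \<mu> \<in> box n m"
  by (auto simp: box_def keys_add_mindex lookup_add intro: le_less_trans[OF le_add1])

lemma zero_in_box [simp]: "0 \<in> box n m"
  by (simp add: box_def)

lemma mno_carry_single: "mno_carry (Poly_Mapping.single i a) \<beta> \<longleftrightarrow> no_carry a (lookup \<beta> i)"
  by (auto simp: mno_carry_def lookup_single when_def)

lemma decomposable_add:
  assumes "mno_carry \<mu> \<nu>" "\<mu> \<noteq> 0" "\<nu> \<noteq> 0" shows "decomposable (\<mu> + \<nu>)"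
  unfolding decomposable_def
proof (intro conjI allI notI)
  show False if "\<mu> + \<nu> = 0"
  proof -
    have "mdeg \<mu> + mdeg \<nu> = 0" using arg_cong[OF that, of mdeg] by simp
    then show False using assms(2) by simp
  qed
  fix i e assume e: "\<mu> + \<nu> = Poly_Mapping.single i (2 ^ e)"
  have off: "lookup \<mu> j = 0 \<and> lookup \<nu> j = 0" if "j \<noteq> i" for j
    using arg_cong[OF e, of "\<lambda>\<alpha>. lookup \<alpha> j"] that by (simp add: lookup_add lookup_single)
  have "lookup \<mu> i + lookup \<nu> i = 2 ^ e"
    using arg_cong[OF e, of "\<lambda>\<alpha>. lookup \<alpha> i"] by (simp add: lookup_add)
  then have "lookup \<mu> i = 0 \<or> lookup \<nu> i = 0"
    using assms(1)[unfolded mno_carry_def, rule_format, of i] by (intro no_carry_eq_pow2)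
  then have "(\<forall>j. lookup \<mu> j = 0) \<or> (\<forall>j. lookup \<nu> j = 0)" using off by metis
  then have "\<mu> = 0 \<or> \<nu> = 0" by (auto simp: poly_mapping_eq_iff fun_eq_iff)
  with assms show False by blast
qed

lemma decomposable_add_left:
  assumes "mno_carry \<mu> \<nu>" "decomposable \<mu>" shows "decomposable (\<mu> + \<nu>)"
  using assms decomposable_add[OF assms(1)] by (cases "\<nu> = 0") (auto simp: decomposable_def)

text \<open>A factorisation of \<open>x\<^bsup>(\<alpha>)\<^esup>\<close>: if \<open>\<alpha>\<close> has at least two keys, one variable is split off; otherwise the exponent
  is not a power of two and its binary digits are distributed.\<close>

lemma decomposableE:
  assumes "decomposable \<alpha>"
  obtains \<mu> \<nu> where "\<alpha> = \<mu> + \<nu>" "\<mu> \<noteq> 0" "\<nu> \<noteq> 0" "mno_carry \<mu> \<nu>"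
proof -
  have "keys \<alpha> \<noteq> {}" using assms by (simp add: decomposable_def)
  then obtain i where "i \<in> keys \<alpha>" by blast
  then have i: "lookup \<alpha> i > 0" by (simp add: in_keys_iff)
  show thesis
  proof (cases "\<alpha> = Poly_Mapping.single i (lookup \<alpha> i)")
    case True
    then have "\<And>e. lookup \<alpha> i \<noteq> 2 ^ e" using assms unfolding decomposable_def by metis
    from no_carry_split[OF i this] obtain b c where "b > 0" "c > 0" "lookup \<alpha> i = b + c" "no_carry b c"
      by blast
    then show thesis using True
      by (intro that[of "Poly_Mapping.single i b" "Poly_Mapping.single i c"])
        (auto simp: mno_carry_single single_add)
  next
    case False
    let ?\<mu> = "Poly_Mapping.single i (lookup \<alpha> i)"
    have s: "?\<mu> + (\<alpha> - ?\<mu>) = \<alpha>" by (rule mindex_le_imp_diff) (simp add: lookup_single when_def)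
    moreover have "\<alpha> - ?\<mu> \<noteq> 0" using s False by auto
    moreover have "mdeg ?\<mu> \<noteq> 0" using i by (simp del: mdeg_eq_0_iff)
    then have "?\<mu> \<noteq> 0" by (simp only: mdeg_eq_0_iff simp_thms)
    moreover have "mno_carry ?\<mu> (\<alpha> - ?\<mu>)" by (simp add: mno_carry_single lookup_minus)
    ultimately show thesis by (intro that[of ?\<mu> "\<alpha> - ?\<mu>"]) auto
  qed
qed

lemma mdeg_pos: "\<alpha> \<noteq> 0 \<Longrightarrow> mdeg \<alpha> > 0"
  by (metis mdeg_eq_0_iff neq0_conv)

lemma decomposable_mdeg:
  assumes "decomposable \<alpha>" shows "2 \<le> mdeg \<alpha>"
proof -
  obtain \<mu> \<nu> where "\<alpha> = \<mu> + \<nu>" "\<mu> \<noteq> 0" "\<nu> \<noteq> 0" using assms by (rule decomposableE)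
  then show ?thesis using mdeg_pos[of \<mu>] mdeg_pos[of \<nu>] by simp
qed

lemma mno_carry_minus_eps_self:
  assumes "mno_carry (\<alpha> - eps k) \<alpha>" "lookup \<alpha> k > 0"
  shows "\<exists>e. \<alpha> = Poly_Mapping.single k (2 ^ e)"
proof -
  have "lookup \<alpha> i = 0" if "i \<noteq> k" for i
    using assms(1) no_carry_self[of "lookup \<alpha> i"] that
    by (auto simp: mno_carry_def lookup_minus lookup_single dest: spec[of _ i])
  moreover have "no_carry (lookup \<alpha> k - 1) (lookup \<alpha> k)"
    using assms(1) by (auto simp: mno_carry_def lookup_minus lookup_single dest: spec[of _ k])
  then obtain e where "lookup \<alpha> k = 2 ^ e" using no_carry_pred_self[OF assms(2)] by blast
  ultimately have "\<alpha> = Poly_Mapping.single k (2 ^ e)"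
    by (intro poly_mapping_eqI) (auto simp: lookup_single when_def)
  then show ?thesis ..
qed

text \<open>Adding \<open>\<alpha> - \<epsilon>\<^sub>k\<close> and \<open>\<alpha>\<close> produces a carry unless \<open>\<alpha> = 2\<^sup>e \<epsilon>\<^sub>k\<close>. This term is the error in the chain rule
  for divided powers when a monomial is added to the argument.\<close>

lemma dmon_times_pd_self:
  assumes "CHAR('a::comm_ring_1) = 2" "decomposable \<alpha>"
  shows "dmon \<alpha> * pd k (dmon \<alpha>) = (0 :: 'a dps)"
  using assms mno_carry_minus_eps_self[of \<alpha> k]
  by (auto simp: pd_dmon dmon_times_char2 decomposable_def mno_carry_commute[of \<alpha>])

section \<open>Substitutions\<close>

definition dec_idx :: "nat \<Rightarrow> (nat \<Rightarrow> nat) \<Rightarrow> nat \<Rightarrow> mindex set" where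
  "dec_idx n m t = {\<alpha> \<in> box n m. decomposable \<alpha> \<and> t \<le> mdeg \<alpha>}"

definition order_ge :: "nat \<Rightarrow> 'a::comm_ring_1 dps set" where
  "order_ge k = supp_in {\<alpha>. k \<le> mdeg \<alpha>}"

lemma order_ge_times:
  fixes f g :: "'a::comm_ring_1 dps"
  assumes "f \<in> order_ge a" "g \<in> order_ge b" shows "f * g \<in> order_ge (a + b)"
  unfolding order_ge_def supp_in_def
proof (safe, rule ccontr)
  fix \<gamma> assume nz: "dcoeff (f * g) \<gamma> \<noteq> 0" and lt: "\<not> a + b \<le> mdeg \<gamma>"
  have "dcoeff (f * g) \<gamma> = 0" unfolding dcoeff_times
  proof (rule sum.neutral, clarify)
    fix \<mu> \<nu> assume "(\<mu>, \<nu>) \<in> splits \<gamma>"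
    then have "mdeg \<mu> + mdeg \<nu> = mdeg \<gamma>" by (auto simp: splits_def)
    then have "\<not> a \<le> mdeg \<mu> \<or> \<not> b \<le> mdeg \<nu>" using lt by linarith
    then have "dcoeff f \<mu> = 0 \<or> dcoeff g \<nu> = 0"
      using assms by (auto simp: order_ge_def supp_in_def)
    then show "of_nat (mchoose \<gamma> \<mu>) * dcoeff f \<mu> * dcoeff g \<nu> = 0" by auto
  qed
  with nz show False ..
qed

lemma order_ge_mono: "a \<le> b \<Longrightarrow> f \<in> order_ge b \<Longrightarrow> f \<in> order_ge a"
  unfolding order_ge_def by (erule supp_in_mono[rotated]) auto

lemma order_ge_add: "f \<in> order_ge a \<Longrightarrow> g \<in> order_ge a \<Longrightarrow> f + g \<in> order_ge a"
  unfolding order_ge_def by (rule supp_in_add)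

lemma order_ge_0 [simp]: "f \<in> order_ge 0" "0 \<in> order_ge a"
  by (auto simp: order_ge_def supp_in_def)

lemma dpow_in_order_ge: "dpow k f \<in> order_ge k"
  unfolding order_ge_def supp_in_def using dpow_order by blast

lemma order_ge_prod:
  fixes f :: "'b \<Rightarrow> 'a::comm_ring_1 dps"
  shows "(\<And>i. i \<in> S \<Longrightarrow> f i \<in> order_ge (a i)) \<Longrightarrow> (\<Prod>i\<in>S. f i) \<in> order_ge (\<Sum>i\<in>S. a i)"
  by (induction S rule: infinite_finite_induct) (auto intro: order_ge_times)

text \<open>A difference of products telescopes into products with a single factor \<open>f'\<^sub>i - f\<^sub>i\<close>.\<close>

lemma order_ge_prod_diff:
  fixes f f' :: "'b \<Rightarrow> 'a::comm_ring_1 dps"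
  assumes "finite S" "\<And>i. i \<in> S \<Longrightarrow> f i \<in> order_ge (a i)" "\<And>i. i \<in> S \<Longrightarrow> f' i \<in> order_ge (a i)"
    "\<And>i. i \<in> S \<Longrightarrow> f' i - f i \<in> order_ge (a i + s)"
  shows "(\<Prod>i\<in>S. f' i) - (\<Prod>i\<in>S. f i) \<in> order_ge ((\<Sum>i\<in>S. a i) + s)"
  using assms
proof (induction S rule: finite_induct)
  case (insert i S)
  let ?P = "\<Prod>j\<in>S. f j" and ?P' = "\<Prod>j\<in>S. f' j"
  have e: "f' i * ?P' - f i * ?P = f' i * (?P' - ?P) + (f' i - f i) * ?P" by (simp add: algebra_simps)
  have "f' i * (?P' - ?P) \<in> order_ge (a i + ((\<Sum>i\<in>S. a i) + s))"
    using insert by (intro order_ge_times insert.IH) auto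
  moreover have "(f' i - f i) * ?P \<in> order_ge ((a i + s) + (\<Sum>i\<in>S. a i))"
    using insert.prems by (intro order_ge_times order_ge_prod) auto
  ultimately show ?case using insert.hyps e by (auto simp: ac_simps intro: order_ge_add)
qed simp

text \<open>The image of \<open>x\<^bsup>(\<alpha>)\<^esup>\<close> when \<open>x\<^sub>i\<close> is replaced by \<open>y i\<close>, and its linear continuous extension.
  The truncation of the sum to \<open>mdeg \<alpha> \<le> mdeg \<beta>\<close> drops only zero terms.\<close>

definition ypow :: "nat \<Rightarrow> (nat \<Rightarrow> 'a::comm_ring_1 dps) \<Rightarrow> mindex \<Rightarrow> 'a dps" where
  "ypow n y \<alpha> = (\<Prod>i\<in>{1..n}. dpow (lookup \<alpha> i) (y i))"

definition subst_dps :: "nat \<Rightarrow> (nat \<Rightarrow> 'a::comm_ring_1 dps) \<Rightarrow> 'a dps \<Rightarrow> 'a dps" where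
  "subst_dps n y f = Abs_dps (\<lambda>\<beta>. \<Sum>\<alpha>\<in>{\<alpha>. keys \<alpha> \<subseteq> {1..n} \<and> mdeg \<alpha> \<le> mdeg \<beta>}.
     dcoeff f \<alpha> * dcoeff (ypow n y \<alpha>) \<beta>)"

lemma ypow_order: "keys \<alpha> \<subseteq> {1..n} \<Longrightarrow> ypow n y \<alpha> \<in> order_ge (mdeg \<alpha>)"
  unfolding ypow_def by (subst mdeg_superset[of "{1..n}"]) (auto intro: order_ge_prod dpow_in_order_ge)

lemma dcoeff_subst:
  assumes "mdeg \<beta> \<le> d"
  shows "dcoeff (subst_dps n y f) \<beta> = (\<Sum>\<alpha>\<in>{\<alpha>. keys \<alpha> \<subseteq> {1..n} \<and> mdeg \<alpha> \<le> d}.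
     dcoeff f \<alpha> * dcoeff (ypow n y \<alpha>) \<beta>)"
  unfolding subst_dps_def dcoeff_Abs
proof (rule sum.mono_neutral_left)
  show "\<forall>\<alpha>\<in>{\<alpha>. keys \<alpha> \<subseteq> {1..n} \<and> mdeg \<alpha> \<le> d} - {\<alpha>. keys \<alpha> \<subseteq> {1..n} \<and> mdeg \<alpha> \<le> mdeg \<beta>}.
       dcoeff f \<alpha> * dcoeff (ypow n y \<alpha>) \<beta> = 0"
  proof
    fix \<alpha> assume "\<alpha> \<in> {\<alpha>. keys \<alpha> \<subseteq> {1..n} \<and> mdeg \<alpha> \<le> d} - {\<alpha>. keys \<alpha> \<subseteq> {1..n} \<and> mdeg \<alpha> \<le> mdeg \<beta>}"
    then have "keys \<alpha> \<subseteq> {1..n}" "\<not> mdeg \<alpha> \<le> mdeg \<beta>" by auto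
    then have "dcoeff (ypow n y \<alpha>) \<beta> = 0"
      using ypow_order[of \<alpha> n y] unfolding order_ge_def by (intro supp_inD) auto
    then show "dcoeff f \<alpha> * dcoeff (ypow n y \<alpha>) \<beta> = 0" by simp
  qed
qed (use assms in \<open>auto simp: finite_bounded_mdeg\<close>)

lemma subst_add: "subst_dps n y (f + g) = subst_dps n y f + subst_dps n y g"
  by (rule dps_eqI) (simp add: subst_dps_def distrib_right sum.distrib)

lemma subst_dscale: "subst_dps n y (dscale c f) = dscale c (subst_dps n y f)"
  by (rule dps_eqI) (simp add: subst_dps_def sum_distrib_left mult.assoc)

lemma subst_0 [simp]: "subst_dps n y 0 = 0"
  by (rule dps_eqI) (simp add: subst_dps_def)

lemma subst_diff: "subst_dps n y (f - g) = subst_dps n y f - subst_dps n y g"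
  by (rule dps_eqI) (simp add: subst_dps_def left_diff_distrib sum_subtractf)

lemma subst_sum: "subst_dps n y (\<Sum>i\<in>S. f i) = (\<Sum>i\<in>S. subst_dps n y (f i))"
  by (induction S rule: infinite_finite_induct) (auto simp: subst_add)

lemma subst_dmon:
  assumes "keys \<alpha> \<subseteq> {1..n}" shows "subst_dps n y (dmon \<alpha>) = ypow n y \<alpha>"
proof (rule dps_eqI)
  fix \<beta>
  let ?S = "{\<alpha>. keys \<alpha> \<subseteq> {1..n} \<and> mdeg \<alpha> \<le> mdeg \<beta> + mdeg \<alpha>}"
  define d where "d = mdeg \<beta> + mdeg \<alpha>"
  have "dcoeff (subst_dps n y (dmon \<alpha>)) \<beta>
      = (\<Sum>\<alpha>'\<in>{\<alpha>. keys \<alpha> \<subseteq> {1..n} \<and> mdeg \<alpha> \<le> d}. if \<alpha>' = \<alpha> then dcoeff (ypow n y \<alpha>) \<beta> else 0)"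
    by (subst dcoeff_subst[of _ d]) (auto simp: d_def intro!: sum.cong)
  also have "\<dots> = dcoeff (ypow n y \<alpha>) \<beta>"
    using assms finite_bounded_mdeg[of "{1..n}" d] by (simp add: sum.delta' d_def)
  finally show "dcoeff (subst_dps n y (dmon \<alpha>)) \<beta> = dcoeff (ypow n y \<alpha>) \<beta>" .
qed

lemma ypow_0 [simp]: "ypow n y 0 = 1"
  by (simp add: ypow_def)

lemma subst_1 [simp]: "subst_dps n y 1 = 1"
  using subst_dmon[of 0 n y] by simp

lemma subst_order:
  assumes "f \<in> order_ge k" shows "subst_dps n y f \<in> order_ge k"
  unfolding order_ge_def supp_in_def
proof (safe, rule ccontr)
  fix \<beta> assume nz: "dcoeff (subst_dps n y f) \<beta> \<noteq> 0" and lt: "\<not> k \<le> mdeg \<beta>"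
  have "dcoeff f \<alpha> = 0" if "mdeg \<alpha> \<le> mdeg \<beta>" for \<alpha>
    using assms lt that unfolding order_ge_def by (intro supp_inD) auto
  then have "dcoeff (subst_dps n y f) \<beta> = 0" by (simp add: subst_dps_def)
  with nz show False ..
qed

locale truncated_dp_algebra =
  fixes n :: nat and m :: "nat \<Rightarrow> nat" and A :: "'k::field dps set"
  assumes char2: "CHAR('k) = 2"
    and height_pos: "\<And>i. i \<in> {1..n} \<Longrightarrow> 0 < m i"
    and A_eq: "A = supp_in (box n m)"
begin

lemma A_add: "f \<in> A \<Longrightarrow> g \<in> A \<Longrightarrow> f + g \<in> A" and A_diff: "f \<in> A \<Longrightarrow> g \<in> A \<Longrightarrow> f - g \<in> A"
  and A_sum: "(\<And>i. i \<in> S \<Longrightarrow> h i \<in> A) \<Longrightarrow> (\<Sum>i\<in>S. h i) \<in> A" and A_dscale: "f \<in> A \<Longrightarrow> dscale c f \<in> A"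
  and A_0: "0 \<in> A"
  unfolding A_eq by (rule supp_in_add supp_in_diff supp_in_sum supp_in_dscale supp_in_0; assumption?)+

lemma A_times: "f \<in> A \<Longrightarrow> g \<in> A \<Longrightarrow> f * g \<in> A"
  unfolding A_eq by (rule supp_in_times[OF char2]) (auto intro: box_add)

lemma A_pd: "f \<in> A \<Longrightarrow> pd k f \<in> A"
  unfolding A_eq by (rule supp_in_pd) (auto dest: box_addD)

lemma A_const: "dp_const c \<in> A"
  unfolding A_eq by (auto simp: supp_in_def)

lemma A_1: "1 \<in> A"
  using A_const[of 1] by (simp add: one_dps_def)

lemma A_prod: "(\<And>i. i \<in> S \<Longrightarrow> h i \<in> A) \<Longrightarrow> (\<Prod>i\<in>S. h i) \<in> A"
  by (induction S rule: infinite_finite_induct) (auto intro: A_1 A_times)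

lemma A_dmon: "\<alpha> \<in> box n m \<Longrightarrow> dmon \<alpha> \<in> A"
  unfolding A_eq by (rule supp_in_dmon)

lemma single_in_box: "i \<in> {1..n} \<Longrightarrow> a < 2 ^ m i \<Longrightarrow> Poly_Mapping.single i a \<in> box n m"
  by (auto simp: box_def lookup_single when_def)

lemma eps_in_box: "i \<in> {1..n} \<Longrightarrow> eps i \<in> box n m"
  using height_pos[of i] one_less_power[of "2 :: nat" "m i"] by (intro single_in_box) auto

lemmas char2_dps' = char2_dps[OF char2]

lemma dsum_self [simp]: "(f :: 'k dps) + f = 0"
  by (rule add_self_char2[OF char2_dps'])

lemma dminus: "(f :: 'k dps) - g = f + g"
  by (rule minus_CHAR_2[OF char2_dps'])

lemma A_ideal_dec: "f \<in> supp_in (dec_idx n m a) \<Longrightarrow> g \<in> A \<Longrightarrow> g \<in> order_ge b \<Longrightarrow> f * g \<in> supp_in (dec_idx n m (a + b))"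
proof -
  assume f: "f \<in> supp_in (dec_idx n m a)" and "g \<in> A" "g \<in> order_ge b"
  then have g: "g \<in> supp_in {\<alpha>\<in>box n m. b \<le> mdeg \<alpha>}"
    unfolding A_eq order_ge_def by (auto simp: supp_in_def)
  show ?thesis by (rule supp_in_times[OF char2 f g]) (auto simp: dec_idx_def intro: box_add decomposable_add_left)
qed

lemma finite_dec_idx: "finite (dec_idx n m t)"
  using finite_box[of n m] by (rule rev_finite_subset) (auto simp: dec_idx_def)

lemma dec_in_A: "f \<in> supp_in (dec_idx n m t) \<Longrightarrow> f \<in> A"
  unfolding A_eq by (erule supp_in_mono[rotated]) (auto simp: dec_idx_def)

lemma dec_order2: "f \<in> supp_in (dec_idx n m t) \<Longrightarrow> f \<in> order_ge 2"
  unfolding order_ge_def by (erule supp_in_mono[rotated]) (auto simp: dec_idx_def decomposable_mdeg)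

text \<open>The product rule and the chain rule hold for the divided powers of \<open>x\<^sub>i + g\<close> because they hold for those of \<open>x\<^sub>i\<close>
  and survive the addition of one decomposable monomial \<open>u\<close> by \<open>dpow_add_dmon\<close>, \<open>u\<^sup>2 = 0\<close> and \<open>u \<partial>\<^sub>k u = 0\<close>.\<close>

lemma dpow_times_dpow:
  assumes "g \<in> supp_in (dec_idx n m t)"
  shows "dpow a (xpow i 1 + g) * dpow b (xpow i 1 + g)
    = of_nat ((a + b) choose a) * (dpow (a + b) (xpow i 1 + g) :: 'k dps)"
  using finite_dec_idx assms
proof (induction g arbitrary: a b rule: supp_in_induct)
  case zero
  have "mchoose (Poly_Mapping.single i a + Poly_Mapping.single i b) (Poly_Mapping.single i a) = (a + b) choose a"
    by (cases "a + b = 0") (auto simp: mchoose_def single_add[symmetric] lookup_single)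
  then show ?case by (simp del: One_nat_def add: dpow_xpow_1 dmon_times_dmon single_add)
next
  case (add f \<alpha> c)
  let ?y = "xpow i 1 + f :: 'k dps" and ?u = "dscale c (dmon \<alpha>) :: 'k dps"
  have \<alpha>: "decomposable \<alpha>" using add by (simp add: dec_idx_def)
  have uu: "?u * ?u = 0"
    using dmon_square_char2[OF char2, of \<alpha>] \<alpha> by (simp add: dscale_mult(1)[symmetric] dscale_mult(2)[symmetric] decomposable_def)
      (simp add: dscale_def)
  have S: "dpow (Suc k) (?y + ?u) = dpow (Suc k) ?y + ?u * dpow k ?y" for k
    by (rule dpow_add_dmon[OF char2 \<alpha>])
  show ?case
  proof (cases "a = 0 \<or> b = 0")
    case True
    then show ?thesis by auto
  next
    case False
    then obtain a' b' where ab: "a = Suc a'" "b = Suc b'" by (metis not0_implies_Suc)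
    let ?F = "\<lambda>k. dpow k ?y"
    have p: "(a + b) choose a = ((a + b') choose a) + ((a' + b) choose a')"
      using ab by simp
    have "(?F a + ?u * ?F a') * (?F b + ?u * ?F b') = ?F a * ?F b + ?u * (?F a * ?F b' + ?F a' * ?F b) + (?u * ?u) * (?F a' * ?F b')"
      by (simp only: algebra_simps)
    also have "\<dots> = of_nat ((a + b) choose a) * ?F (a + b)
        + ?u * (of_nat ((a + b') choose a) * ?F (a + b') + of_nat ((a' + b) choose a') * ?F (a' + b))"
      unfolding add.IH uu by simp
    also have "a' + b = a + b'" using ab by simp
    also have "of_nat ((a + b') choose a) * ?F (a + b') + of_nat ((a + b') choose a') * ?F (a + b')
        = of_nat ((a + b) choose a) * ?F (a + b')"
      unfolding p using ab by (simp add: distrib_right)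
    also have "of_nat ((a + b) choose a) * ?F (a + b) + ?u * (of_nat ((a + b) choose a) * ?F (a + b'))
        = of_nat ((a + b) choose a) * (?F (a + b) + ?u * ?F (a + b'))"
      by (simp add: algebra_simps)
    finally show ?thesis using S[of a'] S[of b'] S[of "a + b'"] ab by (simp add: add.assoc)
  qed
qed

lemma pd_dpow:
  assumes "g \<in> supp_in (dec_idx n m t)"
  shows "pd k (dpow (Suc a) (xpow i 1 + g)) = dpow a (xpow i 1 + g) * pd k (xpow i 1 + g :: 'k dps)"
  using finite_dec_idx assms
proof (induction g arbitrary: a rule: supp_in_induct)
  case zero
  show ?case
    by (auto simp del: One_nat_def simp add: dpow_xpow_1 pd_dmon lookup_single single_diff[symmetric] when_def)
next
  case (add f \<alpha> c)
  let ?y = "xpow i 1 + f :: 'k dps" and ?u = "dscale c (dmon \<alpha>) :: 'k dps"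
  have \<alpha>: "decomposable \<alpha>" using add by (simp add: dec_idx_def)
  have uu: "?u * pd k ?u = 0"
    using dmon_times_pd_self[OF char2 \<alpha>, of k]
    by (simp only: pd_linear dscale_mult(1)[symmetric] dscale_mult(2)[symmetric]) (simp add: dscale_def)
  have S: "dpow (Suc k) (?y + ?u) = dpow (Suc k) ?y + ?u * dpow k ?y" for k
    by (rule dpow_add_dmon[OF char2 \<alpha>])
  have "pd k (dpow (Suc a) (?y + ?u)) = dpow a (?y + ?u) * pd k (?y + ?u)"
  proof (cases a)
    case 0
    then show ?thesis using add.IH[of 0] S[of 0] by (simp add: pd_linear)
  next
    case (Suc b)
    have "pd k (dpow (Suc a) (?y + ?u)) = dpow a ?y * pd k ?y + (pd k ?u * dpow a ?y + ?u * pd k (dpow a ?y))"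
      unfolding S pd_linear(1)[of k "dpow (Suc a) ?y"] pd_times add.IH by (simp only: pd_linear)
    also have "?u * pd k (dpow a ?y) = ?u * dpow b ?y * pd k ?y"
      unfolding Suc add.IH by (simp add: pd_linear mult.assoc)
    also have "dpow a ?y * pd k ?y + (pd k ?u * dpow a ?y + ?u * dpow b ?y * pd k ?y)
      = (dpow a ?y + ?u * dpow b ?y) * (pd k ?y + pd k ?u) - (?u * pd k ?u) * dpow b ?y"
      by (simp add: algebra_simps)
    finally show ?thesis unfolding uu Suc S by (simp add: pd_linear)
  qed
  then show ?case by (simp only: add.assoc)
qed

text \<open>Each monomial of \<open>h\<close> changes \<open>f\<^bsup>(a+1)\<^esup>\<close> by its product with a divided power of order \<open>a\<close>.\<close>

lemma dpow_diff_order: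
  assumes "h \<in> supp_in (dec_idx n m t)"
  shows "dpow (Suc a) (f + h) - dpow (Suc a) f \<in> (order_ge (a + t) :: 'k dps set)"
  using finite_dec_idx assms
proof (induction h rule: supp_in_induct)
  case (add h \<alpha> c)
  then have \<alpha>: "decomposable \<alpha>" "t \<le> mdeg \<alpha>" by (auto simp: dec_idx_def)
  have "dpow (Suc a) (f + (h + dscale c (dmon \<alpha>))) = dpow (Suc a) (f + h) + dscale c (dmon \<alpha>) * dpow a (f + h)"
    using dpow_add_dmon[OF char2 \<alpha>(1), of a "f + h" c] by (simp add: add.assoc)
  then have e: "dpow (Suc a) (f + (h + dscale c (dmon \<alpha>))) - dpow (Suc a) f
      = (dpow (Suc a) (f + h) - dpow (Suc a) f) + dscale c (dmon \<alpha>) * dpow a (f + h)" by simp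
  have "dscale c (dmon \<alpha>) \<in> (order_ge t :: 'k dps set)"
    unfolding order_ge_def by (intro supp_in_dscale supp_in_dmon) (simp add: \<alpha>)
  then have "dscale c (dmon \<alpha>) * dpow a (f + h) \<in> order_ge (a + t)"
    using order_ge_times[OF _ dpow_in_order_ge] by (metis add.commute)
  with add.IH show ?case unfolding e by (rule order_ge_add)
qed simp

text \<open>The bound on \<open>a\<close> includes \<open>2\<^bsup>m i\<^esup>\<close>, although \<open>x\<^sub>i\<^bsup>(a)\<^esup>\<close> then lies outside the algebra: this exponent
  belongs to \<open>z\<^sub>i\<close>, and the image of \<open>z\<^sub>i\<close> must differ from \<open>z\<^sub>i\<close> by an element of the algebra.\<close>

lemma dpow_diff_dec:
  assumes "g \<in> supp_in (dec_idx n m t)" "i \<in> {1..n}" "a \<le> 2 ^ m i"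
  shows "dpow a (xpow i 1 + g) - xpow i a \<in> (supp_in (dec_idx n m 0) :: 'k dps set)"
  using finite_dec_idx assms
proof (induction g arbitrary: a rule: supp_in_induct)
  case (add f \<alpha> c)
  show ?case
  proof (cases a)
    case (Suc b)
    have \<alpha>: "decomposable \<alpha>" "\<alpha> \<in> box n m" using add.hyps by (auto simp: dec_idx_def)
    have b: "b < 2 ^ m i" using add.prems Suc by simp
    have "dpow b (xpow i 1 + f) - xpow i b \<in> A"
      using add.IH[of b] add.prems b by (intro dec_in_A) auto
    then have "dpow b (xpow i 1 + f) - xpow i b + xpow i b \<in> A"
      by (intro A_add A_dmon single_in_box) (use add.prems b in auto)
    then have bA: "dpow b (xpow i 1 + f) \<in> A" by simp
    have "dscale c (dmon \<alpha>) * dpow b (xpow i 1 + f) \<in> supp_in (dec_idx n m (0 + 0))"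
      by (rule A_ideal_dec[OF _ bA]) (use \<alpha> in \<open>auto intro!: supp_in_dscale supp_in_dmon simp: dec_idx_def\<close>)
    moreover have e: "dpow a (xpow i 1 + (f + dscale c (dmon \<alpha>))) - xpow i a
        = (dpow a (xpow i 1 + f) - xpow i a) + dscale c (dmon \<alpha>) * dpow b (xpow i 1 + f)"
      using dpow_add_dmon[OF char2 \<alpha>(1), of b "xpow i 1 + f" c] Suc by (simp add: add.assoc)
    ultimately show ?thesis unfolding e using add.IH[of a] add.prems by (auto intro: supp_in_add)
  qed simp
qed (simp del: One_nat_def add: dpow_xpow_1)

end

declare One_nat_def [simp del]

lemma add_eps_nonzero' [simp]: "\<alpha> + eps k \<noteq> 0" for \<alpha> :: mindex
  using add_eps_nonzero[of \<alpha> k] by (simp only: One_nat_def not_False_eq_True)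

section \<open>Substitutions are automorphisms\<close>

lemma splits_keys: "(\<mu>, \<nu>) \<in> splits \<gamma> \<Longrightarrow> keys \<gamma> = keys \<mu> \<union> keys \<nu>"
  by (auto simp: splits_def keys_add_mindex)

lemma Ohat_eq: "Ohat n = supp_in {\<alpha>. keys \<alpha> \<subseteq> {1..n}}"
  by (simp add: Ohat_def supp_in_def)

lemma keys_sum_mset: "keys (\<Sum>\<^sub># M) = (\<Union>\<alpha>\<in>set_mset M. keys \<alpha>)" for M :: "mindex multiset"
  by (induction M) (auto simp: keys_add_mindex)

lemma dpow_in_Ohat: "f \<in> Ohat n \<Longrightarrow> dpow k f \<in> Ohat n"
  unfolding Ohat_def mem_Collect_eq
proof (intro allI impI)
  fix \<beta> assume f: "\<forall>\<alpha>. dcoeff f \<alpha> \<noteq> 0 \<longrightarrow> keys \<alpha> \<subseteq> {1..n}" and nz: "dcoeff (dpow k f) \<beta> \<noteq> 0"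
  have "\<exists>M\<in>dpow_msets k \<beta>. \<forall>\<alpha>\<in>#M. dcoeff f \<alpha> \<noteq> 0"
    by (rule dcoeff_dpow_nonzeroE[OF nz]) blast
  then obtain M where "M \<in> dpow_msets k \<beta>" "\<forall>\<alpha>\<in>#M. dcoeff f \<alpha> \<noteq> 0" by blast
  moreover from this have "keys \<beta> = (\<Union>\<alpha>\<in>set_mset M. keys \<alpha>)" by (simp add: dpow_msets_def flip: keys_sum_mset)
  ultimately show "keys \<beta> \<subseteq> {1..n}" using f by blast
qed

lemma Ohat_times: "f \<in> Ohat n \<Longrightarrow> g \<in> Ohat n \<Longrightarrow> f * g \<in> Ohat n" for f g :: "'a::comm_ring_1 dps"
  unfolding Ohat_def mem_Collect_eq
proof (intro allI impI, rule ccontr)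
  fix \<gamma> assume f: "\<forall>\<alpha>. dcoeff f \<alpha> \<noteq> 0 \<longrightarrow> keys \<alpha> \<subseteq> {1..n}"
    and g: "\<forall>\<alpha>. dcoeff g \<alpha> \<noteq> 0 \<longrightarrow> keys \<alpha> \<subseteq> {1..n}" and nz: "dcoeff (f * g) \<gamma> \<noteq> 0"
    and n: "\<not> keys \<gamma> \<subseteq> {1..n}"
  have "dcoeff (f * g) \<gamma> = 0" unfolding dcoeff_times
  proof (rule sum.neutral, clarify)
    fix \<mu> \<nu> assume "(\<mu>, \<nu>) \<in> splits \<gamma>"
    then have "\<not> keys \<mu> \<subseteq> {1..n} \<or> \<not> keys \<nu> \<subseteq> {1..n}" using n splits_keys by blast
    then have "dcoeff f \<mu> = 0 \<or> dcoeff g \<nu> = 0" using f g by blast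
    then show "of_nat (mchoose \<gamma> \<mu>) * dcoeff f \<mu> * dcoeff g \<nu> = 0" by auto
  qed
  with nz show False ..
qed

lemma Ohat_1: "1 \<in> Ohat n"
  by (simp add: Ohat_def)

lemma Ohat_prod: "(\<And>i. i \<in> S \<Longrightarrow> f i \<in> Ohat n) \<Longrightarrow> (\<Prod>i\<in>S. f i) \<in> Ohat n" for f :: "'b \<Rightarrow> 'a::comm_ring_1 dps"
  by (induction S rule: infinite_finite_induct) (auto intro: Ohat_1 Ohat_times)

lemma mchoose_prod:
  assumes "keys (\<alpha> + \<beta>) \<subseteq> S" "finite S"
  shows "mchoose (\<alpha> + \<beta>) \<alpha> = (\<Prod>i\<in>S. (lookup \<alpha> i + lookup \<beta> i) choose lookup \<alpha> i)"
  unfolding mchoose_def lookup_add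
  by (rule prod.mono_neutral_left[OF assms(2,1)]) (auto simp: in_keys_iff lookup_add)

lemma sum_singles: "keys \<alpha> \<subseteq> S \<Longrightarrow> finite S \<Longrightarrow> (\<Sum>i\<in>S. Poly_Mapping.single i (lookup \<alpha> i)) = \<alpha>"
  for \<alpha> :: mindex
  by (rule poly_mapping_eqI) (auto simp: lookup_sum lookup_single when_def sum.delta in_keys_iff subset_iff)

text \<open>The coefficients of the preimage of \<open>u\<close>: since \<open>ypow n y \<alpha>\<close> is \<open>x\<^bsup>(\<alpha>)\<^esup>\<close> plus terms of higher
  degree, the equation for the preimage is triangular with respect to the degree.\<close>

function inv_coeff :: "nat \<Rightarrow> (nat \<Rightarrow> 'a::comm_ring_1 dps) \<Rightarrow> 'a dps \<Rightarrow> mindex \<Rightarrow> 'a" where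
  "inv_coeff n y u \<gamma> = dcoeff u \<gamma> - (\<Sum>\<alpha>\<in>{\<alpha>. keys \<alpha> \<subseteq> {1..n} \<and> mdeg \<alpha> < mdeg \<gamma>}.
     inv_coeff n y u \<alpha> * dcoeff (ypow n y \<alpha>) \<gamma>)"
  by auto
termination by (relation "measure (\<lambda>(n, y, u, \<gamma>). mdeg \<gamma>)") auto

declare inv_coeff.simps [simp del]

lemma inv_coeff_supp:
  assumes "u \<in> supp_in S" "\<And>\<alpha>. \<alpha> \<in> S \<Longrightarrow> ypow n y \<alpha> \<in> supp_in S"
  shows "\<gamma> \<notin> S \<Longrightarrow> inv_coeff n y u \<gamma> = 0"
proof (induction "mdeg \<gamma>" arbitrary: \<gamma> rule: less_induct)
  case less
  have "inv_coeff n y u \<alpha> * dcoeff (ypow n y \<alpha>) \<gamma> = 0" if "mdeg \<alpha> < mdeg \<gamma>" for \<alpha>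
  proof (cases "\<alpha> \<in> S")
    case True
    then have "dcoeff (ypow n y \<alpha>) \<gamma> = 0" using assms(2) less.prems by (blast intro: supp_inD)
    then show ?thesis by simp
  qed (use less.hyps[OF that] in simp)
  then show ?case
    unfolding inv_coeff.simps[of n y u \<gamma>] using supp_inD[OF assms(1) less.prems] by (simp add: sum.neutral)
qed

context truncated_dp_algebra
begin

text \<open>The images of the variables under the substitution given by \<open>g\<close>.\<close>

abbreviation yy :: "(nat \<Rightarrow> 'k dps) \<Rightarrow> nat \<Rightarrow> 'k dps" where
  "yy g \<equiv> \<lambda>i. xpow i 1 + g i"

definition dec_family :: "(nat \<Rightarrow> 'k dps) \<Rightarrow> bool" where
  "dec_family g \<longleftrightarrow> (\<forall>i\<in>{1..n}. g i \<in> supp_in (dec_idx n m 0))"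

lemma dec_familyD: "dec_family g \<Longrightarrow> i \<in> {1..n} \<Longrightarrow> g i \<in> supp_in (dec_idx n m 0)"
  by (simp add: dec_family_def)

lemma dec_family_0 [simp]: "dec_family (\<lambda>_. 0)"
  by (simp add: dec_family_def)

lemma dec_idx_2: "dec_idx n m 2 = dec_idx n m 0"
  by (auto simp: dec_idx_def decomposable_mdeg)

lemma ypow_x: "keys \<alpha> \<subseteq> {1..n} \<Longrightarrow> ypow n (yy (\<lambda>_. 0)) \<alpha> = dmon \<alpha>"
proof -
  assume k: "keys \<alpha> \<subseteq> {1..n}"
  have "(\<Prod>i\<in>S. xpow i (lookup \<alpha> i)) = (dmon (\<Sum>i\<in>S. Poly_Mapping.single i (lookup \<alpha> i)) :: 'k dps)"
    if "finite S" for S using that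
  proof (induction S rule: finite_induct)
    case (insert i S)
    have "lookup (\<Sum>i\<in>S. Poly_Mapping.single i (lookup \<alpha> i)) i = 0"
      unfolding lookup_sum using insert.hyps by (intro sum.neutral) (auto simp: lookup_single when_def)
    then have "mno_carry (Poly_Mapping.single i (lookup \<alpha> i)) (\<Sum>i\<in>S. Poly_Mapping.single i (lookup \<alpha> i))"
      by (simp add: mno_carry_single)
    then show ?case using insert by (simp add: dmon_times_char2[OF char2])
  qed simp
  from this[of "{1..n}"] show ?thesis
    using sum_singles[OF k] by (simp del: One_nat_def add: ypow_def dpow_xpow_1)
qed

lemma ypow_times:
  assumes "dec_family g" "keys \<alpha> \<subseteq> {1..n}" "keys \<beta> \<subseteq> {1..n}"
  shows "ypow n (yy g) \<alpha> * ypow n (yy g) \<beta> = of_nat (mchoose (\<alpha> + \<beta>) \<alpha>) * ypow n (yy g) (\<alpha> + \<beta>)"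
proof -
  have "ypow n (yy g) \<alpha> * ypow n (yy g) \<beta>
      = (\<Prod>i\<in>{1..n}. of_nat ((lookup \<alpha> i + lookup \<beta> i) choose lookup \<alpha> i) * dpow (lookup (\<alpha> + \<beta>) i) (yy g i))"
    unfolding ypow_def prod.distrib[symmetric] lookup_add
    by (intro prod.cong refl dpow_times_dpow[OF dec_familyD[OF assms(1)]])
  also have "\<dots> = of_nat (mchoose (\<alpha> + \<beta>) \<alpha>) * ypow n (yy g) (\<alpha> + \<beta>)"
    using assms(2,3) by (subst mchoose_prod[of _ _ "{1..n}"]) (auto simp: keys_add_mindex ypow_def prod.distrib)
  finally show ?thesis .
qed

lemma ypow_diff_order:
  fixes y h :: "nat \<Rightarrow> 'k dps"
  assumes "\<And>i. i \<in> {1..n} \<Longrightarrow> h i \<in> supp_in (dec_idx n m (Suc s))" "keys \<alpha> \<subseteq> {1..n}"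
  shows "ypow n (\<lambda>i. y i + h i) \<alpha> - ypow n y \<alpha> \<in> order_ge (mdeg \<alpha> + s)"
proof -
  have "dpow a (y i + h i) - dpow a (y i) \<in> order_ge (a + s)" if "i \<in> {1..n}" for i a
    using dpow_diff_order[OF assms(1)[OF that], of _ "y i"] by (cases a) auto
  then have "ypow n (\<lambda>i. y i + h i) \<alpha> - ypow n y \<alpha> \<in> order_ge ((\<Sum>i\<in>{1..n}. lookup \<alpha> i) + s)"
    unfolding ypow_def by (intro order_ge_prod_diff dpow_in_order_ge) auto
  then show ?thesis using assms(2) by (simp add: mdeg_superset[of "{1..n}"])
qed

lemma ypow_minus_dmon_order:
  assumes "dec_family g" "keys \<alpha> \<subseteq> {1..n}"
  shows "ypow n (yy g) \<alpha> - dmon \<alpha> \<in> order_ge (mdeg \<alpha> + 1)"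
  using ypow_diff_order[of g 1 \<alpha> "yy (\<lambda>_. 0)"] assms ypow_x[OF assms(2)] dec_idx_2
  by (simp add: dec_family_def numeral_2_eq_2)

lemma ypow_coeff_low:
  assumes "dec_family g" "keys \<alpha> \<subseteq> {1..n}" "mdeg \<gamma> \<le> mdeg \<alpha>"
  shows "dcoeff (ypow n (yy g) \<alpha>) \<gamma> = (if \<gamma> = \<alpha> then 1 else 0)"
proof -
  have "dcoeff (ypow n (yy g) \<alpha> - dmon \<alpha>) \<gamma> = 0"
    using ypow_minus_dmon_order[OF assms(1,2)] assms(3) unfolding order_ge_def by (intro supp_inD) auto
  then show ?thesis by simp
qed

lemma keys_box: "\<alpha> \<in> box n m \<Longrightarrow> keys \<alpha> \<subseteq> {1..n}"
  by (simp add: box_def)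

lemma A_subset_Ohat: "f \<in> A \<Longrightarrow> f \<in> Ohat n"
  unfolding A_eq Ohat_eq by (erule supp_in_mono[rotated]) (auto simp: box_def)

lemma yy_in_A: "dec_family g \<Longrightarrow> i \<in> {1..n} \<Longrightarrow> yy g i \<in> A"
  using dec_familyD[of g i] eps_in_box[of i] by (intro A_add A_dmon dec_in_A) auto

lemma ypow_in_Ohat: "dec_family g \<Longrightarrow> ypow n (yy g) \<alpha> \<in> Ohat n"
  unfolding ypow_def by (intro Ohat_prod dpow_in_Ohat A_subset_Ohat yy_in_A)

lemma dpow_in_A:
  assumes "dec_family g" "i \<in> {1..n}" "a < 2 ^ m i" shows "dpow a (yy g i) \<in> A"
proof -
  have "dpow a (yy g i) - xpow i a \<in> A"
    by (rule dec_in_A[OF dpow_diff_dec[OF dec_familyD[OF assms(1,2)] assms(2)]]) (use assms(3) in simp)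
  then have "dpow a (yy g i) - xpow i a + xpow i a \<in> A"
    using assms by (intro A_add A_dmon single_in_box)
  then show ?thesis by simp
qed

lemma ypow_in_A: "dec_family g \<Longrightarrow> \<alpha> \<in> box n m \<Longrightarrow> ypow n (yy g) \<alpha> \<in> A"
  unfolding ypow_def by (intro A_prod dpow_in_A) (auto simp: box_def)

lemma dec_prod_diff:
  assumes "finite S" "\<And>i. i \<in> S \<Longrightarrow> f i \<in> A" "\<And>i. i \<in> S \<Longrightarrow> f' i \<in> A"
    "\<And>i. i \<in> S \<Longrightarrow> f' i - f i \<in> supp_in (dec_idx n m 0)"
  shows "(\<Prod>i\<in>S. f' i) - (\<Prod>i\<in>S. f i) \<in> supp_in (dec_idx n m 0)"
  using assms
proof (induction S rule: finite_induct)
  case (insert i S)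
  let ?P = "\<Prod>j\<in>S. f j" and ?P' = "\<Prod>j\<in>S. f' j"
  have e: "f' i * ?P' - f i * ?P = (?P' - ?P) * f' i + (f' i - f i) * ?P" by (simp add: algebra_simps)
  have "(?P' - ?P) * f' i \<in> supp_in (dec_idx n m (0 + 0))"
    using insert by (intro A_ideal_dec insert.IH) auto
  moreover have "(f' i - f i) * ?P \<in> supp_in (dec_idx n m (0 + 0))"
    using insert.prems by (intro A_ideal_dec A_prod) auto
  ultimately show ?case using insert.hyps e by (auto intro: supp_in_add)
qed simp

lemma ypow_minus_dmon_dec:
  assumes "dec_family g" "\<alpha> \<in> box n m"
  shows "ypow n (yy g) \<alpha> - dmon \<alpha> \<in> supp_in (dec_idx n m 0)"
proof -
  have "ypow n (yy g) \<alpha> - ypow n (yy (\<lambda>_. 0)) \<alpha> \<in> supp_in (dec_idx n m 0)"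
    unfolding ypow_def
  proof (rule dec_prod_diff)
    fix i assume i: "i \<in> {1..n}"
    then have l: "lookup \<alpha> i < 2 ^ m i" using assms(2) by (simp add: box_def)
    then show "dpow (lookup \<alpha> i) (yy g i) \<in> A" "dpow (lookup \<alpha> i) (yy (\<lambda>_. 0) i) \<in> A"
      using i assms(1) by (intro dpow_in_A; simp)+
    show "dpow (lookup \<alpha> i) (yy g i) - dpow (lookup \<alpha> i) (yy (\<lambda>_. 0) i) \<in> supp_in (dec_idx n m 0)"
      using dpow_diff_dec[OF dec_familyD[OF assms(1) i] i, of "lookup \<alpha> i"] l
      by (simp del: One_nat_def add: dpow_xpow_1)
  qed simp
  then show ?thesis using ypow_x[of \<alpha>] assms(2) by (simp add: box_def)
qed

lemma subst_coeff:
  assumes "dec_family g" "keys \<gamma> \<subseteq> {1..n}"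
  shows "dcoeff (subst_dps n (yy g) f) \<gamma> = dcoeff f \<gamma>
    + (\<Sum>\<alpha>\<in>{\<alpha>. keys \<alpha> \<subseteq> {1..n} \<and> mdeg \<alpha> < mdeg \<gamma>}. dcoeff f \<alpha> * dcoeff (ypow n (yy g) \<alpha>) \<gamma>)"
proof -
  let ?S = "{\<alpha>. keys \<alpha> \<subseteq> {1..n} \<and> mdeg \<alpha> < mdeg \<gamma>}" and ?E = "{\<alpha>. keys \<alpha> \<subseteq> {1..n} \<and> mdeg \<alpha> = mdeg \<gamma>}"
  let ?t = "\<lambda>\<alpha>. dcoeff f \<alpha> * dcoeff (ypow n (yy g) \<alpha>) \<gamma>"
  have fin: "finite ?S" "finite ?E"
    by (rule finite_subset[OF _ finite_bounded_mdeg[of "{1..n}" "mdeg \<gamma>"]]; auto)+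
  have "{\<alpha>. keys \<alpha> \<subseteq> {1..n} \<and> mdeg \<alpha> \<le> mdeg \<gamma>} = ?E \<union> ?S" by auto
  then have "dcoeff (subst_dps n (yy g) f) \<gamma> = sum ?t ?E + sum ?t ?S"
    unfolding subst_dps_def dcoeff_Abs using fin by (simp add: sum.union_disjoint disjoint_iff)
  also have "sum ?t ?E = (\<Sum>\<alpha>\<in>?E. if \<alpha> = \<gamma> then dcoeff f \<gamma> else 0)"
    by (rule sum.cong) (auto simp: ypow_coeff_low[OF assms(1)])
  also have "\<dots> = dcoeff f \<gamma>" using fin(2) assms(2) by (simp add: sum.delta)
  finally show ?thesis .
qed

lemma subst_in_Ohat: "dec_family g \<Longrightarrow> subst_dps n (yy g) f \<in> Ohat n"
proof -
  assume g: "dec_family g"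
  show ?thesis unfolding Ohat_eq supp_in_def
  proof (safe, rule ccontr)
    fix \<beta> i assume nz: "dcoeff (subst_dps n (yy g) f) \<beta> \<noteq> 0" and i: "i \<in> keys \<beta>" "i \<notin> {1..n}"
    have "dcoeff (ypow n (yy g) \<alpha>) \<beta> = 0" for \<alpha>
      using ypow_in_Ohat[OF g, of \<alpha>] i unfolding Ohat_eq by (intro supp_inD) auto
    then show False using nz by (simp add: subst_dps_def)
  qed
qed

lemma subst_eq_sum:
  assumes "f \<in> A"
  shows "subst_dps n y f = (\<Sum>\<alpha>\<in>box n m. dscale (dcoeff f \<alpha>) (ypow n y \<alpha>))"
proof -
  have "f = (\<Sum>\<alpha>\<in>box n m. dscale (dcoeff f \<alpha>) (dmon \<alpha>))"
  proof (rule dps_eqI)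
    fix \<beta>
    have "(\<Sum>\<alpha>\<in>box n m. dcoeff (dscale (dcoeff f \<alpha>) (dmon \<alpha>)) \<beta>)
        = (\<Sum>\<alpha>\<in>box n m. if \<alpha> = \<beta> then dcoeff f \<alpha> else 0)"
      by (rule sum.cong) auto
    then show "dcoeff f \<beta> = dcoeff (\<Sum>\<alpha>\<in>box n m. dscale (dcoeff f \<alpha>) (dmon \<alpha>)) \<beta>"
      using assms finite_box[of n m] unfolding A_eq by (auto simp: sum.delta supp_in_def)
  qed
  then have "subst_dps n y f = (\<Sum>\<alpha>\<in>box n m. dscale (dcoeff f \<alpha>) (subst_dps n y (dmon \<alpha>)))"
    by (metis (no_types, lifting) subst_sum subst_dscale sum.cong)
  also have "\<dots> = (\<Sum>\<alpha>\<in>box n m. dscale (dcoeff f \<alpha>) (ypow n y \<alpha>))"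
    by (intro sum.cong refl) (auto simp: box_def subst_dmon)
  finally show ?thesis .
qed

lemma subst_in_A: "dec_family g \<Longrightarrow> f \<in> A \<Longrightarrow> subst_dps n (yy g) f \<in> A"
  unfolding subst_eq_sum by (intro A_sum A_dscale ypow_in_A)

text \<open>On monomials multiplicativity is \<open>ypow_times\<close>. For power series both sides are expanded at a fixed index, where
  only finitely many pairs of monomials contribute.\<close>

lemma subst_times:
  assumes g: "dec_family g" and f1: "f1 \<in> Ohat n" and f2: "f2 \<in> Ohat n"
  shows "subst_dps n (yy g) (f1 * f2) = subst_dps n (yy g) f1 * subst_dps n (yy g) f2"
proof (rule dps_eqI)
  fix \<gamma>
  define Y where "Y = ypow n (yy g)"
  let ?d = "mdeg \<gamma>"
  let ?B = "{\<alpha>. keys \<alpha> \<subseteq> {1..n} \<and> mdeg \<alpha> \<le> ?d}"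
  let ?T = "{(\<alpha>, \<beta>). keys \<alpha> \<subseteq> {1..n} \<and> keys \<beta> \<subseteq> {1..n} \<and> mdeg \<alpha> + mdeg \<beta> \<le> ?d}"
  let ?t = "\<lambda>\<alpha> \<beta>. dcoeff f1 \<alpha> * dcoeff f2 \<beta> * dcoeff (Y \<alpha> * Y \<beta>) \<gamma>"
  have finB: "finite ?B" by (simp add: finite_bounded_mdeg)
  have TB: "?T \<subseteq> ?B \<times> ?B" by auto
  have Yc: "dcoeff (Y \<alpha> * Y \<beta>) \<gamma> = of_nat (mchoose (\<alpha> + \<beta>) \<alpha>) * dcoeff (Y (\<alpha> + \<beta>)) \<gamma>"
    if "keys \<alpha> \<subseteq> {1..n}" "keys \<beta> \<subseteq> {1..n}" for \<alpha> \<beta>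
    unfolding Y_def ypow_times[OF g that] of_nat_dps by (simp flip: dscale_def)
  have "dcoeff (subst_dps n (yy g) (f1 * f2)) \<gamma>
      = (\<Sum>\<delta>\<in>?B. \<Sum>(\<alpha>, \<beta>)\<in>splits \<delta>. of_nat (mchoose \<delta> \<alpha>) * dcoeff f1 \<alpha> * dcoeff f2 \<beta> * dcoeff (Y \<delta>) \<gamma>)"
    by (simp add: subst_dps_def dcoeff_times sum_distrib_right split_def Y_def)
  also have "\<dots> = (\<Sum>(\<delta>, (\<alpha>, \<beta>))\<in>Sigma ?B splits. of_nat (mchoose \<delta> \<alpha>) * dcoeff f1 \<alpha> * dcoeff f2 \<beta> * dcoeff (Y \<delta>) \<gamma>)"
    by (subst sum.Sigma) (auto simp: finB finite_splits split_def)
  also have "\<dots> = (\<Sum>(\<alpha>, \<beta>)\<in>?T. ?t \<alpha> \<beta>)"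
  proof (rule sum.reindex_bij_witness[where i = "\<lambda>(\<alpha>, \<beta>). (\<alpha> + \<beta>, (\<alpha>, \<beta>))" and j = snd])
    fix p assume "p \<in> Sigma ?B splits"
    then obtain \<alpha> \<beta> where p: "p = (\<alpha> + \<beta>, (\<alpha>, \<beta>))" "keys \<alpha> \<subseteq> {1..n}" "keys \<beta> \<subseteq> {1..n}" "mdeg \<alpha> + mdeg \<beta> \<le> ?d"
      by (auto simp: splits_def keys_add_mindex)
    then show "(\<lambda>(\<alpha>, \<beta>). (\<alpha> + \<beta>, (\<alpha>, \<beta>))) (snd p) = p" "snd p \<in> ?T" by auto
    show "(case snd p of (\<alpha>, \<beta>) \<Rightarrow> ?t \<alpha> \<beta>) = (case p of (\<delta>, (\<alpha>, \<beta>)) \<Rightarrow>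
        of_nat (mchoose \<delta> \<alpha>) * dcoeff f1 \<alpha> * dcoeff f2 \<beta> * dcoeff (Y \<delta>) \<gamma>)"
      using p by (simp add: Yc ac_simps)
  qed (auto simp: splits_def keys_add_mindex simp del: atLeastAtMost_iff)
  also have "\<dots> = (\<Sum>(\<alpha>, \<beta>)\<in>?B \<times> ?B. ?t \<alpha> \<beta>)"
  proof (rule sum.mono_neutral_left[OF _ TB])
    show "\<forall>p\<in>?B \<times> ?B - ?T. (case p of (\<alpha>, \<beta>) \<Rightarrow> ?t \<alpha> \<beta>) = 0"
    proof
      fix p assume "p \<in> ?B \<times> ?B - ?T"
      then obtain \<alpha> \<beta> where p: "p = (\<alpha>, \<beta>)" "keys \<alpha> \<subseteq> {1..n}" "keys \<beta> \<subseteq> {1..n}" "\<not> mdeg \<alpha> + mdeg \<beta> \<le> ?d" by auto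
      have "Y \<alpha> * Y \<beta> \<in> order_ge (mdeg \<alpha> + mdeg \<beta>)" using p unfolding Y_def by (intro order_ge_times ypow_order)
      then have "dcoeff (Y \<alpha> * Y \<beta>) \<gamma> = 0" using p(4) unfolding order_ge_def by (intro supp_inD) auto
      then show "(case p of (\<alpha>, \<beta>) \<Rightarrow> ?t \<alpha> \<beta>) = 0" by (simp add: p(1))
    qed
  qed (use finB in simp)
  also have "\<dots> = (\<Sum>\<alpha>\<in>?B. \<Sum>\<beta>\<in>?B. ?t \<alpha> \<beta>)"
    by (simp add: sum.cartesian_product)
  also have "\<dots> = (\<Sum>\<alpha>\<in>?B. \<Sum>\<beta>\<in>?B. \<Sum>(\<mu>, \<nu>)\<in>splits \<gamma>. of_nat (mchoose \<gamma> \<mu>) *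
      (dcoeff f1 \<alpha> * dcoeff (Y \<alpha>) \<mu>) * (dcoeff f2 \<beta> * dcoeff (Y \<beta>) \<nu>))"
    by (simp add: dcoeff_times sum_distrib_left split_def ac_simps)
  also have "\<dots> = (\<Sum>\<alpha>\<in>?B. \<Sum>(\<mu>, \<nu>)\<in>splits \<gamma>. \<Sum>\<beta>\<in>?B. of_nat (mchoose \<gamma> \<mu>) *
      (dcoeff f1 \<alpha> * dcoeff (Y \<alpha>) \<mu>) * (dcoeff f2 \<beta> * dcoeff (Y \<beta>) \<nu>))"
    unfolding split_def by (subst sum.swap[of _ ?B "splits \<gamma>"]) simp
  also have "\<dots> = (\<Sum>(\<mu>, \<nu>)\<in>splits \<gamma>. \<Sum>\<alpha>\<in>?B. \<Sum>\<beta>\<in>?B. of_nat (mchoose \<gamma> \<mu>) *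
      (dcoeff f1 \<alpha> * dcoeff (Y \<alpha>) \<mu>) * (dcoeff f2 \<beta> * dcoeff (Y \<beta>) \<nu>))"
    unfolding split_def by (subst sum.swap[of _ ?B "splits \<gamma>"]) simp
  also have "\<dots> = (\<Sum>(\<mu>, \<nu>)\<in>splits \<gamma>. of_nat (mchoose \<gamma> \<mu>) *
      (\<Sum>\<alpha>\<in>?B. dcoeff f1 \<alpha> * dcoeff (Y \<alpha>) \<mu>) * (\<Sum>\<beta>\<in>?B. dcoeff f2 \<beta> * dcoeff (Y \<beta>) \<nu>))"
    by (simp add: sum_distrib_left sum_distrib_right ac_simps)
  also have "\<dots> = dcoeff (subst_dps n (yy g) f1 * subst_dps n (yy g) f2) \<gamma>"
    unfolding dcoeff_times
  proof (rule sum.cong[OF refl], clarify)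
    fix \<mu> \<nu> assume "(\<mu>, \<nu>) \<in> splits \<gamma>"
    then have "mdeg \<mu> \<le> ?d" "mdeg \<nu> \<le> ?d" by (auto simp: splits_def)
    then show "of_nat (mchoose \<gamma> \<mu>) * (\<Sum>\<alpha>\<in>?B. dcoeff f1 \<alpha> * dcoeff (Y \<alpha>) \<mu>) * (\<Sum>\<beta>\<in>?B. dcoeff f2 \<beta> * dcoeff (Y \<beta>) \<nu>)
      = of_nat (mchoose \<gamma> \<mu>) * dcoeff (subst_dps n (yy g) f1) \<mu> * dcoeff (subst_dps n (yy g) f2) \<nu>"
      by (simp only: dcoeff_subst Y_def)
  qed
  finally show "dcoeff (subst_dps n (yy g) (f1 * f2)) \<gamma> = dcoeff (subst_dps n (yy g) f1 * subst_dps n (yy g) f2) \<gamma>" .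
qed

lemma subst_inj:
  assumes g: "dec_family g" and f: "f \<in> Ohat n" and 0: "subst_dps n (yy g) f = 0"
  shows "f = 0"
proof (rule dps_eqI)
  fix \<gamma>
  show "dcoeff f \<gamma> = dcoeff 0 \<gamma>"
  proof (induction "mdeg \<gamma>" arbitrary: \<gamma> rule: less_induct)
    case less
    show ?case
    proof (cases "keys \<gamma> \<subseteq> {1..n}")
      case True
      have "(\<Sum>\<alpha>\<in>{\<alpha>. keys \<alpha> \<subseteq> {1..n} \<and> mdeg \<alpha> < mdeg \<gamma>}. dcoeff f \<alpha> * dcoeff (ypow n (yy g) \<alpha>) \<gamma>) = 0"
        by (rule sum.neutral) (use less in auto)
      then show ?thesis using subst_coeff[OF g True, of f] 0 by simp
    next
      case False
      then show ?thesis using f by (auto simp: Ohat_def)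
    qed
  qed
qed

lemma subst_surj:
  assumes g: "dec_family g" and u: "u \<in> supp_in S" and S: "\<And>\<alpha>. \<alpha> \<in> S \<Longrightarrow> keys \<alpha> \<subseteq> {1..n}"
    "\<And>\<alpha>. \<alpha> \<in> S \<Longrightarrow> ypow n (yy g) \<alpha> \<in> supp_in S"
  shows "\<exists>f\<in>supp_in S. subst_dps n (yy g) f = u"
proof -
  define f where "f = Abs_dps (inv_coeff n (yy g) u)"
  have fS: "f \<in> supp_in S"
    using inv_coeff_supp[OF u S(2)] by (auto simp: supp_in_def f_def)
  have "subst_dps n (yy g) f = u"
  proof (rule dps_eqI)
    fix \<gamma>
    show "dcoeff (subst_dps n (yy g) f) \<gamma> = dcoeff u \<gamma>"
    proof (cases "keys \<gamma> \<subseteq> {1..n}")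
      case True
      show ?thesis unfolding subst_coeff[OF g True] f_def dcoeff_Abs
        by (subst inv_coeff.simps) simp
    next
      case False
      then have "dcoeff (subst_dps n (yy g) f) \<gamma> = 0"
        using subst_in_Ohat[OF g, of f] unfolding Ohat_eq by (intro supp_inD) auto
      moreover have "dcoeff u \<gamma> = 0" using False S(1) u by (intro supp_inD) auto
      ultimately show ?thesis by simp
    qed
  qed
  with fS show ?thesis by blast
qed

text \<open>This is used with two sets \<open>S\<close>: all indices in \<open>n\<close> variables for the completion, and the box for the
  truncated algebra.\<close>

lemma subst_bij:
  assumes g: "dec_family g" and S: "\<And>\<alpha>. \<alpha> \<in> S \<Longrightarrow> keys \<alpha> \<subseteq> {1..n}"
    "\<And>\<alpha>. \<alpha> \<in> S \<Longrightarrow> ypow n (yy g) \<alpha> \<in> supp_in S"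
    "\<And>f. f \<in> supp_in S \<Longrightarrow> subst_dps n (yy g) f \<in> supp_in S"
  shows "bij_betw (subst_dps n (yy g)) (supp_in S) (supp_in S)"
  unfolding bij_betw_def
proof
  show "inj_on (subst_dps n (yy g)) (supp_in S)"
  proof (rule inj_onI)
    fix a b assume ab: "a \<in> supp_in S" "b \<in> supp_in S" "subst_dps n (yy g) a = subst_dps n (yy g) b"
    have "a - b \<in> Ohat n" unfolding Ohat_eq
      by (rule supp_in_mono[OF _ supp_in_diff[OF ab(1,2)]]) (use S(1) in auto)
    moreover have "subst_dps n (yy g) (a - b) = 0" by (simp only: subst_diff ab(3) diff_self)
    ultimately have "a - b = 0" by (rule subst_inj[OF g])
    then show "a = b" by simp
  qed
  show "subst_dps n (yy g) ` supp_in S = supp_in S"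
  proof
    show "subst_dps n (yy g) ` supp_in S \<subseteq> supp_in S" using S(3) by blast
    show "supp_in S \<subseteq> subst_dps n (yy g) ` supp_in S"
    proof
      fix u :: "'k dps" assume "u \<in> supp_in S"
      then obtain f where "f \<in> supp_in S" "subst_dps n (yy g) f = u" using subst_surj[OF g _ S(1,2)] by blast
      then show "u \<in> subst_dps n (yy g) ` supp_in S" by blast
    qed
  qed
qed

lemma subst_algebra_aut_Ohat: "dec_family g \<Longrightarrow> algebra_aut (Ohat n) (subst_dps n (yy g))"
  unfolding algebra_aut_def using subst_bij[of g "{\<alpha>. keys \<alpha> \<subseteq> {1..n}}"]
  by (simp add: Ohat_eq[symmetric] subst_add subst_times subst_dscale ypow_in_Ohat subst_in_Ohat)

lemma subst_algebra_aut_A: "dec_family g \<Longrightarrow> algebra_aut A (subst_dps n (yy g))"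
  unfolding algebra_aut_def using subst_bij[of g "box n m"]
  by (simp add: A_eq[symmetric] subst_add subst_times subst_dscale A_subset_Ohat ypow_in_A subst_in_A keys_box)

lemma subst_continuous: "dec_family g \<Longrightarrow> Ohat_continuous n (subst_dps n (yy g))"
proof -
  assume g: "dec_family g"
  have e: "Ohat_ge n j = Ohat n \<inter> order_ge j" for j
    by (auto simp: Ohat_ge_def order_ge_def supp_in_def)
  show ?thesis unfolding Ohat_continuous_def e
  proof (intro ballI allI exI impI)
    fix f h :: "'k dps" and j assume "h - f \<in> Ohat n \<inter> order_ge j"
    then have "subst_dps n (yy g) (h - f) \<in> Ohat n \<inter> order_ge j"
      by (intro IntI subst_in_Ohat[OF g] subst_order) simp
    then show "subst_dps n (yy g) h - subst_dps n (yy g) f \<in> Ohat n \<inter> order_ge j"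
      by (simp only: subst_diff)
  qed
qed

lemma dpow_1_yy: "f \<in> supp_in (dec_idx n m t) \<Longrightarrow> dpow 1 (xpow i 1 + f) = (xpow i 1 + f :: 'k dps)"
proof (induction f rule: supp_in_induct[OF finite_dec_idx, consumes 1])
  case (2 f \<alpha> c)
  then show ?case using dpow_add_dmon[OF char2, of \<alpha> 0 "xpow i 1 + f" c]
    by (simp add: dec_idx_def add.assoc One_nat_def)
qed (use dpow_xpow_1[of 1 i] in simp)

lemma subst_xpow:
  assumes g: "dec_family g" "i \<in> {1..n}"
  shows "subst_dps n (yy g) (xpow i a) = dpow a (yy g i)"
proof -
  have "subst_dps n (yy g) (xpow i a) = ypow n (yy g) (Poly_Mapping.single i a)"
    using g by (intro subst_dmon) auto
  also have "\<dots> = (\<Prod>j\<in>{1..n}. if j = i then dpow a (yy g i) else 1)"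
    unfolding ypow_def by (rule prod.cong) (auto simp: lookup_single when_def)
  also have "\<dots> = dpow a (yy g i)" using g by (simp add: prod.delta)
  finally show ?thesis .
qed

lemma subst_x: "dec_family g \<Longrightarrow> i \<in> {1..n} \<Longrightarrow> subst_dps n (yy g) (xpow i 1) = yy g i"
  using dpow_1_yy[OF dec_familyD] subst_xpow[of g i 1] by simp

lemma subst_admissible: "dec_family g \<Longrightarrow> admissible n A (subst_dps n (yy g))"
  unfolding admissible_def
proof (intro conjI subst_algebra_aut_A exI[of _ "subst_dps n (yy g)"] subst_algebra_aut_Ohat subst_continuous
    allI impI ballI refl)
  fix \<alpha> assume g: "dec_family g" and \<alpha>: "keys \<alpha> \<subseteq> {1..n}"
  show "subst_dps n (yy g) (dmon \<alpha>) = (\<Prod>i = 1..n. dpow (lookup \<alpha> i) (subst_dps n (yy g) (xpow i 1)))"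
    unfolding subst_dmon[OF \<alpha>] ypow_def by (rule prod.cong) (simp_all only: subst_x[OF g])
qed

text \<open>The difference lies in the square of the maximal ideal, so these substitutions belong to \<open>G'\<close>.\<close>

lemma subst_minus_id_dec:
  assumes "dec_family g" "f \<in> A" shows "subst_dps n (yy g) f - f \<in> supp_in (dec_idx n m 0)"
proof -
  have f: "f \<in> supp_in (box n m)" using assms(2) by (simp add: A_eq)
  show ?thesis using finite_box f
  proof (induction f rule: supp_in_induct)
    case (add f \<alpha> c)
    have "subst_dps n (yy g) (dmon \<alpha>) = ypow n (yy g) \<alpha>" using add by (intro subst_dmon) (auto simp: box_def)
    then have e: "subst_dps n (yy g) (f + dscale c (dmon \<alpha>)) - (f + dscale c (dmon \<alpha>))
       = (subst_dps n (yy g) f - f) + dscale c (ypow n (yy g) \<alpha> - dmon \<alpha>)"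
      by (simp add: subst_add subst_dscale) (simp add: dscale_def algebra_simps)
    show ?case unfolding e
      by (intro supp_in_add supp_in_dscale add.IH ypow_minus_dmon_dec[OF assms(1)] add.hyps)
  qed simp
qed

lemma dec_in_max_ideal_sq:
  assumes "f \<in> supp_in (dec_idx n m t)" shows "f \<in> max_ideal_sq A"
proof -
  interpret Modules.module "dscale :: 'k \<Rightarrow> 'k dps \<Rightarrow> 'k dps"
    by unfold_locales (auto intro!: dps_eqI simp: algebra_simps)
  show ?thesis unfolding max_ideal_sq_def using finite_dec_idx assms
  proof (induction f rule: supp_in_induct)
    case (add f \<alpha> c)
    then have d: "decomposable \<alpha>" "\<alpha> \<in> box n m" by (simp_all add: dec_idx_def)
    obtain \<mu> \<nu> where "\<alpha> = \<mu> + \<nu>" "\<mu> \<noteq> 0" "\<nu> \<noteq> 0" "mno_carry \<mu> \<nu>"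
      using d(1) by (rule decomposableE)
    note \<alpha> = this d(2)
    have "\<mu> \<in> box n m" "\<nu> \<in> box n m" using \<alpha> box_addD[of \<mu> \<nu>] box_addD[of \<nu> \<mu>] by (auto simp: add.commute)
    then have "(dmon \<mu> :: 'k dps) \<in> max_ideal A" "(dmon \<nu> :: 'k dps) \<in> max_ideal A"
      using \<alpha> A_dmon by (auto simp: max_ideal_def)
    moreover have "dmon \<alpha> = dmon \<mu> * (dmon \<nu> :: 'k dps)" using \<alpha> by (simp add: dmon_times_char2[OF char2])
    ultimately have "(dmon \<alpha> :: 'k dps) \<in> span {f * g | f g. f \<in> max_ideal A \<and> g \<in> max_ideal A}"
      by (intro span_base) blast
    with add.IH show ?case by (intro span_add span_scale)
  qed (rule span_zero)
qed

lemma subst_in_G': "dec_family g \<Longrightarrow> subst_dps n (yy g) \<in> G' n A"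
  unfolding G'_def using subst_admissible subst_minus_id_dec dec_in_max_ideal_sq by blast

text \<open>The chain rule, from \<open>pd_dpow\<close> on the factors of a monomial.\<close>

lemma pd_subst:
  assumes g: "dec_family g" and f: "f \<in> A"
  shows "pd k (subst_dps n (yy g) f) = (\<Sum>i\<in>{1..n}. subst_dps n (yy g) (pd i f) * pd k (yy g i))"
proof -
  have "f \<in> supp_in (box n m)" using f by (simp add: A_eq)
  with finite_box show ?thesis
  proof (induction f rule: supp_in_induct)
    case (add f \<alpha> c)
    have \<alpha>: "keys \<alpha> \<subseteq> {1..n}" using add by (auto simp: box_def)
    have "pd k (ypow n (yy g) \<alpha>) = (\<Sum>i\<in>{1..n}. subst_dps n (yy g) (pd i (dmon \<alpha>)) * pd k (yy g i))"
      unfolding ypow_def pd_prod[OF finite_atLeastAtMost]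
    proof (rule sum.cong[OF refl])
      fix i assume i: "i \<in> {1..n}"
      show "pd k (dpow (lookup \<alpha> i) (yy g i)) * (\<Prod>j\<in>{1..n} - {i}. dpow (lookup \<alpha> j) (yy g j))
          = subst_dps n (yy g) (pd i (dmon \<alpha>)) * pd k (yy g i)"
      proof (cases "lookup \<alpha> i")
        case 0
        have "pd k (1 :: 'k dps) = 0" by (rule dps_eqI) simp
        with 0 show ?thesis by (simp add: pd_dmon)
      next
        case (Suc a)
        have "keys (\<alpha> - eps i) \<subseteq> {1..n}" using \<alpha> by (auto simp: in_keys_iff lookup_minus subset_iff)
        then have "subst_dps n (yy g) (pd i (dmon \<alpha>)) = ypow n (yy g) (\<alpha> - eps i)"
          using Suc by (simp del: One_nat_def add: pd_dmon subst_dmon)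
        also have "\<dots> = dpow (lookup (\<alpha> - eps i) i) (yy g i) * (\<Prod>j\<in>{1..n} - {i}. dpow (lookup (\<alpha> - eps i) j) (yy g j))"
          unfolding ypow_def using i by (intro prod.remove) auto
        also have "(\<Prod>j\<in>{1..n} - {i}. dpow (lookup (\<alpha> - eps i) j) (yy g j)) = (\<Prod>j\<in>{1..n} - {i}. dpow (lookup \<alpha> j) (yy g j))"
          by (rule prod.cong) (auto simp: lookup_minus lookup_single)
        also have "lookup (\<alpha> - eps i) i = a" using Suc by (simp add: lookup_minus)
        finally show ?thesis
          unfolding Suc pd_dpow[OF dec_familyD[OF g i]] by (simp only: ac_simps)
      qed
    qed
    then show ?case using add.IH \<alpha>
      by (simp add: subst_add pd_linear subst_dscale subst_dmon distrib_right sum.distrib dscale_sum dscale_mult(1))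
  qed (simp add: pd_linear)
qed

lemma subst_diff_order:
  fixes y h :: "nat \<Rightarrow> 'k dps"
  assumes "\<And>i. i \<in> {1..n} \<Longrightarrow> h i \<in> supp_in (dec_idx n m (Suc s))" "f \<in> A" "f \<in> order_ge d"
  shows "subst_dps n (\<lambda>i. y i + h i) f - subst_dps n y f \<in> order_ge (d + s)"
proof -
  have e: "subst_dps n (\<lambda>i. y i + h i) f - subst_dps n y f
    = (\<Sum>\<alpha>\<in>box n m. dscale (dcoeff f \<alpha>) (ypow n (\<lambda>i. y i + h i) \<alpha> - ypow n y \<alpha>))"
    unfolding subst_eq_sum[OF assms(2)] sum_subtractf[symmetric] by (simp add: dscale_def algebra_simps)
  show ?thesis unfolding e order_ge_def
  proof (rule supp_in_sum)
    fix \<alpha> assume \<alpha>: "\<alpha> \<in> box n m"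
    show "dscale (dcoeff f \<alpha>) (ypow n (\<lambda>i. y i + h i) \<alpha> - ypow n y \<alpha>) \<in> supp_in {\<alpha>. d + s \<le> mdeg \<alpha>}"
    proof (cases "d \<le> mdeg \<alpha>")
      case True
      have "ypow n (\<lambda>i. y i + h i) \<alpha> - ypow n y \<alpha> \<in> order_ge (d + s)"
        by (rule order_ge_mono[OF _ ypow_diff_order[OF assms(1)]]) (use \<alpha> True in \<open>auto simp: box_def\<close>)
      then show ?thesis unfolding order_ge_def by (rule supp_in_dscale)
    next
      case False
      then have "dcoeff f \<alpha> = 0" using assms(3) unfolding order_ge_def by (intro supp_inD) auto
      then show ?thesis by (simp add: dscale_def dp_const_def flip: zero_dps_def)
    qed
  qed
qed

end

section \<open>Indices with two binary digits\<close>

text \<open>The indices of \<open>x\<^sub>k\<^bsup>(p)\<^esup> x\<^sub>l\<^bsup>(q)\<^esup>\<close>, \<open>k \<noteq> l\<close>, \<open>p\<close> and \<open>q\<close> powers of two. These are the only monomials \<open>u\<close> with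
  \<open>\<partial>\<^sub>k u \<partial>\<^sub>l u \<noteq> 0\<close> for some \<open>k \<noteq> l\<close>, and for \<open>i \<in> I\<close> the ones excluded from the coefficient at \<open>dx\<^sub>i\<close> of \<open>\<phi>\<close>.\<close>

definition two_digit :: "mindex \<Rightarrow> bool" where
  "two_digit \<alpha> \<longleftrightarrow> (\<exists>k l s t. k \<noteq> l \<and> \<alpha> = Poly_Mapping.single k (2 ^ s) + Poly_Mapping.single l (2 ^ t))"

lemma single_pow2_nonzero: "Poly_Mapping.single k (2 ^ s) \<noteq> (0 :: mindex)"
proof
  assume "Poly_Mapping.single k (2 ^ s) = (0 :: mindex)"
  from arg_cong[OF this, of mdeg] show False by (simp del: mdeg_eq_0_iff)
qed

text \<open>Two binary digits admit no factorisation into three nontrivial factors.\<close>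

lemma two_digit_split:
  assumes "two_digit (\<mu> + \<nu>)" "mno_carry \<mu> \<nu>" "decomposable \<mu>" shows "\<nu> = 0"
proof (rule ccontr)
  assume "\<nu> \<noteq> 0"
  obtain k l s t where kl: "k \<noteq> l" "\<mu> + \<nu> = Poly_Mapping.single k (2 ^ s) + Poly_Mapping.single l (2 ^ t)"
    using assms(1) unfolding two_digit_def by blast
  have L: "lookup \<mu> i + lookup \<nu> i = lookup (Poly_Mapping.single k (2 ^ s)) i + lookup (Poly_Mapping.single l (2 ^ t)) i" for i
    using arg_cong[OF kl(2), of "\<lambda>\<alpha>. lookup \<alpha> i"] by (simp only: lookup_add)
  have off: "lookup \<mu> i = 0 \<and> lookup \<nu> i = 0" if "i \<noteq> k" "i \<noteq> l" for i
    using L[of i] that by (simp add: lookup_single)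
  have nc: "no_carry (lookup \<mu> i) (lookup \<nu> i)" for i using assms(2) by (simp add: mno_carry_def)
  have Lk: "lookup \<mu> k + lookup \<nu> k = 2 ^ s" and Ll: "lookup \<mu> l + lookup \<nu> l = 2 ^ t"
    using L[of k] L[of l] kl(1) by (simp_all add: lookup_single)
  have dk: "lookup \<mu> k = 0 \<or> lookup \<nu> k = 0" by (rule no_carry_eq_pow2[OF nc Lk])
  have dl: "lookup \<mu> l = 0 \<or> lookup \<nu> l = 0" by (rule no_carry_eq_pow2[OF nc Ll])
  have "lookup \<nu> k \<noteq> 0 \<or> lookup \<nu> l \<noteq> 0"
  proof (rule ccontr)
    assume "\<not> ?thesis"
    then have "lookup \<nu> i = lookup 0 i" for i using off[of i] by (cases "i = k"; cases "i = l") auto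
    then have "\<nu> = 0" by (rule poly_mapping_eqI)
    with \<open>\<nu> \<noteq> 0\<close> show False ..
  qed
  then have "\<mu> = 0 \<or> (\<exists>i e. \<mu> = Poly_Mapping.single i (2 ^ e))"
  proof
    assume "lookup \<nu> k \<noteq> 0"
    then have k0: "lookup \<mu> k = 0" using dk by simp
    then have \<mu>: "\<mu> = Poly_Mapping.single l (lookup \<mu> l)"
      using off by (intro poly_mapping_eqI) (metis lookup_single_eq lookup_single_not_eq)
    show ?thesis
    proof (cases "lookup \<mu> l = 0")
      case True
      then show ?thesis using \<mu> by simp
    next
      case False
      then have "lookup \<mu> l = 2 ^ t" using dl Ll by simp
      then show ?thesis using \<mu> by metis
    qed
  next
    assume "lookup \<nu> l \<noteq> 0"
    then have l0: "lookup \<mu> l = 0" using dl by simp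
    then have \<mu>: "\<mu> = Poly_Mapping.single k (lookup \<mu> k)"
      using off by (intro poly_mapping_eqI) (metis lookup_single_eq lookup_single_not_eq)
    show ?thesis
    proof (cases "lookup \<mu> k = 0")
      case True
      then show ?thesis using \<mu> by simp
    next
      case False
      then have "lookup \<mu> k = 2 ^ s" using dk Lk by simp
      then show ?thesis using \<mu> by metis
    qed
  qed
  then show False using assms(3) by (auto simp: decomposable_def)
qed

lemma pow2_add_pred: "(2 ^ s - 1) + 2 ^ s = 2 ^ Suc s - (1 :: nat)"
  using one_le_power[of "2 :: nat" s] by simp

lemma no_carry_pow2_pred: "no_carry (2 ^ s - 1) (2 ^ s)"
  using no_carry_pred_self[of "2 ^ s"] by auto

text \<open>The indices \<open>\<alpha> - \<epsilon>\<^sub>k\<close> and \<open>\<alpha> - \<epsilon>\<^sub>l\<close> agree outside \<open>k\<close> and \<open>l\<close>, so \<open>\<alpha>\<close> vanishes there if their addition has no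
  carry; at \<open>k\<close> and \<open>l\<close> the entries \<open>a - 1\<close> and \<open>a\<close> add without carry for powers of two only.\<close>

lemma pd_mult_pd_dmon_zero:
  assumes "CHAR('a::comm_ring_1) = 2" "k \<noteq> l" "\<And>s t. \<alpha> \<noteq> Poly_Mapping.single k (2 ^ s) + Poly_Mapping.single l (2 ^ t)"
  shows "pd k (dmon \<alpha>) * pd l (dmon \<alpha>) = (0 :: 'a dps)"
proof (rule ccontr)
  assume "pd k (dmon \<alpha>) * pd l (dmon \<alpha>) \<noteq> (0 :: 'a dps)"
  then have pos: "lookup \<alpha> k > 0" "lookup \<alpha> l > 0" and nc: "mno_carry (\<alpha> - eps k) (\<alpha> - eps l)"
    by (auto simp: pd_dmon dmon_times_char2[OF assms(1)] split: if_splits)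
  have N: "no_carry (lookup \<alpha> i - lookup (eps k) i) (lookup \<alpha> i - lookup (eps l) i)" for i
    using nc unfolding mno_carry_def lookup_minus by (rule spec)
  have "lookup \<alpha> i = 0" if "i \<noteq> k" "i \<noteq> l" for i
    using no_carry_self[of "lookup \<alpha> i"] N[of i] that by (simp add: lookup_single)
  moreover obtain s where "lookup \<alpha> k = 2 ^ s"
    using N[of k] no_carry_pred_self[OF pos(1)] assms(2) by (auto simp: lookup_single)
  moreover obtain t where "lookup \<alpha> l = 2 ^ t"
    using N[of l] no_carry_pred_self[OF pos(2)] no_carry_commute[of "lookup \<alpha> l"] assms(2)
    by (auto simp: lookup_single)
  ultimately have "\<alpha> = Poly_Mapping.single k (2 ^ s) + Poly_Mapping.single l (2 ^ t)"
    using assms(2) by (intro poly_mapping_eqI) (auto simp: lookup_add lookup_single when_def)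
  with assms(3) show False by blast
qed

lemma pd_mult_pd_two_digit:
  assumes "CHAR('a::comm_ring_1) = 2" "k \<noteq> l"
    and \<alpha>_def: "\<alpha> = Poly_Mapping.single k (2 ^ s) + Poly_Mapping.single l (2 ^ t)"
  shows "pd k (dmon \<alpha>) * pd l (dmon \<alpha>)
    = (dmon (Poly_Mapping.single k (2 ^ Suc s - 1) + Poly_Mapping.single l (2 ^ Suc t - 1)) :: 'a dps)"
proof -
  have Lk: "lookup \<alpha> k = 2 ^ s" and Ll: "lookup \<alpha> l = 2 ^ t"
    using assms(2) by (simp_all add: \<alpha>_def lookup_add lookup_single)
  have Lo: "lookup \<alpha> i = 0" if "i \<noteq> k" "i \<noteq> l" for i
    using that by (simp add: \<alpha>_def lookup_add lookup_single)
  have "no_carry (lookup (\<alpha> - eps k) i) (lookup (\<alpha> - eps l) i)" for i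
  proof -
    consider "i = k" | "i = l" | "i \<noteq> k" "i \<noteq> l" by blast
    then show ?thesis
    proof cases
      case 1
      then show ?thesis using assms(2) Lk no_carry_pow2_pred[of s] by (simp add: lookup_minus lookup_single)
    next
      case 2
      then show ?thesis using assms(2) Ll no_carry_pow2_pred[of t] no_carry_commute[of "2 ^ t" "2 ^ t - 1"]
        by (simp add: lookup_minus lookup_single)
    next
      case 3
      then show ?thesis using Lo by (simp add: lookup_minus)
    qed
  qed
  then have nc: "mno_carry (\<alpha> - eps k) (\<alpha> - eps l)" by (simp add: mno_carry_def)
  have "(\<alpha> - eps k) + (\<alpha> - eps l) = Poly_Mapping.single k (2 ^ Suc s - 1) + Poly_Mapping.single l (2 ^ Suc t - 1)"
  proof (rule poly_mapping_eqI)
    fix i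
    consider "i = k" | "i = l" | "i \<noteq> k" "i \<noteq> l" by blast
    then show "lookup ((\<alpha> - eps k) + (\<alpha> - eps l)) i
      = lookup (Poly_Mapping.single k (2 ^ Suc s - 1) + Poly_Mapping.single l (2 ^ Suc t - 1)) i"
    proof cases
      case 1
      then show ?thesis using assms(2) Lk pow2_add_pred[of s] by (simp add: lookup_minus lookup_single lookup_add)
    next
      case 2
      then show ?thesis using assms(2) Ll pow2_add_pred[of t] by (simp add: lookup_minus lookup_single lookup_add)
    next
      case 3
      then show ?thesis using Lo by (simp add: lookup_minus lookup_single lookup_add)
    qed
  qed
  with nc show ?thesis using Lk Ll by (simp add: pd_dmon dmon_times_char2[OF assms(1)])
qed

lemma pd_dmon_not_key: "k \<notin> keys \<alpha> \<Longrightarrow> pd k (dmon \<alpha>) = (0 :: 'a::comm_ring_1 dps)"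
  by (simp add: pd_dmon in_keys_iff)

context truncated_dp_algebra
begin

text \<open>Squares of monomials without constant term vanish, and squaring is additive in characteristic two.\<close>

lemma square_eq_const:
  assumes "f \<in> A" shows "f * f = dp_const (dcoeff f 0 * dcoeff f 0)"
proof -
  have "f \<in> supp_in (box n m)" using assms by (simp add: A_eq)
  with finite_box show ?thesis
  proof (induction f rule: supp_in_induct)
    case zero
    show ?case by (rule dps_eqI) simp
  next
    case (add f \<alpha> c)
    let ?u = "dscale c (dmon \<alpha>) :: 'k dps"
    have uu: "?u * ?u = dp_const (dcoeff ?u 0 * dcoeff ?u 0)"
    proof (cases "\<alpha> = 0")
      case True
      have "?u = dp_const c" by (rule dps_eqI) (simp add: True)
      then show ?thesis by (intro dps_eqI) (simp flip: dscale_def)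
    next
      case False
      have "?u * ?u = dscale c (dscale c (dmon \<alpha> * dmon \<alpha>))" unfolding dscale_def by (simp only: ac_simps)
      then show ?thesis using False dmon_square_char2[OF char2 False] by (intro dps_eqI) simp
    qed
    have "(f + ?u) * (f + ?u) = f * f + ?u * ?u + (f * ?u + f * ?u)"
      by (simp only: distrib_left distrib_right ac_simps)
    also have "\<dots> = dp_const (dcoeff f 0 * dcoeff f 0) + dp_const (dcoeff ?u 0 * dcoeff ?u 0)"
      by (simp only: add.IH uu dsum_self add_0_right)
    also have "\<dots> = dp_const (dcoeff (f + ?u) 0 * dcoeff (f + ?u) 0)"
    proof -
      have "a * b + a * b = 0" for a b :: 'k by (rule add_self_char2[OF char2])
      then have "(p + q) * (p + q) = p * p + q * q" for p q :: 'k
        by (simp add: algebra_simps)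
      then show ?thesis by (intro dps_eqI) simp
    qed
    finally show ?case .
  qed
qed

text \<open>The critical monomial of \<open>k\<close> and \<open>l\<close>, the one whose squared differential is \<open>dz\<^sub>k dz\<^sub>l\<close>.\<close>

definition crit :: "nat \<Rightarrow> nat \<Rightarrow> mindex" where
  "crit k l = Poly_Mapping.single k (2 ^ (m k - 1)) + Poly_Mapping.single l (2 ^ (m l - 1))"

text \<open>The coefficient of \<open>dz\<^sub>k\<close> at \<open>dx\<^sub>k\<close>.\<close>

definition zf :: "nat \<Rightarrow> 'k dps" where
  "zf k = xpow k (2 ^ m k - 1)"

text \<open>The coefficient of \<open>d\<eta>\<close> at \<open>dx\<^sub>k dx\<^sub>l\<close> for the one-form \<open>\<eta> = \<Sum>\<^sub>i \<eta>\<^sub>i dx\<^sub>i\<close>. It vanishes for \<open>k = l\<close>.\<close>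

definition dform :: "(nat \<Rightarrow> 'k dps) \<Rightarrow> nat \<Rightarrow> nat \<Rightarrow> 'k dps" where
  "dform \<eta> k l = pd k (\<eta> l) + pd l (\<eta> k)"

definition free_idx :: "nat \<Rightarrow> mindex set" where
  "free_idx t = {\<alpha> \<in> box n m. t \<le> mdeg \<alpha> \<and> \<not> two_digit \<alpha>}"

text \<open>The monomials admitted in the coefficient at \<open>dx\<^sub>i\<close> during the reduction. Only the monomials with two digits that
  involve a variable from \<open>J\<close> are excluded, and only for \<open>i \<in> J\<close>: these are the ones that could alter a coefficient of
  \<open>dz\<^sub>k dz\<^sub>l\<close> with \<open>k \<in> J\<close> or \<open>l \<in> J\<close>.\<close>

definition rest_idx :: "nat set \<Rightarrow> nat \<Rightarrow> nat \<Rightarrow> mindex set" where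
  "rest_idx J i t = {\<alpha> \<in> box n m. t \<le> mdeg \<alpha> \<and> \<not> (i \<in> J \<and> two_digit \<alpha> \<and> keys \<alpha> \<inter> J \<noteq> {})}"

lemma free_subset_rest: "free_idx t \<subseteq> rest_idx J i t"
  by (auto simp: free_idx_def rest_idx_def)

lemma crit_commute: "crit k l = crit l k"
  by (simp add: crit_def add.commute)

lemma keys_crit: "keys (crit k l) = {k, l}"
  by (auto simp: crit_def keys_add_mindex)

lemma lookup_crit: "k \<noteq> l \<Longrightarrow> lookup (crit k l) i = (if i = k then 2 ^ (m k - 1) else if i = l then 2 ^ (m l - 1) else 0)"
  by (auto simp: crit_def lookup_add lookup_single when_def)

lemma two_digit_crit: "k \<noteq> l \<Longrightarrow> two_digit (crit k l)"
  unfolding two_digit_def crit_def by blast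

lemma two_digit_decomposable: "two_digit \<alpha> \<Longrightarrow> decomposable \<alpha>"
  unfolding two_digit_def
  by (auto intro!: decomposable_add simp: mno_carry_single lookup_single single_pow2_nonzero)

lemma dform_sym: "dform \<eta> k l = dform \<eta> l k"
  by (simp add: dform_def add.commute)

lemma dform_add: "dform (\<lambda>p. \<eta> p + \<theta> p) k l = dform \<eta> k l + dform \<theta> k l"
  by (simp add: dform_def pd_linear ac_simps)

lemma dform_sum: "dform (\<lambda>p. \<Sum>i\<in>S. \<eta> i p) k l = (\<Sum>i\<in>S. dform (\<eta> i) k l)"
  by (simp add: dform_def pd_sum sum.distrib)

lemma dform_dscale: "dform (\<lambda>p. dscale c (\<eta> p)) k l = dscale c (dform \<eta> k l)"
  by (simp add: dform_def pd_linear dscale_add)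

lemma dform_0 [simp]: "dform (\<lambda>p. 0) k l = 0"
  by (simp add: dform_def pd_linear)

lemma dform_pd [simp]: "dform (\<lambda>p. pd p v) k l = 0"
  by (simp add: dform_def pd_commute[of l k])

lemma dform_mult_pd: "dform (\<lambda>p. f * pd p h) k l = pd k f * pd l h + pd l f * pd k h"
proof -
  have "dform (\<lambda>p. f * pd p h) k l = pd k f * pd l h + pd l f * pd k h + (f * pd k (pd l h) + f * pd k (pd l h))"
    unfolding dform_def pd_times pd_commute[of l k] by (simp only: ac_simps)
  then show ?thesis by simp
qed

text \<open>The product of a decomposable element with an element without constant term lies in the cube
  of the maximal ideal, which contains no monomial with only two binary digits.\<close>

lemma dec_times_free:
  assumes "f \<in> supp_in (dec_idx n m a)" "h \<in> A" "h \<in> order_ge b" "dcoeff h 0 = 0"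
  shows "f * h \<in> supp_in (free_idx (a + b))"
proof -
  have h: "h \<in> supp_in {\<alpha>\<in>box n m. b \<le> mdeg \<alpha> \<and> \<alpha> \<noteq> 0}"
    using assms(2-4) unfolding A_eq order_ge_def by (auto simp: supp_in_def)
  show ?thesis
    by (rule supp_in_times[OF char2 assms(1) h])
      (auto simp: dec_idx_def free_idx_def box_add dest: two_digit_split)
qed

lemma pd_dec_order: "f \<in> supp_in (dec_idx n m (Suc t)) \<Longrightarrow> pd k f \<in> order_ge t"
  unfolding order_ge_def by (erule supp_in_pd) (auto simp: dec_idx_def)

lemma pd_dec_0: "f \<in> supp_in (dec_idx n m t) \<Longrightarrow> dcoeff (pd k f) 0 = 0"
  by (auto simp: dec_idx_def intro!: supp_inD dest: decomposable_mdeg)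

lemma dec_pd_free:
  fixes f h :: "'k dps"
  assumes "f \<in> supp_in (dec_idx n m a)" "h \<in> supp_in (dec_idx n m (Suc b))"
  shows "f * pd k h \<in> supp_in (free_idx (a + b))"
  by (intro dec_times_free[OF assms(1)] A_pd dec_in_A[OF assms(2)] pd_dec_order[OF assms(2)] pd_dec_0[OF assms(2)])

text \<open>If \<open>x\<^sub>p\<close> has room for another binary digit, \<open>x\<^sub>p\<^bsup>(P-1)\<^esup> x\<^sub>q\<^bsup>(Q-1)\<^esup> dx\<^sub>p dx\<^sub>q\<close> with \<open>P = 2\<^bsup>s+1\<^esup>\<close>, \<open>Q = 2\<^bsup>u+1\<^esup>\<close> is the differential of
  \<open>x\<^sub>p\<^bsup>(P)\<^esup> x\<^sub>q\<^bsup>(Q-1)\<^esup> dx\<^sub>q\<close>. The assumption \<open>q \<notin> J\<close> makes the coefficient of this one-form an admitted one also for \<open>Q = 2\<close>,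
  where it has two digits.\<close>

lemma two_digit_primitive:
  assumes pq: "p \<noteq> q" "p \<in> {1..n}" "q \<in> {1..n}" "q \<notin> J" "Suc s < m p" "u < m q" and d: "t \<le> 2 ^ s + 2 ^ u"
  shows "\<exists>\<rho>. (\<forall>i. \<rho> i \<in> supp_in (rest_idx J i (Suc t))) \<and>
      (\<forall>k l. k \<noteq> l \<longrightarrow> dform \<rho> k l = (if {k, l} = {p, q} then
        dmon (Poly_Mapping.single p (2 ^ Suc s - 1) + Poly_Mapping.single q (2 ^ Suc u - 1)) else 0))"
proof -
  let ?\<beta> = "Poly_Mapping.single p (2 ^ Suc s) + Poly_Mapping.single q (2 ^ Suc u - 1)"
  let ?V = "dmon (Poly_Mapping.single p (2 ^ Suc s - 1) + Poly_Mapping.single q (2 ^ Suc u - 1)) :: 'k dps"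
  define \<rho> where "\<rho> = (\<lambda>i. if i = q then dmon ?\<beta> else (0 :: 'k dps))"
  have Lp: "lookup ?\<beta> p = 2 ^ Suc s" and Lq: "lookup ?\<beta> q = 2 ^ Suc u - 1"
    using pq(1) by (simp_all add: lookup_add lookup_single)
  have Lo: "lookup ?\<beta> i = 0" if "i \<noteq> p" "i \<noteq> q" for i
    using that by (simp add: lookup_add lookup_single)
  have b: "?\<beta> \<in> box n m" unfolding box_def
  proof (safe)
    fix i assume "i \<in> keys ?\<beta>"
    then have "i = p \<or> i = q" using Lo[of i] by (auto simp: in_keys_iff)
    then show "i \<in> {1..n}" using pq by blast
  next
    fix i assume "i \<in> {1..n}"
    have "(2 :: nat) ^ Suc s < 2 ^ m p" using pq(5) by (intro power_strict_increasing) auto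
    moreover have "(2 :: nat) ^ Suc u \<le> 2 ^ m q" using pq(6) by (intro power_increasing) auto
    then have "(2 :: nat) ^ Suc u - 1 < 2 ^ m q" using one_le_power[of "2 :: nat" "Suc u"] by linarith
    ultimately show "lookup ?\<beta> i < 2 ^ m i"
      by (cases "i = p"; cases "i = q") (use Lp Lq Lo in auto)
  qed
  have "(1 :: nat) \<le> 2 ^ s" "(1 :: nat) \<le> 2 ^ u" by simp_all
  moreover have "mdeg ?\<beta> = 2 * 2 ^ s + (2 * 2 ^ u - 1)" by simp
  ultimately have "Suc t \<le> mdeg ?\<beta>" using d by linarith
  then have "?\<beta> \<in> rest_idx J q (Suc t)" using b pq(4) by (simp add: rest_idx_def)
  then have 1: "\<forall>i. \<rho> i \<in> supp_in (rest_idx J i (Suc t))" by (simp add: \<rho>_def supp_in_dmon)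
  have der: "pd p (dmon ?\<beta>) = ?V"
  proof -
    have "?\<beta> - eps p = Poly_Mapping.single p (2 ^ Suc s - 1) + Poly_Mapping.single q (2 ^ Suc u - 1)"
      using pq(1) by (intro poly_mapping_eqI) (auto simp: lookup_minus lookup_add lookup_single when_def)
    then show ?thesis using Lp by (simp add: pd_dmon)
  qed
  have z: "pd k (dmon ?\<beta>) = (0 :: 'k dps)" if "k \<noteq> p" "k \<noteq> q" for k
    using Lo[OF that] by (simp add: pd_dmon)
  have "dform \<rho> k l = (if {k, l} = {p, q} then ?V else 0)" if "k \<noteq> l" for k l
    using that der z pq(1) by (auto simp: dform_def \<rho>_def pd_linear doubleton_eq_iff)
  with 1 show ?thesis by blast
qed

text \<open>The only obstruction to writing \<open>(d\<eta>)\<^bsup>(2)\<^esup>\<close> as a differential is carried by the monomials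
  \<open>crit k l\<close>, whose contribution is \<open>dz\<^sub>k dz\<^sub>l\<close>.\<close>

lemma square_dmon:
  assumes \<alpha>: "\<alpha> \<in> dec_idx n m t" and J: "\<not> (two_digit \<alpha> \<and> keys \<alpha> \<inter> J \<noteq> {})"
  shows "\<exists>\<rho>. (\<forall>p. \<rho> p \<in> supp_in (rest_idx J p (Suc t))) \<and>
    (\<forall>k l. k \<in> {1..n} \<longrightarrow> l \<in> {1..n} \<longrightarrow> k \<noteq> l \<longrightarrow> pd k (dmon \<alpha>) * pd l (dmon \<alpha>)
       = dform \<rho> k l + (if \<alpha> = crit k l then zf k * zf l else 0))"
proof (cases "two_digit \<alpha>")
  case False
  then have "pd k (dmon \<alpha>) * pd l (dmon \<alpha>) = (0 :: 'k dps)" if "k \<noteq> l" for k l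
    using that by (intro pd_mult_pd_dmon_zero[OF char2]) (auto simp: two_digit_def)
  then show ?thesis using False two_digit_crit by (intro exI[of _ "\<lambda>_. 0"]) auto
next
  case True
  then obtain p q s u where pq: "p \<noteq> q" "\<alpha> = Poly_Mapping.single p (2 ^ s) + Poly_Mapping.single q (2 ^ u)"
    unfolding two_digit_def by blast
  have keys\<alpha>: "keys \<alpha> = {p, q}" by (auto simp: pq(2) keys_add_mindex)
  have L: "lookup \<alpha> p = 2 ^ s" "lookup \<alpha> q = 2 ^ u"
    using pq(1) by (simp_all add: pq(2) lookup_add lookup_single)
  have box\<alpha>: "\<alpha> \<in> box n m" and deg\<alpha>: "t \<le> mdeg \<alpha>" using \<alpha> by (auto simp: dec_idx_def)
  have pqn: "p \<in> {1..n}" "q \<in> {1..n}" using box\<alpha> keys\<alpha> by (auto simp: box_def)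
  have "lookup \<alpha> p < 2 ^ m p" "lookup \<alpha> q < 2 ^ m q" using box\<alpha> pqn unfolding box_def by blast+
  then have su: "s < m p" "u < m q" unfolding L by simp_all
  have J': "p \<notin> J" "q \<notin> J" using J True keys\<alpha> by auto
  have off: "pd k (dmon \<alpha>) * pd l (dmon \<alpha>) = (0 :: 'k dps)" if "k \<noteq> l" "{k, l} \<noteq> {p, q}" for k l
  proof -
    have "k \<notin> keys \<alpha> \<or> l \<notin> keys \<alpha>" using that keys\<alpha> by auto
    then show ?thesis by (auto simp: pd_dmon_not_key)
  qed
  have crit_iff: "\<alpha> = crit k l \<longleftrightarrow> {k, l} = {p, q} \<and> Suc s = m p \<and> Suc u = m q" if "k \<noteq> l" for k l
  proof
    assume e: "\<alpha> = crit k l"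
    then have kl: "{k, l} = {p, q}" using keys_crit[of k l] keys\<alpha> by simp
    then have "crit k l = crit p q" by (metis crit_commute doubleton_eq_iff)
    then have "(2 :: nat) ^ s = 2 ^ (m p - 1)" "(2 :: nat) ^ u = 2 ^ (m q - 1)"
      using e L pq(1) by (simp_all add: lookup_crit)
    then have "s = m p - 1" "u = m q - 1" by simp_all
    then show "{k, l} = {p, q} \<and> Suc s = m p \<and> Suc u = m q" using kl su by simp
  next
    assume a: "{k, l} = {p, q} \<and> Suc s = m p \<and> Suc u = m q"
    then have "crit k l = crit p q" by (metis crit_commute doubleton_eq_iff)
    moreover from a have "Suc s = m p" "Suc u = m q" by blast+
    then have su': "m p - 1 = s" "m q - 1 = u" by linarith+
    have "crit p q = \<alpha>" unfolding crit_def pq(2) su' by (rule refl)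
    ultimately show "\<alpha> = crit k l" by simp
  qed
  let ?V = "dmon (Poly_Mapping.single p (2 ^ Suc s - 1) + Poly_Mapping.single q (2 ^ Suc u - 1)) :: 'k dps"
  have V: "pd p (dmon \<alpha>) * pd q (dmon \<alpha>) = ?V"
    by (rule pd_mult_pd_two_digit[OF char2 pq(1,2)])
  then have V': "pd q (dmon \<alpha>) * pd p (dmon \<alpha>) = ?V" by (simp add: mult.commute)
  show ?thesis
  proof (cases "Suc s = m p \<and> Suc u = m q")
    case True
    have zz: "zf p * zf q = ?V"
      unfolding zf_def dmon_times_char2[OF char2] using True pq(1) by (simp add: mno_carry_single lookup_single)
    have "pd k (dmon \<alpha>) * pd l (dmon \<alpha>) = (if \<alpha> = crit k l then zf k * zf l else 0)" if "k \<noteq> l" for k l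
    proof (cases "{k, l} = {p, q}")
      case kl: True
      then have "k = p \<and> l = q \<or> k = q \<and> l = p" by (simp add: doubleton_eq_iff)
      then show ?thesis using crit_iff[OF that] kl True V V' zz by (auto simp: mult.commute)
    next
      case False
      then show ?thesis using off[OF that] crit_iff[OF that] by simp
    qed
    then show ?thesis by (intro exI[of _ "\<lambda>_. 0"]) simp
  next
    case False
    have d: "t \<le> 2 ^ s + 2 ^ u" using deg\<alpha> by (simp add: pq(2))
    have "\<exists>\<rho>. (\<forall>i. \<rho> i \<in> supp_in (rest_idx J i (Suc t))) \<and>
      (\<forall>k l. k \<noteq> l \<longrightarrow> dform \<rho> k l = (if {k, l} = {p, q} then ?V else 0))"
    proof (cases "Suc s < m p")
      case True
      show ?thesis by (rule two_digit_primitive[OF pq(1) pqn J'(2) True su(2) d])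
    next
      case False
      then have "Suc u < m q" using su \<open>\<not> (Suc s = m p \<and> Suc u = m q)\<close> by linarith
      moreover have "{p, q} = {q, p}" by blast
      moreover have "Poly_Mapping.single p (2 ^ Suc s - 1) + Poly_Mapping.single q (2 ^ Suc u - 1)
          = Poly_Mapping.single q (2 ^ Suc u - 1) + Poly_Mapping.single p (2 ^ Suc s - (1 :: nat))"
        by (rule add.commute)
      moreover have "t \<le> 2 ^ u + 2 ^ s" using d by simp
      ultimately show ?thesis
        using two_digit_primitive[OF pq(1)[symmetric] pqn(2,1) J'(1) _ su(1)] by metis
    qed
    then obtain \<rho> where \<rho>: "\<forall>i. \<rho> i \<in> supp_in (rest_idx J i (Suc t))"
      "\<And>k l. k \<noteq> l \<Longrightarrow> dform \<rho> k l = (if {k, l} = {p, q} then ?V else 0)" by blast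
    have "pd k (dmon \<alpha>) * pd l (dmon \<alpha>) = dform \<rho> k l + (if \<alpha> = crit k l then zf k * zf l else 0)"
      if "k \<noteq> l" for k l
    proof (cases "{k, l} = {p, q}")
      case kl: True
      then have "k = p \<and> l = q \<or> k = q \<and> l = p" by (simp add: doubleton_eq_iff)
      then show ?thesis using crit_iff[OF that] kl False V V' \<rho>(2)[OF that] by auto
    next
      case False
      then show ?thesis using off[OF that] crit_iff[OF that] \<rho>(2)[OF that] by simp
    qed
    then show ?thesis using \<rho>(1) by blast
  qed
qed

end

lemma mult_diff_expand: "P * Q - a * b = (P - a) * b + (Q - b) * a + (P - a) * (Q - b)"
  for P Q a b :: "'b::comm_ring_1"
  by (simp add: algebra_simps)

lemma sum_offdiag_pairs:
  fixes f :: "nat \<Rightarrow> nat \<Rightarrow> 'b::ab_group_add"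
  shows "(\<Sum>i\<in>{1..n}. \<Sum>j\<in>{1..n}. f i j) = (\<Sum>i\<in>{1..n}. f i i) + (\<Sum>i\<in>{1..n}. \<Sum>j\<in>{i<..n}. f i j + f j i)"
proof -
  have split: "(\<Sum>j\<in>{1..n}. f i j) = f i i + (\<Sum>j\<in>{i<..n}. f i j) + (\<Sum>j\<in>{1..<i}. f i j)" if "i \<in> {1..n}" for i
  proof -
    have "{1..n} = insert i ({i<..n} \<union> {1..<i})" using that by auto
    then have "(\<Sum>j\<in>{1..n}. f i j) = (\<Sum>j\<in>insert i ({i<..n} \<union> {1..<i}). f i j)" by simp
    also have "\<dots> = f i i + (\<Sum>j\<in>{i<..n} \<union> {1..<i}. f i j)" by (subst sum.insert) auto
    also have "(\<Sum>j\<in>{i<..n} \<union> {1..<i}. f i j) = (\<Sum>j\<in>{i<..n}. f i j) + (\<Sum>j\<in>{1..<i}. f i j)"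
      by (rule sum.union_disjoint) auto
    finally show ?thesis by (simp add: add.assoc)
  qed
  have "(\<Sum>i\<in>{1..n}. \<Sum>j\<in>{1..<i}. f i j) = (\<Sum>(i, j)\<in>Sigma {1..n} (\<lambda>i. {1..<i}). f i j)"
    by (rule sum.Sigma) auto
  also have "\<dots> = (\<Sum>(i, j)\<in>Sigma {1..n} (\<lambda>i. {i<..n}). f j i)"
    by (rule sum.reindex_bij_witness[where i = prod.swap and j = prod.swap]) auto
  also have "\<dots> = (\<Sum>i\<in>{1..n}. \<Sum>j\<in>{i<..n}. f j i)"
    by (rule sum.Sigma[symmetric]) auto
  finally have "(\<Sum>i\<in>{1..n}. \<Sum>j\<in>{1..<i}. f i j) = (\<Sum>i\<in>{1..n}. \<Sum>j\<in>{i<..n}. f j i)" .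
  then show ?thesis by (simp add: split sum.distrib add.assoc)
qed

context truncated_dp_algebra
begin

text \<open>The admitted decomposable monomials: substitutions have to be built from these.\<close>

abbreviation dec_rest :: "nat set \<Rightarrow> nat \<Rightarrow> nat \<Rightarrow> mindex set" where
  "dec_rest J i t \<equiv> dec_idx n m t \<inter> rest_idx J i t"

lemma add_square_char2: "(a + b) * (a + b) = a * a + (b * b :: 'k)"
proof -
  have "a * b + a * b = 0" by (rule add_self_char2[OF char2])
  then show ?thesis by (simp add: algebra_simps)
qed

text \<open>Polarisation: the mixed terms \<open>\<partial>\<^sub>k f \<partial>\<^sub>l h + \<partial>\<^sub>l f \<partial>\<^sub>k h\<close> are the coefficients of \<open>d(f dh)\<close>, and \<open>f dh\<close> contains no
  monomials with two digits when \<open>f\<close> and \<open>h\<close> are decomposable. The coefficients of the critical monomials are squared.\<close>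

lemma square_form:
  assumes "\<eta> \<in> supp_in {\<alpha> \<in> dec_idx n m t. \<not> (two_digit \<alpha> \<and> keys \<alpha> \<inter> J \<noteq> {})}"
  shows "\<exists>\<rho>. (\<forall>p. \<rho> p \<in> supp_in (rest_idx J p (Suc t))) \<and>
    (\<forall>k l. k \<in> {1..n} \<longrightarrow> l \<in> {1..n} \<longrightarrow> k \<noteq> l \<longrightarrow> pd k \<eta> * pd l \<eta>
       = dform \<rho> k l + dscale (dcoeff \<eta> (crit k l) * dcoeff \<eta> (crit k l)) (zf k * zf l))"
proof -
  have fin: "finite {\<alpha> \<in> dec_idx n m t. \<not> (two_digit \<alpha> \<and> keys \<alpha> \<inter> J \<noteq> {})}"
    using finite_dec_idx[of t] by simp
  show ?thesis using fin assms
  proof (induction \<eta> rule: supp_in_induct)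
    case zero
    have "dscale 0 f = 0" for f :: "'k dps" by (rule dps_eqI) simp
    then show ?case by (intro exI[of _ "\<lambda>_. 0"]) (simp add: pd_linear)
  next
    case (add \<eta> \<alpha> c)
    let ?u = "dscale c (dmon \<alpha>) :: 'k dps"
    obtain \<rho>1 where \<rho>1: "\<And>p. \<rho>1 p \<in> supp_in (rest_idx J p (Suc t))"
      "\<And>k l. k \<in> {1..n} \<Longrightarrow> l \<in> {1..n} \<Longrightarrow> k \<noteq> l \<Longrightarrow> pd k \<eta> * pd l \<eta>
         = dform \<rho>1 k l + dscale (dcoeff \<eta> (crit k l) * dcoeff \<eta> (crit k l)) (zf k * zf l)"
      using add.IH by blast
    have \<alpha>: "\<alpha> \<in> dec_idx n m t" "\<not> (two_digit \<alpha> \<and> keys \<alpha> \<inter> J \<noteq> {})" using add.hyps by auto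
    obtain \<rho>2 where \<rho>2: "\<And>p. \<rho>2 p \<in> supp_in (rest_idx J p (Suc t))"
      "\<And>k l. k \<in> {1..n} \<Longrightarrow> l \<in> {1..n} \<Longrightarrow> k \<noteq> l \<Longrightarrow> pd k (dmon \<alpha>) * pd l (dmon \<alpha>)
         = dform \<rho>2 k l + (if \<alpha> = crit k l then zf k * zf l else 0)"
      using square_dmon[OF \<alpha>] by blast
    define \<rho> where "\<rho> = (\<lambda>p. \<rho>1 p + (dscale (c * c) (\<rho>2 p) + \<eta> * pd p ?u))"
    have \<eta>dec: "\<eta> \<in> supp_in (dec_idx n m t)" by (rule supp_in_mono[OF _ add.hyps(1)]) auto
    have udec: "?u \<in> supp_in (dec_idx n m (Suc 1))"
      using \<alpha>(1) by (intro supp_in_dscale supp_in_dmon) (auto simp: dec_idx_def dest: decomposable_mdeg)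
    have "\<eta> * pd p ?u \<in> supp_in (rest_idx J p (Suc t))" for p
      using dec_pd_free[OF \<eta>dec udec, of p] by (intro supp_in_mono[OF free_subset_rest]) (simp add: One_nat_def)
    then have mem: "\<rho> p \<in> supp_in (rest_idx J p (Suc t))" for p
      unfolding \<rho>_def by (intro supp_in_add supp_in_dscale \<rho>1 \<rho>2)
    have eq: "pd k (\<eta> + ?u) * pd l (\<eta> + ?u)
       = dform \<rho> k l + dscale (dcoeff (\<eta> + ?u) (crit k l) * dcoeff (\<eta> + ?u) (crit k l)) (zf k * zf l)"
      if kl: "k \<in> {1..n}" "l \<in> {1..n}" "k \<noteq> l" for k l
    proof -
      have uu: "pd k ?u * pd l ?u = dscale (c * c) (dform \<rho>2 k l) + dscale (dcoeff ?u (crit k l) * dcoeff ?u (crit k l)) (zf k * zf l)"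
      proof -
        have "pd k ?u * pd l ?u = dscale (c * c) (pd k (dmon \<alpha>) * pd l (dmon \<alpha>))"
          by (rule dps_eqI) (simp add: pd_linear mult.assoc flip: dscale_mult)
        also have "\<dots> = dscale (c * c) (dform \<rho>2 k l) + dscale (dcoeff ?u (crit k l) * dcoeff ?u (crit k l)) (zf k * zf l)"
          unfolding \<rho>2(2)[OF kl] by (rule dps_eqI) (simp add: distrib_left)
        finally show ?thesis .
      qed
      have d: "dform \<rho> k l = dform \<rho>1 k l + (dscale (c * c) (dform \<rho>2 k l) + (pd k \<eta> * pd l ?u + pd l \<eta> * pd k ?u))"
        unfolding \<rho>_def dform_add dform_dscale dform_mult_pd ..
      have c: "dscale (dcoeff (\<eta> + ?u) (crit k l) * dcoeff (\<eta> + ?u) (crit k l)) (zf k * zf l)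
        = dscale (dcoeff \<eta> (crit k l) * dcoeff \<eta> (crit k l)) (zf k * zf l)
          + dscale (dcoeff ?u (crit k l) * dcoeff ?u (crit k l)) (zf k * zf l)"
        unfolding dcoeff_simps(2) add_square_char2 by (rule dps_eqI) (simp only: dcoeff_simps(2) dcoeff_dscale distrib_right)
      have "pd k (\<eta> + ?u) * pd l (\<eta> + ?u) = pd k \<eta> * pd l \<eta> + pd k ?u * pd l ?u + (pd k \<eta> * pd l ?u + pd l \<eta> * pd k ?u)"
        unfolding pd_linear(1) by (simp only: distrib_left distrib_right ac_simps)
      then show ?thesis unfolding d c \<rho>1(2)[OF kl] uu by (simp only: ac_simps)
    qed
    show ?case using mem eq by blast
  qed
qed

section \<open>Quadratic expressions in differentials\<close>

text \<open>The coefficient at \<open>dx\<^sub>k dx\<^sub>l\<close> of the image of \<open>\<Sum>\<^sub>i\<^sub>j c\<^sub>i\<^sub>j dx\<^sub>i dx\<^sub>j\<close> (with divided squares on the diagonal) under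
  \<open>x\<^sub>i \<mapsto> Y\<^sub>i\<close>.\<close>

definition qform :: "(nat \<Rightarrow> nat \<Rightarrow> 'k) \<Rightarrow> (nat \<Rightarrow> 'k dps) \<Rightarrow> nat \<Rightarrow> nat \<Rightarrow> 'k dps" where
  "qform c Y k l = (\<Sum>i\<in>{1..n}. \<Sum>j\<in>{1..n}. dscale (c i j) (pd k (Y i) * pd l (Y j)))"

text \<open>The one-form \<open>\<Sum>\<^sub>i\<^sub>j c\<^sub>i\<^sub>j \<theta>\<^sub>i dY\<^sub>j\<close>, a primitive of the polarisation of \<open>qform c\<close>.\<close>

definition mixed :: "(nat \<Rightarrow> nat \<Rightarrow> 'k) \<Rightarrow> (nat \<Rightarrow> 'k dps) \<Rightarrow> (nat \<Rightarrow> 'k dps) \<Rightarrow> nat \<Rightarrow> 'k dps" where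
  "mixed c \<theta> Y p = (\<Sum>i\<in>{1..n}. \<Sum>j\<in>{1..n}. dscale (c i j) (\<theta> i * pd p (Y j)))"

text \<open>The one-form \<open>\<Sum>\<^sub>i\<^sub><\<^sub>j c\<^sub>i\<^sub>j \<theta>\<^sub>i d\<theta>\<^sub>j\<close>, a primitive of the part of \<open>qform c \<theta>\<close> off the diagonal of \<open>c\<close>.\<close>

definition upper :: "(nat \<Rightarrow> nat \<Rightarrow> 'k) \<Rightarrow> (nat \<Rightarrow> 'k dps) \<Rightarrow> nat \<Rightarrow> 'k dps" where
  "upper c \<theta> p = (\<Sum>i\<in>{1..n}. \<Sum>j\<in>{i<..n}. dscale (c i j) (\<theta> i * pd p (\<theta> j)))"

lemma qform_add:
  assumes c: "\<And>i j. c i j = c j i"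
  shows "qform c (\<lambda>i. Y i + \<theta> i) k l = qform c Y k l + dform (mixed c \<theta> Y) k l + qform c \<theta> k l"
proof -
  have d: "dform (mixed c \<theta> Y) k l = (\<Sum>i\<in>{1..n}. \<Sum>j\<in>{1..n}. dscale (c i j) (pd k (\<theta> i) * pd l (Y j)))
      + (\<Sum>i\<in>{1..n}. \<Sum>j\<in>{1..n}. dscale (c i j) (pd l (\<theta> i) * pd k (Y j)))"
    unfolding mixed_def[abs_def] dform_sum dform_dscale dform_mult_pd dscale_add sum.distrib ..
  have s: "(\<Sum>i\<in>{1..n}. \<Sum>j\<in>{1..n}. dscale (c i j) (pd l (\<theta> i) * pd k (Y j)))
      = (\<Sum>i\<in>{1..n}. \<Sum>j\<in>{1..n}. dscale (c i j) (pd k (Y i) * pd l (\<theta> j)))"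
    by (subst sum.swap) (simp only: c[of _ _] mult.commute cong: sum.cong)
  have "qform c (\<lambda>i. Y i + \<theta> i) k l = qform c Y k l
      + ((\<Sum>i\<in>{1..n}. \<Sum>j\<in>{1..n}. dscale (c i j) (pd k (\<theta> i) * pd l (Y j)))
      + (\<Sum>i\<in>{1..n}. \<Sum>j\<in>{1..n}. dscale (c i j) (pd k (Y i) * pd l (\<theta> j)))) + qform c \<theta> k l"
    unfolding qform_def pd_linear(1) distrib_left distrib_right dscale_add sum.distrib by (simp only: ac_simps)
  then show ?thesis unfolding d s .
qed

lemma qform_diag:
  assumes c: "\<And>i j. c i j = c j i"
  shows "qform c \<theta> k l = (\<Sum>i\<in>{1..n}. dscale (c i i) (pd k (\<theta> i) * pd l (\<theta> i))) + dform (upper c \<theta>) k l"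
proof -
  have "dscale (c i j) (pd k (\<theta> i) * pd l (\<theta> j)) + dscale (c j i) (pd k (\<theta> j) * pd l (\<theta> i))
      = dscale (c i j) (pd k (\<theta> i) * pd l (\<theta> j) + pd l (\<theta> i) * pd k (\<theta> j))" for i j
    unfolding c[of j i] dscale_add by (simp only: mult.commute)
  then show ?thesis
    unfolding qform_def sum_offdiag_pairs upper_def[abs_def] dform_sum dform_dscale dform_mult_pd by simp
qed

lemma mixed_free:
  assumes "\<And>i. i \<in> {1..n} \<Longrightarrow> \<theta> i \<in> supp_in (dec_idx n m a)"
    "\<And>j. j \<in> {1..n} \<Longrightarrow> pd p (Y j) \<in> A" "\<And>j. j \<in> {1..n} \<Longrightarrow> pd p (Y j) \<in> order_ge b"
    "\<And>j. j \<in> {1..n} \<Longrightarrow> dcoeff (pd p (Y j)) 0 = 0"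
  shows "mixed c \<theta> Y p \<in> supp_in (free_idx (a + b))"
  unfolding mixed_def using assms by (intro supp_in_sum supp_in_dscale dec_times_free)

lemma upper_free:
  assumes "\<And>i. i \<in> {1..n} \<Longrightarrow> \<theta> i \<in> supp_in (dec_idx n m (Suc t))"
  shows "upper c \<theta> p \<in> supp_in (free_idx (Suc t + t))"
  unfolding upper_def using assms by (intro supp_in_sum supp_in_dscale dec_pd_free) auto

section \<open>The pulled back form\<close>

text \<open>The coefficients of a form \<open>\<Sum> a\<^sub>i\<^sub>j dx\<^sub>i dx\<^sub>j + d\<phi> + \<Sum> b\<^sub>i\<^sub>j dz\<^sub>i dz\<^sub>j\<close>, and of its image under a
  substitution.\<close>

definition form_coeff :: "(nat \<Rightarrow> nat \<Rightarrow> 'k) \<Rightarrow> (nat \<Rightarrow> 'k dps) \<Rightarrow> (nat \<Rightarrow> nat \<Rightarrow> 'k) \<Rightarrow> nat \<Rightarrow> nat \<Rightarrow> 'k dps" where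
  "form_coeff a \<phi> b i j = dp_const (a i j) + dform \<phi> i j + dscale (b i j) (zf i * zf j)"

definition pullback :: "(nat \<Rightarrow> 'k dps) \<Rightarrow> (nat \<Rightarrow> nat \<Rightarrow> 'k dps) \<Rightarrow> nat \<Rightarrow> nat \<Rightarrow> 'k dps" where
  "pullback g w k l = (\<Sum>i\<in>{1..n}. \<Sum>j\<in>{1..n}. subst_dps n (yy g) (w i j) * pd k (yy g i) * pd l (yy g j))"

text \<open>The image of \<open>z\<^sub>i\<close>.\<close>

definition zpow :: "(nat \<Rightarrow> 'k dps) \<Rightarrow> nat \<Rightarrow> 'k dps" where
  "zpow g i = dpow (2 ^ m i) (yy g i)"

text \<open>The image of the one-form \<open>\<phi>\<close>.\<close>

definition chi :: "(nat \<Rightarrow> 'k dps) \<Rightarrow> (nat \<Rightarrow> 'k dps) \<Rightarrow> nat \<Rightarrow> 'k dps" where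
  "chi \<phi> g p = (\<Sum>j\<in>{1..n}. subst_dps n (yy g) (\<phi> j) * pd p (yy g j))"

lemma zf_in_A: "i \<in> {1..n} \<Longrightarrow> zf i \<in> A"
  unfolding zf_def by (intro A_dmon single_in_box) auto

lemma pd_zpow:
  assumes "dec_family g" "i \<in> {1..n}"
  shows "pd k (zpow g i) = subst_dps n (yy g) (zf i) * pd k (yy g i)"
proof -
  have "2 ^ m i = Suc (2 ^ m i - 1)" by simp
  then show ?thesis
    unfolding zpow_def zf_def subst_xpow[OF assms]
    using pd_dpow[OF dec_familyD[OF assms], of k "2 ^ m i - 1"] by simp
qed

lemma subst_const: "subst_dps n (yy g) (dp_const c) = dp_const c"
proof -
  have e: "dp_const c = dscale c 1" by (rule dps_eqI) simp
  show ?thesis unfolding e subst_dscale subst_1 ..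
qed

text \<open>Substitutions commute with \<open>d\<close>. In particular the image of \<open>dz\<^sub>i dz\<^sub>j\<close> is the product of the differentials of
  \<open>zpow g i\<close> and \<open>zpow g j\<close>, although \<open>z\<^sub>i\<close> itself is not in the algebra.\<close>

lemma pullback_form_coeff:
  assumes g: "dec_family g" and \<phi>: "\<And>i. i \<in> {1..n} \<Longrightarrow> \<phi> i \<in> A"
  shows "pullback g (form_coeff a \<phi> b) k l
    = qform a (yy g) k l + dform (chi \<phi> g) k l + qform b (zpow g) k l"
proof -
  let ?\<sigma> = "subst_dps n (yy g)"
  have t: "?\<sigma> (form_coeff a \<phi> b i j) * pd k (yy g i) * pd l (yy g j)
      = dscale (a i j) (pd k (yy g i) * pd l (yy g j))
      + (?\<sigma> (pd i (\<phi> j)) * pd k (yy g i) * pd l (yy g j) + ?\<sigma> (pd j (\<phi> i)) * pd l (yy g j) * pd k (yy g i))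
      + dscale (b i j) (pd k (zpow g i) * pd l (zpow g j))" if "i \<in> {1..n}" "j \<in> {1..n}" for i j
  proof -
    have "?\<sigma> (form_coeff a \<phi> b i j) = dp_const (a i j) + (?\<sigma> (pd i (\<phi> j)) + ?\<sigma> (pd j (\<phi> i))) + dscale (b i j) (?\<sigma> (zf i) * ?\<sigma> (zf j))"
      unfolding form_coeff_def dform_def subst_add subst_const subst_dscale
      using that by (simp add: subst_times[OF g] zf_in_A A_subset_Ohat)
    then show ?thesis
      unfolding pd_zpow[OF g that(1)] pd_zpow[OF g that(2)] dscale_def
      by (simp only: distrib_left distrib_right ac_simps)
  qed
  have 1: "(\<Sum>i\<in>{1..n}. \<Sum>j\<in>{1..n}. ?\<sigma> (pd i (\<phi> j)) * pd k (yy g i) * pd l (yy g j))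
      = (\<Sum>j\<in>{1..n}. pd k (?\<sigma> (\<phi> j)) * pd l (yy g j))"
    by (subst sum.swap) (simp add: pd_subst[OF g \<phi>] sum_distrib_right)
  have 2: "(\<Sum>i\<in>{1..n}. \<Sum>j\<in>{1..n}. ?\<sigma> (pd j (\<phi> i)) * pd l (yy g j) * pd k (yy g i))
      = (\<Sum>i\<in>{1..n}. pd l (?\<sigma> (\<phi> i)) * pd k (yy g i))"
    by (simp add: pd_subst[OF g \<phi>] sum_distrib_right)
  have "dform (chi \<phi> g) k l = (\<Sum>j\<in>{1..n}. pd k (?\<sigma> (\<phi> j)) * pd l (yy g j)) + (\<Sum>i\<in>{1..n}. pd l (?\<sigma> (\<phi> i)) * pd k (yy g i))"
    unfolding chi_def[abs_def] dform_sum dform_mult_pd sum.distrib ..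
  moreover have "pullback g (form_coeff a \<phi> b) k l = qform a (yy g) k l
    + ((\<Sum>i\<in>{1..n}. \<Sum>j\<in>{1..n}. ?\<sigma> (pd i (\<phi> j)) * pd k (yy g i) * pd l (yy g j))
    + (\<Sum>i\<in>{1..n}. \<Sum>j\<in>{1..n}. ?\<sigma> (pd j (\<phi> i)) * pd l (yy g j) * pd k (yy g i))) + qform b (zpow g) k l"
    unfolding pullback_def qform_def sum.distrib[symmetric] by (intro sum.cong refl t)
  ultimately show ?thesis unfolding 1 2 by simp
qed

lemma subst_zero:
  assumes "f \<in> A" shows "subst_dps n (yy (\<lambda>_. 0)) f = f"
proof -
  have "f \<in> supp_in (box n m)" using assms by (simp add: A_eq)
  with finite_box show ?thesis
  proof (induction f rule: supp_in_induct)
    case (add f \<alpha> c)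
    have "subst_dps n (yy (\<lambda>_. 0)) (dmon \<alpha>) = dmon \<alpha>"
      unfolding subst_dmon[OF keys_box[OF add.hyps(2)]] by (rule ypow_x[OF keys_box[OF add.hyps(2)]])
    then show ?case using add.IH by (simp only: subst_add subst_dscale)
  qed simp
qed

lemma pd_x: "pd k (xpow i 1) = (if k = i then 1 else 0 :: 'k dps)"
  by (auto simp: pd_dmon lookup_single when_def)

lemma sum_pd_x: "k \<in> {1..n} \<Longrightarrow> (\<Sum>j\<in>{1..n}. f j * pd k (xpow j 1)) = (f k :: 'k dps)"
  unfolding pd_x by (simp add: if_distrib[of "\<lambda>x. _ * x"] sum.delta cong: if_cong)

lemma pullback_zero:
  assumes "\<And>i j. i \<in> {1..n} \<Longrightarrow> j \<in> {1..n} \<Longrightarrow> w i j \<in> A" "k \<in> {1..n}" "l \<in> {1..n}"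
  shows "pullback (\<lambda>_. 0) w k l = w k l"
proof -
  have "pullback (\<lambda>_. 0) w k l = (\<Sum>i\<in>{1..n}. \<Sum>j\<in>{1..n}. w i j * pd k (xpow i 1) * pd l (xpow j 1))"
    unfolding pullback_def using subst_zero[OF assms(1)] by simp
  also have "\<dots> = (\<Sum>i\<in>{1..n}. w i l * pd k (xpow i 1))"
    using sum_pd_x[OF assms(3), of "\<lambda>j. w i j * pd k (xpow i 1)" for i] by simp
  also have "\<dots> = w k l" by (rule sum_pd_x[OF assms(2)])
  finally show ?thesis .
qed

text \<open>Constants are the only squares, so the coefficients at the \<open>dx\<^sub>k\<^bsup>(2)\<^esup>\<close> are not changed by a substitution. It
  suffices to compare coefficients at \<open>dx\<^sub>k dx\<^sub>l\<close> with \<open>k < l\<close> later on.\<close>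

lemma pullback_diag:
  assumes w: "\<And>i j. i \<in> {1..n} \<Longrightarrow> j \<in> {1..n} \<Longrightarrow> w i j = w j i"
    "\<And>i. i \<in> {1..n} \<Longrightarrow> w i i = dp_const (a i)" and g: "dec_family g" and k: "k \<in> {1..n}"
  shows "pullback g w k k = dp_const (a k)"
proof -
  let ?\<sigma> = "subst_dps n (yy g)"
  let ?f = "\<lambda>i j. ?\<sigma> (w i j) * pd k (yy g i) * pd k (yy g j)"
  have "(\<Sum>i\<in>{1..n}. \<Sum>j\<in>{i<..n}. ?f i j + ?f j i) = 0"
  proof (intro sum.neutral ballI)
    fix i j assume ij: "i \<in> {1..n}" "j \<in> {i<..n}"
    then have "w j i = w i j" by (intro w) auto
    then have "?f j i = ?f i j" by (simp only: ac_simps)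
    then show "?f i j + ?f j i = 0" by simp
  qed
  then have "pullback g w k k = (\<Sum>i\<in>{1..n}. ?f i i)"
    unfolding pullback_def sum_offdiag_pairs by simp
  also have "\<dots> = (\<Sum>i\<in>{1..n}. dp_const (a i) * pd k (xpow i 1))"
  proof (rule sum.cong[OF refl])
    fix i assume i: "i \<in> {1..n}"
    have "pd k (yy g i) * pd k (yy g i) = dp_const (dcoeff (pd k (yy g i)) 0 * dcoeff (pd k (yy g i)) 0)"
      by (intro square_eq_const A_pd yy_in_A[OF g i])
    also have "dcoeff (pd k (yy g i)) 0 = (if k = i then 1 else 0)"
      using pd_dec_0[OF dec_familyD[OF g i], of k] by (simp add: pd_linear(1) pd_x)
    finally have "pd k (yy g i) * pd k (yy g i) = pd k (xpow i 1)"
      unfolding pd_x by (auto simp flip: one_dps_def intro!: dps_eqI)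
    then show "?f i i = dp_const (a i) * pd k (xpow i 1)"
      unfolding w(2)[OF i] subst_const by (simp add: mult.assoc)
  qed
  also have "\<dots> = dp_const (a k)" by (rule sum_pd_x[OF k])
  finally show ?thesis .
qed

lemma supp_in_Int: "f \<in> supp_in S \<Longrightarrow> f \<in> supp_in T \<Longrightarrow> f \<in> supp_in (S \<inter> T)"
  by (auto simp: supp_in_def)

text \<open>A substitution changes a decomposable element only by elements of the cube of the maximal ideal, since it changes each
  of two factors by decomposable elements.\<close>

lemma subst_minus_id_free:
  assumes g: "dec_family g" and f: "f \<in> supp_in (dec_idx n m 0)"
  shows "subst_dps n (yy g) f - f \<in> supp_in (free_idx 0)"
  using finite_dec_idx f
proof (induction f rule: supp_in_induct)
  case (add f \<alpha> c)
  then have d: "decomposable \<alpha>" "\<alpha> \<in> box n m" by (simp_all add: dec_idx_def)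
  obtain \<mu> \<nu> where \<mu>\<nu>: "\<alpha> = \<mu> + \<nu>" "\<mu> \<noteq> 0" "\<nu> \<noteq> 0" "mno_carry \<mu> \<nu>"
    using d(1) by (rule decomposableE)
  have b: "\<mu> \<in> box n m" "\<nu> \<in> box n m"
    using d(2) box_addD[of \<mu> \<nu>] box_addD[of \<nu> \<mu>] \<mu>\<nu>(1) by (auto simp: add.commute)
  have dm: "dmon \<alpha> = (dmon \<mu> * dmon \<nu> :: 'k dps)" using \<mu>\<nu> by (simp add: dmon_times_char2[OF char2])
  let ?\<sigma> = "subst_dps n (yy g)"
  let ?p = "?\<sigma> (dmon \<mu>) - dmon \<mu> :: 'k dps" and ?q = "?\<sigma> (dmon \<nu>) - dmon \<nu> :: 'k dps"
  have p: "?p \<in> supp_in (dec_idx n m 0)" and q: "?q \<in> supp_in (dec_idx n m 0)"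
    using b by (auto intro!: subst_minus_id_dec[OF g] A_dmon)
  have q0: "dcoeff ?q 0 = 0" using q by (rule supp_inD) (simp add: dec_idx_def decomposable_def)
  have "?\<sigma> (dmon \<alpha>) - dmon \<alpha> = ?\<sigma> (dmon \<mu>) * ?\<sigma> (dmon \<nu>) - dmon \<mu> * dmon \<nu>"
    unfolding dm using b by (simp only: subst_times[OF g] A_dmon A_subset_Ohat)
  also have "\<dots> = ?p * dmon \<nu> + ?q * dmon \<mu> + ?p * ?q" by (rule mult_diff_expand)
  finally have e: "?\<sigma> (dmon \<alpha>) - dmon \<alpha> = ?p * dmon \<nu> + ?q * dmon \<mu> + ?p * ?q" .
  have "?p * dmon \<nu> \<in> supp_in (free_idx (0 + 0))" "?q * dmon \<mu> \<in> supp_in (free_idx (0 + 0))"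
    "?p * ?q \<in> supp_in (free_idx (0 + 0))"
    using p q q0 b \<mu>\<nu>(2,3) by (intro dec_times_free A_dmon dec_in_A[OF q]; simp)+
  then have \<alpha>f: "?\<sigma> (dmon \<alpha>) - dmon \<alpha> \<in> supp_in (free_idx 0)" unfolding e by (auto intro!: supp_in_add)
  have e': "?\<sigma> (f + dscale c (dmon \<alpha>)) - (f + dscale c (dmon \<alpha>)) = (?\<sigma> f - f) + dscale c (?\<sigma> (dmon \<alpha>) - dmon \<alpha>)"
    by (simp add: subst_add subst_dscale) (simp add: dscale_def algebra_simps)
  show ?case unfolding e' by (rule supp_in_add[OF add.IH supp_in_dscale[OF \<alpha>f]])
qed simp

end

section \<open>Normalising one-forms\<close>

context truncated_dp_algebra
begin

text \<open>The function \<open>\<Sum>\<^sub>j\<^sub>k\<^sub>e c x\<^sub>k\<^bsup>(q)\<^esup> x\<^sub>j\<close>, \<open>q = 2\<^bsup>e+1\<^esup>\<close>, where \<open>c\<close> is the coefficient of \<open>x\<^sub>k\<^bsup>(q)\<^esup>\<close> in \<open>\<rho>\<^sub>j\<close>. It is defined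
  coefficientwise; the position of the odd entry determines \<open>j\<close>, and \<open>k = j\<close> is allowed, where the index has one
  key.\<close>

definition fill :: "(nat \<Rightarrow> 'k dps) \<Rightarrow> 'k dps" where
  "fill \<rho> = Abs_dps (\<lambda>\<alpha>. \<Sum>j\<in>{1..n}.
     if \<exists>k e. \<alpha> = Poly_Mapping.single k (2 ^ Suc e) + eps j then dcoeff (\<rho> j) (\<alpha> - eps j) else 0)"

lemma odd_index:
  assumes "\<alpha> = Poly_Mapping.single k (2 ^ Suc e) + eps j"
  shows "odd (lookup \<alpha> i) \<longleftrightarrow> i = j"
  unfolding assms by (auto simp: lookup_add lookup_single when_def)

lemma dcoeff_fill:
  assumes "\<alpha> = Poly_Mapping.single k (2 ^ Suc e) + eps j"
  shows "dcoeff (fill \<rho>) \<alpha> = (if j \<in> {1..n} then dcoeff (\<rho> j) (Poly_Mapping.single k (2 ^ Suc e)) else 0)"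
proof -
  have "(if \<exists>k e. \<alpha> = Poly_Mapping.single k (2 ^ Suc e) + eps i then dcoeff (\<rho> i) (\<alpha> - eps i) else 0)
      = (if i = j then dcoeff (\<rho> j) (Poly_Mapping.single k (2 ^ Suc e)) else 0)" for i
  proof (cases "i = j")
    case True
    then have "\<exists>k e. \<alpha> = Poly_Mapping.single k (2 ^ Suc e) + eps i" using assms by blast
    moreover have "\<alpha> - eps i = Poly_Mapping.single k (2 ^ Suc e)" using True assms by simp
    ultimately show ?thesis using True by simp
  next
    case False
    then have "\<not> (\<exists>k e. \<alpha> = Poly_Mapping.single k (2 ^ Suc e) + eps i)"
      using odd_index[OF assms] odd_index by blast
    then show ?thesis using False by simp
  qed
  then show ?thesis unfolding fill_def dcoeff_Abs by (simp add: sum.delta)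
qed

lemma fill_nonzeroE:
  assumes "dcoeff (fill \<rho>) \<alpha> \<noteq> 0"
  obtains k e j where "\<alpha> = Poly_Mapping.single k (2 ^ Suc e) + eps j" "j \<in> {1..n}"
    "dcoeff (\<rho> j) (Poly_Mapping.single k (2 ^ Suc e)) \<noteq> 0"
proof -
  have "\<exists>k e j. \<alpha> = Poly_Mapping.single k (2 ^ Suc e) + eps j"
  proof (rule ccontr)
    assume "\<not> ?thesis"
    then have "dcoeff (fill \<rho>) \<alpha> = 0" unfolding fill_def dcoeff_Abs by (intro sum.neutral) auto
    with assms show False ..
  qed
  then obtain k e j where \<alpha>: "\<alpha> = Poly_Mapping.single k (2 ^ Suc e) + eps j" by blast
  show thesis using assms unfolding dcoeff_fill[OF \<alpha>] by (intro that[OF \<alpha>]) (auto split: if_splits)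
qed

lemma single_not_two_digit: "\<not> two_digit (Poly_Mapping.single i a)"
proof
  assume "two_digit (Poly_Mapping.single i a)"
  then obtain k l s t where "k \<noteq> l" "Poly_Mapping.single i a = Poly_Mapping.single k (2 ^ s) + Poly_Mapping.single l (2 ^ t)"
    unfolding two_digit_def by blast
  then have "lookup (Poly_Mapping.single i a) k = 2 ^ s" "lookup (Poly_Mapping.single i a) l = 2 ^ t"
    by (simp_all add: lookup_add lookup_single)
  then show False using \<open>k \<noteq> l\<close> by (cases "i = k") (auto simp: lookup_single)
qed

text \<open>The differential of \<open>fill \<rho>\<close> cancels the indecomposable monomials \<open>x\<^sub>k\<^bsup>(q)\<^esup>\<close> of the \<open>\<rho>\<^sub>j\<close>, because
  \<open>x\<^sub>k\<^bsup>(q)\<^esup> dx\<^sub>j + x\<^sub>k\<^bsup>(q-1)\<^esup> x\<^sub>j dx\<^sub>k\<close> is exact. The bound \<open>2 \<le> t\<close> excludes \<open>q = 1\<close>, where the new monomial would be indecomposable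
  again. A new monomial at \<open>dx\<^sub>k\<close> requires \<open>x\<^sub>k\<close> to have height greater than one, so no excluded monomial arises for
  \<open>k \<in> J\<close>.\<close>

lemma normalise_form:
  assumes \<rho>: "\<And>p. p \<in> {1..n} \<Longrightarrow> \<rho> p \<in> supp_in (rest_idx J p t)" and t: "2 \<le> t"
    and J: "J \<subseteq> {1..n}" "\<And>j. j \<in> J \<Longrightarrow> m j = 1"
    and p: "p \<in> {1..n}"
  shows "\<rho> p + pd p (fill \<rho>) \<in> supp_in (dec_rest J p t)"
  unfolding supp_in_def
proof (intro CollectI allI impI)
  fix \<beta> assume nz: "dcoeff (\<rho> p + pd p (fill \<rho>)) \<beta> \<noteq> 0"
  have fill: "\<exists>k e j. \<beta> + eps p = Poly_Mapping.single k (2 ^ Suc e) + eps j \<and> j \<in> {1..n} \<and> k \<in> {1..n} \<and> Suc e < m k \<and> t \<le> 2 ^ Suc e"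
    if f: "dcoeff (fill \<rho>) (\<beta> + eps p) \<noteq> 0"
  proof -
    obtain k e j where kej: "\<beta> + eps p = Poly_Mapping.single k (2 ^ Suc e) + eps j" "j \<in> {1..n}"
      "dcoeff (\<rho> j) (Poly_Mapping.single k (2 ^ Suc e)) \<noteq> 0"
      using f by (rule fill_nonzeroE)
    then have "Poly_Mapping.single k (2 ^ Suc e) \<in> rest_idx J j t"
      using \<rho>[OF kej(2)] unfolding supp_in_def by blast
    then have b: "Poly_Mapping.single k (2 ^ Suc e) \<in> box n m" and d: "t \<le> 2 ^ Suc e"
      unfolding rest_idx_def by auto
    from b have k: "k \<in> {1..n}" by (simp add: box_def)
    from b this have "lookup (Poly_Mapping.single k (2 ^ Suc e)) k < 2 ^ m k" unfolding box_def by blast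
    then have "(2 :: nat) ^ Suc e < 2 ^ m k" by simp
    then have "Suc e < m k" by (simp only: power_strict_increasing_iff)
    with kej k d show ?thesis by blast
  qed
  have "\<beta> \<in> box n m \<and> t \<le> mdeg \<beta>"
  proof (cases "dcoeff (fill \<rho>) (\<beta> + eps p) = 0")
    case True
    then have "dcoeff (\<rho> p) \<beta> \<noteq> 0" using nz by simp
    then have "\<beta> \<in> rest_idx J p t" using \<rho>[OF p] unfolding supp_in_def by blast
    then show ?thesis unfolding rest_idx_def by auto
  next
    case False
    then obtain k e j where kej: "\<beta> + eps p = Poly_Mapping.single k (2 ^ Suc e) + eps j" "j \<in> {1..n}" "k \<in> {1..n}"
      "Suc e < m k" "t \<le> 2 ^ Suc e" using fill by blast
    have deg: "mdeg \<beta> = 2 ^ Suc e" using arg_cong[OF kej(1), of mdeg] by simp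
    have lt: "(2 :: nat) ^ Suc e + 1 < 2 ^ m k"
    proof -
      have "(2 :: nat) ^ Suc (Suc e) \<le> 2 ^ m k" using kej(4) by (intro power_increasing) auto
      moreover have "(1 :: nat) < 2 ^ Suc e" by (rule one_less_power) auto
      ultimately show ?thesis by simp
    qed
    have "\<beta> + eps p \<in> box n m" unfolding kej(1)
    proof (cases "k = j")
      case True
      have "Poly_Mapping.single k (2 ^ Suc e) + eps j = Poly_Mapping.single k (2 ^ Suc e + 1)"
        unfolding True by (simp only: single_add)
      then show "Poly_Mapping.single k (2 ^ Suc e) + eps j \<in> box n m"
        using kej(3) lt by (simp only: single_in_box)
    next
      case False
      have "mno_carry (Poly_Mapping.single k (2 ^ Suc e)) (eps j)"
        using False by (simp add: mno_carry_single lookup_single)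
      then show "Poly_Mapping.single k (2 ^ Suc e) + eps j \<in> box n m"
        using kej lt by (intro box_add single_in_box eps_in_box) auto
    qed
    then show ?thesis using deg kej(5) box_addD by auto
  qed
  then have box: "\<beta> \<in> box n m" and deg: "t \<le> mdeg \<beta>" by auto
  have dec: "decomposable \<beta>" unfolding decomposable_def
  proof (intro conjI allI notI)
    show "False" if "\<beta> = 0" using that deg t by simp
    fix i e assume e: "\<beta> = Poly_Mapping.single i (2 ^ e)"
    then have "e \<noteq> 0" using deg t by (intro notI) simp
    then obtain e' where e': "e = Suc e'" by (metis not0_implies_Suc)
    have "dcoeff (fill \<rho>) (\<beta> + eps p) = dcoeff (\<rho> p) \<beta>"
      using dcoeff_fill[of "\<beta> + eps p" i e' p \<rho>] e e' p by simp
    then show False using nz add_self_char2[OF char2] by simp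
  qed
  have "\<not> (p \<in> J \<and> two_digit \<beta> \<and> keys \<beta> \<inter> J \<noteq> {})"
  proof
    assume a: "p \<in> J \<and> two_digit \<beta> \<and> keys \<beta> \<inter> J \<noteq> {}"
    then have "\<beta> \<notin> rest_idx J p t" by (simp add: rest_idx_def)
    then have "dcoeff (\<rho> p) \<beta> = 0" using \<rho>[OF p] by (intro supp_inD)
    then obtain k e j where kej: "\<beta> + eps p = Poly_Mapping.single k (2 ^ Suc e) + eps j" "j \<in> {1..n}" "k \<in> {1..n}"
      "Suc e < m k" using nz fill by auto
    have "p \<noteq> k" using kej(4) J(2)[of p] a by auto
    have "p = j"
    proof (rule ccontr)
      assume "p \<noteq> j"
      then have "lookup (Poly_Mapping.single k (2 ^ Suc e) + eps j) p = 0"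
        using \<open>p \<noteq> k\<close> by (simp add: lookup_add lookup_single)
      then have "lookup (\<beta> + eps p) p = 0" unfolding kej(1) .
      then show False by (simp add: lookup_add)
    qed
    then have "\<beta> = Poly_Mapping.single k (2 ^ Suc e)" using kej(1) by simp
    then show False using a single_not_two_digit by blast
  qed
  then show "\<beta> \<in> dec_rest J p t" using box deg dec by (simp add: dec_idx_def rest_idx_def)
qed

end

section \<open>Reduction to the normal form\<close>

text \<open>The data of the reduction: \<open>a\<close> is the matrix of \<open>\<omega>(0)\<close>, \<open>ab\<close> its inverse, and \<open>i0\<close> the index through which the
  coefficients of the \<open>dz\<^sub>k dz\<^sub>l\<close> are adjusted. The set \<open>J\<close> is empty if \<open>i0\<close> has height greater than one, and otherwise the
  set of all \<open>i\<close> with \<open>ab\<^sub>i\<^sub>i \<noteq> 0\<close>, all of height one. The coefficients \<open>b\<^sub>k\<^sub>l\<close> with \<open>k, l \<notin> J\<close> can be moved arbitrarily. The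
  entries of \<open>b\<close> on the diagonal are zero, as no \<open>dz\<^sub>i dz\<^sub>i\<close> occurs.\<close>

locale form_reduction = truncated_dp_algebra n m A
  for n :: nat and m :: "nat \<Rightarrow> nat" and A :: "'k::field dps set" +
  fixes a ab b :: "nat \<Rightarrow> nat \<Rightarrow> 'k" and \<phi> :: "nat \<Rightarrow> 'k dps" and J :: "nat set" and i0 :: nat
  assumes perfect: "surj (\<lambda>x::'k. x ^ 2)"
    and a_sym: "\<And>i j. a i j = a j i" and ab_sym: "\<And>i j. ab i j = ab j i"
    and inverse: "\<And>i j. i \<in> {1..n} \<Longrightarrow> j \<in> {1..n} \<Longrightarrow> (\<Sum>l\<in>{1..n}. a i l * ab l j) = (if i = j then 1 else 0)"
    and b_sym: "\<And>i j. b i j = b j i" and b_diag: "\<And>i. b i i = 0"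
    and \<phi>: "\<And>i. i \<in> {1..n} \<Longrightarrow> \<phi> i \<in> supp_in (dec_rest J i 0)"
    and i0: "i0 \<in> {1..n}" "ab i0 i0 \<noteq> 0"
    and J_cases: "J = {} \<and> 1 < m i0 \<or> J = {i\<in>{1..n}. ab i i \<noteq> 0} \<and> (\<forall>j\<in>J. m j = 1)"
begin

lemma J_sub: "J \<subseteq> {1..n}" and J_height: "j \<in> J \<Longrightarrow> m j = 1"
  using J_cases by auto

lemma J_full: "i \<in> {1..n} \<Longrightarrow> ab i i \<noteq> 0 \<Longrightarrow> J = {} \<or> i \<in> J"
  using J_cases by blast

text \<open>Multiplication by the inverse matrix; it makes the linear term of the image equal to \<open>d\<psi>\<close>.\<close>

definition lift :: "(nat \<Rightarrow> 'k dps) \<Rightarrow> nat \<Rightarrow> 'k dps" where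
  "lift \<psi> i = (\<Sum>j\<in>{1..n}. dscale (ab i j) (\<psi> j))"

lemma lift_add: "lift (\<lambda>i. \<psi> i + \<eta> i) i = lift \<psi> i + lift \<eta> i"
  by (simp add: lift_def dscale_add sum.distrib)

lemma lift_in:
  assumes "\<And>i. i \<in> {1..n} \<Longrightarrow> \<psi> i \<in> supp_in (dec_rest J i t)"
  shows "lift \<psi> i \<in> supp_in (dec_idx n m t)"
  unfolding lift_def by (intro supp_in_sum supp_in_dscale) (use assms in \<open>auto intro: supp_in_mono[rotated]\<close>)

lemma lift_family:
  assumes "\<And>i. i \<in> {1..n} \<Longrightarrow> \<psi> i \<in> supp_in (dec_rest J i 0)"
  shows "dec_family (lift \<psi>)"
  unfolding dec_family_def using lift_in[OF assms] by blast

lemma lift_inverse: "i \<in> {1..n} \<Longrightarrow> (\<Sum>j\<in>{1..n}. dscale (a i j) (lift \<eta> j)) = \<eta> i"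
proof -
  assume i: "i \<in> {1..n}"
  have "(\<Sum>j\<in>{1..n}. dscale (a i j) (lift \<eta> j)) = (\<Sum>l\<in>{1..n}. dscale (\<Sum>j\<in>{1..n}. a i j * ab j l) (\<eta> l))"
  proof -
    have "(\<Sum>j\<in>{1..n}. dscale (a i j) (lift \<eta> j)) = (\<Sum>j\<in>{1..n}. \<Sum>l\<in>{1..n}. dscale (a i j * ab j l) (\<eta> l))"
      unfolding lift_def dscale_sum by (intro sum.cong refl dps_eqI) (simp add: mult.assoc)
    also have "\<dots> = (\<Sum>l\<in>{1..n}. \<Sum>j\<in>{1..n}. dscale (a i j * ab j l) (\<eta> l))" by (rule sum.swap)
    also have "\<dots> = (\<Sum>l\<in>{1..n}. dscale (\<Sum>j\<in>{1..n}. a i j * ab j l) (\<eta> l))"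
      by (intro sum.cong refl dps_eqI) (simp add: sum_distrib_right)
    finally show ?thesis .
  qed
  also have "\<dots> = (\<Sum>l\<in>{1..n}. if l = i then \<eta> i else 0)"
    by (rule sum.cong[OF refl]) (auto simp: inverse[OF i] intro!: dps_eqI)
  also have "\<dots> = \<eta> i" using i by (simp add: sum.delta)
  finally show ?thesis .
qed

lemma qform_lift: "qform a (lift \<eta>) k l = qform ab \<eta> k l"
proof -
  have "qform a (lift \<eta>) k l = (\<Sum>i\<in>{1..n}. pd k (lift \<eta> i) * pd l (\<Sum>j\<in>{1..n}. dscale (a i j) (lift \<eta> j)))"
    unfolding qform_def pd_sum pd_linear sum_distrib_left by (simp only: dscale_mult(2))
  also have "\<dots> = (\<Sum>i\<in>{1..n}. pd k (lift \<eta> i) * pd l (\<eta> i))"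
    by (rule sum.cong[OF refl]) (simp only: lift_inverse)
  also have "\<dots> = (\<Sum>i\<in>{1..n}. \<Sum>j\<in>{1..n}. dscale (ab j i) (pd k (\<eta> j) * pd l (\<eta> i)))"
    unfolding lift_def pd_sum pd_linear sum_distrib_right by (simp only: dscale_mult(1) ab_sym)
  also have "\<dots> = qform ab \<eta> k l" unfolding qform_def by (rule sum.swap)
  finally show ?thesis .
qed

text \<open>The image of \<open>\<omega>\<close> under \<open>x\<^sub>i \<mapsto> x\<^sub>i + (M\<^bsup>-1\<^esup> \<psi>)\<^sub>i\<close>, \<open>M\<close> the matrix of \<open>\<omega>(0)\<close>.\<close>

definition image_coeff :: "(nat \<Rightarrow> 'k dps) \<Rightarrow> nat \<Rightarrow> nat \<Rightarrow> 'k dps" where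
  "image_coeff \<psi> = pullback (lift \<psi>) (form_coeff a \<phi> b)"

lemma \<phi>_dec: "i \<in> {1..n} \<Longrightarrow> \<phi> i \<in> supp_in (dec_idx n m 0)"
  using \<phi> by (auto intro: supp_in_mono[rotated])

definition crit_sum :: "(nat \<Rightarrow> 'k dps) \<Rightarrow> nat \<Rightarrow> nat \<Rightarrow> 'k" where
  "crit_sum \<eta> k l = (\<Sum>i\<in>{1..n}. ab i i * (dcoeff (\<eta> i) (crit k l) * dcoeff (\<eta> i) (crit k l)))"

text \<open>An index with \<open>ab\<^sub>i\<^sub>i \<noteq> 0\<close> lies in \<open>J\<close> or \<open>J\<close> is empty. In both cases \<open>\<eta>\<^sub>i\<close> has no two-digit monomial that involves \<open>J\<close>, as
  \<open>square_form\<close> demands.\<close>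

lemma squares_form:
  assumes \<eta>: "\<And>i. i \<in> {1..n} \<Longrightarrow> \<eta> i \<in> supp_in (dec_rest J i t)"
  shows "\<exists>\<rho>. (\<forall>p. \<rho> p \<in> supp_in (rest_idx J p (Suc t))) \<and>
    (\<forall>k l. k \<in> {1..n} \<longrightarrow> l \<in> {1..n} \<longrightarrow> k \<noteq> l \<longrightarrow>
      (\<Sum>i\<in>{1..n}. dscale (ab i i) (pd k (\<eta> i) * pd l (\<eta> i))) = dform \<rho> k l + dscale (crit_sum \<eta> k l) (zf k * zf l))"
proof -
  have "\<exists>\<rho>. (\<forall>p. \<rho> p \<in> supp_in (rest_idx J p (Suc t))) \<and>
    (\<forall>k l. k \<in> {1..n} \<longrightarrow> l \<in> {1..n} \<longrightarrow> k \<noteq> l \<longrightarrow> dscale (ab i i) (pd k (\<eta> i) * pd l (\<eta> i))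
       = dform \<rho> k l + dscale (ab i i * (dcoeff (\<eta> i) (crit k l) * dcoeff (\<eta> i) (crit k l))) (zf k * zf l))"
    if i: "i \<in> {1..n}" for i
  proof (cases "ab i i = 0")
    case True
    have z: "dscale 0 f = 0" for f :: "'k dps" by (rule dps_eqI) simp
    show ?thesis by (intro exI[of _ "\<lambda>_. 0"]) (simp add: True z)
  next
    case False
    then have "\<eta> i \<in> supp_in {\<alpha> \<in> dec_idx n m t. \<not> (two_digit \<alpha> \<and> keys \<alpha> \<inter> J \<noteq> {})}"
      using J_full[OF i] by (intro supp_in_mono[OF _ \<eta>[OF i]]) (auto simp: rest_idx_def)
    from square_form[OF this] obtain \<rho> where \<rho>: "\<And>p. \<rho> p \<in> supp_in (rest_idx J p (Suc t))"
      "\<And>k l. k \<in> {1..n} \<Longrightarrow> l \<in> {1..n} \<Longrightarrow> k \<noteq> l \<Longrightarrow> pd k (\<eta> i) * pd l (\<eta> i)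
       = dform \<rho> k l + dscale (dcoeff (\<eta> i) (crit k l) * dcoeff (\<eta> i) (crit k l)) (zf k * zf l)" by blast
    have "dscale (ab i i) (pd k (\<eta> i) * pd l (\<eta> i)) = dform (\<lambda>p. dscale (ab i i) (\<rho> p)) k l
        + dscale (ab i i * (dcoeff (\<eta> i) (crit k l) * dcoeff (\<eta> i) (crit k l))) (zf k * zf l)"
      if "k \<in> {1..n}" "l \<in> {1..n}" "k \<noteq> l" for k l
      unfolding \<rho>(2)[OF that] dform_dscale by (rule dps_eqI) (simp add: distrib_left mult.assoc)
    then show ?thesis using \<rho>(1) by (intro exI[of _ "\<lambda>p. dscale (ab i i) (\<rho> p)"]) (auto intro: supp_in_dscale)
  qed
  then obtain \<rho> where \<rho>: "\<And>i p. i \<in> {1..n} \<Longrightarrow> \<rho> i p \<in> supp_in (rest_idx J p (Suc t))"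
    "\<And>i k l. i \<in> {1..n} \<Longrightarrow> k \<in> {1..n} \<Longrightarrow> l \<in> {1..n} \<Longrightarrow> k \<noteq> l \<Longrightarrow> dscale (ab i i) (pd k (\<eta> i) * pd l (\<eta> i))
       = dform (\<rho> i) k l + dscale (ab i i * (dcoeff (\<eta> i) (crit k l) * dcoeff (\<eta> i) (crit k l))) (zf k * zf l)"
    by metis
  have s: "dscale (\<Sum>i\<in>S. c i) f = (\<Sum>i\<in>S. dscale (c i) f)" for S :: "nat set" and c and f :: "'k dps"
    by (rule dps_eqI) (simp add: sum_distrib_right)
  show ?thesis
  proof (intro exI[of _ "\<lambda>p. \<Sum>i\<in>{1..n}. \<rho> i p"] conjI allI impI)
    fix p show "(\<Sum>i\<in>{1..n}. \<rho> i p) \<in> supp_in (rest_idx J p (Suc t))" by (intro supp_in_sum \<rho>)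
  next
    fix k l assume "k \<in> {1..n}" "l \<in> {1..n}" "k \<noteq> l"
    then show "(\<Sum>i\<in>{1..n}. dscale (ab i i) (pd k (\<eta> i) * pd l (\<eta> i)))
      = dform (\<lambda>p. \<Sum>i\<in>{1..n}. \<rho> i p) k l + dscale (crit_sum \<eta> k l) (zf k * zf l)"
      unfolding dform_sum crit_sum_def s sum.distrib[symmetric] by (intro sum.cong refl \<rho>(2))
  qed
qed

end

lemma product_difference:
  "P' * (x + (g + h)) - P * (x + g) = (P' - P) * x + (P' - P) * (g + h) + P * h" for P P' x g h :: "'b::comm_ring_1"
  by (simp add: algebra_simps)

context form_reduction
begin

lemma free_idx_mono: "s \<le> t \<Longrightarrow> f \<in> supp_in (free_idx t) \<Longrightarrow> f \<in> supp_in (free_idx s)"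
  by (erule supp_in_mono[rotated]) (auto simp: free_idx_def)

lemma dec_idx_2_1: "dec_idx n m (Suc 1) = dec_idx n m 0"
  using dec_idx_2 by (simp add: numeral_2_eq_2 One_nat_def)

lemma mixed_yy:
  assumes p: "p \<in> {1..n}"
  shows "mixed a (lift \<eta>) (yy g) p = \<eta> p + mixed a (lift \<eta>) g p"
proof -
  have "mixed a (lift \<eta>) (yy g) p = (\<Sum>i\<in>{1..n}. \<Sum>j\<in>{1..n}. dscale (a i j) (lift \<eta> i) * pd p (xpow j 1))
      + mixed a (lift \<eta>) g p"
    unfolding mixed_def pd_linear(1) distrib_left dscale_add sum.distrib by (simp only: dscale_mult(1))
  also have "(\<Sum>i\<in>{1..n}. \<Sum>j\<in>{1..n}. dscale (a i j) (lift \<eta> i) * pd p (xpow j 1)) = (\<Sum>i\<in>{1..n}. dscale (a p i) (lift \<eta> i))"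
    unfolding sum_pd_x[OF p] by (simp only: a_sym)
  also have "\<dots> = \<eta> p" by (rule lift_inverse[OF p])
  finally show ?thesis .
qed

text \<open>The product \<open>\<sigma>\<phi>\<^sub>j \<partial>\<^sub>p(x\<^sub>j + g\<^sub>j)\<close> has degree at least two in its first factor, so a change of \<open>g\<close> in degree
  \<open>s + 1\<close> is felt only from degree \<open>s + 2\<close> on.\<close>

lemma chi_diff:
  assumes g: "dec_family g" "dec_family g'" and \<gamma>: "\<And>i. i \<in> {1..n} \<Longrightarrow> \<gamma> i \<in> supp_in (dec_idx n m (Suc s))"
    and g': "\<And>i. g' i = g i + \<gamma> i"
  shows "chi \<phi> g' p - chi \<phi> g p \<in> supp_in (free_idx (Suc (Suc s)))"
proof -
  let ?\<sigma> = "subst_dps n (yy g)" and ?\<sigma>' = "subst_dps n (yy g')"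
  have yy': "yy g' = (\<lambda>i. yy g i + \<gamma> i)" by (simp add: fun_eq_iff g' add.assoc)
  have "chi \<phi> g' p - chi \<phi> g p = (\<Sum>j\<in>{1..n}. ?\<sigma>' (\<phi> j) * pd p (yy g' j) - ?\<sigma> (\<phi> j) * pd p (yy g j))"
    by (simp add: chi_def sum_subtractf)
  also have "\<dots> \<in> supp_in (free_idx (Suc (Suc s)))"
  proof (rule supp_in_sum)
    fix j assume j: "j \<in> {1..n}"
    let ?D = "?\<sigma>' (\<phi> j) - ?\<sigma> (\<phi> j)"
    have \<phi>j: "\<phi> j \<in> supp_in (dec_idx n m 0)" by (rule \<phi>_dec[OF j])
    have \<phi>A: "\<phi> j \<in> A" by (rule dec_in_A[OF \<phi>j])
    have D: "?D = (?\<sigma>' (\<phi> j) - \<phi> j) - (?\<sigma> (\<phi> j) - \<phi> j)" by simp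
    have D0: "?D \<in> supp_in (dec_idx n m 0)"
      unfolding D by (intro supp_in_diff subst_minus_id_dec g \<phi>A)
    have Df: "?D \<in> supp_in (free_idx 0)"
      unfolding D by (intro supp_in_diff subst_minus_id_free g \<phi>j)
    have "?D \<in> order_ge (2 + s)"
      unfolding yy' by (rule subst_diff_order[OF \<gamma> \<phi>A dec_order2[OF \<phi>j]])
    then have Do: "?D \<in> supp_in {\<alpha>. Suc (Suc s) \<le> mdeg \<alpha>}" by (simp add: order_ge_def)
    have Dd: "?D \<in> supp_in (dec_idx n m (Suc (Suc s)))"
      by (rule supp_in_mono[OF _ supp_in_Int[OF D0 Do]]) (auto simp: dec_idx_def)
    have Dff: "?D \<in> supp_in (free_idx (Suc (Suc s)))"
      by (rule supp_in_mono[OF _ supp_in_Int[OF Df Do]]) (auto simp: free_idx_def)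
    have 1: "?D * pd p (xpow j 1) \<in> supp_in (free_idx (Suc (Suc s)))"
      using Dff by (simp add: pd_x)
    have gj: "g' j \<in> supp_in (dec_idx n m (Suc 1))" using dec_familyD[OF g(2) j] by (simp only: dec_idx_2_1)
    have 2: "?D * pd p (g' j) \<in> supp_in (free_idx (Suc (Suc s)))"
      by (rule free_idx_mono[OF _ dec_pd_free[OF Dd gj]]) simp
    have "(?\<sigma> (\<phi> j) - \<phi> j) + \<phi> j \<in> supp_in (dec_idx n m 0)"
      by (rule supp_in_add[OF subst_minus_id_dec[OF g(1) \<phi>A] \<phi>j])
    then have "?\<sigma> (\<phi> j) \<in> supp_in (dec_idx n m 0)" by simp
    then have "?\<sigma> (\<phi> j) \<in> supp_in (dec_idx n m 2)" by (simp only: dec_idx_2)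
    from dec_pd_free[OF this \<gamma>[OF j], of p]
    have 3: "?\<sigma> (\<phi> j) * pd p (\<gamma> j) \<in> supp_in (free_idx (Suc (Suc s)))" by simp
    have "?\<sigma>' (\<phi> j) * pd p (yy g' j) - ?\<sigma> (\<phi> j) * pd p (yy g j)
        = ?D * pd p (xpow j 1) + ?D * pd p (g' j) + ?\<sigma> (\<phi> j) * pd p (\<gamma> j)"
      unfolding g' pd_linear(1) by (rule product_difference)
    then show "?\<sigma>' (\<phi> j) * pd p (yy g' j) - ?\<sigma> (\<phi> j) * pd p (yy g j) \<in> supp_in (free_idx (Suc (Suc s)))"
      using 1 2 3 by (simp only: supp_in_add)
  qed
  finally show ?thesis .
qed

lemma zpow_diff:
  assumes g: "dec_family g" "dec_family g'" and \<gamma>: "\<And>i. i \<in> {1..n} \<Longrightarrow> \<gamma> i \<in> supp_in (dec_idx n m t)"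
    and g': "\<And>i. g' i = g i + \<gamma> i" and i: "i \<in> {1..n}"
  shows "zpow g' i - zpow g i \<in> supp_in (dec_idx n m (Suc t))"
proof -
  have D: "zpow g' i - zpow g i = (zpow g' i - xpow i (2 ^ m i)) - (zpow g i - xpow i (2 ^ m i))" by simp
  have D0: "zpow g' i - zpow g i \<in> supp_in (dec_idx n m 0)"
    unfolding D unfolding zpow_def by (intro supp_in_diff dpow_diff_dec[OF dec_familyD[OF g(1) i] i] dpow_diff_dec[OF dec_familyD[OF g(2) i] i]) simp_all
  have y': "yy g' i = yy g i + \<gamma> i" by (simp add: g' add.assoc)
  have "(2 :: nat) \<le> 2 ^ m i" using height_pos[OF i] power_increasing[of 1 "m i" "2 :: nat"] by simp
  then obtain c where c: "2 ^ m i = Suc c" "1 \<le> c" by (cases "2 ^ m i :: nat") auto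
  have "zpow g' i - zpow g i \<in> order_ge (c + t)"
    unfolding zpow_def y' c(1) by (rule dpow_diff_order[OF \<gamma>[OF i]])
  then have Do: "zpow g' i - zpow g i \<in> supp_in {\<alpha>. c + t \<le> mdeg \<alpha>}" by (simp add: order_ge_def)
  show ?thesis
    by (rule supp_in_mono[OF _ supp_in_Int[OF D0 Do]]) (use c(2) in \<open>auto simp: dec_idx_def\<close>)
qed

lemma pd_zpow_props:
  assumes g: "dec_family g" and i: "i \<in> {1..n}"
  shows "pd p (zpow g i) \<in> A" "dcoeff (pd p (zpow g i)) 0 = 0"
proof -
  show "pd p (zpow g i) \<in> A"
    unfolding pd_zpow[OF g i] by (intro A_times subst_in_A g zf_in_A i A_pd yy_in_A)
  have "(2 :: nat) \<le> 2 ^ m i" using height_pos[OF i] power_increasing[of 1 "m i" "2 :: nat"] by simp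
  then have "zf i \<in> order_ge 1" unfolding zf_def order_ge_def by (intro supp_in_dmon) simp
  then have "pd p (zpow g i) \<in> order_ge (1 + 0)"
    unfolding pd_zpow[OF g i] by (intro order_ge_times subst_order) simp_all
  then show "dcoeff (pd p (zpow g i)) 0 = 0" unfolding order_ge_def by (intro supp_inD) auto
qed

lemma dform_cong: "\<theta> k = \<eta> k \<Longrightarrow> \<theta> l = \<eta> l \<Longrightarrow> dform \<theta> k l = dform \<eta> k l"
  by (simp add: dform_def)

text \<open>Changing the substitution in degree \<open>t\<close> changes the image by the linear term \<open>d\<eta>\<close>, by differentials of higher
  degree, and by the squares \<open>(d\<eta>\<^sub>i)\<^bsup>(2)\<^esup>\<close>. The matrix \<open>b\<close> contributes no squares since its diagonal is zero.\<close>

lemma image_coeff_diff: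
  assumes \<psi>: "\<And>i. i \<in> {1..n} \<Longrightarrow> \<psi> i \<in> supp_in (dec_rest J i 0)"
    and \<eta>: "\<And>i. i \<in> {1..n} \<Longrightarrow> \<eta> i \<in> supp_in (dec_rest J i t)" and t: "2 \<le> t"
  shows "\<exists>\<rho>. (\<forall>p\<in>{1..n}. \<rho> p \<in> supp_in (rest_idx J p (Suc t))) \<and>
    (\<forall>k l. k \<in> {1..n} \<longrightarrow> l \<in> {1..n} \<longrightarrow> k \<noteq> l \<longrightarrow>
      image_coeff (\<lambda>i. \<psi> i + \<eta> i) k l = image_coeff \<psi> k l + dform \<eta> k l + dform \<rho> k l + dscale (crit_sum \<eta> k l) (zf k * zf l))"
proof -
  obtain s where s: "t = Suc s" "1 \<le> s" using t by (cases t) auto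
  define g g' \<gamma> where "g = lift \<psi>" and "g' = lift (\<lambda>i. \<psi> i + \<eta> i)" and "\<gamma> = lift \<eta>"
  have \<eta>0: "\<eta> i \<in> supp_in (dec_rest J i 0)" if "i \<in> {1..n}" for i
    by (rule supp_in_mono[OF _ \<eta>[OF that]]) (auto simp: dec_idx_def rest_idx_def)
  have \<eta>d: "\<eta> i \<in> supp_in (dec_idx n m t)" if "i \<in> {1..n}" for i
    by (rule supp_in_mono[OF _ \<eta>[OF that]]) auto
  have g: "dec_family g" unfolding g_def by (rule lift_family[OF \<psi>])
  have g'f: "dec_family g'" unfolding g'_def by (rule lift_family) (intro supp_in_add \<psi> \<eta>0)
  have \<gamma>: "\<gamma> i \<in> supp_in (dec_idx n m t)" for i unfolding \<gamma>_def by (rule lift_in[OF \<eta>])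
  have \<gamma>s: "\<gamma> i \<in> supp_in (dec_idx n m (Suc s))" for i using \<gamma> s by simp
  have g': "g' i = g i + \<gamma> i" for i unfolding g_def g'_def \<gamma>_def by (rule lift_add)
  have yy': "yy g' = (\<lambda>i. yy g i + \<gamma> i)" by (simp add: fun_eq_iff g' add.assoc)
  define \<theta> where "\<theta> = (\<lambda>i. zpow g' i - zpow g i)"
  define \<kappa> where "\<kappa> = (\<lambda>p. chi \<phi> g' p - chi \<phi> g p)"
  have zp: "zpow g' = (\<lambda>i. zpow g i + \<theta> i)" and ch: "chi \<phi> g' = (\<lambda>p. chi \<phi> g p + \<kappa> p)"
    by (simp_all add: \<theta>_def \<kappa>_def)
  have \<theta>: "\<theta> i \<in> supp_in (dec_idx n m (Suc t))" if "i \<in> {1..n}" for i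
    unfolding \<theta>_def by (rule zpow_diff[OF g g'f \<gamma> g' that])
  have \<kappa>: "\<kappa> p \<in> supp_in (free_idx (Suc t))" for p
    unfolding \<kappa>_def s by (rule chi_diff[OF g g'f \<gamma>s g'])
  obtain \<rho>S where \<rho>S: "\<And>p. \<rho>S p \<in> supp_in (rest_idx J p (Suc t))"
    "\<And>k l. k \<in> {1..n} \<Longrightarrow> l \<in> {1..n} \<Longrightarrow> k \<noteq> l \<Longrightarrow>
      (\<Sum>i\<in>{1..n}. dscale (ab i i) (pd k (\<eta> i) * pd l (\<eta> i))) = dform \<rho>S k l + dscale (crit_sum \<eta> k l) (zf k * zf l)"
    using squares_form[OF \<eta>] by blast
  define \<rho>F where "\<rho>F = (\<lambda>p. mixed a \<gamma> g p + upper ab \<eta> p + \<kappa> p + mixed b \<theta> (zpow g) p + upper b \<theta> p)"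
  have gd: "g j \<in> supp_in (dec_idx n m (Suc 1))" if "j \<in> {1..n}" for j
    using dec_familyD[OF g that] by (simp only: dec_idx_2_1)
  have F1: "mixed a \<gamma> g p \<in> supp_in (free_idx (t + 1))" for p
  proof (rule mixed_free[OF \<gamma>])
    fix j assume j: "j \<in> {1..n}"
    show "pd p (g j) \<in> A" "pd p (g j) \<in> order_ge 1" "dcoeff (pd p (g j)) 0 = 0"
      by (rule A_pd[OF dec_in_A[OF gd[OF j]]], rule pd_dec_order[OF gd[OF j]], rule pd_dec_0[OF gd[OF j]])
  qed
  have F2: "upper ab \<eta> p \<in> supp_in (free_idx (Suc s + s))" for p
    by (rule upper_free) (use \<eta>d s in auto)
  have F3: "mixed b \<theta> (zpow g) p \<in> supp_in (free_idx (Suc t + 0))" for p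
    by (rule mixed_free) (use \<theta> pd_zpow_props[OF g] in auto)
  have F4: "upper b \<theta> p \<in> supp_in (free_idx (Suc t + t))" for p
    by (rule upper_free) (use \<theta> in auto)
  have F: "\<rho>F p \<in> supp_in (free_idx (Suc t))" for p
    unfolding \<rho>F_def
    by (intro supp_in_add \<kappa> free_idx_mono[OF _ F1] free_idx_mono[OF _ F2] free_idx_mono[OF _ F3] free_idx_mono[OF _ F4])
      (use s in auto)
  have mem: "\<rho>F p + \<rho>S p \<in> supp_in (rest_idx J p (Suc t))" for p
    by (intro supp_in_add \<rho>S supp_in_mono[OF free_subset_rest F])
  have eq: "image_coeff (\<lambda>i. \<psi> i + \<eta> i) k l = image_coeff \<psi> k l + dform \<eta> k l + dform (\<lambda>p. \<rho>F p + \<rho>S p) k l + dscale (crit_sum \<eta> k l) (zf k * zf l)"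
    if kl: "k \<in> {1..n}" "l \<in> {1..n}" "k \<noteq> l" for k l
  proof -
    have \<phi>A: "\<phi> i \<in> A" if "i \<in> {1..n}" for i using \<phi>_dec[OF that] by (rule dec_in_A)
    have L: "image_coeff \<psi> k l = qform a (yy g) k l + dform (chi \<phi> g) k l + qform b (zpow g) k l"
      unfolding image_coeff_def g_def[symmetric] by (rule pullback_form_coeff[OF g \<phi>A])
    have L': "image_coeff (\<lambda>i. \<psi> i + \<eta> i) k l = qform a (yy g') k l + dform (chi \<phi> g') k l + qform b (zpow g') k l"
      unfolding image_coeff_def g'_def[symmetric] by (rule pullback_form_coeff[OF g'f \<phi>A])
    have M: "dform (mixed a \<gamma> (yy g)) k l = dform \<eta> k l + dform (mixed a \<gamma> g) k l"
    proof -
      have "dform (mixed a \<gamma> (yy g)) k l = dform (\<lambda>p. \<eta> p + mixed a \<gamma> g p) k l"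
        unfolding \<gamma>_def by (rule dform_cong; rule mixed_yy; fact)
      then show ?thesis unfolding dform_add .
    qed
    have Q1: "qform a (yy g') k l = qform a (yy g) k l + (dform \<eta> k l + dform (mixed a \<gamma> g) k l)
        + ((dform \<rho>S k l + dscale (crit_sum \<eta> k l) (zf k * zf l)) + dform (upper ab \<eta>) k l)"
    proof -
      have "qform a \<gamma> k l = qform ab \<eta> k l" unfolding \<gamma>_def by (rule qform_lift)
      also have "\<dots> = (dform \<rho>S k l + dscale (crit_sum \<eta> k l) (zf k * zf l)) + dform (upper ab \<eta>) k l"
        unfolding qform_diag[OF ab_sym] \<rho>S(2)[OF kl] ..
      finally show ?thesis unfolding yy' qform_add[OF a_sym] M by simp
    qed
    have Q2: "qform b (zpow g') k l = qform b (zpow g) k l + dform (mixed b \<theta> (zpow g)) k l + dform (upper b \<theta>) k l"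
    proof -
      have z: "dscale 0 f = 0" for f :: "'k dps" by (rule dps_eqI) simp
      have "qform b \<theta> k l = dform (upper b \<theta>) k l" unfolding qform_diag[OF b_sym] b_diag z by simp
      then show ?thesis unfolding zp qform_add[OF b_sym] by simp
    qed
    show ?thesis
      unfolding L L' Q1 Q2 unfolding ch dform_add \<rho>F_def by (simp only: ac_simps)
  qed
  from mem eq show ?thesis by (intro exI[of _ "\<lambda>p. \<rho>F p + \<rho>S p"]) blast
qed

end

lemma square_root_function:
  assumes "surj (\<lambda>x::'k::field. x ^ 2)"
  shows "\<exists>r. (\<forall>x::'k. r x * r x = x) \<and> r 0 = 0"
proof -
  have s: "inv_into UNIV (\<lambda>x::'k. x ^ 2) x ^ 2 = x" for x using surj_f_inv_f[OF assms] .
  then have "inv_into UNIV (\<lambda>x::'k. x ^ 2) x * inv_into UNIV (\<lambda>x::'k. x ^ 2) x = x" for x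
    by (simp only: power2_eq_square)
  moreover have "inv_into UNIV (\<lambda>x::'k. x ^ 2) 0 = 0" using s[of 0] by (simp only: power_eq_0_iff)
  ultimately show ?thesis by blast
qed

context form_reduction
begin

lemma crit_eq_iff:
  assumes "k < l" "k' < l'" shows "crit k l = crit k' l' \<longleftrightarrow> k = k' \<and> l = l'"
proof
  assume "crit k l = crit k' l'"
  then have "{k, l} = {k', l'}" using keys_crit by metis
  then show "k = k' \<and> l = l'" using assms by (auto simp: doubleton_eq_iff)
qed simp

lemma crit_add_eps_in_box:
  assumes "k \<in> {1..n} - J" "l \<in> {1..n} - J" "k \<noteq> l"
  shows "crit k l + eps i0 \<in> box n m"
proof -
  have pw: "(2 :: nat) ^ (m i - 1) < 2 ^ m i" if "i \<in> {1..n}" for i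
    using height_pos[OF that] by (intro power_strict_increasing) auto
  have big: "(2 :: nat) ^ (m i0 - 1) + 1 < 2 ^ m i0" if "J = {}"
  proof -
    have "1 < m i0" using J_cases that i0 by auto
    define c where "c = m i0 - 2"
    have c: "m i0 = Suc (Suc c)" using \<open>1 < m i0\<close> unfolding c_def by linarith
    have "(1 :: nat) \<le> 2 ^ c" by simp
    moreover have e: "m i0 - 1 = Suc c" using c by simp
    ultimately show ?thesis unfolding e unfolding c power_Suc by linarith
  qed
  have J_or: "J = {} \<or> i0 \<noteq> k \<and> i0 \<noteq> l" using J_full[OF i0] assms by auto
  have "lookup (crit k l + eps i0) i < 2 ^ m i" if i: "i \<in> {1..n}" for i
  proof (cases "i = i0")
    case True
    have "(1 :: nat) < 2 ^ m i0" using height_pos[OF i0(1)] by (intro one_less_power) auto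
    then show ?thesis using True big J_or assms(3) by (auto simp: lookup_add lookup_crit lookup_single)
  next
    case False
    then show ?thesis using pw[OF i] assms(3) by (auto simp: lookup_add lookup_crit lookup_single)
  qed
  then show ?thesis using assms i0 by (auto simp: box_def keys_add_mindex keys_crit)
qed

text \<open>The differential of the critical monomial times \<open>x\<^sub>i\<^sub>0\<close> has admitted decomposable coefficients. At \<open>dx\<^sub>i\<^sub>0\<close>
  this is the critical monomial itself. At \<open>dx\<^sub>p\<close> with \<open>p \<noteq> i0\<close> a factor \<open>x\<^sub>i\<^sub>0\<close> and the power of the other variable
  remain; they could merge into an indecomposable monomial only if \<open>i0 \<in> {k, l}\<close>, and then \<open>i0\<close> has height
  greater than one, so that the exponent of \<open>x\<^sub>i\<^sub>0\<close> is odd and greater than one.\<close>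

lemma pd_crit_add_eps:
  assumes k: "k \<in> {1..n} - J" and l: "l \<in> {1..n} - J" and kl: "k \<noteq> l" and t: "t \<le> mdeg (crit k l)"
  shows "pd p (dmon (crit k l + eps i0)) \<in> supp_in (dec_rest J p t)"
proof (cases "lookup (crit k l + eps i0) p > 0")
  case False
  then show ?thesis by (simp add: pd_dmon)
next
  case True
  define \<beta> where "\<beta> = crit k l + eps i0 - eps p"
  have \<beta>p: "\<beta> + eps p = crit k l + eps i0" unfolding \<beta>_def by (rule minus_eps_add[OF True])
  have box: "\<beta> \<in> box n m"
    using crit_add_eps_in_box[OF k l kl] box_addD[of \<beta> "eps p" n m] \<beta>p by simp
  have deg: "mdeg \<beta> = mdeg (crit k l)" using arg_cong[OF \<beta>p, of mdeg] by simp
  have L: "lookup \<beta> i + lookup (eps p) i = lookup (crit k l) i + lookup (eps i0) i" for i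
    using arg_cong[OF \<beta>p, of "\<lambda>\<alpha>. lookup \<alpha> i"] by (simp only: lookup_add)
  have dec: "decomposable \<beta>"
  proof (cases "p = i0")
    case True
    then have "\<beta> = crit k l" using \<beta>p by simp
    then show ?thesis using two_digit_decomposable[OF two_digit_crit[OF kl]] by simp
  next
    case False
    \<comment> \<open>\<open>p\<close> is one of \<open>k, l\<close>; let \<open>q\<close> be the other one\<close>
    have "p \<in> {k, l}" using True False kl by (auto simp: lookup_add lookup_crit lookup_single split: if_splits)
    define q where "q = (if p = k then l else k)"
    have q: "q \<noteq> p" "q \<in> {k, l}" using \<open>p \<in> {k, l}\<close> kl by (auto simp: q_def)
    have pos: "lookup \<beta> i0 \<ge> 1" using L[of i0] False by (simp add: lookup_single)
    have Lq: "lookup \<beta> q = 2 ^ (m q - 1) + lookup (eps i0) q"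
      using L[of q] q(1,2) kl by (auto simp: lookup_single lookup_crit)
    show ?thesis unfolding decomposable_def
    proof (intro conjI allI notI)
      show False if "\<beta> = 0" using that pos by simp
      fix i e assume e: "\<beta> = Poly_Mapping.single i (2 ^ e)"
      have "i = i0" using pos e by (auto simp: lookup_single when_def split: if_splits)
      moreover have "i = q" using Lq e by (auto simp: lookup_single when_def split: if_splits)
      ultimately have qi: "q = i0" "lookup \<beta> i0 = 2 ^ e" using e by auto
      then have "2 ^ e = (2 :: nat) ^ (m i0 - 1) + 1" using Lq by simp
      moreover have "1 < m i0" using J_cases i0 qi(1) q(2) k l by auto
      then have "even ((2 :: nat) ^ (m i0 - 1))" by simp
      ultimately have "odd ((2 :: nat) ^ e)" by simp
      then have "e = 0" by simp
      then show False using \<open>2 ^ e = (2 :: nat) ^ (m i0 - 1) + 1\<close> by simp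
    qed
  qed
  have "\<not> (p \<in> J \<and> two_digit \<beta> \<and> keys \<beta> \<inter> J \<noteq> {})"
  proof
    assume a: "p \<in> J \<and> two_digit \<beta> \<and> keys \<beta> \<inter> J \<noteq> {}"
    then have "p = i0" using True k l kl by (auto simp: lookup_add lookup_crit lookup_single split: if_splits)
    then have "\<beta> = crit k l" using \<beta>p by simp
    then show False using a k l by (auto simp: keys_crit)
  qed
  then have "\<beta> \<in> dec_rest J p t" using box deg dec t by (simp add: dec_idx_def rest_idx_def)
  then show ?thesis using True unfolding \<beta>_def by (simp add: pd_dmon supp_in_dmon)
qed

text \<open>The function whose differential is added to prescribe the coefficients of the critical monomials.\<close>

definition bump :: "(nat \<Rightarrow> nat \<Rightarrow> 'k) \<Rightarrow> 'k dps" where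
  "bump c = (\<Sum>k\<in>{1..n}. \<Sum>l\<in>{k<..n}. dscale (c k l) (dmon (crit k l + eps i0)))"

lemma bump_in:
  assumes c: "\<And>k l. k \<in> {1..n} \<Longrightarrow> l \<in> {k<..n} \<Longrightarrow> c k l \<noteq> 0 \<Longrightarrow> k \<notin> J \<and> l \<notin> J \<and> t \<le> mdeg (crit k l)"
  shows "pd p (bump c) \<in> supp_in (dec_rest J p t)"
  unfolding bump_def pd_sum pd_linear
proof (intro supp_in_sum)
  fix k l assume kl: "k \<in> {1..n}" "l \<in> {k<..n}"
  show "dscale (c k l) (pd p (dmon (crit k l + eps i0))) \<in> supp_in (dec_rest J p t)"
  proof (cases "c k l = 0")
    case True
    have "dscale 0 f = 0" for f :: "'k dps" by (rule dps_eqI) simp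
    then show ?thesis using True by simp
  next
    case False
    with c[OF kl] have "k \<in> {1..n} - J" "l \<in> {1..n} - J" "k \<noteq> l" "t \<le> mdeg (crit k l)" using kl by auto
    then show ?thesis by (intro supp_in_dscale pd_crit_add_eps)
  qed
qed

text \<open>The differential of \<open>bump c\<close> contains the critical monomials at \<open>dx\<^sub>i\<^sub>0\<close>, with coefficients \<open>c\<close>, and at no other
  \<open>dx\<^sub>i\<close> with \<open>ab\<^sub>i\<^sub>i \<noteq> 0\<close>. If \<open>i0\<close> has height greater than one, this follows from the parity of the exponent of \<open>x\<^sub>i\<^sub>0\<close>; in the
  other case such an \<open>i\<close> lies in \<open>J\<close> while \<open>k\<close> and \<open>l\<close> do not.\<close>

lemma bump_crit:
  assumes c: "\<And>k l. k \<in> {1..n} \<Longrightarrow> l \<in> {k<..n} \<Longrightarrow> c k l \<noteq> 0 \<Longrightarrow> k \<notin> J \<and> l \<notin> J"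
    and kl: "k \<in> {1..n}" "l \<in> {k<..n}" and i: "i \<in> {1..n}" "ab i i \<noteq> 0"
  shows "dcoeff (pd i (bump c)) (crit k l) = (if i = i0 then c k l else 0)"
proof -
  have e: "dcoeff (pd i (bump c)) (crit k l)
    = (\<Sum>k'\<in>{1..n}. \<Sum>l'\<in>{k'<..n}. c k' l' * (if crit k l + eps i = crit k' l' + eps i0 then 1 else 0))"
    unfolding bump_def by simp
  show ?thesis
  proof (cases "i = i0")
    case True
    have "(\<Sum>l'\<in>{k'<..n}. c k' l' * (if crit k l + eps i = crit k' l' + eps i0 then 1 else 0))
        = (if k' = k then c k l else 0)" if "k' \<in> {1..n}" for k'
    proof -
      have "(\<Sum>l'\<in>{k'<..n}. c k' l' * (if crit k l + eps i = crit k' l' + eps i0 then 1 else 0))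
        = (\<Sum>l'\<in>{k'<..n}. if l' = l then (if k' = k then c k l else 0) else 0)"
        using True kl crit_eq_iff[of k l k'] by (intro sum.cong refl) auto
      also have "\<dots> = (if k' = k then c k l else 0)" using kl by (auto simp: sum.delta)
      finally show ?thesis .
    qed
    then have "dcoeff (pd i (bump c)) (crit k l) = (\<Sum>k'\<in>{1..n}. if k' = k then c k l else 0)"
      unfolding e by (rule sum.cong[OF refl])
    then show ?thesis using kl True by (simp add: sum.delta)
  next
    case False
    have z: "c k' l' * (if crit k l + eps i = crit k' l' + eps i0 then 1 else 0) = 0"
      if kl': "k' \<in> {1..n}" "l' \<in> {k'<..n}" for k' l'
    proof (rule ccontr)
      assume "\<not> ?thesis"
      then have nz: "c k' l' \<noteq> 0" and eq: "crit k l + eps i = crit k' l' + eps i0" by (auto split: if_splits)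
      have L: "lookup (crit k l) j + lookup (eps i) j = lookup (crit k' l') j + lookup (eps i0) j" for j
        using arg_cong[OF eq, of "\<lambda>\<alpha>. lookup \<alpha> j"] by (simp only: lookup_add)
      have J': "k' \<notin> J" "l' \<notin> J" using c[OF kl' nz] by auto
      have ne: "k \<noteq> l" "k' \<noteq> l'" using kl kl' by auto
      from J_cases show False
      proof
        assume "J = {} \<and> 1 < m i0"
        then have ev: "even ((2 :: nat) ^ (m i0 - 1))" by simp
        have "even (lookup (crit k l) i0)" "even (lookup (crit k' l') i0)"
          using ev ne by (auto simp: lookup_crit)
        moreover have "lookup (crit k l) i0 = lookup (crit k' l') i0 + 1"
          using L[of i0] False by (simp add: lookup_single)
        ultimately show False by simp
      next
        assume "J = {i \<in> {1..n}. ab i i \<noteq> 0} \<and> (\<forall>j\<in>J. m j = 1)"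
        then have "i \<in> J" using i by blast
        then have "i \<noteq> k'" "i \<noteq> l'" using J' by auto
        then have "lookup (crit k' l') i = 0" using ne by (simp add: lookup_crit)
        then show False using L[of i] False by (simp add: lookup_single)
      qed
    qed
    have "(\<Sum>k'\<in>{1..n}. \<Sum>l'\<in>{k'<..n}. c k' l' * (if crit k l + eps i = crit k' l' + eps i0 then 1 else 0)) = 0"
      by (intro sum.neutral ballI z)
    then show ?thesis unfolding e using False by simp
  qed
qed

lemma crit_zero:
  assumes "\<eta> i \<in> supp_in (dec_rest J i t)" "i \<in> {1..n}" "ab i i \<noteq> 0" "k \<noteq> l" "k \<in> J \<or> l \<in> J"
  shows "dcoeff (\<eta> i) (crit k l) = 0"
proof -
  have "i \<in> J" using J_full[OF assms(2,3)] assms(5) by auto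
  then have "crit k l \<notin> dec_rest J i t"
    using assms(5) two_digit_crit[OF assms(4)] by (auto simp: rest_idx_def keys_crit)
  with assms(1) show ?thesis by (rule supp_inD)
qed

text \<open>Adding an exact form to \<open>\<eta>\<close> prescribes the sums \<open>crit_sum \<eta> k l\<close>: the coefficient of the critical monomial
  at \<open>dx\<^sub>i\<^sub>0\<close> is changed by a square root of the missing amount divided by \<open>ab\<^sub>i\<^sub>0\<^sub>i\<^sub>0\<close>. The assumption on \<open>\<delta>\<close> guarantees that
  this affects only pairs outside \<open>J\<close> and only degrees from \<open>t\<close> on.\<close>

lemma adjust_crit_sum:
  assumes \<eta>: "\<And>i. i \<in> {1..n} \<Longrightarrow> \<eta> i \<in> supp_in (dec_rest J i t)"
    and \<delta>: "\<And>k l. k \<in> {1..n} \<Longrightarrow> l \<in> {1..n} \<Longrightarrow> \<delta> k l \<noteq> 0 \<Longrightarrow> k \<notin> J \<and> l \<notin> J \<and> t \<le> mdeg (crit k l)"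
  shows "\<exists>w. (\<forall>p. pd p w \<in> supp_in (dec_rest J p t)) \<and>
    (\<forall>k l. k \<in> {1..n} \<longrightarrow> l \<in> {k<..n} \<longrightarrow> crit_sum (\<lambda>p. \<eta> p + pd p w) k l = \<delta> k l)"
proof -
  obtain r where r: "\<And>x::'k. r x * r x = x" "r 0 = 0" using square_root_function[OF perfect] by blast
  (* with r 0 = 0 the function c vanishes wherever nothing is to be changed *)
  define c where "c = (\<lambda>k l. r ((\<delta> k l - crit_sum \<eta> k l) / ab i0 i0))"
  have zero: "crit_sum \<eta> k l = 0" if "k \<noteq> l" "k \<in> J \<or> l \<in> J \<or> \<not> t \<le> mdeg (crit k l)" for k l
    unfolding crit_sum_def
  proof (rule sum.neutral, rule ballI)
    fix i assume i: "i \<in> {1..n}"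
    have "dcoeff (\<eta> i) (crit k l) = 0" if "ab i i \<noteq> 0"
    proof (cases "k \<in> J \<or> l \<in> J")
      case True
      show ?thesis by (rule crit_zero[where t = t]; fact \<eta>[OF i] i that \<open>k \<noteq> l\<close> True)
    next
      case False
      then have "crit k l \<notin> dec_rest J i t"
        using \<open>k \<in> J \<or> l \<in> J \<or> \<not> t \<le> mdeg (crit k l)\<close> by (auto simp: dec_idx_def)
      with \<eta>[OF i] show ?thesis by (rule supp_inD)
    qed
    then show "ab i i * (dcoeff (\<eta> i) (crit k l) * dcoeff (\<eta> i) (crit k l)) = 0" by auto
  qed
  have c: "k \<notin> J \<and> l \<notin> J \<and> t \<le> mdeg (crit k l)" if kl: "k \<in> {1..n}" "l \<in> {k<..n}" and nz: "c k l \<noteq> 0" for k l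
  proof (rule ccontr)
    assume n: "\<not> ?thesis"
    have "k \<noteq> l" "l \<in> {1..n}" using kl by auto
    then have "\<delta> k l = 0" "crit_sum \<eta> k l = 0" using n \<delta>[OF kl(1)] zero by blast+
    then have "c k l = 0" unfolding c_def using r(2) by simp
    with nz show False ..
  qed
  have "crit_sum (\<lambda>p. \<eta> p + pd p (bump c)) k l = \<delta> k l" if kl: "k \<in> {1..n}" "l \<in> {k<..n}" for k l
  proof -
    have "crit_sum (\<lambda>p. \<eta> p + pd p (bump c)) k l
      = (\<Sum>i\<in>{1..n}. ab i i * (dcoeff (\<eta> i) (crit k l) * dcoeff (\<eta> i) (crit k l))
          + (if i = i0 then ab i0 i0 * (c k l * c k l) else 0))"
      unfolding crit_sum_def
    proof (rule sum.cong[OF refl])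
      fix i assume i: "i \<in> {1..n}"
      show "ab i i * (dcoeff (\<eta> i + pd i (bump c)) (crit k l) * dcoeff (\<eta> i + pd i (bump c)) (crit k l))
        = ab i i * (dcoeff (\<eta> i) (crit k l) * dcoeff (\<eta> i) (crit k l)) + (if i = i0 then ab i0 i0 * (c k l * c k l) else 0)"
      proof (cases "ab i i = 0")
        case True
        then show ?thesis using i0(2) by auto
      next
        case False
        have "dcoeff (pd i (bump c)) (crit k l) = (if i = i0 then c k l else 0)"
          by (rule bump_crit[OF _ kl i False]) (use c in blast)
        then have d: "dcoeff (\<eta> i + pd i (bump c)) (crit k l) = dcoeff (\<eta> i) (crit k l) + (if i = i0 then c k l else 0)"
          by (simp only: dcoeff_simps(2))
        show ?thesis unfolding d add_square_char2 by (auto simp: distrib_left)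
      qed
    qed
    also have "\<dots> = crit_sum \<eta> k l + ab i0 i0 * (c k l * c k l)"
      using i0(1) by (simp add: sum.distrib crit_sum_def sum.delta)
    also have "\<dots> = \<delta> k l" unfolding c_def r(1) using i0(2) by simp
    finally show ?thesis .
  qed
  moreover have "pd p (bump c) \<in> supp_in (dec_rest J p t)" for p by (rule bump_in) (rule c)
  ultimately show ?thesis by blast
qed

definition target :: "(nat \<Rightarrow> nat \<Rightarrow> 'k) \<Rightarrow> nat \<Rightarrow> nat \<Rightarrow> 'k dps" where
  "target b' k l = dp_const (a k l) + dscale (b' k l) (zf k * zf l)"

text \<open>If the image agrees with the target up to \<open>d\<eta>\<close> with \<open>\<eta>\<close> of degree at least \<open>t\<close>, and up to multiples of \<open>dz\<^sub>k dz\<^sub>l\<close>, then \<open>\<psi>\<close> is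
  changed by \<open>\<eta>\<close>, after adding a differential to \<open>\<eta>\<close> so that its squares cancel these multiples.\<close>

lemma reduction_step:
  assumes \<psi>: "\<And>i. i \<in> {1..n} \<Longrightarrow> \<psi> i \<in> supp_in (dec_rest J i 0)"
    and \<eta>: "\<And>i. i \<in> {1..n} \<Longrightarrow> \<eta> i \<in> supp_in (dec_rest J i t)" and t: "2 \<le> t"
    and \<delta>: "\<And>k l. k \<in> {1..n} \<Longrightarrow> l \<in> {1..n} \<Longrightarrow> \<delta> k l \<noteq> 0 \<Longrightarrow> k \<notin> J \<and> l \<notin> J \<and> t \<le> mdeg (crit k l)"
    and eq: "\<And>k l. k \<in> {1..n} \<Longrightarrow> l \<in> {k<..n} \<Longrightarrow>
      image_coeff \<psi> k l + target b' k l = dform \<eta> k l + dscale (\<delta> k l) (zf k * zf l)"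
  shows "\<exists>\<psi>' \<rho>. (\<forall>i\<in>{1..n}. \<psi>' i \<in> supp_in (dec_rest J i 0)) \<and>
    (\<forall>i\<in>{1..n}. \<rho> i \<in> supp_in (rest_idx J i (Suc t))) \<and>
    (\<forall>k l. k \<in> {1..n} \<longrightarrow> l \<in> {k<..n} \<longrightarrow> image_coeff \<psi>' k l + target b' k l = dform \<rho> k l)"
proof -
  obtain w where w: "\<And>p. pd p w \<in> supp_in (dec_rest J p t)"
    "\<And>k l. k \<in> {1..n} \<Longrightarrow> l \<in> {k<..n} \<Longrightarrow> crit_sum (\<lambda>p. \<eta> p + pd p w) k l = \<delta> k l"
    using adjust_crit_sum[OF \<eta> \<delta>] by blast
  define \<theta> where "\<theta> = (\<lambda>p. \<eta> p + pd p w)"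
  have \<theta>: "\<theta> i \<in> supp_in (dec_rest J i t)" if "i \<in> {1..n}" for i
    unfolding \<theta>_def by (intro supp_in_add \<eta>[OF that] w)
  obtain \<rho> where \<rho>: "\<forall>p\<in>{1..n}. \<rho> p \<in> supp_in (rest_idx J p (Suc t))"
    "\<And>k l. k \<in> {1..n} \<Longrightarrow> l \<in> {1..n} \<Longrightarrow> k \<noteq> l \<Longrightarrow>
      image_coeff (\<lambda>i. \<psi> i + \<theta> i) k l = image_coeff \<psi> k l + dform \<theta> k l + dform \<rho> k l + dscale (crit_sum \<theta> k l) (zf k * zf l)"
    using image_coeff_diff[OF \<psi> \<theta> t] by blast
  have "image_coeff (\<lambda>i. \<psi> i + \<theta> i) k l + target b' k l = dform \<rho> k l" if kl: "k \<in> {1..n}" "l \<in> {k<..n}" for k l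
  proof -
    have d: "dform \<theta> k l = dform \<eta> k l" unfolding \<theta>_def dform_add dform_pd by simp
    have cs: "crit_sum \<theta> k l = \<delta> k l" unfolding \<theta>_def by (rule w(2)[OF kl])
    have "image_coeff (\<lambda>i. \<psi> i + \<theta> i) k l + target b' k l
        = (image_coeff \<psi> k l + target b' k l) + (dform \<eta> k l + dscale (\<delta> k l) (zf k * zf l)) + dform \<rho> k l"
      using \<rho>(2)[of k l] kl d cs by (simp add: ac_simps)
    then show ?thesis unfolding eq[OF kl] by simp
  qed
  moreover have "\<psi> i + \<theta> i \<in> supp_in (dec_rest J i 0)" if "i \<in> {1..n}" for i
    by (intro supp_in_add \<psi>[OF that] supp_in_mono[OF _ \<theta>[OF that]]) (auto simp: dec_idx_def rest_idx_def)
  ultimately show ?thesis using \<rho>(1) by (intro exI[of _ "\<lambda>i. \<psi> i + \<theta> i"] exI[of _ \<rho>]) blast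
qed

text \<open>The coefficients \<open>\<delta>\<close> are nonzero at most in the first step, in degree \<open>2\<close>, where they account for the difference
  of \<open>b\<close> and \<open>b'\<close>. From then on the squares have to produce nothing. Before each further step the
  remainder is made decomposable by \<open>normalise_form\<close>.\<close>

lemma reduction_iterate:
  assumes b': "\<And>k l. k \<in> {1..n} \<Longrightarrow> l \<in> {1..n} \<Longrightarrow> b k l \<noteq> b' k l \<Longrightarrow> k \<notin> J \<and> l \<notin> J"
    and t: "3 \<le> t"
  shows "\<exists>\<psi> \<rho>. (\<forall>i\<in>{1..n}. \<psi> i \<in> supp_in (dec_rest J i 0)) \<and>
    (\<forall>i\<in>{1..n}. \<rho> i \<in> supp_in (rest_idx J i t)) \<and>
    (\<forall>k l. k \<in> {1..n} \<longrightarrow> l \<in> {k<..n} \<longrightarrow> image_coeff \<psi> k l + target b' k l = dform \<rho> k l)"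
  using t
proof (induction t rule: dec_induct)
  case base
  have \<phi>2: "\<phi> i \<in> supp_in (dec_rest J i 2)" if "i \<in> {1..n}" for i
    using \<phi>[OF that] dec_idx_2 by (intro supp_in_mono[OF _ \<phi>[OF that]]) (auto simp: rest_idx_def dec_idx_def)
  have "image_coeff (\<lambda>_. 0) k l + target b' k l = dform \<phi> k l + dscale (b k l - b' k l) (zf k * zf l)"
    if kl: "k \<in> {1..n}" "l \<in> {k<..n}" for k l
  proof -
    have "form_coeff a \<phi> b i j \<in> A" if "i \<in> {1..n}" "j \<in> {1..n}" for i j
      unfolding form_coeff_def dform_def using that
      by (intro A_add A_const A_dscale A_times zf_in_A A_pd dec_in_A[OF \<phi>_dec])
    then have "pullback (\<lambda>_. 0) (form_coeff a \<phi> b) k l = form_coeff a \<phi> b k l"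
      using kl by (intro pullback_zero) auto
    moreover have "lift (\<lambda>_. 0) = (\<lambda>_. 0)" by (simp add: fun_eq_iff lift_def dscale_def)
    ultimately have "image_coeff (\<lambda>_. 0) k l = form_coeff a \<phi> b k l" by (simp add: image_coeff_def)
    moreover have "form_coeff a \<phi> b k l + target b' k l
        = (dp_const (a k l) + dp_const (a k l)) + dform \<phi> k l + (dscale (b k l) (zf k * zf l) + dscale (b' k l) (zf k * zf l))"
      unfolding form_coeff_def target_def by (simp only: ac_simps)
    moreover have "dscale (b k l) (zf k * zf l) + dscale (b' k l) (zf k * zf l) = dscale (b k l - b' k l) (zf k * zf l)"
      by (rule dps_eqI) (simp add: minus_CHAR_2[OF char2] distrib_right)
    ultimately show ?thesis by simp
  qed
  moreover have "k \<notin> J \<and> l \<notin> J \<and> 2 \<le> mdeg (crit k l)" if "k \<in> {1..n}" "l \<in> {1..n}" "b k l - b' k l \<noteq> 0" for k l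
  proof -
    have "(1 :: nat) \<le> 2 ^ (m k - 1)" "(1 :: nat) \<le> 2 ^ (m l - 1)" by simp_all
    then have "2 \<le> mdeg (crit k l)" unfolding crit_def mdeg_add mdeg_single by linarith
    then show ?thesis using b'[of k l] that by auto
  qed
  ultimately show ?case
    using reduction_step[of "\<lambda>_. 0" \<phi> 2 "\<lambda>k l. b k l - b' k l" b'] \<phi>2 by simp
next
  case (step t)
  then obtain \<psi> \<rho> where I: "\<And>i. i \<in> {1..n} \<Longrightarrow> \<psi> i \<in> supp_in (dec_rest J i 0)"
    "\<And>i. i \<in> {1..n} \<Longrightarrow> \<rho> i \<in> supp_in (rest_idx J i t)"
    "\<And>k l. k \<in> {1..n} \<Longrightarrow> l \<in> {k<..n} \<Longrightarrow> image_coeff \<psi> k l + target b' k l = dform \<rho> k l"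
    by blast
  have t2: "2 \<le> t" using step by simp
  define \<eta> where "\<eta> = (\<lambda>p. \<rho> p + pd p (fill \<rho>))"
  have \<eta>: "\<eta> i \<in> supp_in (dec_rest J i t)" if "i \<in> {1..n}" for i
    unfolding \<eta>_def by (rule normalise_form[OF I(2) t2 J_sub J_height that])
  have z: "dscale 0 f = 0" for f :: "'k dps" by (rule dps_eqI) simp
  have "image_coeff \<psi> k l + target b' k l = dform \<eta> k l + dscale 0 (zf k * zf l)" if "k \<in> {1..n}" "l \<in> {k<..n}" for k l
    unfolding I(3)[OF that] \<eta>_def dform_add dform_pd z by simp
  then show ?case by (intro reduction_step[OF I(1) \<eta> t2, of "\<lambda>_ _. 0" b']) auto
qed

text \<open>The iteration ends because the algebra is finite-dimensional: for large \<open>t\<close> no monomials are left.\<close>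

theorem reduction:
  assumes b': "\<And>k l. k \<in> {1..n} \<Longrightarrow> l \<in> {1..n} \<Longrightarrow> b k l \<noteq> b' k l \<Longrightarrow> k \<notin> J \<and> l \<notin> J"
    and b'_sym: "\<And>k l. b' k l = b' l k" and b'_diag: "\<And>k. b' k k = 0"
  shows "\<exists>g. dec_family g \<and> (\<forall>k\<in>{1..n}. \<forall>l\<in>{1..n}. pullback g (form_coeff a \<phi> b) k l = target b' k l)"
proof -
  (* a bound for all degrees in the box, and large enough for reduction_iterate *)
  define t where "t = (\<Sum>i\<in>{1..n}. 2 ^ m i) + (3 :: nat)"
  have t3: "3 \<le> t" by (simp add: t_def)
  obtain \<psi> \<rho> where \<psi>: "\<And>i. i \<in> {1..n} \<Longrightarrow> \<psi> i \<in> supp_in (dec_rest J i 0)"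
    and \<rho>: "\<And>i. i \<in> {1..n} \<Longrightarrow> \<rho> i \<in> supp_in (rest_idx J i t)"
    and eq: "\<And>k l. k \<in> {1..n} \<Longrightarrow> l \<in> {k<..n} \<Longrightarrow> image_coeff \<psi> k l + target b' k l = dform \<rho> k l"
    using reduction_iterate[where t = t and b' = b', OF b' t3] by blast
  have empty: "rest_idx J i t = {}" for i
  proof -
    have "mdeg \<alpha> < t" if "\<alpha> \<in> box n m" for \<alpha>
    proof -
      have "mdeg \<alpha> = (\<Sum>i\<in>{1..n}. lookup \<alpha> i)" using that by (intro mdeg_superset) (auto simp: box_def)
      also have "\<dots> \<le> (\<Sum>i\<in>{1..n}. 2 ^ m i)" using that by (intro sum_mono less_imp_le) (simp add: box_def)
      finally show ?thesis by (simp add: t_def)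
    qed
    then show ?thesis by (fastforce simp: rest_idx_def)
  qed
  have \<rho>0: "\<rho> i = 0" if "i \<in> {1..n}" for i
    using \<rho>[OF that] unfolding empty by (intro dps_eqI) (simp add: supp_in_def)
  have g: "dec_family (lift \<psi>)" by (rule lift_family[OF \<psi>])
  have up: "image_coeff \<psi> k l = target b' k l" if kl: "k \<in> {1..n}" "l \<in> {k<..n}" for k l
  proof -
    have "l \<in> {1..n}" using kl by auto
    then have "image_coeff \<psi> k l + target b' k l = 0" unfolding eq[OF kl] dform_def using \<rho>0 kl(1) by (simp add: pd_linear)
    then have "image_coeff \<psi> k l - target b' k l = 0" unfolding dminus .
    then show ?thesis by simp
  qed
  have fc_sym: "form_coeff a \<phi> b i j = form_coeff a \<phi> b j i" for i j
    unfolding form_coeff_def dform_sym[of \<phi> i j] a_sym[of i j] b_sym[of i j] by (simp only: mult.commute)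
  have z: "dscale 0 f = 0" for f :: "'k dps" by (rule dps_eqI) simp
  have fc_diag: "form_coeff a \<phi> b i i = dp_const (a i i)" for i
    unfolding form_coeff_def dform_def b_diag z by simp
  have diag: "image_coeff \<psi> k k = target b' k k" if "k \<in> {1..n}" for k
    unfolding image_coeff_def target_def b'_diag z using pullback_diag[where w = "form_coeff a \<phi> b" and a = "\<lambda>i. a i i", OF fc_sym fc_diag g that] by simp
  have image_sym: "image_coeff \<psi> k l = image_coeff \<psi> l k" for k l
    unfolding image_coeff_def pullback_def
    by (subst sum.swap) (simp only: fc_sym[of _ _] ac_simps cong: sum.cong)
  have "image_coeff \<psi> k l = target b' k l" if "k \<in> {1..n}" "l \<in> {1..n}" for k l
  proof -
    consider "k < l" | "k = l" | "l < k" by linarith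
    then show ?thesis
    proof cases
      case 1
      then show ?thesis using up that by simp
    next
      case 2
      then show ?thesis using diag that by simp
    next
      case 3
      have "target b' k l = target b' l k"
        unfolding target_def a_sym[of k l] b'_sym[of k l] by (simp only: mult.commute)
      then show ?thesis using up[of l k] that 3 image_sym[of k l] by simp
    qed
  qed
  then show ?thesis using g unfolding image_coeff_def by blast
qed

end

section \<open>The algebra of a flag\<close>

lemma (in vector_space) representation_coordinated:
  assumes "independent B" "B' \<subseteq> B" "v \<in> span B'" "representation B v b \<noteq> 0"
  shows "b \<in> B'"
proof -
  have "representation B v = representation B' v"
    by (rule representation_extend) (use assms in auto)
  then show ?thesis using assms(4) representation_ne_zero[of B' v b] by simp
qed

lemma flag_mono:
  assumes "is_flag sc s Fl" "i \<le> j" "j \<le> Suc s" shows "Fl j \<subseteq> Fl i"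
  using assms(2,3)
proof (induction j rule: dec_induct)
  case (step k)
  then have "k \<le> s" by simp
  then have "Fl (Suc k) \<subseteq> Fl k" using assms(1) by (simp add: is_flag_def)
  with step show ?case by simp
qed simp

lemma height_props:
  assumes E: "vector_space sc" and F: "is_flag sc s Fl" and B: "coordinated_basis sc s Fl n x" and i: "i \<in> {1..n}"
  shows "0 < height Fl x i" "height Fl x i \<le> Suc s" "\<And>j. j \<le> Suc s \<Longrightarrow> x i \<in> Fl j \<longleftrightarrow> j < height Fl x i"
proof -
  interpret vector_space sc by fact
  have "\<not> module.dependent sc (x ` {1..n})" using B by (simp add: coordinated_basis_def is_basis_of_def)
  then have "0 \<notin> x ` {1..n}" using dependent_zero by blast
  then have "x i \<noteq> 0" using i by (metis image_eqI)
  then have out: "x i \<notin> Fl (Suc s)" using F by (simp add: is_flag_def)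
  have in0: "x i \<in> Fl 0" using F by (simp add: is_flag_def)
  have nh: "x i \<notin> Fl (height Fl x i)" unfolding height_def by (rule LeastI[of "\<lambda>j. x i \<notin> Fl j", OF out])
  show "height Fl x i \<le> Suc s" unfolding height_def by (rule Least_le) (rule out)
  show "0 < height Fl x i" using nh in0 by (metis neq0_conv)
  fix j assume j: "j \<le> Suc s"
  show "x i \<in> Fl j \<longleftrightarrow> j < height Fl x i"
  proof
    assume "x i \<in> Fl j"
    show "j < height Fl x i"
    proof (rule ccontr)
      assume "\<not> j < height Fl x i"
      then have "Fl j \<subseteq> Fl (height Fl x i)" using j by (intro flag_mono[OF F]) auto
      then show False using nh \<open>x i \<in> Fl j\<close> by blast
    qed
  next
    assume "j < height Fl x i"
    then show "x i \<in> Fl j" unfolding height_def using not_less_Least by blast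
  qed
qed

lemma zero_in_gen_subalgebra: "0 \<in> gen_subalgebra G"
proof -
  have "0 = dp_const 0" by (rule dps_eqI) simp
  then show ?thesis using gen_subalgebra.intros(1) by metis
qed

lemma mdeg_sum_mset_one: "(\<And>\<alpha>. \<alpha> \<in># M \<Longrightarrow> mdeg \<alpha> = 1) \<Longrightarrow> mdeg (\<Sum>\<^sub># M) = size M"
  by (induction M) (auto simp: One_nat_def)

text \<open>The divided power \<open>u\<^bsup>(q)\<^esup>\<close>, \<open>q = 2\<^sup>j\<close>, of \<open>u \<in> E\<^sub>j\<close> involves only variables of height greater than \<open>j\<close>, with
  exponents at most \<open>q\<close>, and so lies in the span of the box; the span is closed under products as there are no
  carries into the digit \<open>m\<^sub>i\<close>. Conversely the binary expansion of the exponents writes each monomial in the box as a product of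
  generators \<open>x\<^sub>i\<^bsup>(q)\<^esup>\<close>.\<close>

theorem O_flag_eq:
  fixes sc :: "'k::field \<Rightarrow> 'e::ab_group_add \<Rightarrow> 'e"
  assumes c2: "CHAR('k) = 2" and E: "vector_space sc" and F: "is_flag sc s Fl" and B: "coordinated_basis sc s Fl n x"
  shows "O_flag sc s Fl n x = supp_in (box n (height Fl x))"
proof -
  interpret vector_space sc by fact
  let ?m = "height Fl x" and ?X = "x ` {1..n}"
  let ?G = "{dpow (2 ^ j) (embedE sc n x u) | j u. j \<le> s \<and> u \<in> Fl j}"
  note hp = height_props[OF E F B]
  have ind: "\<not> dependent ?X" and inj: "inj_on x {1..n}"
    using B by (simp_all add: coordinated_basis_def is_basis_of_def)
  interpret T: truncated_dp_algebra n ?m "supp_in (box n ?m) :: 'k dps set"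
    by unfold_locales (auto simp: c2 hp(1))
  have gens: "g \<in> supp_in (box n ?m)" if gG: "g \<in> ?G" for g
  proof -
    obtain j u where ju: "g = dpow (2 ^ j) (embedE sc n x u)" "j \<le> s" "u \<in> Fl j" using gG by blast
    have sp: "u \<in> span (?X \<inter> Fl j)" using B ju by (simp add: coordinated_basis_def is_basis_of_def)
    have low: "\<exists>i\<in>{1..n}. \<alpha> = eps i \<and> j < ?m i" if nz: "dcoeff (embedE sc n x u) \<alpha> \<noteq> 0" for \<alpha>
    proof -
      have "dcoeff (embedE sc n x u) \<alpha> = (\<Sum>i\<in>{1..n}. representation ?X u (x i) * (if \<alpha> = eps i then 1 else 0))"
        by (simp add: embedE_def)
      with nz have "(\<Sum>i\<in>{1..n}. representation ?X u (x i) * (if \<alpha> = eps i then 1 else 0)) \<noteq> 0" by simp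
      then obtain i where i: "i \<in> {1..n}" "representation ?X u (x i) * (if \<alpha> = eps i then 1 else 0) \<noteq> 0"
        by (rule sum.not_neutral_contains_not_neutral)
      then have "\<alpha> = eps i" "representation ?X u (x i) \<noteq> 0" by (auto split: if_splits)
      then have "x i \<in> ?X \<inter> Fl j" using representation_coordinated[OF ind _ sp] by blast
      then show ?thesis using hp(3)[OF i(1), of j] ju(2) i(1) \<open>\<alpha> = eps i\<close> by auto
    qed
    show ?thesis unfolding supp_in_def
    proof (intro CollectI allI impI)
      fix \<beta> assume "dcoeff g \<beta> \<noteq> 0"
      then have nz: "dcoeff (dpow (2 ^ j) (embedE sc n x u)) \<beta> \<noteq> 0" unfolding ju(1) .
      have "\<exists>M\<in>dpow_msets (2 ^ j) \<beta>. \<forall>\<alpha>\<in>#M. dcoeff (embedE sc n x u) \<alpha> \<noteq> 0"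
        by (rule dcoeff_dpow_nonzeroE[OF nz]) blast
      then obtain M where M: "size M = 2 ^ j" "\<Sum>\<^sub># M = \<beta>" "\<forall>\<alpha>\<in>#M. dcoeff (embedE sc n x u) \<alpha> \<noteq> 0"
        by (auto simp: dpow_msets_def)
      then have M': "\<exists>i\<in>{1..n}. \<alpha> = eps i \<and> j < ?m i" if "\<alpha> \<in># M" for \<alpha> using low that by blast
      have "mdeg \<beta> = 2 ^ j"
        unfolding M(1)[symmetric] M(2)[symmetric] by (rule mdeg_sum_mset_one) (auto dest!: M')
      moreover have "lookup \<beta> i \<le> mdeg \<beta>" for i
        unfolding mdeg_def by (cases "i \<in> keys \<beta>") (auto intro: member_le_sum simp: in_keys_iff)
      ultimately have le: "lookup \<beta> i \<le> 2 ^ j" for i by simp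
      have k: "i \<in> {1..n} \<and> j < ?m i" if "i \<in> keys \<beta>" for i
      proof -
        have "i \<in> (\<Union>\<alpha>\<in>set_mset M. keys \<alpha>)" using that unfolding M(2)[symmetric] keys_sum_mset .
        then obtain \<alpha> where "\<alpha> \<in># M" "i \<in> keys \<alpha>" by blast
        then show ?thesis using M'[of \<alpha>] by (auto split: if_splits)
      qed
      have "lookup \<beta> i < 2 ^ ?m i" for i
      proof (cases "i \<in> keys \<beta>")
        case True
        then have "(2 :: nat) ^ j < 2 ^ ?m i" using k by (intro power_strict_increasing) auto
        then show ?thesis using le[of i] by linarith
      qed (simp add: in_keys_iff)
      then show "\<beta> \<in> box n ?m" using k by (auto simp: box_def)
    qed
  qed
  have "f \<in> supp_in (box n ?m)" if "f \<in> gen_subalgebra ?G" for f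
    using that by induction (auto intro: T.A_const gens T.A_add T.A_times)
  moreover have "f \<in> gen_subalgebra ?G" if f: "f \<in> supp_in (box n ?m)" for f
  proof -
    have pow2: "xpow i (2 ^ e) \<in> gen_subalgebra ?G" if i: "i \<in> {1..n}" and e: "e < ?m i" for i e
    proof -
      have "embedE sc n x (x i) = xpow i 1"
      proof -
        have "x i \<in> ?X" using i by (rule imageI)
        then have rb: "representation ?X (x i) = (\<lambda>v. if v = x i then 1 else 0)"
          by (rule representation_basis[OF ind])
        have "representation ?X (x i) (x j) = (if j = i then 1 else 0)" if "j \<in> {1..n}" for j
          unfolding rb inj_on_eq_iff[OF inj that i] ..
        then have "embedE sc n x (x i) = (\<Sum>j\<in>{1..n}. if j = i then xpow i 1 else 0)"
          unfolding embedE_def by (intro sum.cong refl dps_eqI) auto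
        then show ?thesis using i by (simp add: sum.delta)
      qed
      then have "xpow i (2 ^ e) = dpow (2 ^ e) (embedE sc n x (x i))" by (simp only: dpow_xpow_1)
      moreover have "e \<le> s" "x i \<in> Fl e" using e hp(2)[OF i] hp(3)[OF i, of e] by auto
      ultimately show ?thesis by (intro gen_subalgebra.intros(2)) blast
    qed
    have xp: "xpow i a \<in> gen_subalgebra ?G" if i: "i \<in> {1..n}" and a: "a < 2 ^ ?m i" for i a
      using a
    proof (induction a rule: less_induct)
      case (less a)
      show ?case
      proof (cases "a = 0")
        case True
        then show ?thesis using gen_subalgebra.intros(1)[of 1 ?G] by (simp flip: one_dps_def)
      next
        case False
        show ?thesis
        proof (cases "\<exists>e. a = 2 ^ e")
          case True
          then obtain e where e: "a = 2 ^ e" by blast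
          with less.prems have "e < ?m i" by simp
          then show ?thesis unfolding e by (rule pow2[OF i])
        next
          case nopow: False
          obtain b c where bc: "b > 0" "c > 0" "a = b + c" "no_carry b c"
            using no_carry_split[of a] False nopow by blast
          have "xpow i b \<in> gen_subalgebra ?G" "xpow i c \<in> gen_subalgebra ?G"
            using bc less.prems by (intro less.IH; simp)+
          moreover have "xpow i a = xpow i b * (xpow i c :: 'k dps)"
            unfolding bc(3) using bc(4) by (simp add: dmon_times_char2[OF c2] mno_carry_single single_add)
          ultimately show ?thesis by (simp add: gen_subalgebra.intros(4))
        qed
      qed
    qed
    have mon: "dmon \<alpha> \<in> gen_subalgebra ?G" if \<alpha>: "\<alpha> \<in> box n ?m" for \<alpha>
    proof -
      have one: "(1 :: 'k dps) \<in> gen_subalgebra ?G" using gen_subalgebra.intros(1)[of 1 ?G] by (simp only: one_dps_def)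
      have "(\<Prod>i\<in>S. xpow i (lookup \<alpha> i)) \<in> gen_subalgebra ?G" if "S \<subseteq> {1..n}" for S
        using finite_subset[OF that finite_atLeastAtMost] that
      proof (induction S rule: finite_induct)
        case (insert i S)
        then have "xpow i (lookup \<alpha> i) \<in> gen_subalgebra ?G" using \<alpha> by (intro xp) (auto simp: box_def)
        then show ?case using insert by (simp add: gen_subalgebra.intros(4))
      qed (simp add: one)
      from this[OF order_refl] show ?thesis
        using T.ypow_x[OF T.keys_box[OF \<alpha>]] by (simp add: ypow_def dpow_xpow_1)
    qed
    have "finite (box n ?m)" by (rule finite_box)
    then show ?thesis using f
    proof (induction f rule: supp_in_induct)
      case zero
      show ?case by (rule zero_in_gen_subalgebra)
    next
      case (add f \<alpha> c)
      have "dscale c (dmon \<alpha>) \<in> gen_subalgebra ?G"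
        unfolding dscale_def by (intro gen_subalgebra.intros(4) gen_subalgebra.intros(1) mon add.hyps)
      with add.IH show ?case by (rule gen_subalgebra.intros(3))
    qed
  qed
  ultimately show ?thesis unfolding O_flag_def by blast
qed

section \<open>Forms and their coefficients\<close>

text \<open>For \<open>i = j\<close> this is the coefficient at the divided square \<open>dx\<^sub>i\<^bsup>(2)\<^esup>\<close>.\<close>

definition fcoeff :: "'a::comm_ring_1 form \<Rightarrow> nat \<Rightarrow> nat \<Rightarrow> 'a dps" where
  "fcoeff \<omega> i j = dcoeff \<omega> (eps i + eps j)"

lemma fcoeff_sym: "fcoeff \<omega> i j = fcoeff \<omega> j i"
  by (simp add: fcoeff_def add.commute)

lemma eps_inj: "eps i = eps j \<longleftrightarrow> i = j"
proof
  assume "eps i = eps j"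
  then have "keys (eps i) = keys (eps j)" by simp
  then show "i = j" by simp
qed simp

lemma eps_pair_eq: "eps i + eps j = eps k + eps l \<longleftrightarrow> i = k \<and> j = l \<or> i = l \<and> j = k"
proof
  assume e: "eps i + eps j = eps k + eps l"
  have "i \<in> keys (eps k + eps l)" unfolding e[symmetric] by (simp add: keys_add_mindex)
  then have "i = k \<or> i = l" by (auto simp: keys_add_mindex)
  then show "i = k \<and> j = l \<or> i = l \<and> j = k"
  proof
    assume "i = k"
    then have "eps j = eps l" using e by simp
    then show ?thesis using \<open>i = k\<close> eps_inj by blast
  next
    assume "i = l"
    then have "eps j = eps k" using e by (simp add: add.commute)
    then show ?thesis using \<open>i = l\<close> eps_inj by blast
  qed
qed (auto simp: add.commute)

lemma mno_carry_eps: "mno_carry (eps k) (eps l) \<longleftrightarrow> k \<noteq> l"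
  by (auto simp: mno_carry_single lookup_single when_def One_nat_def)

lemma fcoeff_dx_times:
  assumes "CHAR('a::comm_ring_1) = 2"
  shows "fcoeff (dx i * F :: 'a form) k l = (if k = l then 0 else if i = k then dcoeff F (eps l)
    else if i = l then dcoeff F (eps k) else 0)"
proof -
  have c: "(of_nat (mchoose (eps k + eps l) (eps k)) :: 'a dps) = (if k \<noteq> l then 1 else 0)" for k l
    using odd_mchoose[of "eps k" "eps l"] mno_carry_eps[of k l] by (simp add: of_nat_char2[OF char2_dps[OF assms]])
  have a: "fcoeff (dx k * F :: 'a form) k l = (if k \<noteq> l then dcoeff F (eps l) else 0)" for k l
    unfolding fcoeff_def dcoeff_times_dmon c by simp
  have z: "fcoeff (dx i * F :: 'a form) k l = 0" if "i \<noteq> k" "i \<noteq> l"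
    unfolding fcoeff_def
  proof (rule dcoeff_times_dmon_0, rule notI)
    fix \<beta> assume "eps k + eps l = eps i + \<beta>"
    then have "i \<in> keys (eps k + eps l)" by (simp add: keys_add_mindex)
    then show False using that by (simp add: keys_add_mindex)
  qed
  show ?thesis
  proof (cases "i = k \<or> i = l")
    case True
    then show ?thesis using a[of k l] a[of l k] fcoeff_sym[of "dx i * F" k l] by auto
  next
    case False
    then show ?thesis using z by auto
  qed
qed

lemma fcoeff_diff_form:
  assumes "CHAR('a::comm_ring_1) = 2" "k \<in> {1..n}" "l \<in> {1..n}"
  shows "fcoeff (diff_form n (\<phi> :: 'a form)) k l = pd k (dcoeff \<phi> (eps l)) + pd l (dcoeff \<phi> (eps k))"
proof -
  let ?P = "\<lambda>i. pd i (dcoeff \<phi> (eps l))" and ?Q = "\<lambda>i. pd i (dcoeff \<phi> (eps k))"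
  have "fcoeff (diff_form n \<phi>) k l = (\<Sum>i\<in>{1..n}. fcoeff (dx i * Abs_dps (\<lambda>\<gamma>. pd i (dcoeff \<phi> \<gamma>))) k l)"
    by (simp add: diff_form_def fcoeff_def)
  also have "\<dots> = (\<Sum>i\<in>{1..n}. (if i = k then if k = l then 0 else ?P k else 0) + (if i = l then if k = l then 0 else ?Q l else 0))"
    by (rule sum.cong[OF refl]) (simp add: fcoeff_dx_times[OF assms(1)])
  also have "\<dots> = (if k = l then 0 else ?P k + ?Q l)" using assms(2,3) by (simp add: sum.distrib sum.delta)
  also have "\<dots> = ?P k + ?Q l" using add_self_char2[OF char2_dps[OF assms(1)]] by simp
  finally show ?thesis .
qed

lemma kscale_dz_dz:
  assumes "i \<noteq> j" "CHAR('a::comm_ring_1) = 2"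
  shows "kscale c (dz m i * dz m j :: 'a form)
    = dscale (dscale c (xpow i (2 ^ m i - 1) * xpow j (2 ^ m j - 1))) (dmon (eps i + eps j))"
proof -
  have "dx i * dx j = (dmon (eps i + eps j) :: 'a form)"
    using assms by (simp add: dmon_times_char2[OF char2_dps] mno_carry_eps)
  then have e: "dz m i * dz m j = dscale (xpow i (2 ^ m i - 1) * xpow j (2 ^ m j - 1)) (dmon (eps i + eps j) :: 'a form)"
    unfolding dz_def dscale_mult[symmetric] by (intro dps_eqI) (simp add: ac_simps)
  show ?thesis unfolding kscale_def e unfolding dscale_def[of c] by (rule dps_eqI) (simp only: dcoeff_dscale mult.assoc)
qed

section \<open>Conjugacy\<close>

context truncated_dp_algebra
begin

lemma W_memD:
  assumes "D \<in> W n A"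
  obtains d where "\<And>i. i \<in> {1..n} \<Longrightarrow> d i \<in> A" "D = (\<lambda>f. \<Sum>i\<in>{1..n}. d i * pd i f)"
  using assms unfolding W_def by blast

lemma W_in_A:
  assumes D: "D \<in> W n A" and f: "f \<in> A" shows "D f \<in> A"
proof -
  obtain d where d: "\<And>i. i \<in> {1..n} \<Longrightarrow> d i \<in> A" "D = (\<lambda>f. \<Sum>i\<in>{1..n}. d i * pd i f)"
    using D by (rule W_memD) blast
  have "(\<Sum>i\<in>{1..n}. d i * pd i f) \<in> A"
    by (rule A_sum, rule A_times, erule d(1), rule A_pd, rule f)
  then show ?thesis unfolding d(2) .
qed

lemma W_x:
  assumes "i \<in> {1..n}" "D = (\<lambda>f. \<Sum>i\<in>{1..n}. d i * pd i f)" shows "D (xpow i 1) = (d i :: 'k dps)"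
proof -
  have "D (xpow i 1) = (\<Sum>j\<in>{1..n}. if j = i then d j else 0)"
    unfolding assms(2) by (rule sum.cong[OF refl]) (simp add: pd_x)
  then show ?thesis using assms(1) by (simp add: sum.delta)
qed

text \<open>With \<open>D = \<Sum>\<^sub>k d\<^sub>k \<partial>\<^sub>k\<close> one has \<open>\<sigma>((\<sigma>\<^bsup>-1\<^esup> D \<sigma>) x\<^sub>i) = D (\<sigma> x\<^sub>i) = \<Sum>\<^sub>k d\<^sub>k \<partial>\<^sub>k (x\<^sub>i + g\<^sub>i)\<close>, so the matrix of the image form is obtained from that of \<open>\<omega>\<close> by
  applying \<open>\<sigma>\<close> and multiplying with the Jacobian matrix from both sides.\<close>

lemma acts_to_pullback:
  assumes g: "dec_family g" and \<omega>: "\<And>i j. i \<in> {1..n} \<Longrightarrow> j \<in> {1..n} \<Longrightarrow> fcoeff \<omega> i j \<in> A"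
    and \<omega>': "\<omega>' \<in> SOmega n A 2"
    and eq: "\<And>k l. k \<in> {1..n} \<Longrightarrow> l \<in> {1..n} \<Longrightarrow> pullback g (fcoeff \<omega>) k l = fcoeff \<omega>' k l"
  shows "acts_to n A (subst_dps n (yy g)) \<omega> \<omega>'"
  unfolding acts_to_def
proof (intro conjI ballI \<omega>')
  let ?\<sigma> = "subst_dps n (yy g)"
  let ?\<tau> = "the_inv_into A ?\<sigma>"
  fix D D' assume D: "D \<in> W n A" and D': "D' \<in> W n A"
  obtain d where d: "\<And>i. i \<in> {1..n} \<Longrightarrow> d i \<in> A" "D = (\<lambda>f. \<Sum>i\<in>{1..n}. d i * pd i f)"
    using D by (rule W_memD) blast
  obtain d' where d': "\<And>i. i \<in> {1..n} \<Longrightarrow> d' i \<in> A" "D' = (\<lambda>f. \<Sum>i\<in>{1..n}. d' i * pd i f)"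
    using D' by (rule W_memD) blast
  have bij: "bij_betw ?\<sigma> A A" using subst_algebra_aut_A[OF g] by (simp add: algebra_aut_def)
  have inv: "?\<sigma> (?\<tau> f) = f" "?\<tau> f \<in> A" if "f \<in> A" for f
    using bij that f_the_inv_into_f_bij_betw[OF bij] bij_betwE[OF bij_betw_the_inv_into[OF bij]] by auto
  have X: "(?\<tau> \<circ> D \<circ> ?\<sigma>) (xpow i 1) = ?\<tau> (D (yy g i))" "(?\<tau> \<circ> D' \<circ> ?\<sigma>) (xpow i 1) = ?\<tau> (D' (yy g i))"
    if "i \<in> {1..n}" for i using subst_x[OF g that] by (simp_all only: o_apply)
  have DA: "D (yy g i) \<in> A" "D' (yy g i) \<in> A" if "i \<in> {1..n}" for i
    using W_in_A[OF D yy_in_A[OF g that]] W_in_A[OF D' yy_in_A[OF g that]] by auto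
  have "?\<sigma> (eval2 n \<omega> (?\<tau> \<circ> D \<circ> ?\<sigma>) (?\<tau> \<circ> D' \<circ> ?\<sigma>))
      = ?\<sigma> (\<Sum>i\<in>{1..n}. \<Sum>j\<in>{1..n}. fcoeff \<omega> i j * ?\<tau> (D (yy g i)) * ?\<tau> (D' (yy g j)))"
    unfolding eval2_def fcoeff_def by (intro arg_cong[of _ _ ?\<sigma>] sum.cong refl) (simp only: X)
  also have "\<dots> = (\<Sum>i\<in>{1..n}. \<Sum>j\<in>{1..n}. ?\<sigma> (fcoeff \<omega> i j) * D (yy g i) * D' (yy g j))"
    unfolding subst_sum
  proof (intro sum.cong refl)
    fix i j assume ij: "i \<in> {1..n}" "j \<in> {1..n}"
    show "?\<sigma> (fcoeff \<omega> i j * ?\<tau> (D (yy g i)) * ?\<tau> (D' (yy g j))) = ?\<sigma> (fcoeff \<omega> i j) * D (yy g i) * D' (yy g j)"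
      using \<omega>[OF ij] inv[OF DA(1)[OF ij(1)]] inv[OF DA(2)[OF ij(2)]]
      by (simp add: subst_times[OF g] A_subset_Ohat A_times)
  qed
  also have "\<dots> = (\<Sum>i\<in>{1..n}. \<Sum>j\<in>{1..n}. \<Sum>k\<in>{1..n}. \<Sum>l\<in>{1..n}.
      ?\<sigma> (fcoeff \<omega> i j) * pd k (yy g i) * pd l (yy g j) * (d k * d' l))"
    unfolding d(2) d'(2) by (simp add: sum_distrib_left sum_distrib_right ac_simps)
  also have "\<dots> = (\<Sum>i\<in>{1..n}. \<Sum>k\<in>{1..n}. \<Sum>j\<in>{1..n}. \<Sum>l\<in>{1..n}.
      ?\<sigma> (fcoeff \<omega> i j) * pd k (yy g i) * pd l (yy g j) * (d k * d' l))"
    by (intro sum.cong refl sum.swap)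
  also have "\<dots> = (\<Sum>k\<in>{1..n}. \<Sum>i\<in>{1..n}. \<Sum>j\<in>{1..n}. \<Sum>l\<in>{1..n}.
      ?\<sigma> (fcoeff \<omega> i j) * pd k (yy g i) * pd l (yy g j) * (d k * d' l))"
    by (rule sum.swap)
  also have "\<dots> = (\<Sum>k\<in>{1..n}. \<Sum>i\<in>{1..n}. \<Sum>l\<in>{1..n}. \<Sum>j\<in>{1..n}.
      ?\<sigma> (fcoeff \<omega> i j) * pd k (yy g i) * pd l (yy g j) * (d k * d' l))"
    by (intro sum.cong refl sum.swap)
  also have "\<dots> = (\<Sum>k\<in>{1..n}. \<Sum>l\<in>{1..n}. \<Sum>i\<in>{1..n}. \<Sum>j\<in>{1..n}.
      ?\<sigma> (fcoeff \<omega> i j) * pd k (yy g i) * pd l (yy g j) * (d k * d' l))"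
    by (intro sum.cong refl sum.swap)
  also have "\<dots> = (\<Sum>k\<in>{1..n}. \<Sum>l\<in>{1..n}. pullback g (fcoeff \<omega>) k l * (d k * d' l))"
    unfolding pullback_def sum_distrib_right ..
  also have "\<dots> = eval2 n \<omega>' D D'"
    unfolding eval2_def
  proof (intro sum.cong refl)
    fix k l assume kl: "k \<in> {1..n}" "l \<in> {1..n}"
    show "pullback g (fcoeff \<omega>) k l * (d k * d' l) = dcoeff \<omega>' (eps k + eps l) * D (xpow k 1) * D' (xpow l 1)"
      unfolding eq[OF kl] W_x[OF kl(1) d(2)] W_x[OF kl(2) d'(2)] fcoeff_def by (simp only: mult.assoc)
  qed
  finally show "eval2 n \<omega>' D D' = ?\<sigma> (eval2 n \<omega> (?\<tau> \<circ> D \<circ> ?\<sigma>) (?\<tau> \<circ> D' \<circ> ?\<sigma>))" by simp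
qed

lemma G'_conjugate_pullback:
  assumes "dec_family g" "\<And>i j. i \<in> {1..n} \<Longrightarrow> j \<in> {1..n} \<Longrightarrow> fcoeff \<omega> i j \<in> A" "\<omega>' \<in> SOmega n A 2"
    "\<And>k l. k \<in> {1..n} \<Longrightarrow> l \<in> {1..n} \<Longrightarrow> pullback g (fcoeff \<omega>) k l = fcoeff \<omega>' k l"
  shows "G'_conjugate n A \<omega> \<omega>'"
  unfolding G'_conjugate_def using subst_in_G'[OF assms(1)] acts_to_pullback[OF assms] by blast

lemma SOmega_add: "\<omega> \<in> SOmega n A k \<Longrightarrow> \<omega>' \<in> SOmega n A k \<Longrightarrow> \<omega> + \<omega>' \<in> SOmega n A k"
  unfolding SOmega_def by (auto simp: A_add simp del: atLeastAtMost_iff) (metis add_0 subsetD)+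

lemma SOmega_0: "0 \<in> SOmega n A k"
  by (simp add: SOmega_def A_0)

lemma SOmega_sum: "(\<And>i. i \<in> S \<Longrightarrow> f i \<in> SOmega n A k) \<Longrightarrow> (\<Sum>i\<in>S. f i) \<in> SOmega n A k"
  by (induction S rule: infinite_finite_induct) (auto intro: SOmega_add SOmega_0)

lemma kscale_dz_dz':
  "i \<noteq> j \<Longrightarrow> kscale c (dz m i * dz m j) = dscale (dscale c (zf i * zf j)) (dmon (eps i + eps j) :: 'k form)"
  unfolding zf_def by (rule kscale_dz_dz[OF _ char2])

lemma dz_dz_SOmega:
  assumes "i \<in> {1..n}" "j \<in> {1..n}" "i \<noteq> j"
  shows "kscale c (dz m i * dz m j) \<in> SOmega n A 2"
  unfolding kscale_dz_dz'[OF assms(3)] SOmega_def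
  using assms by (auto simp: A_dscale A_times zf_in_A A_0 keys_add_mindex)

lemma fcoeff_dz_dz:
  assumes "i \<noteq> j"
  shows "fcoeff (kscale c (dz m i * dz m j)) k l = (if i = k \<and> j = l \<or> i = l \<and> j = k then dscale c (zf k * zf l) else 0)"
  unfolding kscale_dz_dz'[OF assms] fcoeff_def dcoeff_dscale dcoeff_simps
  using eps_pair_eq[of k l i j] by (auto simp: mult.commute)

lemma dscale_0_left [simp]: "dscale 0 f = (0 :: 'k dps)"
  by (rule dps_eqI) simp

lemma fcoeff_dz_sum:
  assumes S: "finite S" "\<And>i j. (i, j) \<in> S \<Longrightarrow> i \<noteq> j \<and> (j, i) \<notin> S" and b: "\<And>i j. b j i = b i j"
  shows "fcoeff (\<Sum>(i, j)\<in>S. kscale (b i j) (dz m i * dz m j)) k l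
    = dscale (if (k, l) \<in> S \<or> (l, k) \<in> S then b k l else 0) (zf k * zf l)"
proof -
  have "fcoeff (\<Sum>(i, j)\<in>S. kscale (b i j) (dz m i * dz m j)) k l
      = (\<Sum>p\<in>S. fcoeff (kscale (b (fst p) (snd p)) (dz m (fst p) * dz m (snd p))) k l)"
    by (simp add: fcoeff_def split_def)
  also have "\<dots> = (\<Sum>p\<in>S. (if p = (k, l) then dscale (b k l) (zf k * zf l) else 0) + (if p = (l, k) then dscale (b k l) (zf k * zf l) else 0))"
  proof (rule sum.cong[OF refl])
    fix p assume "p \<in> S"
    then obtain i j where p: "p = (i, j)" "i \<noteq> j" using S(2) by (metis surj_pair)
    then show "fcoeff (kscale (b (fst p) (snd p)) (dz m (fst p) * dz m (snd p))) k l
      = (if p = (k, l) then dscale (b k l) (zf k * zf l) else 0) + (if p = (l, k) then dscale (b k l) (zf k * zf l) else 0)"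
      using b[of k l] by (auto simp: fcoeff_dz_dz)
  qed
  also have "\<dots> = dscale (if (k, l) \<in> S \<or> (l, k) \<in> S then b k l else 0) (zf k * zf l)"
    using S by (auto simp: sum.distrib sum.delta)
  finally show ?thesis .
qed

text \<open>The condition on \<open>\<phi>\<close> in the form needed for the reduction: a two-digit monomial is a product of the kind removed
  from the spanning set.\<close>

lemma m_tilde_rest:
  fixes \<phi> :: "'k form"
  assumes \<phi>: "\<phi> \<in> m_tilde n m I t" and J: "J \<subseteq> I" and p: "p \<in> {1..n}"
  shows "dcoeff \<phi> (eps p) \<in> supp_in (rest_idx J p t)"
proof -
  have ks: "dcoeff (kscale c \<psi>) \<gamma> = dscale c (dcoeff \<psi> \<gamma>)" for c and \<psi> :: "'k form" and \<gamma>
    by (simp add: kscale_def) (simp add: dscale_def)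
  interpret K: Modules.module "kscale :: 'k \<Rightarrow> 'k form \<Rightarrow> 'k form"
    by unfold_locales (auto intro!: dps_eqI simp: ks distrib_left distrib_right mult.assoc)
  let ?V = "{\<psi> :: 'k form. \<forall>p\<in>{1..n}. dcoeff \<psi> (eps p) \<in> supp_in (rest_idx J p t)}"
  let ?S1 = "{dscale (dmon \<alpha>) (dx k) :: 'k form | \<alpha> k. keys \<alpha> \<subseteq> {1..n} \<and> (\<forall>i\<in>{1..n}. lookup \<alpha> i < 2 ^ m i) \<and>
         mdeg \<alpha> \<ge> t \<and> k \<in> {1..n}}"
  let ?S2 = "{dscale (xpow r (2 ^ l) * xpow s (2 ^ t)) (dx i) :: 'k form | r s l t i. r \<in> {1..n} \<and> s \<in> {1..n} \<and> i \<in> I}"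
  let ?S3 = "{dscale (xpow q 2) (dx i) :: 'k form | q i. q \<in> I \<and> i \<in> I}"
  have "K.subspace ?V"
    unfolding K.subspace_def by (simp add: ks supp_in_add supp_in_dscale)
  moreover have "?S1 - (?S2 \<union> ?S3) \<subseteq> ?V"
  proof
    fix \<psi> assume \<psi>: "\<psi> \<in> ?S1 - (?S2 \<union> ?S3)"
    then obtain \<alpha> k where \<psi>_eq: "\<psi> = dscale (dmon \<alpha>) (dx k)" and \<alpha>: "\<alpha> \<in> box n m" "t \<le> mdeg \<alpha>" and k: "k \<in> {1..n}"
      unfolding box_def by blast
    have "\<not> (k \<in> J \<and> two_digit \<alpha> \<and> keys \<alpha> \<inter> J \<noteq> {})"
    proof
      assume a: "k \<in> J \<and> two_digit \<alpha> \<and> keys \<alpha> \<inter> J \<noteq> {}"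
      then obtain r s l u where rs: "r \<noteq> s" "\<alpha> = Poly_Mapping.single r (2 ^ l) + Poly_Mapping.single s (2 ^ u)"
        unfolding two_digit_def by blast
      then have "keys \<alpha> = {r, s}" by (auto simp: keys_add_mindex)
      then have "r \<in> {1..n}" "s \<in> {1..n}" using \<alpha>(1) by (auto simp: box_def)
      moreover have "dmon \<alpha> = xpow r (2 ^ l) * (xpow s (2 ^ u) :: 'k dps)"
        unfolding rs(2) dmon_times_char2[OF char2] using rs(1) by (simp add: mno_carry_single lookup_single)
      moreover have "k \<in> I" using a J by blast
      ultimately have "\<psi> = dscale (xpow r (2 ^ l) * xpow s (2 ^ u)) (dx k) \<and> r \<in> {1..n} \<and> s \<in> {1..n} \<and> k \<in> I"
        using \<psi>_eq by (simp only: refl simp_thms)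
      then have "\<psi> \<in> ?S2" by (intro CollectI exI)
      then show False using \<psi> by blast
    qed
    then have \<alpha>r: "\<alpha> \<in> rest_idx J k t" using \<alpha> by (simp add: rest_idx_def)
    have "dcoeff \<psi> (eps p) \<in> supp_in (rest_idx J p t)" for p
    proof (cases "p = k")
      case True
      then have "dcoeff \<psi> (eps p) = dmon \<alpha>" unfolding \<psi>_eq by simp
      then show ?thesis using \<alpha>r True by (simp add: supp_in_dmon)
    next
      case False
      then have "dcoeff \<psi> (eps p) = 0" unfolding \<psi>_eq by (simp add: eps_inj)
      then show ?thesis by simp
    qed
    then show "\<psi> \<in> ?V" by blast
  qed
  ultimately have "K.span (?S1 - (?S2 \<union> ?S3)) \<subseteq> ?V" by (rule K.span_minimal[rotated])
  moreover have "\<phi> \<in> K.span (?S1 - (?S2 \<union> ?S3))" using \<phi> unfolding m_tilde_def .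
  ultimately have "\<phi> \<in> ?V" by (rule subsetD)
  then show ?thesis using p by simp
qed

lemma pullback_cong:
  assumes "\<And>i j. i \<in> {1..n} \<Longrightarrow> j \<in> {1..n} \<Longrightarrow> w i j = w' i j"
  shows "pullback g w k l = pullback g w' k l"
  unfolding pullback_def using assms by (intro sum.cong refl) simp

text \<open>Here \<open>b'\<close> is the matrix of the coefficients that are to remain. If \<open>i0\<close> has height greater than one it is arbitrary,
  and otherwise it has to agree with \<open>b\<close> on the pairs that meet \<open>I\<close>.\<close>

lemma conjugate_reduction:
  fixes a ab b b' :: "nat \<Rightarrow> nat \<Rightarrow> 'k" and \<omega> \<omega>' \<phi> :: "'k form"
  assumes perfect: "surj (\<lambda>x::'k. x ^ 2)"
    and a_sym: "\<And>i j. a i j = a j i" and ab_sym: "\<And>i j. ab i j = ab j i"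
    and inverse: "\<And>i j. i \<in> {1..n} \<Longrightarrow> j \<in> {1..n} \<Longrightarrow> (\<Sum>l\<in>{1..n}. a i l * ab l j) = (if i = j then 1 else 0)"
    and b_sym: "\<And>i j. b i j = b j i" and b_diag: "\<And>i. b i i = 0"
    and b'_sym: "\<And>i j. b' i j = b' j i" and b'_diag: "\<And>i. b' i i = 0"
    and I: "I = {i\<in>{1..n}. ab i i \<noteq> 0}" and i0: "i0 \<in> I"
    and \<phi>: "\<phi> \<in> m_tilde n m I 2"
    and cases: "1 < m i0 \<or> (\<forall>i\<in>I. m i = 1) \<and>
      (\<forall>k\<in>{1..n}. \<forall>l\<in>{1..n}. b k l \<noteq> b' k l \<longrightarrow> k \<notin> I \<and> l \<notin> I)"
    and \<omega>: "\<And>k l. k \<in> {1..n} \<Longrightarrow> l \<in> {1..n} \<Longrightarrow> fcoeff \<omega> k l = form_coeff a (\<lambda>i. dcoeff \<phi> (eps i)) b k l"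
    and \<omega>A: "\<omega> \<in> SOmega n A 2" and \<omega>'A: "\<omega>' \<in> SOmega n A 2"
    and \<omega>': "\<And>k l. k \<in> {1..n} \<Longrightarrow> l \<in> {1..n} \<Longrightarrow> fcoeff \<omega>' k l = dp_const (a k l) + dscale (b' k l) (zf k * zf l)"
  shows "G'_conjugate n A \<omega> \<omega>'"
proof -
  (* the first alternative of cases allows all coefficients to move, even if I contains indices of height one *)
  define J where "J = (if 1 < m i0 then {} else I)"
  let ?f = "\<lambda>i. dcoeff \<phi> (eps i)"
  define \<phi>' where "\<phi>' = (\<lambda>p. ?f p + pd p (fill ?f))"
  have J: "J \<subseteq> I" "J \<subseteq> {1..n}" "\<And>j. j \<in> J \<Longrightarrow> m j = 1" using cases I by (auto simp: J_def split: if_splits)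
  have \<phi>': "\<phi>' p \<in> supp_in (dec_rest J p 2)" if "p \<in> {1..n}" for p
    unfolding \<phi>'_def by (rule normalise_form[OF m_tilde_rest[OF \<phi> J(1)] order_refl J(2,3) that])
  have d: "form_coeff a \<phi>' b k l = form_coeff a ?f b k l" for k l
    unfolding form_coeff_def \<phi>'_def dform_add dform_pd by simp
  interpret R: form_reduction n m A a ab b \<phi>' J i0
  proof unfold_locales
    show "\<phi>' i \<in> supp_in (dec_rest J i 0)" if "i \<in> {1..n}" for i
      by (rule supp_in_mono[OF _ \<phi>'[OF that]]) (auto simp: dec_idx_def rest_idx_def)
    show "i0 \<in> {1..n}" "ab i0 i0 \<noteq> 0" using i0 unfolding I by auto
    show "J = {} \<and> 1 < m i0 \<or> J = {i \<in> {1..n}. ab i i \<noteq> 0} \<and> (\<forall>j\<in>J. m j = 1)"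
    proof (cases "1 < m i0")
      case True
      then show ?thesis by (simp add: J_def)
    next
      case False
      then have "J = I" by (simp add: J_def)
      then show ?thesis using J(3) unfolding I by blast
    qed
  qed (fact perfect a_sym ab_sym b_sym b_diag | rule inverse; assumption)+
  have nJ: "k \<notin> J \<and> l \<notin> J" if "k \<in> {1..n}" "l \<in> {1..n}" "b k l \<noteq> b' k l" for k l
  proof (cases "1 < m i0")
    case True
    then show ?thesis by (simp add: J_def)
  next
    case False
    then have "J = I" by (simp add: J_def)
    then show ?thesis using cases False that by blast
  qed
  have "\<exists>g. dec_family g \<and>
      (\<forall>k\<in>{1..n}. \<forall>l\<in>{1..n}. pullback g (form_coeff a \<phi>' b) k l = R.target b' k l)"
    by (rule R.reduction[OF _ b'_sym b'_diag]) (rule nJ)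
  then obtain g where g: "dec_family g"
    "\<And>k l. k \<in> {1..n} \<Longrightarrow> l \<in> {1..n} \<Longrightarrow> pullback g (form_coeff a \<phi>' b) k l = R.target b' k l"
    by blast
  show ?thesis
  proof (rule G'_conjugate_pullback[OF g(1) _ \<omega>'A])
    fix k l assume kl: "k \<in> {1..n}" "l \<in> {1..n}"
    show "fcoeff \<omega> k l \<in> A" using \<omega>A by (simp add: SOmega_def fcoeff_def)
    have "pullback g (fcoeff \<omega>) k l = pullback g (form_coeff a \<phi>' b) k l"
      by (rule pullback_cong) (simp only: \<omega> d)
    then show "pullback g (fcoeff \<omega>) k l = fcoeff \<omega>' k l"
      unfolding g(2)[OF kl] R.target_def \<omega>'[OF kl] .
  qed
qed

end

lemma inverse_symmetric:
  fixes M B :: "'k::field mat"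
  assumes M: "M \<in> carrier_mat n n" and B: "B \<in> carrier_mat n n" and sym: "transpose_mat M = M" and MB: "M * B = 1\<^sub>m n"
  shows "transpose_mat B = B"
proof -
  have BT: "transpose_mat B \<in> carrier_mat n n" using B by simp
  have "transpose_mat (M * B) = transpose_mat B * transpose_mat M" by (rule transpose_mult[OF M B])
  then have BM: "transpose_mat B * M = 1\<^sub>m n" unfolding MB sym by (simp add: transpose_one)
  have "transpose_mat B = transpose_mat B * (M * B)" unfolding MB using BT by simp
  also have "\<dots> = (transpose_mat B * M) * B" by (rule assoc_mult_mat[OF BT M B, symmetric])
  also have "\<dots> = B" unfolding BM using B by simp
  finally show ?thesis .
qed

lemma sum_shift: "(\<Sum>l\<in>{0..<n}. f l) = (\<Sum>l\<in>{1..n}. f (l - 1))" for f :: "nat \<Rightarrow> 'b::comm_monoid_add"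
  by (rule sum.reindex_bij_witness[where i = "\<lambda>l. l - 1" and j = Suc]) auto

text \<open>With \<open>M\<close> symmetric, \<open>M = M M\<^bsup>-1\<^esup> M\<close> is congruent to \<open>M\<^bsup>-1\<^esup>\<close>, and in characteristic two congruence preserves a
  zero diagonal.\<close>

lemma alternating_inverse:
  fixes a ab :: "nat \<Rightarrow> nat \<Rightarrow> 'k::field"
  assumes c2: "CHAR('k) = 2" and a_sym: "\<And>i j. a i j = a j i" and ab_sym: "\<And>i j. ab i j = ab j i"
    and inv: "\<And>i j. i \<in> {1..n} \<Longrightarrow> j \<in> {1..n} \<Longrightarrow> (\<Sum>l\<in>{1..n}. a i l * ab l j) = (if i = j then 1 else 0)"
    and zero: "\<And>i. i \<in> {1..n} \<Longrightarrow> ab i i = 0" and i: "i \<in> {1..n}"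
  shows "a i i = 0"
proof -
  have "a i i = (\<Sum>k\<in>{1..n}. if i = k then a k i else 0)" using i by (simp add: sum.delta')
  also have "\<dots> = (\<Sum>k\<in>{1..n}. (if i = k then 1 else 0) * a k i)" by (rule sum.cong) auto
  also have "\<dots> = (\<Sum>k\<in>{1..n}. (\<Sum>l\<in>{1..n}. a i l * ab l k) * a k i)" using inv i by simp
  also have "\<dots> = (\<Sum>k\<in>{1..n}. \<Sum>l\<in>{1..n}. a i l * ab l k * a k i)" by (simp add: sum_distrib_right)
  also have "\<dots> = (\<Sum>k\<in>{1..n}. a i k * ab k k * a k i)
      + (\<Sum>k\<in>{1..n}. \<Sum>l\<in>{k<..n}. a i l * ab l k * a k i + a i k * ab k l * a l i)"
    by (rule sum_offdiag_pairs)
  also have "\<dots> = 0"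
  proof -
    have "a i l * ab l k * a k i + a i k * ab k l * a l i = 0" for k l
    proof -
      have "a i k * ab k l * a l i = a i l * ab l k * a k i"
        using a_sym[of i k] a_sym[of l i] ab_sym[of k l] by (simp add: ac_simps)
      then show ?thesis by (simp only: add_self_char2[OF c2])
    qed
    moreover have "(\<Sum>k\<in>{1..n}. a i k * ab k k * a k i) = 0" using zero by (intro sum.neutral ballI) simp
    ultimately show ?thesis by (simp only: sum.neutral_const add_0_left)
  qed
  finally show ?thesis .
qed

theorem theorem4p2:
  fixes sc :: "'k::field \<Rightarrow> 'e::ab_group_add \<Rightarrow> 'e"
    and Fl :: "nat \<Rightarrow> 'e set" and s :: nat
    and x :: "nat \<Rightarrow> 'e" and n :: nat
    and m :: "nat \<Rightarrow> nat" and A :: "'k dps set"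
    and \<omega> \<omega>0 \<phi> :: "'k form" and b :: "nat \<Rightarrow> nat \<Rightarrow> 'k"
    and abar :: "'k mat" and I :: "nat set"
  assumes char2: "CHAR('k) = 2"
    and perfect: "surj (\<lambda>a::'k. a ^ 2)"
    and E: "vector_space sc"
    and flag: "is_flag sc s Fl"
    and basis: "coordinated_basis sc s Fl n x"
    and m: "m = height Fl x"
    and A: "A = O_flag sc s Fl n x"
    and ham: "nonalt_Hamiltonian n A \<omega>"
    and \<omega>0: "\<omega>0 = form_at_0 \<omega>"
    and canonical: "canonical_form n m \<omega>0"
    and abar: "abar \<in> carrier_mat n n"
      "inverts_mat (mat_at_0 n \<omega>0) abar" "inverts_mat abar (mat_at_0 n \<omega>0)"
    and I: "I = {i \<in> {1..n}. abar $$ (i - 1, i - 1) \<noteq> 0}"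
    and \<phi>: "\<phi> \<in> m_tilde n m I 2"
    and b_sym: "\<And>i j. b j i = b i j"
    and \<omega>: "\<omega> = \<omega>0 + diff_form n \<phi> + (\<Sum>i=1..n. \<Sum>j\<in>{i<..n}. kscale (b i j) (dz m i * dz m j))"
  shows "((\<exists>i\<in>I. m i > 1) \<or>
            (\<forall>i\<in>I. m i = 1) \<and>
            (\<forall>i\<in>{1..n}. \<forall>j\<in>{i<..n}. b i j \<noteq> 0 \<longrightarrow> i \<notin> I \<and> j \<notin> I)
          \<longrightarrow> G'_conjugate n A \<omega> \<omega>0) \<and>
         G'_conjugate n A \<omega>
           (\<omega>0 + (\<Sum>i\<in>I. \<Sum>j\<in>{1..n} - I. kscale (b i j) (dz m i * dz m j))
               + (\<Sum>i\<in>I. \<Sum>j\<in>{j\<in>I. i < j}. kscale (b i j) (dz m i * dz m j)))"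
proof -
  interpret T: truncated_dp_algebra n m A
  proof
    show "A = supp_in (box n m)" unfolding A m by (rule O_flag_eq[OF char2 E flag basis])
    show "0 < m i" if "i \<in> {1..n}" for i unfolding m by (rule height_props(1)[OF E flag basis that])
  qed (rule char2)
  define a where "a = (\<lambda>k l. dcoeff (fcoeff \<omega> k l) 0)"
  (* the entries b i i do not enter the form and may be nonzero *)
  define b0 where "b0 = (\<lambda>k l. if k = l then 0 else b k l)"
  define ab where "ab = (\<lambda>i j. if i \<in> {1..n} \<and> j \<in> {1..n} then abar $$ (i - 1, j - 1) else 0)"
  have \<omega>S: "\<omega> \<in> SOmega n A 2" using ham by (simp add: nonalt_Hamiltonian_def)
  have a_sym: "a i j = a j i" for i j by (simp add: a_def fcoeff_sym[of \<omega> i])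
  have b0_sym: "b0 i j = b0 j i" and b0_diag: "b0 i i = 0" for i j using b_sym by (auto simp: b0_def)
  have \<omega>0c: "fcoeff \<omega>0 k l = dp_const (a k l)" for k l
    by (simp add: \<omega>0 form_at_0_def fcoeff_def a_def)
  have \<omega>0S: "\<omega>0 \<in> SOmega n A 2"
  proof -
    have "dcoeff \<omega> \<gamma> \<noteq> 0" if "dcoeff \<omega>0 \<gamma> \<noteq> 0" for \<gamma>
    proof
      assume "dcoeff \<omega> \<gamma> = 0"
      then have "dcoeff \<omega>0 \<gamma> = 0" unfolding \<omega>0 form_at_0_def by (intro dps_eqI) simp
      with that show False ..
    qed
    moreover have "dcoeff \<omega>0 \<gamma> \<in> A" for \<gamma> unfolding \<omega>0 form_at_0_def by (simp add: T.A_const)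
    ultimately show ?thesis using \<omega>S unfolding SOmega_def by blast
  qed
  have fadd: "fcoeff (\<omega>1 + \<omega>2) k l = fcoeff \<omega>1 k l + fcoeff \<omega>2 k l" for \<omega>1 \<omega>2 :: "'k form" and k l
    by (simp add: fcoeff_def)
  have \<omega>c: "fcoeff \<omega> k l = T.form_coeff a (\<lambda>i. dcoeff \<phi> (eps i)) b0 k l"
    if kl: "k \<in> {1..n}" "l \<in> {1..n}" for k l
  proof -
    let ?S = "Sigma {1..n} (\<lambda>i. {i<..n})"
    have "(\<Sum>i=1..n. \<Sum>j\<in>{i<..n}. kscale (b i j) (dz m i * dz m j)) = (\<Sum>(i, j)\<in>?S. kscale (b i j) (dz m i * dz m j))"
      by (rule sum.Sigma) auto
    moreover have "fcoeff (\<Sum>(i, j)\<in>?S. kscale (b i j) (dz m i * dz m j)) k l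
        = dscale (if (k, l) \<in> ?S \<or> (l, k) \<in> ?S then b k l else 0) (T.zf k * T.zf l)"
      by (rule T.fcoeff_dz_sum) (auto simp: b_sym)
    moreover have "(if (k, l) \<in> ?S \<or> (l, k) \<in> ?S then b k l else 0) = b0 k l" using kl by (auto simp: b0_def)
    ultimately have "fcoeff (\<Sum>i=1..n. \<Sum>j\<in>{i<..n}. kscale (b i j) (dz m i * dz m j)) k l
        = dscale (b0 k l) (T.zf k * T.zf l)" by simp
    then have "fcoeff (\<omega>0 + diff_form n \<phi> + (\<Sum>i=1..n. \<Sum>j\<in>{i<..n}. kscale (b i j) (dz m i * dz m j))) k l
        = T.form_coeff a (\<lambda>i. dcoeff \<phi> (eps i)) b0 k l"
      unfolding fadd \<omega>0c fcoeff_diff_form[OF char2 kl] T.form_coeff_def T.dform_def by simp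
    then show ?thesis unfolding \<omega>[symmetric] .
  qed
  let ?M = "mat_at_0 n \<omega>0"
  have M: "?M \<in> carrier_mat n n" by (simp add: mat_at_0_def form_mat_def)
  have Mc: "?M $$ (i - 1, j - 1) = a i j" if "i \<in> {1..n}" "j \<in> {1..n}" for i j
    using that \<omega>0c[of i j] by (auto simp: mat_at_0_def form_mat_def fcoeff_def)
  have MB: "?M * abar = 1\<^sub>m n" using abar(2) M by (simp add: inverts_mat_def)
  have Msym: "transpose_mat ?M = ?M"
  proof (rule eq_matI)
    fix i j assume "i < dim_row ?M" "j < dim_col ?M"
    then have ij: "i < n" "j < n" using M by auto
    then have "?M $$ (i, j) = a (Suc i) (Suc j)" "?M $$ (j, i) = a (Suc j) (Suc i)"
      using Mc[of "Suc i" "Suc j"] Mc[of "Suc j" "Suc i"] by auto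
    then show "transpose_mat ?M $$ (i, j) = ?M $$ (i, j)" using ij M a_sym by simp
  qed (use M in auto)
  have Bsym: "transpose_mat abar = abar" by (rule inverse_symmetric[OF M abar(1) Msym MB])
  have ab_sym: "ab i j = ab j i" for i j
  proof (cases "i \<in> {1..n} \<and> j \<in> {1..n}")
    case True
    then have "transpose_mat abar $$ (i - 1, j - 1) = abar $$ (j - 1, i - 1)" using abar(1) by auto
    then show ?thesis unfolding Bsym ab_def by simp
  qed (auto simp: ab_def)
  have inv: "(\<Sum>l\<in>{1..n}. a i l * ab l j) = (if i = j then 1 else 0)" if ij: "i \<in> {1..n}" "j \<in> {1..n}" for i j
  proof -
    have "(?M * abar) $$ (i - 1, j - 1) = (\<Sum>l\<in>{0..<n}. ?M $$ (i - 1, l) * abar $$ (l, j - 1))"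
      using ij M abar(1) by (auto simp: times_mat_def scalar_prod_def)
    also have "\<dots> = (\<Sum>l\<in>{1..n}. ?M $$ (i - 1, l - 1) * abar $$ (l - 1, j - 1))" by (rule sum_shift)
    also have "\<dots> = (\<Sum>l\<in>{1..n}. a i l * ab l j)"
      by (rule sum.cong[OF refl]) (use ij Mc in \<open>simp add: ab_def\<close>)
    finally have "(\<Sum>l\<in>{1..n}. a i l * ab l j) = (1\<^sub>m n) $$ (i - 1, j - 1)" unfolding MB ..
    moreover have "i - 1 < n" "j - 1 < n" "i - 1 = j - 1 \<longleftrightarrow> i = j" using ij by auto
    ultimately show ?thesis by simp
  qed
  have I': "I = {i \<in> {1..n}. ab i i \<noteq> 0}" unfolding I ab_def by auto
  have "I \<noteq> {}"
  proof
    assume "I = {}"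
    then have ab0: "ab i i = 0" if "i \<in> {1..n}" for i using that I' by blast
    have a0: "a i i = 0" if "i \<in> {1..n}" for i
      by (rule alternating_inverse[OF char2 a_sym ab_sym inv ab0 that])
    have \<omega>ii: "fcoeff \<omega> i i = 0" if "i \<in> {1..n}" for i
      unfolding \<omega>c[OF that that] T.form_coeff_def T.dform_def a0[OF that] b0_diag
      by (intro dps_eqI) (simp add: add_self_char2[OF char2])
    obtain D where D: "eval2 n \<omega> D D \<noteq> 0" using ham by (auto simp: nonalt_Hamiltonian_def)
    have "fcoeff \<omega> i j * D (xpow i 1) * D (xpow j 1) + fcoeff \<omega> j i * D (xpow j 1) * D (xpow i 1) = 0" for i j
    proof -
      have "fcoeff \<omega> j i * D (xpow j 1) * D (xpow i 1) = fcoeff \<omega> i j * D (xpow i 1) * D (xpow j 1)"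
        unfolding fcoeff_sym[of \<omega> j] by (simp only: ac_simps)
      then show ?thesis by simp
    qed
    then have "eval2 n \<omega> D D = 0"
      unfolding eval2_def fcoeff_def[symmetric] sum_offdiag_pairs using \<omega>ii by simp
    with D show False ..
  qed
  have In: "I \<subseteq> {1..n}" and Ifin: "finite I" unfolding I by auto
  (* the coefficients that remain in the second part *)
  define b2 where "b2 = (\<lambda>k l. if k \<noteq> l \<and> (k \<in> I \<or> l \<in> I) then b k l else 0)"
  define \<omega>2 where "\<omega>2 = \<omega>0 + (\<Sum>i\<in>I. \<Sum>j\<in>{1..n} - I. kscale (b i j) (dz m i * dz m j))
               + (\<Sum>i\<in>I. \<Sum>j\<in>{j\<in>I. i < j}. kscale (b i j) (dz m i * dz m j))"
  have b2_sym: "b2 i j = b2 j i" and b2_diag: "b2 i i = 0" for i j using b_sym by (auto simp: b2_def)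
  have \<omega>2S: "\<omega>2 \<in> SOmega n A 2"
    unfolding \<omega>2_def
    by (intro T.SOmega_add T.SOmega_sum \<omega>0S T.dz_dz_SOmega) (use In in auto)
  have \<omega>2c: "fcoeff \<omega>2 k l = dp_const (a k l) + dscale (b2 k l) (T.zf k * T.zf l)"
    if kl: "k \<in> {1..n}" "l \<in> {1..n}" for k l
  proof -
    let ?S = "Sigma I (\<lambda>i. {1..n} - I)" and ?T = "Sigma I (\<lambda>i. {j\<in>I. i < j})"
    have S: "(\<Sum>i\<in>I. \<Sum>j\<in>{1..n} - I. kscale (b i j) (dz m i * dz m j)) = (\<Sum>(i, j)\<in>?S. kscale (b i j) (dz m i * dz m j))"
      by (rule sum.Sigma) (use Ifin in auto)
    have T: "(\<Sum>i\<in>I. \<Sum>j\<in>{j\<in>I. i < j}. kscale (b i j) (dz m i * dz m j)) = (\<Sum>(i, j)\<in>?T. kscale (b i j) (dz m i * dz m j))"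
      by (rule sum.Sigma) (use Ifin in auto)
    have cS: "fcoeff (\<Sum>(i, j)\<in>?S. kscale (b i j) (dz m i * dz m j)) k l
        = dscale (if (k, l) \<in> ?S \<or> (l, k) \<in> ?S then b k l else 0) (T.zf k * T.zf l)"
      by (rule T.fcoeff_dz_sum) (use Ifin b_sym in auto)
    have cT: "fcoeff (\<Sum>(i, j)\<in>?T. kscale (b i j) (dz m i * dz m j)) k l
        = dscale (if (k, l) \<in> ?T \<or> (l, k) \<in> ?T then b k l else 0) (T.zf k * T.zf l)"
      by (rule T.fcoeff_dz_sum) (use Ifin b_sym in auto)
    have "(if (k, l) \<in> ?S \<or> (l, k) \<in> ?S then b k l else 0) + (if (k, l) \<in> ?T \<or> (l, k) \<in> ?T then b k l else 0) = b2 k l"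
      using kl by (auto simp: b2_def)
    then have "dscale (if (k, l) \<in> ?S \<or> (l, k) \<in> ?S then b k l else 0) (T.zf k * T.zf l)
        + dscale (if (k, l) \<in> ?T \<or> (l, k) \<in> ?T then b k l else 0) (T.zf k * T.zf l) = dscale (b2 k l) (T.zf k * T.zf l)"
      by (intro dps_eqI) (simp only: dcoeff_simps dcoeff_dscale distrib_right[symmetric])
    then show ?thesis unfolding \<omega>2_def fadd S T cS cT \<omega>0c by (simp add: add.assoc)
  qed
  note red = T.conjugate_reduction[OF perfect a_sym ab_sym inv b0_sym b0_diag _ _ I' _ \<phi> _ \<omega>c \<omega>S]
  have mI: "(\<exists>i\<in>I. m i > 1) \<or> (\<forall>i\<in>I. m i = 1)"
  proof -
    have "m i > 1 \<or> m i = 1" if "i \<in> I" for i using T.height_pos[of i] that In by force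
    then show ?thesis by blast
  qed
  have "G'_conjugate n A \<omega> \<omega>0"
    if AB: "(\<exists>i\<in>I. m i > 1) \<or> (\<forall>i\<in>I. m i = 1) \<and> (\<forall>i\<in>{1..n}. \<forall>j\<in>{i<..n}. b i j \<noteq> 0 \<longrightarrow> i \<notin> I \<and> j \<notin> I)"
  proof -
    have "\<exists>i0\<in>I. 1 < m i0 \<or> (\<forall>i\<in>I. m i = 1) \<and>
      (\<forall>k\<in>{1..n}. \<forall>l\<in>{1..n}. b0 k l \<noteq> 0 \<longrightarrow> k \<notin> I \<and> l \<notin> I)"
    proof (cases "\<exists>i\<in>I. m i > 1")
      case False
      then have all: "\<forall>i\<in>I. m i = 1" and B: "\<And>i j. i \<in> {1..n} \<Longrightarrow> j \<in> {i<..n} \<Longrightarrow> b i j \<noteq> 0 \<Longrightarrow> i \<notin> I \<and> j \<notin> I"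
        using AB by blast+
      have "k \<notin> I \<and> l \<notin> I" if "k \<in> {1..n}" "l \<in> {1..n}" "b0 k l \<noteq> 0" for k l
      proof -
        have nz: "k \<noteq> l" "b k l \<noteq> 0" "b l k \<noteq> 0" using that(3) b_sym[of k l] by (auto simp: b0_def split: if_splits)
        then show ?thesis using B[of k l] B[of l k] that by (cases "k < l") auto
      qed
      then show ?thesis using all \<open>I \<noteq> {}\<close> by blast
    qed blast
    then obtain i0 where "i0 \<in> I" "1 < m i0 \<or> (\<forall>i\<in>I. m i = 1) \<and>
      (\<forall>k\<in>{1..n}. \<forall>l\<in>{1..n}. b0 k l \<noteq> 0 \<longrightarrow> k \<notin> I \<and> l \<notin> I)" by blast
    then show ?thesis
      by (intro red[of "\<lambda>_ _. 0" i0 \<omega>0]) (auto simp: \<omega>0S \<omega>0c)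
  qed
  moreover have "G'_conjugate n A \<omega> \<omega>2"
  proof -
    have "\<exists>i0\<in>I. 1 < m i0 \<or> (\<forall>i\<in>I. m i = 1) \<and>
      (\<forall>k\<in>{1..n}. \<forall>l\<in>{1..n}. b0 k l \<noteq> b2 k l \<longrightarrow> k \<notin> I \<and> l \<notin> I)"
      using mI \<open>I \<noteq> {}\<close> by (auto simp: b0_def b2_def)
    then obtain i0 where "i0 \<in> I" "1 < m i0 \<or> (\<forall>i\<in>I. m i = 1) \<and>
      (\<forall>k\<in>{1..n}. \<forall>l\<in>{1..n}. b0 k l \<noteq> b2 k l \<longrightarrow> k \<notin> I \<and> l \<notin> I)" by blast
    then show ?thesis
      by (intro red[of b2 i0 \<omega>2] b2_sym b2_diag \<omega>2S \<omega>2c)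
  qed
  ultimately show ?thesis unfolding \<omega>2_def by blast
qed

end
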